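(* Fix an integer $m\ge 1$. For $g\ge 0$ and a partition $\nu=(\nu_1,\dots,\nu_t)$ of $n=|\nu|\ge 1$, let $$b_{g,\nu,m}=\frac{1}{n!}\,\#\Bigl\{(\sigma_0,\sigma_1,\dots,\sigma_m)\in S_n^{m+1} \;:\; \sigma_0\sigma_1\cdots\sigma_m=\mathrm{id},\ \sigma_0 \text{ has cycle type } \nu,\ \langle\sigma_0,\dots,\sigma_m\rangle \text{ acts transitively on }\{1,\dots,n\},\ 2-2g=2n-\sum_{i=0}^{m}\bigl(n-\ell(\sigma_i)\bigr)\Bigr\},$$ where $\ell(\sigma)$ is the number of cycles of $\sigma$ (fixed points included) and $\sigma_1,\dots,\sigma_m$ are arbitrary (the identity is allowed). Equivalently, $b_{g,\nu,m}$ is the number of isomorphism classes of connected degree-$n$ ramified coverings $f:X\to\mathbb{C}P^1$ by a compact oriented surface $X$ of genus $g$, unramified outside $m+1$ fixed points $y_0,y_1,\dots,y_m$, with ramification type $\nu$ over $y_0$ and arbitrary ramification types over $y_1,\dots,y_m$, each class counted with weight $1/|\mathrm{Aut}(f)|$. Define $$S(\hbar,p_1,p_2,\ldots;m)=\sum_{g\ge 0}\sum_{n\ge 1}\sum_{\nu\vdash n} b_{g,\nu,m}\,p_\nu\,\hbar^{2g},\qquad p_\nu=p_{\nu_1}\cdots p_{\nu_t}.$$ Then, as formal power series in $p_1,p_2,\dots$ with coefficients Laurent series in $\hbar$, $$S(\hbar,p_1,p_2,\ldots;m)=\hbar^2\log\Bigl(\sum_{n=0}^{\infty}\sum_{\nu\vdash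 n}\prod_{k\in\nu}\bigl(1+c(k)\hbar\bigr)^m\,\frac{\dim_\nu}{n!}\,\hbar^{-2n}\,s_\nu\bigl(p_1,\,p_2\hbar,\,p_3\hbar^2,\dots\bigr)\Bigr).$$
   Context: $S_n$ is the symmetric group on $n$ letters; a permutation has cycle type $\nu$ if its cycle lengths are $\nu_1,\dots,\nu_t$. Partitions $\nu\vdash n$ are identified with Young diagrams: rows of lengths $\nu_1\ge\nu_2\ge\dots\ge\nu_t$, stacked top to bottom, left-justified. For a cell $k$ in row $r$ and column $j$ of the diagram, its content is $c(k)=j-r$; the product $\prod_{k\in\nu}$ runs over all cells of the diagram of $\nu$ (for $n=0$ it is the empty product $1$). $\dim_\nu$ is the dimension of the irreducible complex representation of $S_n$ indexed by $\nu$ (equivalently, $n!/\prod_{k\in\nu}h(k)$ where $h(k)$ is the hook length of $k$). The Schur function $s_\nu$ is written in the power-sum variables: $s_k(p_1,p_2,\dots)$ is the coefficient of $u^k$ in $\exp\bigl(\sum_{i\ge1}p_iu^i/i\bigr)$ (with $s_0=1$, $s_k=0$ for $k<0$), and $s_\nu=\det\bigl(s_{\nu_i-i+j}\bigr)_{1\le i,j\le t}$; $s_\emptyset=1$. The scaled Schur function is obtained by substituting $p_i\mapsto p_i\hbar^{i-1}$. An automorphism of a covering $f:X\to\mathbb{C}P^1$ is an orientation-preserving homeomorphism $u:X\to X$ with $f\circ u=f$. *)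

theory Defs
  imports
    "HOL-Library.Multiset"
    "HOL-Library.Groups_Big_Fun"
    "HOL-Library.Function_Algebras"
    "HOL-Combinatorics.Orbits"
    "HOL-Algebra.Generated_Groups"
    "HOL-Algebra.Sym_Groups"
    "HOL-Computational_Algebra.Formal_Laurent_Series"
    "Jordan_Normal_Form.Determinant"
begin

section \<open>Formal power series in arbitrarily many variables\<close>

text \<open>
  A formal power series over \<^typ>\<open>'a\<close> in variables indexed by \<^typ>\<open>'v\<close>
  is a family of coefficients indexed by the monomials, that is, by the finite multisets
  of variables.
\<close>

typedef (overloaded) ('v, 'a) mps = "UNIV :: ('v multiset \<Rightarrow> 'a) set"
  morphisms mps_coeff Abs_mps ..

setup_lifting type_definition_mps

lemma mps_eqI: "(\<And>M. mps_coeff f M = mps_coeff g M) \<Longrightarrow> f = g"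
  by transfer auto

lemma mps_coeff_Abs [simp]: "mps_coeff (Abs_mps f) = f"
  by (simp add: Abs_mps_inverse)

definition mset_splits :: "'v multiset \<Rightarrow> ('v multiset \<times> 'v multiset) set" where
  "mset_splits M = {(A, B). A + B = M}"

lemma finite_subseteq_mset: "finite {A. A \<subseteq># M}"
proof (induction M)
  case empty
  then show ?case by simp
next
  case (add x M)
  have "{A. A \<subseteq># add_mset x M} \<subseteq> {A. A \<subseteq># M} \<union> add_mset x ` {A. A \<subseteq># M}"
  proof
    fix A assume A: "A \<in> {A. A \<subseteq># add_mset x M}"
    show "A \<in> {A. A \<subseteq># M} \<union> add_mset x ` {A. A \<subseteq># M}"
    proof (cases "x \<in># A")
      case True
      then obtain B where "A = add_mset x B" by (metis insert_DiffM)
      with A show ?thesis by auto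
    next
      case False
      have "count A y \<le> count M y" for y
        using A False mset_subset_eq_count [of A "add_mset x M" y]
        by (cases "y = x") (auto simp: not_in_iff)
      then have "A \<subseteq># M" by (rule mset_subset_eqI)
      then show ?thesis by auto
    qed
  qed
  with add show ?case by (meson finite_UnI finite_imageI finite_subset)
qed

lemma finite_mset_splits [simp]: "finite (mset_splits M)"
proof (rule finite_subset)
  show "mset_splits M \<subseteq> {A. A \<subseteq># M} \<times> {A. A \<subseteq># M}"
    by (auto simp: mset_splits_def)
  show "finite ({A. A \<subseteq># M} \<times> {A. A \<subseteq># M})"
    using finite_subseteq_mset by auto
qed

instantiation mps :: (type, zero) zero
begin
lift_definition zero_mps :: "('a, 'b) mps" is "\<lambda>_. 0" .
instance ..
end

instantiation mps :: (type, comm_ring_1) comm_ring_1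
begin

lift_definition one_mps :: "('a, 'b) mps" is "\<lambda>M. if M = {#} then 1 else 0" .
lift_definition plus_mps :: "('a, 'b) mps \<Rightarrow> ('a, 'b) mps \<Rightarrow> ('a, 'b) mps"
  is "\<lambda>f g M. f M + g M" .
lift_definition minus_mps :: "('a, 'b) mps \<Rightarrow> ('a, 'b) mps \<Rightarrow> ('a, 'b) mps"
  is "\<lambda>f g M. f M - g M" .
lift_definition uminus_mps :: "('a, 'b) mps \<Rightarrow> ('a, 'b) mps" is "\<lambda>f M. - f M" .
lift_definition times_mps :: "('a, 'b) mps \<Rightarrow> ('a, 'b) mps \<Rightarrow> ('a, 'b) mps"
  is "\<lambda>f g M. \<Sum>(A, B)\<in>mset_splits M. f A * g B" .

instance
proof
  fix a b c :: "('a, 'b) mps"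
  show "a * b * c = a * (b * c)"
  proof (transfer, rule ext)
    fix f g h :: "'a multiset \<Rightarrow> 'b" and M
    have "(\<Sum>(A, B)\<in>mset_splits M. (\<Sum>(A, B)\<in>mset_splits A. f A * g B) * h B)
        = (\<Sum>(x, y)\<in>(SIGMA x:mset_splits M. mset_splits (fst x)). f (fst y) * g (snd y) * h (snd x))"
      by (subst sum.Sigma [symmetric]) (auto simp: sum_distrib_right split_def)
    also have "\<dots> = (\<Sum>(x, y)\<in>(SIGMA x:mset_splits M. mset_splits (snd x)). f (fst x) * (g (fst y) * h (snd y)))"
      by (rule sum.reindex_bij_witness
          [of _ "\<lambda>((A, _), (C, D)). ((A + C, D), (A, C))" "\<lambda>((_, B), (C, D)). ((C, D + B), (D, B))"])
         (auto simp: mset_splits_def mult.assoc add.assoc)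
    also have "\<dots> = (\<Sum>(A, B)\<in>mset_splits M. f A * (\<Sum>(A, B)\<in>mset_splits B. g A * h B))"
      by (subst sum.Sigma [symmetric]) (auto simp: sum_distrib_left split_def)
    finally show "(\<Sum>(A, B)\<in>mset_splits M. (\<Sum>(A, B)\<in>mset_splits A. f A * g B) * h B)
        = (\<Sum>(A, B)\<in>mset_splits M. f A * (\<Sum>(A, B)\<in>mset_splits B. g A * h B))" .
  qed
  show "a * b = b * a"
  proof (transfer, rule ext)
    fix f g :: "'a multiset \<Rightarrow> 'b" and M
    show "(\<Sum>(A, B)\<in>mset_splits M. f A * g B) = (\<Sum>(A, B)\<in>mset_splits M. g A * f B)"
      by (rule sum.reindex_bij_witness [of _ "\<lambda>(A, B). (B, A)" "\<lambda>(A, B). (B, A)"])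
         (auto simp: mset_splits_def ac_simps)
  qed
  show "1 * a = a"
  proof (transfer, rule ext)
    fix f :: "'a multiset \<Rightarrow> 'b" and M
    have "(\<Sum>(A, B)\<in>mset_splits M. (if A = {#} then 1 else 0) * f B)
        = (\<Sum>(A, B)\<in>{({#} :: 'a multiset, M)}. (if A = {#} then 1 else 0) * f B)"
    proof (rule sum.mono_neutral_right)
      show "\<forall>i\<in>mset_splits M - {({#}, M)}. (case i of (A, B) \<Rightarrow> (if A = {#} then 1 else 0) * f B) = 0"
        by (auto simp: mset_splits_def split: if_splits)
    qed (simp, simp add: mset_splits_def)
    then show "(\<Sum>(A, B)\<in>mset_splits M. (if A = {#} then 1 else 0) * f B) = f M"
      by simp
  qed
  show "(a + b) * c = a * c + b * c"
    by transfer (auto simp: fun_eq_iff split_def algebra_simps sum.distrib)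
  show "(0 :: ('a, 'b) mps) \<noteq> 1"
    by transfer (auto simp: fun_eq_iff)
qed (transfer; simp add: fun_eq_iff algebra_simps)+

end

lift_definition mps_const :: "'a :: zero \<Rightarrow> ('v, 'a) mps"
  is "\<lambda>c M. if M = {#} then c else 0" .

lift_definition mps_var :: "'v \<Rightarrow> ('v, 'a :: zero_neq_one) mps"
  is "\<lambda>v M. if M = {#v#} then 1 else 0" .

text \<open>
  The sum of a locally finite family of series, i.e. one in which every monomial has
  only finitely many non-zero coefficients. This is the case below, because the \<open>n\<close>-th member
  is isobaric of weight \<open>n\<close> when the \<open>i\<close>-th variable is given weight \<open>i\<close>
  (\<^const>\<open>Sum_any\<close> would return 0 for infinitely many non-zero summands).
\<close>

definition mps_sum :: "('i \<Rightarrow> ('v, 'a :: comm_monoid_add) mps) \<Rightarrow> ('v, 'a) mps" where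
  "mps_sum F = Abs_mps (\<lambda>M. Sum_any (\<lambda>i. mps_coeff (F i) M))"

text \<open>
  The logarithm of a series with constant term \<^term>\<open>1\<close>: the powers beyond \<^term>\<open>size M\<close>
  do not contribute to the coefficient of the monomial \<^term>\<open>M\<close>.
\<close>

definition mps_log :: "('v, 'a :: field_char_0) mps \<Rightarrow> ('v, 'a) mps" where
  "mps_log F = Abs_mps (\<lambda>M. \<Sum>k = 1..size M. (-1) ^ (k + 1) / of_nat k * mps_coeff ((F - 1) ^ k) M)"


section \<open>Partitions, contents and Schur functions\<close>

definition partitions :: "nat \<Rightarrow> nat list set" where
  "partitions n = {\<nu>. sorted_wrt (\<ge>) \<nu> \<and> 0 \<notin> set \<nu> \<and> sum_list \<nu> = n}"

text \<open>Cells are (row, column), both counted from \<^term>\<open>0 :: nat\<close>.\<close>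

definition diagram :: "nat list \<Rightarrow> (nat \<times> nat) set" where
  "diagram \<nu> = {(r, j). r < length \<nu> \<and> j < \<nu> ! r}"

definition cell_content :: "nat \<times> nat \<Rightarrow> int" where
  "cell_content k = int (snd k) - int (fst k)"

text \<open>
  The arguments \<open>p\<^sub>1, p\<^sub>2, \<dots>\<close> are elements of a ring of power series over a field of
  characteristic 0; the value \<^term>\<open>p 0\<close> is never used.
\<close>

definition schur_row :: "(nat \<Rightarrow> ('v, 'a :: field_char_0) mps) \<Rightarrow> int \<Rightarrow> ('v, 'a) mps" where
  "schur_row p k = (if k < 0 then 0 else
     fps_nth (fps_compose (Abs_fps (\<lambda>j. mps_const (1 / fact j)))
                          (Abs_fps (\<lambda>i. if i = 0 then 0 else p i * mps_const (1 / of_nat i))))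
             (nat k))"

definition schur :: "(nat \<Rightarrow> ('v, 'a :: field_char_0) mps) \<Rightarrow> nat list \<Rightarrow> ('v, 'a) mps" where
  "schur p \<nu> = det (mat (length \<nu>) (length \<nu>)
     (\<lambda>(i, j). schur_row p (int (\<nu> ! i) - int i + int j)))"


section \<open>Irreducible representations of the symmetric group\<close>

text \<open>
  The irreducible complex representation of the symmetric group indexed by \<open>\<nu>\<close> is
  the Specht module: the span of the polytabloids inside the permutation module on tabloids
  of shape \<open>\<nu>\<close>. A tabloid is represented by the function mapping a row index to the
  set of entries of that row, and the permutation module by complex functions on tabloids.
\<close>

definition tableaux :: "nat list \<Rightarrow> (nat \<times> nat \<Rightarrow> nat) set" where
  "tableaux \<nu> = {T. bij_betw T (diagram \<nu>) {1..sum_list \<nu>}}"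

definition tabloid :: "nat list \<Rightarrow> (nat \<times> nat \<Rightarrow> nat) \<Rightarrow> nat \<Rightarrow> nat set" where
  "tabloid \<nu> T r = T ` {k \<in> diagram \<nu>. fst k = r}"

definition tableau_column :: "nat list \<Rightarrow> (nat \<times> nat \<Rightarrow> nat) \<Rightarrow> nat \<Rightarrow> nat set" where
  "tableau_column \<nu> T j = T ` {k \<in> diagram \<nu>. snd k = j}"

definition column_stabilizer :: "nat list \<Rightarrow> (nat \<times> nat \<Rightarrow> nat) \<Rightarrow> (nat \<Rightarrow> nat) set" where
  "column_stabilizer \<nu> T = {\<pi>. \<pi> permutes {1..sum_list \<nu>} \<and>
     (\<forall>j. \<pi> ` tableau_column \<nu> T j = tableau_column \<nu> T j)}"

definition polytabloid :: "nat list \<Rightarrow> (nat \<times> nat \<Rightarrow> nat) \<Rightarrow> (nat \<Rightarrow> nat set) \<Rightarrow> complex" where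
  "polytabloid \<nu> T = (\<lambda>x. \<Sum>\<pi>\<in>column_stabilizer \<nu> T.
     of_int (sign \<pi>) * (if tabloid \<nu> (\<pi> \<circ> T) = x then 1 else 0))"

global_interpretation cfun: vector_space "\<lambda>(c :: complex) (f :: 'b \<Rightarrow> complex) x. c * f x"
  defines cfun_span = cfun.span and cfun_dim = cfun.dim
  by unfold_locales (auto simp: fun_eq_iff algebra_simps)

definition specht_module :: "nat list \<Rightarrow> ((nat \<Rightarrow> nat set) \<Rightarrow> complex) set" where
  "specht_module \<nu> = cfun_span (polytabloid \<nu> ` tableaux \<nu>)"

definition irrep_dim :: "nat list \<Rightarrow> nat" where
  "irrep_dim \<nu> = cfun_dim (specht_module \<nu>)"


section \<open>The numbers of factorizations\<close>

definition perm_cycles :: "nat \<Rightarrow> (nat \<Rightarrow> nat) \<Rightarrow> nat set set" where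
  "perm_cycles n \<sigma> = (\<lambda>x. orbit \<sigma> x) ` {1..n}"

definition cycle_type :: "nat \<Rightarrow> (nat \<Rightarrow> nat) \<Rightarrow> nat multiset" where
  "cycle_type n \<sigma> = image_mset card (mset_set (perm_cycles n \<sigma>))"

text \<open>A tuple \<open>(\<sigma>\<^sub>0, \<dots>, \<sigma>\<^sub>m)\<close> is a list of length \<^term>\<open>m + 1\<close>.\<close>

definition factorizations :: "nat \<Rightarrow> nat list \<Rightarrow> nat \<Rightarrow> (nat \<Rightarrow> nat) list set" where
  "factorizations g \<nu> m = (let n = sum_list \<nu> in {\<sigma>s.
     length \<sigma>s = m + 1 \<and>
     set \<sigma>s \<subseteq> carrier (sym_group n) \<and>
     foldr (\<circ>) \<sigma>s id = id \<and>
     cycle_type n (\<sigma>s ! 0) = mset \<nu> \<and>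
     (\<forall>x\<in>{1..n}. \<forall>y\<in>{1..n}. \<exists>\<tau>\<in>generate (sym_group n) (set \<sigma>s). \<tau> x = y) \<and>
     2 - 2 * int g = 2 * int n - (\<Sum>i = 0..m. int n - int (card (perm_cycles n (\<sigma>s ! i))))})"

definition b_number :: "nat \<Rightarrow> nat list \<Rightarrow> nat \<Rightarrow> rat" where
  "b_number g \<nu> m = of_nat (card (factorizations g \<nu> m)) / fact (sum_list \<nu>)"


section \<open>The generating series\<close>

abbreviation hbar :: "rat fls" where
  "hbar \<equiv> fls_X"

definition p_monom :: "nat list \<Rightarrow> (nat, rat fls) mps" where
  "p_monom \<nu> = prod_list (map mps_var \<nu>)"

text \<open>The inner sum over \<open>g\<close> is the power series in \<open>\<hbar>\<close> with coefficient
  \<^term>\<open>b_number g \<nu> m\<close> at \<open>\<hbar>\<^bsup>2g\<^esup>\<close>.\<close>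

definition S_series :: "nat \<Rightarrow> (nat, rat fls) mps" where
  "S_series m = mps_sum (\<lambda>n. if n = 0 then 0 else
     (\<Sum>\<nu>\<in>partitions n.
        mps_const (fps_to_fls (Abs_fps (\<lambda>d. if even d then b_number (d div 2) \<nu> m else 0)))
        * p_monom \<nu>))"

definition schur_scaled :: "nat list \<Rightarrow> (nat, rat fls) mps" where
  "schur_scaled \<nu> = schur (\<lambda>i. mps_var i * mps_const (hbar ^ (i - 1))) \<nu>"

end

theory Submission
  imports Defs
begin

text \<open>
  The product of the sums \<open>\<Sum>\<^sub>\<sigma> \<hbar>\<^bsup>n - \<ell>(\<sigma>)\<^esup> \<sigma>\<close> over \<open>\<sigma>\<^sub>1, \<dots>, \<sigma>\<^sub>m\<close> is evaluated without characters.
  By Jucys, each of these sums is the product of \<open>1 + \<hbar> J\<^sub>k\<close> over the Jucys--Murphy elements \<open>J\<^sub>k\<close>, and \<open>J\<^sub>k\<close> is the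
  difference of the sums of all transpositions in \<open>S\<^sub>k\<close> and in \<open>S\<^bsub>k-1\<^esub>\<close>. On cycle monomials the sum of
  all transpositions acts as the cut-and-join operator, whose eigenvectors are the Schur functions, the
  eigenvalue being the sum of the contents. Multiplication by \<open>p\<^sub>1\<close> adds a box (Pieri), so adding the
  points one by one builds up a sum over standard tableaux in which every box of content \<open>c\<close>
  contributes the factor \<open>(1 + c \<hbar>)\<^sup>m\<close>; the number of standard tableaux is the dimension of the Specht module.
  This gives the sum over all tuples, connected or not, and the logarithm selects the
  transitive ones: the component of a fixed point yields the recursion for the coefficients
  of an exponential. For a transitive tuple \<open>\<Sum> (n - \<ell>(\<sigma>\<^sub>i)) = 2n - 2 + 2g\<close>, which accounts for the
  powers of \<open>\<hbar>\<close>; that this defines a non-negative integer \<open>g\<close> follows by factorizing every permutation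
  minimally into transpositions.
\<close>

section \<open>The dimension of a Specht module\<close>

text \<open>The dimension is that of a span of polytabloids and has to be matched with a number of
  standard tableaux. Independence is the usual triangularity. For the upper bound, all elements of
  the module satisfy linear relations of Garnir type, which force a vector that vanishes at the
  tabloids of standard tableaux to be zero; this replaces the straightening of polytabloids. That
  Schur functions are eigenvectors is shown coefficient by coefficient. A factor
  \<open>1 + h J\<close> for a new point becomes a commutator of the cut-and-join operator with
  multiplication by \<open>p_1\<close>; the content of a box appears as half the difference of two
  eigenvalues. The permutation \<open>\<sigma>\<^sub>0\<close> is eliminated as an inverse, and the
  substitution of \<open>p_i h^(i-1)\<close> for \<open>p_i\<close> restores its weight, since a
  cycle of length \<open>i\<close> contributes \<open>i - 1\<close> to it.\<close>

definition row_len :: "nat list \<Rightarrow> nat \<Rightarrow> nat" where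
  "row_len \<nu> r = (if r < length \<nu> then \<nu> ! r else 0)"

lemma mem_diagram_iff: "(r, j) \<in> diagram \<nu> \<longleftrightarrow> j < row_len \<nu> r"
  by (auto simp: diagram_def row_len_def)

lemma row_len_Suc_le: "sorted_wrt (\<ge>) \<nu> \<Longrightarrow> row_len \<nu> (Suc r) \<le> row_len \<nu> r"
  by (auto simp: row_len_def sorted_wrt_iff_nth_less)

lemma tabloid_eq: "tabloid \<nu> T r = (\<lambda>j. T (r, j)) ` {..<row_len \<nu> r}"
  by (auto simp: tabloid_def mem_diagram_iff image_iff)

lemma mem_tabloid_iff: "e \<in> tabloid \<nu> T r \<longleftrightarrow> (\<exists>j. (r, j) \<in> diagram \<nu> \<and> e = T (r, j))"
  by (auto simp: tabloid_eq mem_diagram_iff)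

lemma tableau_bij: "T \<in> tableaux \<nu> \<Longrightarrow> bij_betw T (diagram \<nu>) {1..sum_list \<nu>}"
  by (simp add: tableaux_def)

lemma tableau_inj:
  "T \<in> tableaux \<nu> \<Longrightarrow> k \<in> diagram \<nu> \<Longrightarrow> l \<in> diagram \<nu> \<Longrightarrow> T k = T l \<longleftrightarrow> k = l"
  using tableau_bij[of T \<nu>] by (auto simp: bij_betw_def inj_on_def)

lemma tableau_range: "T \<in> tableaux \<nu> \<Longrightarrow> k \<in> diagram \<nu> \<Longrightarrow> T k \<in> {1..sum_list \<nu>}"
  using tableau_bij[of T \<nu>] by (auto simp: bij_betw_def)

lemma tableau_surj: "T \<in> tableaux \<nu> \<Longrightarrow> e \<in> {1..sum_list \<nu>} \<Longrightarrow> \<exists>k\<in>diagram \<nu>. T k = e"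
  using tableau_bij[of T \<nu>] unfolding bij_betw_def by (metis imageE)

lemma tabloid_permuted: "tabloid \<nu> (\<pi> \<circ> T) r = \<pi> ` tabloid \<nu> T r"
  by (auto simp: tabloid_def)

lemma permuted_tableau:
  "T \<in> tableaux \<nu> \<Longrightarrow> \<pi> permutes {1..sum_list \<nu>} \<Longrightarrow> \<pi> \<circ> T \<in> tableaux \<nu>"
  by (auto simp: tableaux_def intro: bij_betw_trans permutes_imp_bij)

definition tabloids :: "nat list \<Rightarrow> (nat \<Rightarrow> nat set) set" where
  "tabloids \<nu> = tabloid \<nu> ` tableaux \<nu>"

lemma finite_tabloids: "finite (tabloids \<nu>)"
proof (rule finite_subset)
  show "tabloids \<nu> \<subseteq> {f. \<forall>r. (r \<in> {..<length \<nu>} \<longrightarrow> f r \<in> Pow {1..sum_list \<nu>}) \<and>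
      (r \<notin> {..<length \<nu>} \<longrightarrow> f r = {})}"
    using tableau_range by (fastforce simp: tabloids_def tabloid_def diagram_def)
  show "finite \<dots>"
    by (rule finite_set_of_finite_funs) auto
qed

lemma tabloid_disjoint:
  "x \<in> tabloids \<nu> \<Longrightarrow> e \<in> x r \<Longrightarrow> e \<in> x s \<Longrightarrow> r = s"
  using tableau_inj by (fastforce simp: tabloids_def mem_tabloid_iff)

lemma tabloid_cover:
  "x \<in> tabloids \<nu> \<Longrightarrow> e \<in> {1..sum_list \<nu>} \<Longrightarrow> \<exists>r<length \<nu>. e \<in> x r"
proof -
  assume "x \<in> tabloids \<nu>" "e \<in> {1..sum_list \<nu>}"
  then obtain T k where "T \<in> tableaux \<nu>" "x = tabloid \<nu> T" "k \<in> diagram \<nu>" "T k = e"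
    using tableau_surj by (fastforce simp: tabloids_def)
  then show ?thesis
    by (intro exI[of _ "fst k"]) (auto simp: mem_tabloid_iff diagram_def split: prod.splits)
qed

lemma tabloid_subset: "x \<in> tabloids \<nu> \<Longrightarrow> x r \<subseteq> {1..sum_list \<nu>}"
  using tableau_range by (fastforce simp: tabloids_def mem_tabloid_iff)

lemma finite_tabloid_row: "x \<in> tabloids \<nu> \<Longrightarrow> finite (x r)"
  by (rule finite_subset[OF tabloid_subset]) auto

lemma card_tabloid_row: "x \<in> tabloids \<nu> \<Longrightarrow> card (x r) = row_len \<nu> r"
proof -
  assume "x \<in> tabloids \<nu>"
  then obtain T where T: "T \<in> tableaux \<nu>" "x = tabloid \<nu> T" by (auto simp: tabloids_def)
  have "inj_on (\<lambda>j. T (r, j)) {..<row_len \<nu> r}"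
    using T(1) by (auto simp: inj_on_def tableau_inj mem_diagram_iff)
  then show ?thesis by (simp add: T(2) tabloid_eq card_image)
qed

lemma column_stabilizer_column:
  assumes "T \<in> tableaux \<nu>" "\<pi> \<in> column_stabilizer \<nu> T" "(r, j) \<in> diagram \<nu>"
  shows "\<exists>s. (s, j) \<in> diagram \<nu> \<and> \<pi> (T (r, j)) = T (s, j)"
proof -
  have "\<pi> (T (r, j)) \<in> \<pi> ` tableau_column \<nu> T j"
    using assms(3) by (auto simp: tableau_column_def)
  also have "\<dots> = tableau_column \<nu> T j" using assms(2) by (simp add: column_stabilizer_def)
  finally show ?thesis by (auto simp: tableau_column_def)
qed

lemma finite_column_stabilizer: "finite (column_stabilizer \<nu> T)"
  by (rule finite_subset[OF _ finite_permutations[of "{1..sum_list \<nu>}"]])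
     (auto simp: column_stabilizer_def)

lemma polytabloid_outside: "T \<in> tableaux \<nu> \<Longrightarrow> x \<notin> tabloids \<nu> \<Longrightarrow> polytabloid \<nu> T x = 0"
  unfolding polytabloid_def
  by (rule sum.neutral) (auto simp: column_stabilizer_def tabloids_def permuted_tableau)

section \<open>Linear relations in a Specht module\<close>

lemma transpose_image_diff:
  assumes "u \<in> G" "w \<in> G" shows "transpose u w ` A - G = A - G"
proof -
  have "transpose u w ` A - G = transpose u w ` A - transpose u w ` G" using assms by simp
  also have "\<dots> = transpose u w ` (A - G)" by (simp add: image_set_diff)
  also have "\<dots> = id ` (A - G)" using assms by (intro image_cong) (auto simp: transpose_def)
  finally show ?thesis by simp
qed

text \<open>A dual form of the Garnir relations: since \<open>G\<close> has more elements than row \<open>r\<close>, in every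
  term of a polytabloid that occurs in the sum two elements of \<open>G\<close> lie in the same column,
  and exchanging them changes the sign but leaves the set of redistributions invariant.\<close>

definition redistributions :: "nat list \<Rightarrow> (nat \<Rightarrow> nat set) \<Rightarrow> nat set \<Rightarrow> nat \<Rightarrow> (nat \<Rightarrow> nat set) set"
  where "redistributions \<nu> x G r = {y \<in> tabloids \<nu>. G \<subseteq> y r \<union> y (Suc r) \<and> (\<forall>s. y s - G = x s - G)}"

lemma polytabloid_sum_redistributions:
  assumes T: "T \<in> tableaux \<nu>" and sorted: "sorted_wrt (\<ge>) \<nu>"
    and G: "card G > row_len \<nu> r"
  shows "(\<Sum>y\<in>redistributions \<nu> x G r. polytabloid \<nu> T y) = 0"
proof -
  let ?X = "redistributions \<nu> x G r" and ?C = "column_stabilizer \<nu> T"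
  \<comment> \<open>The permutations whose terms meet the set of redistributions; \<open>sw\<close>
    pairs them off with opposite signs.\<close>
  define Q where "Q = {\<pi> \<in> ?C. tabloid \<nu> (\<pi> \<circ> T) \<in> ?X}"
  define P where "P \<pi> c \<longleftrightarrow> (Suc r, c) \<in> diagram \<nu> \<and> \<pi> (T (r, c)) \<in> G \<and> \<pi> (T (Suc r, c)) \<in> G" for \<pi> c
  \<comment> \<open>\<open>P\<close> is not affected by the exchange that \<open>sw\<close>
    performs, so the least such column is chosen again the second time and \<open>sw\<close> is an
    involution.\<close>
  define c where "c \<pi> = (LEAST c. P \<pi> c)" for \<pi>
  define sw where "sw \<pi> = transpose (\<pi> (T (r, c \<pi>))) (\<pi> (T (Suc r, c \<pi>))) \<circ> \<pi>" for \<pi>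
  have finX: "finite ?X"
    by (rule finite_subset[OF _ finite_tabloids[of \<nu>]]) (auto simp: redistributions_def)
  have finG: "finite G" using G by (metis card.infinite not_less_zero)
  have P: "P \<pi> (c \<pi>)" if "\<pi> \<in> Q" for \<pi>
  proof -
    let ?T = "\<pi> \<circ> T"
    have perm: "\<pi> permutes {1..sum_list \<nu>}" using that by (simp add: Q_def column_stabilizer_def)
    have T': "?T \<in> tableaux \<nu>" using permuted_tableau[OF T perm] .
    have GX: "G \<subseteq> tabloid \<nu> ?T r \<union> tabloid \<nu> ?T (Suc r)"
      using that by (auto simp: Q_def redistributions_def)
    have cell: "\<exists>s j. s \<in> {r, Suc r} \<and> (s, j) \<in> diagram \<nu> \<and> ?T (s, j) = g" if "g \<in> G" for g
    proof -
      from that GX have "g \<in> tabloid \<nu> ?T r \<or> g \<in> tabloid \<nu> ?T (Suc r)" by blast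
      then show ?thesis unfolding mem_tabloid_iff by blast
    qed
    define col where "col g = snd (the_inv_into (diagram \<nu>) ?T g)" for g
    have inj: "inj_on ?T (diagram \<nu>)" using tableau_bij[OF T'] by (simp add: bij_betw_def)
    have col: "col (?T (s, j)) = j" if "(s, j) \<in> diagram \<nu>" for s j
      using the_inv_into_f_f[OF inj that] by (simp add: col_def)
    \<comment> \<open>Both rows only have columns below \<open>row_len \<nu> r\<close>, so the
      larger set \<open>G\<close> meets some column twice, once in row \<open>r\<close> and once in
      row \<open>Suc r\<close>.\<close>
    have "col ` G \<subseteq> {..<row_len \<nu> r}"
    proof
      fix b assume "b \<in> col ` G"
      then obtain g where g: "g \<in> G" "b = col g" by blast
      obtain s j where s: "s \<in> {r, Suc r}" "(s, j) \<in> diagram \<nu>" "?T (s, j) = g" using cell g by blast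
      then have "b = j" using col g by metis
      then show "b \<in> {..<row_len \<nu> r}"
        using s row_len_Suc_le[OF sorted, of r] by (auto simp: mem_diagram_iff)
    qed
    then have "card (col ` G) < card G"
      using G card_mono[of "{..<row_len \<nu> r}" "col ` G"] by simp
    then have "\<not> inj_on col G" using pigeonhole by blast
    then obtain g h where gh: "g \<in> G" "h \<in> G" "g \<noteq> h" "col g = col h" by (auto simp: inj_on_def)
    obtain s j where s: "s \<in> {r, Suc r}" "(s, j) \<in> diagram \<nu>" "?T (s, j) = g" using cell gh by blast
    obtain s' j' where s': "s' \<in> {r, Suc r}" "(s', j') \<in> diagram \<nu>" "?T (s', j') = h" using cell gh by blast
    have jj: "j = j'" using gh s s' col by metis
    then have "s \<noteq> s'" using gh s s' by auto
    then have "P \<pi> j" using s s' jj gh by (auto simp: P_def)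
    then show ?thesis unfolding c_def by (rule LeastI)
  qed
  have cells: "(r, c \<pi>) \<in> diagram \<nu>" "(Suc r, c \<pi>) \<in> diagram \<nu>" if "\<pi> \<in> Q" for \<pi>
    using P[OF that] row_len_Suc_le[OF sorted, of r] by (auto simp: P_def mem_diagram_iff)
  have key: "sw \<pi> \<in> Q \<and> sw (sw \<pi>) = \<pi> \<and> sign (sw \<pi>) = - sign \<pi>" if pQ: "\<pi> \<in> Q" for \<pi>
  proof (intro conjI)
    let ?u = "\<pi> (T (r, c \<pi>))" and ?w = "\<pi> (T (Suc r, c \<pi>))"
    have perm: "\<pi> permutes {1..sum_list \<nu>}" using pQ by (simp add: Q_def column_stabilizer_def)
    have piC: "\<pi> \<in> ?C" using pQ by (simp add: Q_def)
    have T': "\<pi> \<circ> T \<in> tableaux \<nu>" using permuted_tableau[OF T perm] .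
    have ne: "?u \<noteq> ?w" using tableau_inj[OF T' cells(1)[OF pQ] cells(2)[OF pQ]] by simp
    have uw: "?u \<in> {1..sum_list \<nu>}" "?w \<in> {1..sum_list \<nu>}"
      using tableau_range[OF T' cells(1)[OF pQ]] tableau_range[OF T' cells(2)[OF pQ]] by auto
    have uwG: "?u \<in> G" "?w \<in> G" using P[OF pQ] by (auto simp: P_def)
    \<comment> \<open>Both elements come from cells of column \<open>c \<pi>\<close>, and
      \<open>\<pi>\<close> preserves the columns of \<open>T\<close>. So they share a column of
      \<open>T\<close>, and exchanging them stays inside the column stabilizer.\<close>
    have uwcol: "?u \<in> tableau_column \<nu> T j \<longleftrightarrow> ?w \<in> tableau_column \<nu> T j" for j
    proof -
      obtain s where s: "(s, c \<pi>) \<in> diagram \<nu>" "?u = T (s, c \<pi>)"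
        using column_stabilizer_column[OF T piC cells(1)[OF pQ]] by auto
      obtain s' where s': "(s', c \<pi>) \<in> diagram \<nu>" "?w = T (s', c \<pi>)"
        using column_stabilizer_column[OF T piC cells(2)[OF pQ]] by auto
      have *: "T (a, b) \<in> tableau_column \<nu> T j \<longleftrightarrow> b = j" if "(a, b) \<in> diagram \<nu>" for a b
        using that tableau_inj[OF T that] unfolding tableau_column_def image_iff by fastforce
      show ?thesis using s s' * by simp
    qed
    have trans_im: "transpose ?u ?w ` A = A" if "?u \<in> A \<longleftrightarrow> ?w \<in> A" for A
      using that by (cases "?u \<in> A") (auto simp: transpose_image_eq)
    have perm': "sw \<pi> permutes {1..sum_list \<nu>}"
      unfolding sw_def by (intro permutes_compose[OF perm] permutes_swap_id uw)
    have C': "sw \<pi> \<in> ?C"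
    proof -
      have "sw \<pi> ` tableau_column \<nu> T j = tableau_column \<nu> T j" for j
      proof -
        have "sw \<pi> ` tableau_column \<nu> T j = transpose ?u ?w ` \<pi> ` tableau_column \<nu> T j"
          unfolding sw_def image_comp ..
        also have "\<pi> ` tableau_column \<nu> T j = tableau_column \<nu> T j"
          using piC by (simp add: column_stabilizer_def)
        also have "transpose ?u ?w ` tableau_column \<nu> T j = tableau_column \<nu> T j"
          by (rule trans_im) (rule uwcol)
        finally show ?thesis .
      qed
      then show ?thesis using perm' by (simp add: column_stabilizer_def)
    qed
    have tab': "tabloid \<nu> (sw \<pi> \<circ> T) \<in> tabloids \<nu>"
      using permuted_tableau[OF T perm'] by (auto simp: tabloids_def)
    have eq: "tabloid \<nu> (sw \<pi> \<circ> T) s = transpose ?u ?w ` tabloid \<nu> (\<pi> \<circ> T) s" for s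
      by (simp add: tabloid_permuted sw_def image_comp)
    have u: "?u \<in> tabloid \<nu> (\<pi> \<circ> T) r" "?w \<in> tabloid \<nu> (\<pi> \<circ> T) (Suc r)"
      using cells[OF pQ] by (auto simp: mem_tabloid_iff)
    have "transpose ?u ?w ` A - G = A - G" for A
      using uwG by (rule transpose_image_diff)
    moreover have "G \<subseteq> transpose ?u ?w ` (tabloid \<nu> (\<pi> \<circ> T) r) \<union> transpose ?u ?w ` (tabloid \<nu> (\<pi> \<circ> T) (Suc r))"
    proof -
      have "transpose ?u ?w ` G \<subseteq> transpose ?u ?w ` (tabloid \<nu> (\<pi> \<circ> T) r \<union> tabloid \<nu> (\<pi> \<circ> T) (Suc r))"
        using pQ by (intro image_mono) (auto simp: Q_def redistributions_def)
      then show ?thesis using trans_im[of G] uwG by (simp add: image_Un)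
    qed
    ultimately show inQ: "sw \<pi> \<in> Q"
      using pQ C' tab' eq by (auto simp: Q_def redistributions_def)
    have PP: "P (sw \<pi>) b = P \<pi> b" for b
      using uwG by (auto simp: P_def sw_def transpose_def)
    then have cc: "c (sw \<pi>) = c \<pi>" by (simp add: c_def)
    show "sw (sw \<pi>) = \<pi>"
      unfolding sw_def[of "sw \<pi>"] cc by (auto simp: sw_def transpose_def fun_eq_iff)
    have "sign (sw \<pi>) = sign (transpose ?u ?w) * sign \<pi>" unfolding sw_def
      by (rule sign_compose) (use perm permutation_swap_id in \<open>auto intro: permutation_permutes[THEN iffD2]\<close>)
    then show "sign (sw \<pi>) = - sign \<pi>" using ne by (simp add: sign_swap_id)
  qed
  have "(\<Sum>y\<in>?X. polytabloid \<nu> T y)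
      = (\<Sum>\<pi>\<in>?C. \<Sum>y\<in>?X. of_int (sign \<pi>) * (if tabloid \<nu> (\<pi> \<circ> T) = y then 1 else 0))"
    unfolding polytabloid_def by (rule sum.swap)
  also have "\<dots> = (\<Sum>\<pi>\<in>?C. if tabloid \<nu> (\<pi> \<circ> T) \<in> ?X then of_int (sign \<pi>) else 0)"
    using finX by (intro sum.cong) (auto simp: sum.delta if_distrib cong: if_cong)
  also have "\<dots> = (\<Sum>\<pi>\<in>Q. of_int (sign \<pi>))"
    unfolding Q_def by (subst sum.inter_filter[symmetric]) (auto simp: finite_column_stabilizer)
  finally have S: "(\<Sum>y\<in>?X. polytabloid \<nu> T y) = (\<Sum>\<pi>\<in>Q. of_int (sign \<pi>))" .
  also have "\<dots> = (\<Sum>\<pi>\<in>Q. - of_int (sign \<pi>))"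
    by (rule sum.reindex_bij_witness[of _ sw sw]) (use key in auto)
  also have "\<dots> = - (\<Sum>y\<in>?X. polytabloid \<nu> T y)" by (simp add: S sum_negf)
  finally show ?thesis by (simp add: equation_minus_iff)
qed

lemma specht_module_outside:
  assumes "v \<in> specht_module \<nu>" "x \<notin> tabloids \<nu>" shows "v x = 0"
proof -
  have "\<forall>x. x \<notin> tabloids \<nu> \<longrightarrow> v x = 0"
    using assms(1) unfolding specht_module_def
    by (induction rule: cfun.span_induct_alt) (auto simp: polytabloid_outside)
  with assms(2) show ?thesis by blast
qed

lemma specht_module_sum_redistributions:
  assumes "v \<in> specht_module \<nu>" "sorted_wrt (\<ge>) \<nu>" "card G > row_len \<nu> r"
  shows "(\<Sum>y\<in>redistributions \<nu> x G r. v y) = 0"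
  using assms(1) unfolding specht_module_def
proof (induction rule: cfun.span_induct_alt)
  case (step c p v)
  then obtain T where "T \<in> tableaux \<nu>" "p = polytabloid \<nu> T" by blast
  then have "(\<Sum>y\<in>redistributions \<nu> x G r. p y) = 0"
    using polytabloid_sum_redistributions assms(2,3) by simp
  with step.IH show ?case by (simp add: sum.distrib sum_distrib_left[symmetric])
qed auto

text \<open>The tabloids of standard tableaux, described by a ballot condition so that no choice of
  a tableau enters. Prefixes of lattice words later give the same condition.\<close>

definition lattice_tabloids :: "nat list \<Rightarrow> (nat \<Rightarrow> nat set) set" where
  "lattice_tabloids \<nu> = {x \<in> tabloids \<nu>. \<forall>k r. card (x (Suc r) \<inter> {..k}) \<le> card (x r \<inter> {..k})}"

text \<open>The base exceeds every row index, so weights compare lexicographically, the rows of the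
  largest entries first.\<close>

definition tabloid_weight :: "nat list \<Rightarrow> (nat \<Rightarrow> nat set) \<Rightarrow> nat" where
  "tabloid_weight \<nu> x = (\<Sum>s<length \<nu>. s * (\<Sum>e\<in>x s. (length \<nu> + 1) ^ e))"

text \<open>After the common elements are cancelled, both sides have equally many terms, those of
  \<open>B\<close> at most \<open>f k\<close> and those of \<open>Y\<close> above it. This will make
  a tabloid the lightest among its redistributions.\<close>

lemma sum_less_exchange:
  fixes f :: "nat \<Rightarrow> nat"
  assumes "strict_mono f" "finite Y" "finite B" "card Y = card B" "Y \<noteq> B"
    and "\<And>b. b \<in> B \<Longrightarrow> b \<le> k" "\<And>y. y \<in> Y - B \<Longrightarrow> k < y"
  shows "sum f B < sum f Y"
proof -
  have "card (Y - B) = card (B - Y)"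
    using assms(2-4) card_Diff_subset_Int[of Y B] card_Diff_subset_Int[of B Y]
    by (simp add: Int_commute)
  moreover have "Y - B \<noteq> {}"
    using assms(2-5) calculation by (metis Diff_eq_empty_iff card_eq_0_iff finite_Diff subset_antisym)
  ultimately have "sum f (B - Y) \<le> card (Y - B) * f k"
    using sum_bounded_above[of "B - Y" f "f k"] assms(1,6)
    by (auto simp: strict_mono_less_eq)
  also have "\<dots> = (\<Sum>y\<in>Y-B. f k)" by simp
  also have "\<dots> < sum f (Y - B)"
    using assms(1,2,7) \<open>Y - B \<noteq> {}\<close> by (intro sum_strict_mono) (auto simp: strict_mono_less)
  finally have "sum f (B - Y) < sum f (Y - B)" .
  moreover have "sum f B = sum f (B - Y) + sum f (B \<inter> Y)" "sum f Y = sum f (Y - B) + sum f (B \<inter> Y)"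
    using assms(2,3) by (metis add.commute sum.Int_Diff, metis add.commute inf_commute sum.Int_Diff)
  ultimately show ?thesis by simp
qed

text \<open>Take a tabloid of largest weight in the support of \<open>v\<close>. If it were not a
  lattice tabloid, the relation for a suitable \<open>G\<close> would contain it as its lightest
  member; \<open>v\<close> vanishes at the other, heavier members and hence at the chosen one as
  well. This is the upper bound for the dimension.\<close>

lemma tabloid_eqI_lattice:
  assumes v: "v \<in> specht_module \<nu>" and sorted: "sorted_wrt (\<ge>) \<nu>"
    and zero: "\<And>y. y \<in> lattice_tabloids \<nu> \<Longrightarrow> v y = 0"
  shows "v = 0"
proof (rule ccontr)
  assume "v \<noteq> 0"
  define S where "S = {x \<in> tabloids \<nu>. v x \<noteq> 0}"
  let ?W = "tabloid_weight \<nu>"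
  have fin: "finite S" using finite_tabloids by (auto simp: S_def)
  have "S \<noteq> {}" using \<open>v \<noteq> 0\<close> specht_module_outside[OF v] by (auto simp: S_def fun_eq_iff)
  with fin have "Max (?W ` S) \<in> ?W ` S" by (intro Max_in) auto
  then obtain x where x: "x \<in> S" "?W x = Max (?W ` S)" by auto
  then have max: "?W y \<le> ?W x" if "y \<in> S" for y using that fin by simp
  have xt: "x \<in> tabloids \<nu>" and vx: "v x \<noteq> 0" using x by (auto simp: S_def)
  with zero have "x \<notin> lattice_tabloids \<nu>" by blast
  then obtain k r where kr: "card (x (Suc r) \<inter> {..k}) > card (x r \<inter> {..k})"
    using xt by (auto simp: lattice_tabloids_def not_le)
  define B where "B = x (Suc r) \<inter> {..k}"
  \<comment> \<open>The entries above \<open>k\<close> in row \<open>r\<close> and those up to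
    \<open>k\<close> in row \<open>Suc r\<close>. As row \<open>Suc r\<close> has more entries up to
    \<open>k\<close> than row \<open>r\<close>, these are too many for row \<open>r\<close>. In
    \<open>x\<close> the lower row holds the smallest elements of \<open>G\<close>, which makes
    \<open>x\<close> the lightest redistribution.\<close>
  define G where "G = (x r - {..k}) \<union> B"
  have finx: "finite (x s)" for s using finite_tabloid_row[OF xt] .
  have disj: "x r \<inter> x (Suc r) = {}" using tabloid_disjoint[OF xt, of _ r "Suc r"] by auto
  have finG: "finite G" "finite B" using finx by (auto simp: G_def B_def)
  have cG: "card G = card (x r - {..k}) + card B"
    unfolding G_def using disj finx by (intro card_Un_disjoint) (auto simp: B_def)
  have "card (x r) = card (x r - {..k}) + card (x r \<inter> {..k})"
    using finx card_Int_Diff[of "x r" "{..k}"] by simp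
  then have G: "card G > row_len \<nu> r" using cG kr card_tabloid_row[OF xt] by (simp add: B_def)
  have "B \<noteq> {}" using kr by (auto simp: B_def)
  then have rlen: "Suc r < length \<nu>"
    using card_tabloid_row[OF xt, of "Suc r"] finx by (auto simp: B_def row_len_def split: if_splits)
  let ?X = "redistributions \<nu> x G r"
  let ?g = "\<lambda>A. \<Sum>e\<in>A. (length \<nu> + 1) ^ e"
  have xX: "x \<in> ?X" using xt by (auto simp: redistributions_def G_def B_def)
  \<comment> \<open>Redistributions agree outside \<open>G\<close>, so their weights differ only by
    the part of \<open>G\<close> that is placed in row \<open>Suc r\<close>.\<close>
  have W: "?W y = (\<Sum>s<length \<nu>. s * ?g (x s - G)) + r * ?g G + ?g (y (Suc r) \<inter> G)"
    if "y \<in> ?X" for y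
  proof -
    have yt: "y \<in> tabloids \<nu>" and Gy: "G \<subseteq> y r \<union> y (Suc r)" and yx: "y s - G = x s - G" for s
      using that by (auto simp: redistributions_def)
    have finy: "finite (y s)" for s using finite_tabloid_row[OF yt] .
    have "?W y = (\<Sum>s<length \<nu>. s * ?g (y s - G) + s * ?g (y s \<inter> G))"
      unfolding tabloid_weight_def
      by (intro sum.cong refl) (metis add.commute add_mult_distrib2 finy sum.Int_Diff)
    also have "\<dots> = (\<Sum>s<length \<nu>. s * ?g (x s - G)) + (\<Sum>s<length \<nu>. s * ?g (y s \<inter> G))"
      by (simp add: sum.distrib yx)
    also have "(\<Sum>s<length \<nu>. s * ?g (y s \<inter> G)) = (\<Sum>s\<in>{r, Suc r}. s * ?g (y s \<inter> G))"
    proof (rule sum.mono_neutral_right)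
      show "\<forall>s\<in>{..<length \<nu>} - {r, Suc r}. s * ?g (y s \<inter> G) = 0"
      proof
        fix s assume s: "s \<in> {..<length \<nu>} - {r, Suc r}"
        then have "y s \<inter> G = {}" using Gy tabloid_disjoint[OF yt, of _ s] by auto
        then show "s * ?g (y s \<inter> G) = 0" by simp
      qed
    qed (use rlen in auto)
    also have "\<dots> = r * (?g (y r \<inter> G) + ?g (y (Suc r) \<inter> G)) + ?g (y (Suc r) \<inter> G)"
      by (simp add: algebra_simps)
    also have "?g (y r \<inter> G) + ?g (y (Suc r) \<inter> G) = ?g ((y r \<inter> G) \<union> (y (Suc r) \<inter> G))"
      using finG tabloid_disjoint[OF yt, of _ r "Suc r"] by (intro sum.union_disjoint[symmetric]) auto
    also have "(y r \<inter> G) \<union> (y (Suc r) \<inter> G) = G" using Gy by blast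
    finally show ?thesis by simp
  qed
  have v0: "v y = 0" if "y \<in> ?X - {x}" for y
  proof (rule ccontr)
    assume "v y \<noteq> 0"
    let ?Y = "y (Suc r) \<inter> G"
    have yX: "y \<in> ?X" using that by blast
    have yt: "y \<in> tabloids \<nu>" and Gy: "G \<subseteq> y r \<union> y (Suc r)" and yx: "y s - G = x s - G" for s
      using yX by (auto simp: redistributions_def)
    have finy: "finite (y s)" for s using finite_tabloid_row[OF yt] .
    have BG: "x (Suc r) \<inter> G = B" using disj by (auto simp: G_def B_def)
    have "card ?Y = card (x (Suc r) \<inter> G)"
      using card_Int_Diff[OF finy, of "Suc r" G] card_Int_Diff[OF finx, of "Suc r" G] yx[of "Suc r"]
        card_tabloid_row[OF xt, of "Suc r"] card_tabloid_row[OF yt, of "Suc r"] by simp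
    then have card: "card ?Y = card B" by (simp add: BG)
    have "?Y \<noteq> B"
    proof
      assume eq: "?Y = B"
      have "y s = x s" for s
      proof -
        have "y s \<inter> G = x s \<inter> G"
        proof -
          have yr: "y r \<inter> G = G - ?Y" using Gy tabloid_disjoint[OF yt, of _ r "Suc r"] by auto
          have xr: "x r \<inter> G = G - (x (Suc r) \<inter> G)" using disj by (auto simp: G_def B_def)
          consider "s = r" | "s = Suc r" | "s \<noteq> r" "s \<noteq> Suc r" by blast
          then show ?thesis
          proof cases
            case 3
            have "x s \<inter> G = {}" using 3 tabloid_disjoint[OF xt, of _ s] by (auto simp: G_def B_def)
            moreover have "y s \<inter> G = {}" using 3 Gy tabloid_disjoint[OF yt, of _ s] by auto
            ultimately show ?thesis by simp
          qed (use eq BG yr xr in auto)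
        qed
        then show ?thesis using yx[of s] by blast
      qed
      then show False using that by auto
    qed
    moreover have "strict_mono (\<lambda>e. (length \<nu> + 1) ^ e)"
      using rlen by (intro strict_monoI power_strict_increasing) auto
    ultimately have "?g B < ?g ?Y"
      using finG card by (intro sum_less_exchange[where k = k]) (auto simp: G_def B_def)
    then have "?W x < ?W y" using W[OF yX] W[OF xX] BG by simp
    moreover have "y \<in> S" using yt \<open>v y \<noteq> 0\<close> by (simp add: S_def)
    ultimately show False using max[of y] by simp
  qed
  have finX: "finite ?X"
    by (rule finite_subset[OF _ finite_tabloids[of \<nu>]]) (auto simp: redistributions_def)
  have "(\<Sum>y\<in>?X. v y) = v x + (\<Sum>y\<in>?X - {x}. v y)" using finX xX by (rule sum.remove)
  also have "(\<Sum>y\<in>?X - {x}. v y) = 0" by (intro sum.neutral ballI) (rule v0)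
  finally show False using vx specht_module_sum_redistributions[OF v sorted G] by simp
qed

section \<open>Triangularity of the polytabloids of standard tableaux\<close>

lemma digit_sum_bound:
  fixes f :: "nat \<Rightarrow> nat"
  assumes "\<And>e. e < a \<Longrightarrow> f e < b"
  shows "(\<Sum>e<a. f e * b ^ e) < b ^ a"
  using assms
proof (induction a)
  case (Suc a)
  then have "(\<Sum>e<a. f e * b ^ e) < b ^ a" "Suc (f a) \<le> b" by (auto simp: Suc_le_eq)
  then have "(\<Sum>e<Suc a. f e * b ^ e) < Suc (f a) * b ^ a" by simp
  also have "\<dots> \<le> b * b ^ a" using \<open>Suc (f a) \<le> b\<close> by (rule mult_le_mono1)
  finally show ?case by simp
qed auto

text \<open>In base \<open>b\<close> the highest position with different digits decides, because the
  digits below it add up to less than one unit of that position.\<close>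

lemma digit_sum_less:
  fixes f g :: "nat \<Rightarrow> nat"
  assumes "\<And>e. e < a \<Longrightarrow> f e < b" "f a < g a" "\<And>e. a < e \<Longrightarrow> e \<le> n \<Longrightarrow> f e = g e" "a \<le> n"
  shows "(\<Sum>e\<le>n. f e * b ^ e) < (\<Sum>e\<le>n. g e * b ^ e)"
proof -
  have split: "(\<Sum>e\<le>n. h e) = (\<Sum>e<a. h e) + h a + (\<Sum>e\<in>{a<..n}. h e)" for h :: "nat \<Rightarrow> nat"
  proof -
    have "{..n} = insert a {..<a} \<union> {a<..n}" using assms(4) by auto
    then have "(\<Sum>e\<le>n. h e) = (\<Sum>e\<in>insert a {..<a}. h e) + (\<Sum>e\<in>{a<..n}. h e)"
      by (simp only: sum.union_disjoint[of "insert a {..<a}" "{a<..n}"]) (subst sum.union_disjoint; auto)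
    then show ?thesis by simp
  qed
  have "(\<Sum>e<a. f e * b ^ e) + f a * b ^ a < b ^ a + f a * b ^ a"
    using digit_sum_bound[of a f b] assms(1) by simp
  also have "\<dots> = Suc (f a) * b ^ a" by simp
  also have "\<dots> \<le> g a * b ^ a" using assms(2) by (intro mult_le_mono1) auto
  also have "\<dots> \<le> (\<Sum>e<a. g e * b ^ e) + g a * b ^ a" by simp
  finally have "(\<Sum>e<a. f e * b ^ e) + f a * b ^ a < (\<Sum>e<a. g e * b ^ e) + g a * b ^ a" .
  moreover have "(\<Sum>e\<in>{a<..n}. f e * b ^ e) = (\<Sum>e\<in>{a<..n}. g e * b ^ e)"
    using assms(3) by (intro sum.cong) auto
  ultimately show ?thesis unfolding split[of "\<lambda>e. f e * b ^ e"] split[of "\<lambda>e. g e * b ^ e"] by simp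
qed

lemma diagram_eq_Sigma: "diagram \<nu> = (SIGMA r:{..<length \<nu>}. {..<\<nu> ! r})"
  by (auto simp: diagram_def)

lemma tabloid_weight_tabloid:
  assumes "T \<in> tableaux \<nu>"
  shows "tabloid_weight \<nu> (tabloid \<nu> T) = (\<Sum>k\<in>diagram \<nu>. fst k * (length \<nu> + 1) ^ T k)"
proof -
  have "(\<Sum>e\<in>tabloid \<nu> T s. (length \<nu> + 1) ^ e) = (\<Sum>j<\<nu>!s. (length \<nu> + 1) ^ T (s, j))"
    if "s < length \<nu>" for s
  proof -
    have "inj_on (\<lambda>j. T (s, j)) {..<\<nu> ! s}"
      using that assms by (auto simp: inj_on_def tableau_inj diagram_def)
    then show ?thesis using that by (simp add: tabloid_eq row_len_def sum.reindex)
  qed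
  then have "tabloid_weight \<nu> (tabloid \<nu> T)
      = (\<Sum>s<length \<nu>. \<Sum>j<\<nu>!s. s * (length \<nu> + 1) ^ T (s, j))"
    unfolding tabloid_weight_def by (simp add: sum_distrib_left)
  also have "\<dots> = (\<Sum>(s, j)\<in>diagram \<nu>. s * (length \<nu> + 1) ^ T (s, j))"
    unfolding diagram_eq_Sigma by (rule sum.Sigma) auto
  finally show ?thesis by (simp add: split_def)
qed

text \<open>Let \<open>a\<close> be the largest entry moved by \<open>\<pi>\<close>. In the permuted
  tableau it takes the place of a smaller entry of its column, hence it moves to a row above, while
  all larger entries stay. So the most significant digit that changes becomes smaller.\<close>

lemma tabloid_weight_column_permuted:
  assumes T: "T \<in> tableaux \<nu>" and pi: "\<pi> \<in> column_stabilizer \<nu> T" "\<pi> \<noteq> id"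
    and col: "\<And>r s j. r < s \<Longrightarrow> (s, j) \<in> diagram \<nu> \<Longrightarrow> (r, j) \<in> diagram \<nu> \<Longrightarrow> T (r, j) < T (s, j)"
  shows "tabloid_weight \<nu> (tabloid \<nu> (\<pi> \<circ> T)) < tabloid_weight \<nu> (tabloid \<nu> T)"
proof -
  let ?n = "sum_list \<nu>" and ?b = "length \<nu> + 1"
  \<comment> \<open>The row of the entry \<open>e\<close> in \<open>T\<close>. The value 0 outside
    the range of entries lets the digit sums run over \<open>{..?n}\<close>, including the position
    0, which is no entry.\<close>
  define \<rho> where "\<rho> e = (if e \<in> {1..?n} then fst (the_inv_into (diagram \<nu>) T e) else 0)" for e
  have perm: "\<pi> permutes {1..?n}" using pi by (simp add: column_stabilizer_def)
  have inj: "inj_on T (diagram \<nu>)" using tableau_bij[OF T] by (simp add: bij_betw_def)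
  have \<rho>: "\<rho> (T k) = fst k" if "k \<in> diagram \<nu>" for k
    using tableau_range[OF T that] the_inv_into_f_f[OF inj that] by (simp add: \<rho>_def)
  have \<rho>0: "\<rho> e = 0" if "e \<notin> {1..?n}" for e unfolding \<rho>_def using that by (rule if_not_P)
  have bound: "\<rho> e < ?b" for e
  proof (cases "e \<in> {1..?n}")
    case True
    then obtain k where k: "k \<in> diagram \<nu>" "T k = e" using tableau_surj[OF T] by blast
    moreover have "fst k < length \<nu>" using k(1) by (auto simp: diagram_def)
    ultimately show ?thesis using \<rho>[OF k(1)] by simp
  qed (simp add: \<rho>0)
  have "(\<Sum>k\<in>diagram \<nu>. fst k * ?b ^ T k) = (\<Sum>k\<in>diagram \<nu>. \<rho> (T k) * ?b ^ T k)"
    using \<rho> by simp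
  also have "\<dots> = (\<Sum>e\<in>{1..?n}. \<rho> e * ?b ^ e)"
    by (rule sum.reindex_bij_betw[OF tableau_bij[OF T]])
  also have "\<dots> = (\<Sum>e\<le>?n. \<rho> e * ?b ^ e)" using \<rho>0 by (intro sum.mono_neutral_left) (auto simp del: atLeastAtMost_iff)
  finally have W: "tabloid_weight \<nu> (tabloid \<nu> T) = (\<Sum>e\<le>?n. \<rho> e * ?b ^ e)"
    by (simp add: tabloid_weight_tabloid[OF T])
  have T': "\<pi> \<circ> T \<in> tableaux \<nu>" using permuted_tableau[OF T perm] .
  have "(\<Sum>k\<in>diagram \<nu>. fst k * ?b ^ (\<pi> \<circ> T) k)
      = (\<Sum>k\<in>diagram \<nu>. \<rho> (inv' \<pi> ((\<pi> \<circ> T) k)) * ?b ^ (\<pi> \<circ> T) k)"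
    using \<rho> permutes_inverses[OF perm] by simp
  also have "\<dots> = (\<Sum>e\<in>{1..?n}. \<rho> (inv' \<pi> e) * ?b ^ e)"
    by (rule sum.reindex_bij_betw[OF tableau_bij[OF T']])
  also have "\<dots> = (\<Sum>e\<le>?n. \<rho> (inv' \<pi> e) * ?b ^ e)"
    using \<rho>0 permutes_not_in[OF permutes_inv[OF perm]]
    by (intro sum.mono_neutral_left) (auto simp del: atLeastAtMost_iff)
  finally have W': "tabloid_weight \<nu> (tabloid \<nu> (\<pi> \<circ> T)) = (\<Sum>e\<le>?n. \<rho> (inv' \<pi> e) * ?b ^ e)"
    by (simp add: tabloid_weight_tabloid[OF T'])
  define a where "a = Max {e. \<pi> e \<noteq> e}"
  have sub: "{e. \<pi> e \<noteq> e} \<subseteq> {1..?n}" using permutes_not_in[OF perm] by blast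
  have fin: "finite {e. \<pi> e \<noteq> e}" using finite_subset[OF sub] by simp
  have "{e. \<pi> e \<noteq> e} \<noteq> {}" using pi(2) by (auto simp: fun_eq_iff)
  then have amov: "\<pi> a \<noteq> a" using Max_in[OF fin] by (auto simp: a_def)
  have amax: "\<pi> e = e" if "a < e" for e using Max_ge[OF fin, of e] that by (auto simp: a_def not_le[symmetric])
  have an: "a \<in> {1..?n}" using amov sub by blast
  define b where "b = inv' \<pi> a"
  have pb: "\<pi> b = a" using permutes_inverses[OF perm] by (simp add: b_def)
  then have "b \<noteq> a" using amov by auto
  with pb amax[of b] have ba: "b < a" by (metis linorder_neqE_nat)
  have "b \<in> {1..?n}" by (rule subsetD[OF sub]) (use pb \<open>b \<noteq> a\<close> in auto)
  then obtain k where "k \<in> diagram \<nu>" "T k = b" using tableau_surj[OF T] by blast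
  then obtain s j where sj: "(s, j) \<in> diagram \<nu>" "T (s, j) = b" by (cases k) auto
  then obtain r where r: "(r, j) \<in> diagram \<nu>" "T (r, j) = a"
    using column_stabilizer_column[OF T pi(1) sj(1)] pb by auto
  have "s < r" using col[of r s j] sj r ba by (cases r s rule: linorder_cases) auto
  then have less: "\<rho> (inv' \<pi> a) < \<rho> a" using \<rho>[OF sj(1)] \<rho>[OF r(1)] sj r by (simp add: b_def)
  show ?thesis unfolding W W'
  proof (rule digit_sum_less[where a = a])
    show "\<rho> (inv' \<pi> e) = \<rho> e" if "a < e" for e
      using amax[OF that] permutes_inverses(2)[OF perm, of e] by simp
  qed (use less bound an in auto)
qed

definition row_tableau :: "(nat \<Rightarrow> nat set) \<Rightarrow> nat \<times> nat \<Rightarrow> nat" where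
  "row_tableau x k = sorted_list_of_set (x (fst k)) ! snd k"

lemma tabloid_row_lists:
  assumes "\<And>r. x r \<subseteq> {1..sum_list \<nu>}" "\<And>r. card (x r) = row_len \<nu> r"
  obtains l where "\<And>r. length (l r) = row_len \<nu> r" "\<And>r. set (l r) = x r"
    "\<And>r. sorted_wrt (<) (l r)" "\<And>r j. row_tableau x (r, j) = l r ! j"
proof (rule that[of "\<lambda>r. sorted_list_of_set (x r)"])
  fix r j
  show "length (sorted_list_of_set (x r)) = row_len \<nu> r" "set (sorted_list_of_set (x r)) = x r"
    using assms(2) finite_subset[OF assms(1)] by auto
qed (auto simp: row_tableau_def strict_sorted_list_of_set)

lemma row_tableau:
  assumes sub: "\<And>r. x r \<subseteq> {1..sum_list \<nu>}" and disj: "\<And>e r s. e \<in> x r \<Longrightarrow> e \<in> x s \<Longrightarrow> r = s"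
    and cover: "\<And>e. e \<in> {1..sum_list \<nu>} \<Longrightarrow> \<exists>r. e \<in> x r" and card: "\<And>r. card (x r) = row_len \<nu> r"
  shows "row_tableau x \<in> tableaux \<nu>" "tabloid \<nu> (row_tableau x) = x"
proof -
  obtain l where len: "\<And>r. length (l r) = row_len \<nu> r" and set: "\<And>r. set (l r) = x r"
    and sorted: "\<And>r. sorted_wrt (<) (l r)" and row: "\<And>r j. row_tableau x (r, j) = l r ! j"
    using tabloid_row_lists[OF sub card] by blast
  have mem: "row_tableau x (r, j) \<in> x r" if "j < row_len \<nu> r" for r j
    unfolding row set[symmetric] using that by (intro nth_mem) (simp add: len)
  have im: "row_tableau x ` ({r} \<times> {..<row_len \<nu> r}) = x r" for r
  proof -
    have "row_tableau x ` ({r} \<times> {..<row_len \<nu> r}) = (!) (l r) ` {..<row_len \<nu> r}"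
      by (force simp: row)
    also have "\<dots> = x r" unfolding set[symmetric] set_conv_nth len by auto
    finally show ?thesis .
  qed
  have "tabloid \<nu> (row_tableau x) r = x r" for r
  proof -
    have "tabloid \<nu> (row_tableau x) r = row_tableau x ` ({r} \<times> {..<row_len \<nu> r})"
      by (auto simp: tabloid_eq)
    then show ?thesis by (simp only: im)
  qed
  then show "tabloid \<nu> (row_tableau x) = x" ..
  have "inj_on (row_tableau x) (diagram \<nu>)"
  proof (rule inj_onI, clarify)
    fix r j s i
    assume *: "(r, j) \<in> diagram \<nu>" "(s, i) \<in> diagram \<nu>" "row_tableau x (r, j) = row_tableau x (s, i)"
    have "row_tableau x (r, j) \<in> x r" "row_tableau x (r, j) \<in> x s"
      using * mem[of j r] mem[of i s] by (auto simp: mem_diagram_iff)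
    then have "r = s" by (rule disj)
    with * show "r = s \<and> j = i"
      using sorted[of r] len[of r]
      by (auto simp: row mem_diagram_iff nth_eq_iff_index_eq strict_sorted_iff)
  qed
  moreover have "row_tableau x ` diagram \<nu> = {1..sum_list \<nu>}"
  proof
    show "row_tableau x ` diagram \<nu> \<subseteq> {1..sum_list \<nu>}"
    proof clarify
      fix r j assume "(r, j) \<in> diagram \<nu>"
      then have "row_tableau x (r, j) \<in> x r" using mem by (simp add: mem_diagram_iff)
      then show "row_tableau x (r, j) \<in> {1..sum_list \<nu>}" using sub by blast
    qed
    show "{1..sum_list \<nu>} \<subseteq> row_tableau x ` diagram \<nu>"
    proof
      fix e assume "e \<in> {1..sum_list \<nu>}"
      then obtain r where "e \<in> x r" using cover by blast
      then have "e \<in> row_tableau x ` ({r} \<times> {..<row_len \<nu> r})" by (simp only: im)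
      then show "e \<in> row_tableau x ` diagram \<nu>" by (auto simp: mem_diagram_iff)
    qed
  qed
  ultimately show "row_tableau x \<in> tableaux \<nu>" by (simp add: tableaux_def bij_betw_def)
qed

lemma row_tableau_in:
  assumes "x \<in> tabloids \<nu>"
  shows "row_tableau x \<in> tableaux \<nu>" "tabloid \<nu> (row_tableau x) = x"
proof -
  have cover: "\<exists>r. e \<in> x r" if "e \<in> {1..sum_list \<nu>}" for e using tabloid_cover[OF assms that] by blast
  note row = row_tableau[of x \<nu>, OF tabloid_subset[OF assms] tabloid_disjoint[OF assms] cover card_tabloid_row[OF assms]]
  show "row_tableau x \<in> tableaux \<nu>" by (rule row(1))
  show "tabloid \<nu> (row_tableau x) = x" by (rule row(2))
qed

lemma tabloidsI:
  assumes "\<And>r. x r \<subseteq> {1..sum_list \<nu>}" "\<And>e r s. e \<in> x r \<Longrightarrow> e \<in> x s \<Longrightarrow> r = s"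
    and "\<And>e. e \<in> {1..sum_list \<nu>} \<Longrightarrow> \<exists>r. e \<in> x r" and "\<And>r. card (x r) = row_len \<nu> r"
  shows "x \<in> tabloids \<nu>"
proof -
  have "row_tableau x \<in> tableaux \<nu>" by (rule row_tableau(1)) (fact assms)+
  moreover have "tabloid \<nu> (row_tableau x) = x" by (rule row_tableau(2)) (fact assms)+
  ultimately show ?thesis unfolding tabloids_def by (metis image_eqI)
qed

text \<open>If the entry \<open>k\<close> of the cell \<open>(Suc r, j)\<close> were below the entry
  above it, row \<open>Suc r\<close> would contain at least \<open>j + 1\<close> entries up to
  \<open>k\<close> and row \<open>r\<close> at most \<open>j\<close>, against the ballot
  condition.\<close>

lemma row_tableau_column_less:
  assumes x: "x \<in> lattice_tabloids \<nu>" and s: "(Suc r, j) \<in> diagram \<nu>" "(r, j) \<in> diagram \<nu>"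
  shows "row_tableau x (r, j) < row_tableau x (Suc r, j)"
proof (rule ccontr)
  assume "\<not> ?thesis"
  then have le: "row_tableau x (Suc r, j) \<le> row_tableau x (r, j)" by simp
  have xt: "x \<in> tabloids \<nu>" using x by (simp add: lattice_tabloids_def)
  obtain l where len: "\<And>r. length (l r) = row_len \<nu> r" and set: "\<And>r. set (l r) = x r"
    and sorted: "\<And>r. sorted_wrt (<) (l r)" and row: "\<And>r j. row_tableau x (r, j) = l r ! j"
    using tabloid_row_lists[OF tabloid_subset[OF xt] card_tabloid_row[OF xt]] by blast
  define k where "k = l (Suc r) ! j"
  have mono: "l r ! i < l r ! i'" if "i < i'" "i' < row_len \<nu> r" for i i' r
    using sorted[of r] that len by (auto simp: sorted_wrt_iff_nth_less)
  have mem: "l r ! i \<in> x r" if "i < row_len \<nu> r" for r i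
    unfolding set[symmetric] using that by (intro nth_mem) (simp add: len)
  have j: "j < row_len \<nu> r" "j < row_len \<nu> (Suc r)" using s by (auto simp: mem_diagram_iff)
  have "l (Suc r) ! j \<noteq> l r ! j"
    using tabloid_disjoint[OF xt, of "l r ! j" r "Suc r"] mem[OF j(1)] mem[OF j(2)] by auto
  with le have kl: "k < l r ! j" by (simp add: row k_def)
  have "(!) (l (Suc r)) ` {..j} \<subseteq> x (Suc r) \<inter> {..k}"
  proof
    fix e assume "e \<in> (!) (l (Suc r)) ` {..j}"
    then obtain i where i: "i \<le> j" "e = l (Suc r) ! i" by auto
    then have "e \<in> x (Suc r)" using mem[of i "Suc r"] j by simp
    moreover have "e \<le> k" using mono[of i j "Suc r"] i j by (cases "i = j") (auto simp: k_def)
    ultimately show "e \<in> x (Suc r) \<inter> {..k}" by simp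
  qed
  then have "card ((!) (l (Suc r)) ` {..j}) \<le> card (x (Suc r) \<inter> {..k})"
    by (intro card_mono) auto
  moreover have "inj_on ((!) (l (Suc r))) {..j}"
    using j len sorted[of "Suc r"] by (auto simp: inj_on_def nth_eq_iff_index_eq strict_sorted_iff)
  ultimately have big: "Suc j \<le> card (x (Suc r) \<inter> {..k})" by (simp add: card_image)
  have sub: "x r \<inter> {..k} \<subseteq> (!) (l r) ` {..<j}"
  proof
    fix e assume e: "e \<in> x r \<inter> {..k}"
    then obtain i where i: "i < row_len \<nu> r" "e = l r ! i"
      using set[of r] len[of r] by (metis IntD1 in_set_conv_nth)
    have "i < j"
    proof (rule ccontr)
      assume "\<not> i < j"
      then have "l r ! j \<le> e" using mono[of j i r] i by (cases "i = j") auto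
      then show False using kl e by auto
    qed
    then show "e \<in> (!) (l r) ` {..<j}" using i by blast
  qed
  have "card (x r \<inter> {..k}) \<le> card ((!) (l r) ` {..<j})" by (rule card_mono[OF _ sub]) simp
  also have "\<dots> \<le> j" using card_image_le[of "{..<j}" "(!) (l r)"] by simp
  finally have "card (x r \<inter> {..k}) \<le> j" .
  with big have "card (x r \<inter> {..k}) < card (x (Suc r) \<inter> {..k})" by simp
  moreover have "card (x (Suc r) \<inter> {..k}) \<le> card (x r \<inter> {..k})"
    using x by (simp add: lattice_tabloids_def)
  ultimately show False by simp
qed

text \<open>The columns of \<open>row_tableau x\<close> increase. Hence the identity contributes
  \<open>x\<close> with coefficient 1, and every other element of the column stabilizer gives a
  lighter tabloid.\<close>

lemma polytabloid_row_tableau: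
  assumes x: "x \<in> lattice_tabloids \<nu>" and sorted: "sorted_wrt (\<ge>) \<nu>"
  shows "polytabloid \<nu> (row_tableau x) x = 1"
    and "polytabloid \<nu> (row_tableau x) y \<noteq> 0 \<Longrightarrow> y = x \<or> tabloid_weight \<nu> y < tabloid_weight \<nu> x"
proof -
  let ?T = "row_tableau x" and ?C = "column_stabilizer \<nu> (row_tableau x)"
  have xt: "x \<in> tabloids \<nu>" using x by (simp add: lattice_tabloids_def)
  note T = row_tableau_in[OF xt]
  have col: "?T (r, j) < ?T (s, j)" if "r < s" "(s, j) \<in> diagram \<nu>" "(r, j) \<in> diagram \<nu>" for r s j
    using that
  proof (induction s)
    case (Suc s)
    have s: "(s, j) \<in> diagram \<nu>" using Suc.prems row_len_Suc_le[OF sorted, of s] by (simp add: mem_diagram_iff)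
    show ?case using Suc.IH row_tableau_column_less[OF x Suc.prems(2) s] Suc.prems s
      by (cases "r = s") auto
  qed auto
  have less: "tabloid_weight \<nu> (tabloid \<nu> (\<pi> \<circ> ?T)) < tabloid_weight \<nu> x" if "\<pi> \<in> ?C" "\<pi> \<noteq> id" for \<pi>
    using tabloid_weight_column_permuted[OF T(1) that col] T(2) by simp
  have idC: "id \<in> ?C" by (simp add: column_stabilizer_def permutes_id)
  have "polytabloid \<nu> ?T y = (if x = y then 1 else 0) +
      (\<Sum>\<pi>\<in>?C - {id}. of_int (sign \<pi>) * (if tabloid \<nu> (\<pi> \<circ> ?T) = y then 1 else 0))" for y
    unfolding polytabloid_def using T(2) by (subst sum.remove[OF finite_column_stabilizer idC]) auto
  moreover have "(\<Sum>\<pi>\<in>?C - {id}. of_int (sign \<pi>) * (if tabloid \<nu> (\<pi> \<circ> ?T) = y then 1 else 0)) = (0 :: complex)"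
    if "\<not> tabloid_weight \<nu> y < tabloid_weight \<nu> x" for y
    using that less by (intro sum.neutral) auto
  ultimately show "polytabloid \<nu> ?T x = 1"
    and "polytabloid \<nu> ?T y \<noteq> 0 \<Longrightarrow> y = x \<or> tabloid_weight \<nu> y < tabloid_weight \<nu> x"
    by (auto split: if_splits)
qed

lemma sum_fun_apply: "(\<Sum>a\<in>A. f a) x = (\<Sum>a\<in>A. f a x)"
  for f :: "'i \<Rightarrow> 'b \<Rightarrow> 'c :: comm_monoid_add"
  by (induction A rule: infinite_finite_induct) auto

text \<open>Triangularity makes the polytabloids of the lattice tabloids independent. Subtracting
  multiples of them, heaviest first, makes any element of the module vanish at all lattice tabloids,
  and then it is zero by \<open>tabloid_eqI_lattice\<close>.\<close>

theorem irrep_dim_eq_card_lattice_tabloids: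
  assumes sorted: "sorted_wrt (\<ge>) \<nu>"
  shows "irrep_dim \<nu> = card (lattice_tabloids \<nu>)"
proof -
  let ?W = "tabloid_weight \<nu>" and ?L = "lattice_tabloids \<nu>"
  define e where "e x = polytabloid \<nu> (row_tableau x)" for x
  have fin: "finite ?L"
    by (rule finite_subset[OF _ finite_tabloids[of \<nu>]]) (auto simp: lattice_tabloids_def)
  have e1: "e x x = 1" if "x \<in> ?L" for x
    using polytabloid_row_tableau(1)[OF that sorted] by (simp add: e_def)
  have e0: "e x y = 0" if "x \<in> ?L" "y \<noteq> x" "?W x \<le> ?W y" for x y
    using polytabloid_row_tableau(2)[OF that(1) sorted, of y] that by (auto simp: e_def)
  have eS: "e x \<in> specht_module \<nu>" if "x \<in> ?L" for x
    unfolding specht_module_def e_def using that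
    by (intro cfun.span_base imageI row_tableau_in) (auto simp: lattice_tabloids_def)
  have max: "\<exists>x\<in>A. \<forall>y\<in>A. ?W y \<le> ?W x" if "A \<subseteq> ?L" "A \<noteq> {}" for A
  proof -
    have finA: "finite A" using finite_subset[OF that(1) fin] .
    then have "Max (?W ` A) \<in> ?W ` A" using that by (intro Max_in) auto
    then obtain x where "x \<in> A" "?W x = Max (?W ` A)" by auto
    then show ?thesis using finA by (intro bexI[of _ x]) auto
  qed
  have inj: "inj_on e ?L"
  proof (rule inj_onI)
    fix x y assume xy: "x \<in> ?L" "y \<in> ?L" "e x = e y"
    show "x = y"
    proof (cases "?W x \<le> ?W y")
      case True
      then show ?thesis using e0[OF xy(1), of y] e1[OF xy(2)] xy(3) by auto
    next
      case False
      then show ?thesis using e0[OF xy(2), of x] e1[OF xy(1)] xy(3) by auto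
    qed
  qed
  have indep: "cfun.independent (e ` ?L)"
  proof
    assume "cfun.dependent (e ` ?L)"
    then obtain u where u: "\<exists>v\<in>e ` ?L. u v \<noteq> 0" "(\<Sum>v\<in>e ` ?L. (\<lambda>z. u v * v z)) = 0"
      using cfun.dependent_finite[of "e ` ?L"] fin by auto
    define A where "A = {x \<in> ?L. u (e x) \<noteq> 0}"
    have "A \<noteq> {}" using u(1) by (auto simp: A_def)
    then obtain x where x: "x \<in> A" "\<forall>y\<in>A. ?W y \<le> ?W x" using max[of A] by (auto simp: A_def)
    have "0 = (\<Sum>v\<in>e ` ?L. (\<lambda>z. u v * v z)) x" by (simp add: u(2))
    also have "\<dots> = (\<Sum>v\<in>e ` ?L. u v * v x)"
      by (rule sum_fun_apply)
    also have "\<dots> = (\<Sum>y\<in>?L. u (e y) * e y x)" by (simp add: sum.reindex[OF inj])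
    also have "\<dots> = (\<Sum>y\<in>{x}. u (e y) * e y x)"
      using x fin by (intro sum.mono_neutral_right) (auto simp: A_def intro: e0)
    also have "\<dots> = u (e x)" using x e1 by (simp add: A_def)
    finally show False using x by (simp add: A_def)
  qed
  \<comment> \<open>Lattice tabloids outside \<open>A\<close> are at least as heavy as those in
    \<open>A\<close>, and \<open>v\<close> is zero there. Subtracting \<open>v x * e x\<close> for a
    heaviest \<open>x\<close> in \<open>A\<close> therefore creates no new nonzero values outside
    \<open>A\<close>.\<close>
  have span: "v \<in> cfun_span (e ` ?L)"
    if "v \<in> specht_module \<nu>" "A \<subseteq> ?L" "\<forall>y\<in>?L - A. v y = 0 \<and> (\<forall>x\<in>A. ?W x \<le> ?W y)" for v A
    using finite_subset[OF that(2) fin] that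
  proof (induction A arbitrary: v rule: finite_remove_induct)
    case empty
    then have "v = 0" using tabloid_eqI_lattice[OF _ sorted] by simp
    then show ?case by (metis cfun.span_zero)
  next
    case (remove A)
    obtain x where x: "x \<in> A" "\<forall>y\<in>A. ?W y \<le> ?W x" using max[of A] remove by blast
    have xL: "x \<in> ?L" using x remove.prems by blast
    define v' where "v' = v - (\<lambda>z. v x * e x z)"
    have "v' \<in> specht_module \<nu>"
      using remove.prems(1) eS[OF xL] unfolding v'_def specht_module_def
      by (intro cfun.span_diff cfun.span_scale) auto
    moreover have "\<forall>y\<in>?L - (A - {x}). v' y = 0 \<and> (\<forall>x\<in>A - {x}. ?W x \<le> ?W y)"
    proof
      fix y assume y: "y \<in> ?L - (A - {x})"
      show "v' y = 0 \<and> (\<forall>x\<in>A - {x}. ?W x \<le> ?W y)"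
      proof (cases "y = x")
        case True
        then show ?thesis using e1[OF xL] x by (simp add: v'_def)
      next
        case False
        then have "v y = 0" "\<forall>x\<in>A. ?W x \<le> ?W y" using y remove.prems(3) by auto
        then show ?thesis using e0[OF xL False] x(1) by (simp add: v'_def)
      qed
    qed
    ultimately have "v' \<in> cfun_span (e ` ?L)"
      using remove.IH[OF x(1), of v'] remove.prems(2) by blast
    moreover have "(\<lambda>z. v x * e x z) \<in> cfun_span (e ` ?L)"
      using xL by (intro cfun.span_scale cfun.span_base) auto
    moreover have "v = v' + (\<lambda>z. v x * e x z)" by (simp add: v'_def)
    ultimately show ?case using cfun.span_add by metis
  qed
  have "specht_module \<nu> = cfun_span (e ` ?L)"
  proof
    show "specht_module \<nu> \<subseteq> cfun_span (e ` ?L)" using span[OF _ subset_refl] by blast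
    have "e ` ?L \<subseteq> specht_module \<nu>" using eS by blast
    then have "cfun_span (e ` ?L) \<subseteq> cfun_span (specht_module \<nu>)" by (rule cfun.span_mono)
    then show "cfun_span (e ` ?L) \<subseteq> specht_module \<nu>" by (simp add: specht_module_def cfun.span_span)
  qed
  then have "irrep_dim \<nu> = card (e ` ?L)"
    unfolding irrep_dim_def using cfun.dim_span_eq_card_independent[OF indep] by simp
  then show ?thesis by (simp add: card_image[OF inj])
qed

section \<open>Derivations on power series in many variables\<close>

lemma mps_coeff_zero [simp]: "mps_coeff 0 M = 0"
  by transfer simp

lemma mps_coeff_one: "mps_coeff 1 M = (if M = {#} then 1 else 0)"
  by transfer simp

lemma mps_coeff_add [simp]: "mps_coeff (f + g) M = mps_coeff f M + mps_coeff g M"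
  by transfer simp

lemma mps_coeff_diff [simp]: "mps_coeff (f - g) M = mps_coeff f M - mps_coeff g M"
  by transfer simp

lemma mps_coeff_uminus [simp]: "mps_coeff (- f) M = - mps_coeff f M"
  by transfer simp

lemma mps_coeff_mult:
  "mps_coeff (f * g) M = (\<Sum>(A, B)\<in>mset_splits M. mps_coeff f A * mps_coeff g B)"
  by transfer simp

lemma mps_coeff_sum [simp]: "mps_coeff (\<Sum>a\<in>A. f a) M = (\<Sum>a\<in>A. mps_coeff (f a) M)"
  for f :: "'i \<Rightarrow> ('v, 'a :: comm_ring_1) mps"
  by (induction A rule: infinite_finite_induct) auto

lemma mps_coeff_const: "mps_coeff (mps_const c) M = (if M = {#} then c else 0)"
  by transfer simp

lemma mps_coeff_var: "mps_coeff (mps_var v) M = (if M = {#v#} then 1 else 0)"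
  by transfer simp

lemma mps_coeff_const_mult [simp]: "mps_coeff (mps_const c * f) M = c * mps_coeff f M"
  for f :: "('v, 'a :: comm_ring_1) mps"
proof -
  have "mps_coeff (mps_const c * f) M = (\<Sum>(A, B)\<in>{({#} :: 'v multiset, M)}. mps_coeff (mps_const c) A * mps_coeff f B)"
    unfolding mps_coeff_mult
    by (rule sum.mono_neutral_right, simp, simp add: mset_splits_def)
       (auto simp: mset_splits_def mps_coeff_const split: if_splits)
  then show ?thesis by (simp add: mps_coeff_const)
qed

lemma mps_const_0 [simp]: "mps_const 0 = 0"
  by (rule mps_eqI) (simp add: mps_coeff_const)

lemma mps_const_1 [simp]: "mps_const 1 = 1"
  by (rule mps_eqI) (simp add: mps_coeff_const mps_coeff_one)

lemma mps_const_add: "mps_const (a + b) = mps_const a + mps_const b" for a :: "'a :: comm_ring_1"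
  by (rule mps_eqI) (simp add: mps_coeff_const)

lemma mps_const_mult: "mps_const (a * b) = mps_const a * mps_const b" for a :: "'a :: comm_ring_1"
  by (rule mps_eqI) (simp add: mps_coeff_const)

lemma mps_const_power: "mps_const (a ^ n) = mps_const a ^ n" for a :: "'a :: comm_ring_1"
  by (induction n) (simp_all add: mps_const_mult)

lemma mps_const_sum: "mps_const (\<Sum>a\<in>A. f a) = (\<Sum>a\<in>A. mps_const (f a))"
  for f :: "'i \<Rightarrow> 'a :: comm_ring_1"
  by (induction A rule: infinite_finite_induct) (simp_all add: mps_const_add)

lemma of_nat_mps: "of_nat n = mps_const (of_nat n)"
  by (induction n) (simp_all add: mps_const_add)

lemma mps_coeff_of_nat_mult [simp]: "mps_coeff (of_nat n * f) M = of_nat n * mps_coeff f M"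
  by (simp add: of_nat_mps)

lemma of_int_mps: "of_int n = mps_const (of_int n)"
  by (cases n rule: int_cases2) (simp_all add: of_nat_mps mps_eqI mps_coeff_const)

lemma mps_coeff_of_int_mult [simp]: "mps_coeff (of_int n * f) M = of_int n * mps_coeff f M"
  by (simp add: of_int_mps)

text \<open>Division takes place in the coefficient field, which has characteristic 0. This allows
  Newton's identity to be solved for its leading term.\<close>

lemma mps_of_nat_cancel:
  fixes f g :: "('v, 'a :: field_char_0) mps"
  assumes "of_nat n * f = of_nat n * g" "n > 0" shows "f = g"
proof (rule mps_eqI)
  fix M
  have "of_nat n * mps_coeff f M = of_nat n * mps_coeff g M"
    using assms(1) by (metis mps_coeff_of_nat_mult)
  then show "mps_coeff f M = mps_coeff g M" using assms(2) by simp
qed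

text \<open>Characteristic 0 turns every sign-reversing symmetry below into a vanishing
  statement.\<close>

lemma mps_eq_uminus_self:
  fixes f :: "('v, 'a :: field_char_0) mps"
  assumes "f = - f" shows "f = 0"
proof (rule mps_eqI)
  fix M
  have "mps_coeff f M = - mps_coeff f M" using arg_cong[OF assms, of "\<lambda>g. mps_coeff g M"] by simp
  then have "mps_coeff f M + mps_coeff f M = 0" by (metis add.right_inverse)
  then have "2 * mps_coeff f M = 0" by (simp only: mult_2)
  then show "mps_coeff f M = mps_coeff 0 M" by simp
qed

section \<open>Derivations and the product rule\<close>

definition derivation :: "('a :: comm_ring_1 \<Rightarrow> 'a) \<Rightarrow> bool" where
  "derivation D \<longleftrightarrow> (\<forall>a b. D (a + b) = D a + D b) \<and> (\<forall>a b. D (a * b) = D a * b + a * D b)"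

lemma derivation_add: "derivation D \<Longrightarrow> D (a + b) = D a + D b"
  by (simp add: derivation_def)

lemma derivation_mult: "derivation D \<Longrightarrow> D (a * b) = D a * b + a * D b"
  by (simp add: derivation_def)

lemma derivation_0: "derivation D \<Longrightarrow> D 0 = 0"
  using derivation_add[of D 0 0] by simp

lemma derivation_1: "derivation D \<Longrightarrow> D 1 = 0"
  using derivation_mult[of D 1 1] by simp

lemma derivation_uminus: "derivation D \<Longrightarrow> D (- a) = - D a"
  using derivation_add[of D a "- a"] derivation_0[of D] by (simp add: eq_neg_iff_add_eq_0 add.commute)

lemma derivation_diff: "derivation D \<Longrightarrow> D (a - b) = D a - D b"
  using derivation_add[of D a "- b"] derivation_uminus[of D b] by simp

lemma derivation_sum: "derivation D \<Longrightarrow> D (\<Sum>a\<in>A. f a) = (\<Sum>a\<in>A. D (f a))"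
  by (induction A rule: infinite_finite_induct) (simp_all add: derivation_0 derivation_add)

lemma derivation_of_nat: "derivation D \<Longrightarrow> D (of_nat n) = 0"
  by (induction n) (simp_all add: derivation_0 derivation_1 derivation_add)

lemma derivation_of_int: "derivation D \<Longrightarrow> D (of_int n) = 0"
  by (cases n rule: int_cases2) (simp_all add: derivation_of_nat derivation_uminus)

lemma derivation_of_nat_mult: "derivation D \<Longrightarrow> D (of_nat n * a) = of_nat n * D a"
  by (simp add: derivation_mult derivation_of_nat)

lemma derivation_of_int_mult: "derivation D \<Longrightarrow> D (of_int n * a) = of_int n * D a"
  by (simp add: derivation_mult derivation_of_int)

lemma derivation_prod:
  assumes "derivation D" "finite A"
  shows "D (\<Prod>a\<in>A. f a) = (\<Sum>a\<in>A. D (f a) * (\<Prod>b\<in>A-{a}. f b))"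
  using assms(2)
proof (induction A rule: finite_induct)
  case (insert x A)
  have "(\<Sum>a\<in>A. D (f a) * (\<Prod>b\<in>insert x A - {a}. f b)) = (\<Sum>a\<in>A. f x * (D (f a) * (\<Prod>b\<in>A-{a}. f b)))"
  proof (rule sum.cong[OF refl])
    fix a assume "a \<in> A"
    with insert.hyps have "insert x A - {a} = insert x (A - {a})" "x \<notin> A - {a}" by auto
    then show "D (f a) * (\<Prod>b\<in>insert x A - {a}. f b) = f x * (D (f a) * (\<Prod>b\<in>A-{a}. f b))"
      using insert.hyps by (simp add: ac_simps)
  qed
  with insert show ?case by (simp add: derivation_mult[OF assms(1)] sum_distrib_left)
qed (simp add: derivation_1[OF assms(1)])

lemma derivation_mult_left: "derivation D \<Longrightarrow> derivation (\<lambda>f. c * D f)"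
  by (simp add: derivation_def algebra_simps)

lemma derivation_sum_fun:
  assumes "\<And>a. a \<in> A \<Longrightarrow> derivation (D a)"
  shows "derivation (\<lambda>f. \<Sum>a\<in>A. D a f)"
  using assms by (simp add: derivation_def sum.distrib sum_distrib_left sum_distrib_right)

text \<open>The derivation \<open>k \<partial>/\<partial>p\<^sub>k\<close>.\<close>

definition mps_E :: "nat \<Rightarrow> (nat, 'a :: field_char_0) mps \<Rightarrow> (nat, 'a) mps" where
  "mps_E k f = Abs_mps (\<lambda>M. of_nat k * of_nat (count M k + 1) * mps_coeff f (add_mset k M))"

lemma mps_coeff_E [simp]:
  "mps_coeff (mps_E k f) M = of_nat k * of_nat (count M k + 1) * mps_coeff f (add_mset k M)"
  by (simp add: mps_E_def)

text \<open>The factor \<open>count A k\<close> removes the splittings in which \<open>A\<close>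
  does not contain \<open>k\<close>; all others arise uniquely from a splitting of \<open>M\<close>
  by adding \<open>k\<close> to the first part. This is the derivative of the first factor in the
  product rule.\<close>

lemma mset_splits_count_sum:
  fixes f :: "'v multiset \<Rightarrow> 'v multiset \<Rightarrow> 'a :: comm_ring_1"
  shows "(\<Sum>(A, B)\<in>mset_splits (add_mset k M). of_nat (count A k) * f A B)
       = (\<Sum>(A, B)\<in>mset_splits M. of_nat (count A k + 1) * f (add_mset k A) B)"
proof -
  have "(\<Sum>(A, B)\<in>mset_splits (add_mset k M). of_nat (count A k) * f A B)
      = (\<Sum>(A, B)\<in>{(A, B) \<in> mset_splits (add_mset k M). k \<in># A}. of_nat (count A k) * f A B)"
    by (rule sum.mono_neutral_right) (auto intro: ccontr simp: not_in_iff)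
  also have "\<dots> = (\<Sum>(A, B)\<in>mset_splits M. of_nat (count A k + 1) * f (add_mset k A) B)"
    by (rule sum.reindex_bij_witness[of _ "\<lambda>(A, B). (add_mset k A, B)" "\<lambda>(A, B). (A - {#k#}, B)"])
       (auto simp: mset_splits_def simp flip: union_mset_add_mset_left)
  finally show ?thesis .
qed

lemma mset_splits_swap: "(\<Sum>(A, B)\<in>mset_splits M. f A B) = (\<Sum>(A, B)\<in>mset_splits M. f B A)"
  by (rule sum.reindex_bij_witness[of _ "\<lambda>(A, B). (B, A)" "\<lambda>(A, B). (B, A)"])
     (auto simp: mset_splits_def ac_simps)

lemma derivation_E: "derivation (mps_E k :: (nat, 'a :: field_char_0) mps \<Rightarrow> _)"
  unfolding derivation_def
proof (intro conjI allI)
  fix f g :: "(nat, 'a) mps"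
  show "mps_E k (f + g) = mps_E k f + mps_E k g"
    by (rule mps_eqI) (simp add: algebra_simps)
  show "mps_E k (f * g) = mps_E k f * g + f * mps_E k g"
  proof (rule mps_eqI)
    fix M
    let ?f = "mps_coeff f" and ?g = "mps_coeff g"
    have "mps_coeff (mps_E k (f * g)) M
        = of_nat k * (\<Sum>(A, B)\<in>mset_splits (add_mset k M). of_nat (count M k + 1) * (?f A * ?g B))"
      by (simp add: mps_coeff_mult sum_distrib_left split_def algebra_simps)
    also have "(\<Sum>(A, B)\<in>mset_splits (add_mset k M). of_nat (count M k + 1) * (?f A * ?g B))
        = (\<Sum>(A, B)\<in>mset_splits (add_mset k M). of_nat (count A k) * (?f A * ?g B)
             + of_nat (count B k) * (?f A * ?g B))"
    proof (rule sum.cong[OF refl], clarify)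
      fix A B assume "(A, B) \<in> mset_splits (add_mset k M)"
      then have "A + B = add_mset k M" by (simp add: mset_splits_def)
      then have "count A k + count B k = count M k + 1" by (metis add.commute count_add_mset count_union plus_1_eq_Suc)
      then have "of_nat (count M k + 1) = (of_nat (count A k) + of_nat (count B k) :: 'a)" by (metis of_nat_add)
      then show "of_nat (count M k + 1) * (?f A * ?g B)
        = of_nat (count A k) * (?f A * ?g B) + of_nat (count B k) * (?f A * ?g B)"
        by (simp only: distrib_right)
    qed
    also have "\<dots> = (\<Sum>(A, B)\<in>mset_splits (add_mset k M). of_nat (count A k) * (?f A * ?g B))
        + (\<Sum>(A, B)\<in>mset_splits (add_mset k M). of_nat (count B k) * (?f A * ?g B))"
      by (simp add: split_def sum.distrib)
    also have "(\<Sum>(A, B)\<in>mset_splits (add_mset k M). of_nat (count B k) * (?f A * ?g B))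
        = (\<Sum>(A, B)\<in>mset_splits (add_mset k M). of_nat (count A k) * (?f B * ?g A))"
      by (rule mset_splits_swap)
    also have "\<dots> = (\<Sum>(A, B)\<in>mset_splits M. of_nat (count B k + 1) * (?f A * ?g (add_mset k B)))"
      unfolding mset_splits_count_sum by (rule mset_splits_swap)
    finally show "mps_coeff (mps_E k (f * g)) M = mps_coeff (mps_E k f * g + f * mps_E k g) M"
      unfolding mset_splits_count_sum mps_coeff_add mps_coeff_mult mps_coeff_E distrib_left sum_distrib_left
      by (simp add: split_def ac_simps del: of_nat_add of_nat_Suc)
  qed
qed

lemma mps_E_const_mult: "mps_E k (mps_const c * f) = mps_const c * mps_E k f"
  by (rule mps_eqI) simp

lemma mps_E_var: "mps_E k (mps_var j) = (if k = j then of_nat k else 0)"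
  by (rule mps_eqI) (auto simp: mps_coeff_var of_nat_mps mps_coeff_const)

lemma mps_E_commute: "mps_E j (mps_E k f) = mps_E k (mps_E j f)"
  by (rule mps_eqI) (auto simp: add_mset_commute)

section \<open>The complete homogeneous symmetric functions\<close>

lemma fps_power_nth_below:
  fixes P :: "'a :: comm_ring_1 fps"
  shows "fps_nth P 0 = 0 \<Longrightarrow> n < k \<Longrightarrow> fps_nth (P ^ k) n = 0"
proof (induction k arbitrary: n)
  case (Suc k)
  have "fps_nth (P * P ^ k) n = (\<Sum>i=0..n. fps_nth P i * fps_nth (P ^ k) (n - i))" by (simp add: fps_mult_nth)
  also have "\<dots> = 0"
  proof (rule sum.neutral, clarify)
    fix i assume "i \<in> {0..n}"
    then show "fps_nth P i * fps_nth (P ^ k) (n - i) = 0"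
      using Suc by (cases "i = 0") auto
  qed
  finally show ?case by simp
qed auto

lemma fps_nth_of_nat_mult: "fps_nth (of_nat m * F) n = of_nat m * fps_nth F n"
  for F :: "'a :: comm_ring_1 fps"
  by (simp flip: fps_of_nat)

text \<open>The Euler operator \<open>\<theta> = u d/du\<close> is a derivation, so it maps
  \<open>P^(k+1)\<close> to \<open>(k+1) (\<theta> P) P^k\<close>; here the coefficients of both
  sides are compared.\<close>

lemma fps_X_deriv_power:
  fixes P :: "'a :: comm_ring_1 fps"
  shows "of_nat n * fps_nth (P ^ Suc k) n
    = of_nat (Suc k) * (\<Sum>i\<le>n. of_nat i * fps_nth P i * fps_nth (P ^ k) (n - i))"
proof (induction k arbitrary: n)
  case 0
  have "(\<Sum>i\<le>n. of_nat i * fps_nth P i * fps_nth 1 (n - i)) = (\<Sum>i\<in>{n}. of_nat i * fps_nth P i * fps_nth 1 (n - i))"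
    by (rule sum.mono_neutral_right) auto
  then show ?case by simp
next
  case (Suc k)
  define \<theta> :: "'a fps \<Rightarrow> 'a fps" where "\<theta> F = Abs_fps (\<lambda>n. of_nat n * fps_nth F n)" for F
  have \<theta>_nth: "fps_nth (\<theta> F) n = of_nat n * fps_nth F n" for F n by (simp add: \<theta>_def)
  have \<theta>_mult: "\<theta> (F * G) = \<theta> F * G + F * \<theta> G" for F G
  proof (rule fps_ext)
    fix n
    have "fps_nth (\<theta> (F * G)) n = (\<Sum>i=0..n. of_nat n * (fps_nth F i * fps_nth G (n - i)))"
      by (simp add: \<theta>_nth fps_mult_nth sum_distrib_left)
    also have "\<dots> = (\<Sum>i=0..n. of_nat i * fps_nth F i * fps_nth G (n - i)
        + fps_nth F i * (of_nat (n - i) * fps_nth G (n - i)))"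
    proof (rule sum.cong[OF refl])
      fix i assume "i \<in> {0..n}"
      then have "of_nat n = (of_nat i + of_nat (n - i) :: 'a)" by (simp flip: of_nat_add)
      then show "of_nat n * (fps_nth F i * fps_nth G (n - i)) = of_nat i * fps_nth F i * fps_nth G (n - i)
        + fps_nth F i * (of_nat (n - i) * fps_nth G (n - i))" by (simp only:) (simp add: algebra_simps)
    qed
    finally show "fps_nth (\<theta> (F * G)) n = fps_nth (\<theta> F * G + F * \<theta> G) n"
      by (simp add: fps_mult_nth \<theta>_nth sum.distrib)
  qed
  have IH: "\<theta> (P ^ Suc k) = of_nat (Suc k) * (\<theta> P * P ^ k)"
    by (rule fps_ext) (simp only: \<theta>_nth Suc fps_nth_of_nat_mult, simp only: fps_mult_nth \<theta>_nth atMost_atLeast0)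
  have "\<theta> (P ^ Suc (Suc k)) = \<theta> P * P ^ Suc k + P * \<theta> (P ^ Suc k)" using \<theta>_mult[of P "P ^ Suc k"] by simp
  also have "\<dots> = of_nat (Suc (Suc k)) * (\<theta> P * P ^ Suc k)" unfolding IH by (simp add: algebra_simps)
  finally have "fps_nth (\<theta> (P ^ Suc (Suc k))) n = fps_nth (of_nat (Suc (Suc k)) * (\<theta> P * P ^ Suc k)) n" by simp
  then have "of_nat n * fps_nth (P ^ Suc (Suc k)) n = of_nat (Suc (Suc k)) * fps_nth (\<theta> P * P ^ Suc k) n"
    by (simp only: \<theta>_nth fps_nth_of_nat_mult)
  then show ?case by (simp only: \<theta>_nth fps_mult_nth atMost_atLeast0)
qed

lemma schur_row_neg: "k < 0 \<Longrightarrow> schur_row p k = 0"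
  by (simp add: schur_row_def)

lemma schur_row_0: "schur_row p 0 = 1"
  by (simp add: schur_row_def fps_compose_nth)

text \<open>Newton's identity, from the logarithmic derivative of the generating function.\<close>

lemma schur_row_recursion:
  fixes p :: "nat \<Rightarrow> ('v, 'a :: field_char_0) mps"
  shows "of_nat n * schur_row p (int n) = (\<Sum>i=1..n. p i * schur_row p (int n - int i))"
proof -
  define P where "P = Abs_fps (\<lambda>i. if i = 0 then 0 else p i * mps_const (1 / of_nat i))"
  have P0: "fps_nth P 0 = 0" by (simp add: P_def)
  have P: "of_nat i * fps_nth P i = (if i = 0 then 0 else p i)" for i
  proof (cases "i = 0")
    case False
    have "of_nat i * (p i * mps_const (1 / of_nat i)) = p i * (mps_const (of_nat i) * mps_const (1 / of_nat i))"
      by (simp add: of_nat_mps ac_simps)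
    also have "mps_const (of_nat i) * mps_const (1 / of_nat i) = (1 :: ('v, 'a) mps)"
      using False by (simp flip: mps_const_mult)
    finally show ?thesis using False by (simp add: P_def)
  qed simp
  \<comment> \<open>\<open>P\<close> has no constant term, so the exponential series may be cut off
    at any \<open>N \<ge> n\<close>. The freedom is used twice: \<open>Suc n\<close> makes room for
    an index shift, and \<open>n\<close> is a common range for all indices
    \<open>n - i\<close>.\<close>
  have H: "schur_row p (int n) = (\<Sum>k\<le>N. mps_const (1 / fact k) * fps_nth (P ^ k) n)" if "n \<le> N" for n N
  proof -
    have "schur_row p (int n) = (\<Sum>k\<le>n. mps_const (1 / fact k) * fps_nth (P ^ k) n)"
      by (simp add: schur_row_def fps_compose_nth P_def atMost_atLeast0)
    also have "\<dots> = (\<Sum>k\<le>N. mps_const (1 / fact k) * fps_nth (P ^ k) n)"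
      using that fps_power_nth_below[OF P0] by (intro sum.mono_neutral_left) auto
    finally show ?thesis .
  qed
  have fact: "mps_const (1 / fact (Suc k)) * of_nat (Suc k) = (mps_const (1 / fact k) :: ('v, 'a) mps)" for k
    unfolding of_nat_mps mps_const_mult[symmetric] by (simp add: field_simps del: of_nat_Suc)
  have "of_nat n * schur_row p (int n) = (\<Sum>k\<le>Suc n. mps_const (1 / fact k) * (of_nat n * fps_nth (P ^ k) n))"
    unfolding H[of n "Suc n", OF le_SucI, OF order_refl] sum_distrib_left
    by (rule sum.cong) (simp_all add: ac_simps)
  also have "\<dots> = (\<Sum>k\<le>n. mps_const (1 / fact (Suc k)) * (of_nat n * fps_nth (P ^ Suc k) n))"
    by (subst sum.atMost_Suc_shift) (cases n; simp)
  also have "\<dots> = (\<Sum>k\<le>n. mps_const (1 / fact k) * (\<Sum>i\<le>n. of_nat i * fps_nth P i * fps_nth (P ^ k) (n - i)))"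
    unfolding fps_X_deriv_power mult.assoc[symmetric] fact ..
  also have "\<dots> = (\<Sum>i\<le>n. of_nat i * fps_nth P i * (\<Sum>k\<le>n. mps_const (1 / fact k) * fps_nth (P ^ k) (n - i)))"
    unfolding sum_distrib_left by (subst sum.swap) (simp add: ac_simps)
  also have "\<dots> = (\<Sum>i\<le>n. of_nat i * fps_nth P i * schur_row p (int (n - i)))"
    by (intro sum.cong refl arg_cong2[where f = "(*)"] H[symmetric]) simp
  also have "\<dots> = (\<Sum>i=1..n. p i * schur_row p (int n - int i))"
    unfolding P by (rule sum.mono_neutral_cong_right) (auto simp: of_nat_diff)
  finally show ?thesis .
qed

text \<open>Terms with negative index are zero, so the range of summation can be made independent of
  \<open>a\<close>. One truncation \<open>B\<close> then serves all entries of a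
  determinant.\<close>

lemma schur_row_recursion_int:
  fixes p :: "nat \<Rightarrow> ('v, 'a :: field_char_0) mps"
  assumes "a \<le> int B"
  shows "(\<Sum>i=1..B. p i * schur_row p (a - int i)) = of_int a * schur_row p a"
proof (cases "a \<ge> 0")
  case True
  then obtain n where n: "a = int n" by (metis nonneg_int_cases)
  have "(\<Sum>i=1..B. p i * schur_row p (a - int i)) = (\<Sum>i=1..n. p i * schur_row p (a - int i))"
    using assms n by (intro sum.mono_neutral_right) (auto simp: schur_row_neg)
  then show ?thesis using schur_row_recursion[of n p] n by simp
next
  case False
  then show ?thesis by (simp add: schur_row_neg)
qed

text \<open>Differentiating Newton's identity for \<open>n h_n\<close> yields
  \<open>k h_(n-k)\<close> from the explicit variable \<open>p_k\<close>, and by induction and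
  Newton's identity again \<open>(n - k) h_(n-k)\<close> from the other factors; together this is
  \<open>n h_(n-k)\<close>.\<close>

lemma mps_E_schur_row:
  fixes k :: nat assumes "k > 0"
  shows "mps_E k (schur_row mps_var a) = (schur_row mps_var (a - int k) :: (nat, 'a :: field_char_0) mps)"
proof (cases "a \<ge> 0")
  case True
  then obtain n where "a = int n" by (metis nonneg_int_cases)
  moreover have "mps_E k (schur_row mps_var (int n)) = (schur_row mps_var (int n - int k) :: (nat, 'a) mps)"
  proof (induction n rule: less_induct)
    case (less n)
    let ?h = "schur_row mps_var :: int \<Rightarrow> (nat, 'a) mps"
    show ?case
    proof (cases "n = 0")
      case True
      then show ?thesis using assms by (simp add: schur_row_0 schur_row_neg derivation_1[OF derivation_E])
    next
      case False
      have "of_nat n * mps_E k (?h (int n)) = mps_E k (of_nat n * ?h (int n))"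
        by (simp add: derivation_of_nat_mult[OF derivation_E])
      also have "\<dots> = (\<Sum>i=1..n. mps_E k (mps_var i) * ?h (int n - int i) + mps_var i * mps_E k (?h (int n - int i)))"
        by (simp only: schur_row_recursion derivation_sum[OF derivation_E] derivation_mult[OF derivation_E])
      also have "\<dots> = (\<Sum>i=1..n. mps_E k (mps_var i) * ?h (int n - int i)) +
          (\<Sum>i=1..n. mps_var i * mps_E k (?h (int n - int i)))"
        by (rule sum.distrib)
      also have "(\<Sum>i=1..n. mps_E k (mps_var i) * ?h (int n - int i)) = of_nat k * ?h (int n - int k)"
      proof (cases "k \<le> n")
        case True
        have "(\<Sum>i=1..n. mps_E k (mps_var i) * ?h (int n - int i)) =
            (\<Sum>i\<in>{k}. mps_E k (mps_var i) * ?h (int n - int i))"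
          using True assms by (intro sum.mono_neutral_right) (auto simp: mps_E_var)
        then show ?thesis by (simp add: mps_E_var)
      next
        case False
        then have "(\<Sum>i=1..n. mps_E k (mps_var i) * ?h (int n - int i)) = 0"
          by (intro sum.neutral) (auto simp: mps_E_var)
        then show ?thesis using False by (simp add: schur_row_neg)
      qed
      also have "(\<Sum>i=1..n. mps_var i * mps_E k (?h (int n - int i)))
          = (\<Sum>i=1..n. mps_var i * ?h (int n - int k - int i))"
      proof (rule sum.cong[OF refl])
        fix i assume i: "i \<in> {1..n}"
        then have "mps_E k (?h (int (n - i))) = ?h (int (n - i) - int k)" by (intro less.IH) auto
        then show "mps_var i * mps_E k (?h (int n - int i)) = mps_var i * ?h (int n - int k - int i)"
          using i by (simp add: of_nat_diff algebra_simps)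
      qed
      also have "\<dots> = of_int (int n - int k) * ?h (int n - int k)"
        by (rule schur_row_recursion_int) simp
      also have "of_nat k * ?h (int n - int k) + of_int (int n - int k) * ?h (int n - int k)
          = of_nat n * ?h (int n - int k)" by (simp add: algebra_simps)
      finally have "of_nat n * mps_E k (?h (int n)) = of_nat n * ?h (int n - int k)" .
      then show ?thesis by (rule mps_of_nat_cancel) (use False in simp)
    qed
  qed
  ultimately show ?thesis by simp
next
  case False
  then show ?thesis by (simp add: schur_row_neg derivation_0[OF derivation_E])
qed

section \<open>Jacobi--Trudi determinants\<close>

abbreviation hsym :: "int \<Rightarrow> (nat, 'a :: field_char_0) mps" where
  "hsym \<equiv> schur_row mps_var"

text \<open>The determinant \<open>det (h\<^bsub>x i + \<kappa> c\<^esub>)\<^bsub>i, c < N\<^esub>\<close>, for arbitrary integers, so that the row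
  index \<open>x\<close> and the column index \<open>\<kappa>\<close> can be shifted independently of each other.\<close>

definition hdet :: "nat \<Rightarrow> (nat \<Rightarrow> int) \<Rightarrow> (nat \<Rightarrow> int) \<Rightarrow> (nat, 'a :: field_char_0) mps" where
  "hdet N x \<kappa> = (\<Sum>p | p permutes {..<N}. of_int (sign p) * (\<Prod>i<N. hsym (x i + \<kappa> (p i))))"

lemma hdet_shift_row:
  assumes "i < N"
  shows "(hdet N (x(i := x i + t)) \<kappa> :: (nat, 'a :: field_char_0) mps) = (\<Sum>p | p permutes {..<N}. of_int (sign p) *
    (hsym (x i + \<kappa> (p i) + t) * (\<Prod>j\<in>{..<N}-{i}. hsym (x j + \<kappa> (p j)))))"
  unfolding hdet_def
proof (intro sum.cong refl arg_cong2[where f = "(*)"])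
  fix p
  have "(\<Prod>j\<in>{..<N}-{i}. hsym ((x(i := x i + t)) j + \<kappa> (p j)))
      = (\<Prod>j\<in>{..<N}-{i}. hsym (x j + \<kappa> (p j)) :: (nat, 'a) mps)"
    by (intro prod.cong) auto
  then show "(\<Prod>j<N. hsym ((x(i := x i + t)) j + \<kappa> (p j)))
      = (hsym (x i + \<kappa> (p i) + t) * (\<Prod>j\<in>{..<N}-{i}. hsym (x j + \<kappa> (p j))) :: (nat, 'a) mps)"
    using assms by (subst prod.remove[of _ i]) (auto simp: algebra_simps)
qed

text \<open>A derivation that sends each \<open>h_k\<close> to a multiple of \<open>h_(k+t)\<close>
  turns the Leibniz expansion into a sum of this kind. Weights that depend on the row alone
  recombine to determinants with one shifted row; weights that depend on the column
  \<open>p i\<close> recombine to shifted columns in \<open>hdet_weighted_columns\<close>.\<close>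

lemma hdet_weighted_rows:
  "(\<Sum>p | p permutes {..<N}. of_int (sign p) * (\<Sum>i<N. of_int (a i) *
      (hsym (x i + \<kappa> (p i) + t) * (\<Prod>j\<in>{..<N}-{i}. hsym (x j + \<kappa> (p j))))))
    = (\<Sum>i<N. of_int (a i) * hdet N (x(i := x i + t)) \<kappa> :: (nat, 'a :: field_char_0) mps)"
proof -
  have "(\<Sum>i<N. of_int (a i) * hdet N (x(i := x i + t)) \<kappa> :: (nat, 'a) mps) = (\<Sum>i<N. \<Sum>p | p permutes {..<N}.
      of_int (a i) * (of_int (sign p) *
      (hsym (x i + \<kappa> (p i) + t) * (\<Prod>j\<in>{..<N}-{i}. hsym (x j + \<kappa> (p j))))))"
    by (intro sum.cong refl) (simp only: hdet_shift_row sum_distrib_left lessThan_iff)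
  then show ?thesis unfolding sum_distrib_left by (subst sum.swap) (simp add: mult.left_commute)
qed

lemma hdet_weighted_columns:
  "(\<Sum>p | p permutes {..<N}. of_int (sign p) * (\<Sum>i<N. of_int (b (p i)) *
      (hsym (x i + \<kappa> (p i) + t) * (\<Prod>j\<in>{..<N}-{i}. hsym (x j + \<kappa> (p j))))))
    = (\<Sum>c<N. of_int (b c) * hdet N x (\<kappa>(c := \<kappa> c + t)) :: (nat, 'a :: field_char_0) mps)"
proof -
  have "(\<Sum>c<N. of_int (b c) * hdet N x (\<kappa>(c := \<kappa> c + t)) :: (nat, 'a) mps) = (\<Sum>p | p permutes {..<N}. \<Sum>c<N.
      of_int (sign p) * (of_int (b c) * (\<Prod>j<N. hsym (x j + (\<kappa>(c := \<kappa> c + t)) (p j)))))"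
    unfolding hdet_def sum_distrib_left by (subst sum.swap) (simp add: mult.left_commute)
  also have "\<dots> = (\<Sum>p | p permutes {..<N}. \<Sum>i<N.
      of_int (sign p) * (of_int (b (p i)) * (hsym (x i + \<kappa> (p i) + t) * (\<Prod>j\<in>{..<N}-{i}. hsym (x j + \<kappa> (p j))))))"
  proof (rule sum.cong[OF refl])
    fix p assume "p \<in> {p. p permutes {..<N}}"
    then have p: "p permutes {..<N}" by simp
    have "(\<Sum>c<N. of_int (sign p) * (of_int (b c) * (\<Prod>j<N. hsym (x j + (\<kappa>(c := \<kappa> c + t)) (p j)))) :: (nat, 'a) mps)
      = (\<Sum>i<N. of_int (sign p) * (of_int (b (p i)) * (\<Prod>j<N. hsym (x j + (\<kappa>(p i := \<kappa> (p i) + t)) (p j)))))"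
      by (rule sum.reindex_bij_betw[OF permutes_imp_bij[OF p], symmetric])
    also have "\<dots> = (\<Sum>i<N. of_int (sign p) * (of_int (b (p i)) *
        (hsym (x i + \<kappa> (p i) + t) * (\<Prod>j\<in>{..<N}-{i}. hsym (x j + \<kappa> (p j))))))"
    proof (intro sum.cong refl arg_cong2[where f = "(*)"])
      fix i assume i: "i \<in> {..<N}"
      have "(\<Prod>j\<in>{..<N}-{i}. hsym (x j + (\<kappa>(p i := \<kappa> (p i) + t)) (p j)))
          = (\<Prod>j\<in>{..<N}-{i}. hsym (x j + \<kappa> (p j)) :: (nat, 'a) mps)"
        using permutes_inj[OF p] by (intro prod.cong) (auto simp: inj_eq)
      then show "(\<Prod>j<N. hsym (x j + (\<kappa>(p i := \<kappa> (p i) + t)) (p j)))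
          = (hsym (x i + \<kappa> (p i) + t) * (\<Prod>j\<in>{..<N}-{i}. hsym (x j + \<kappa> (p j))) :: (nat, 'a) mps)"
        using i by (subst prod.remove[of _ i]) (auto simp: algebra_simps)
    qed
    finally show "(\<Sum>c<N. of_int (sign p) * (of_int (b c) * (\<Prod>j<N. hsym (x j + (\<kappa>(c := \<kappa> c + t)) (p j)))))
      = (\<Sum>i<N. of_int (sign p) * (of_int (b (p i)) *
        (hsym (x i + \<kappa> (p i) + t) * (\<Prod>j\<in>{..<N}-{i}. hsym (x j + \<kappa> (p j))))) :: (nat, 'a) mps)" .
  qed
  finally show ?thesis by (simp add: sum_distrib_left)
qed

text \<open>With all weights equal to 1, one and the same sum can be read by rows or by columns. In
  the applications the columns have the indices \<open>0, ..., N - 1\<close>, so that shifted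
  columns often collide with others, whereas shifted rows change the shape.\<close>

lemma hdet_shift_rows_eq_columns:
  "(\<Sum>i<N. hdet N (x(i := x i + t)) \<kappa>) = (\<Sum>c<N. hdet N x (\<kappa>(c := \<kappa> c + t)))"
  using trans[OF hdet_weighted_rows[where a = "\<lambda>_. 1" and N = N and x = x and \<kappa> = \<kappa> and t = t, symmetric]
    hdet_weighted_columns[where b = "\<lambda>_. 1" and N = N and x = x and \<kappa> = \<kappa> and t = t]] by simp

lemma derivation_hdet:
  assumes "derivation D"
  shows "D (hdet N x \<kappa>) = (\<Sum>p | p permutes {..<N}. of_int (sign p) * (\<Sum>i<N.
      D (hsym (x i + \<kappa> (p i))) * (\<Prod>j\<in>{..<N}-{i}. hsym (x j + \<kappa> (p j)))))"
  by (simp add: hdet_def derivation_sum[OF assms] derivation_of_int_mult[OF assms] derivation_prod[OF assms])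

lemma mps_E_hdet_rows:
  assumes "k > 0"
  shows "mps_E k (hdet N x \<kappa>) = (\<Sum>i<N. hdet N (x(i := x i - int k)) \<kappa>)"
  using hdet_weighted_rows[where a = "\<lambda>_. 1" and N = N and x = x and \<kappa> = \<kappa> and t = "- int k"]
  by (simp add: derivation_hdet[OF derivation_E] mps_E_schur_row[OF assms])

lemma mps_E_hdet_columns:
  assumes "k > 0"
  shows "mps_E k (hdet N x \<kappa>) = (\<Sum>c<N. hdet N x (\<kappa>(c := \<kappa> c - int k)))"
  unfolding mps_E_hdet_rows[OF assms] using hdet_shift_rows_eq_columns[of N x "- int k" \<kappa>] by simp

lemma hdet_swap_columns:
  assumes "c < N" "d < N" "c \<noteq> d"
  shows "(hdet N x (\<kappa> \<circ> transpose c d) :: (nat, 'a :: field_char_0) mps) = - hdet N x \<kappa>"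
proof -
  have *: "transpose c d \<circ> p permutes {..<N}" if "p permutes {..<N}" for p
    using assms that by (intro permutes_compose permutes_swap_id) auto
  have "(hdet N x (\<kappa> \<circ> transpose c d) :: (nat, 'a) mps) = (\<Sum>p | p permutes {..<N}.
      of_int (sign p) * (\<Prod>i<N. hsym (x i + \<kappa> ((transpose c d \<circ> p) i))))"
    by (simp add: hdet_def)
  also have "\<dots> = (\<Sum>p | p permutes {..<N}. - (of_int (sign p) * (\<Prod>i<N. hsym (x i + \<kappa> (p i)))))"
  proof (rule sum.reindex_bij_witness[of _ "\<lambda>p. transpose c d \<circ> p" "\<lambda>p. transpose c d \<circ> p"])
    fix p assume "p \<in> {p. p permutes {..<N}}"
    then have p: "p permutes {..<N}" by simp
    have "permutation p" using p by (meson finite_lessThan permutation_permutes)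
    then have "sign (transpose c d \<circ> p) = - sign p"
      using assms by (simp add: sign_compose permutation_swap_id sign_swap_id)
    then show "- (of_int (sign (transpose c d \<circ> p)) * (\<Prod>i<N. hsym (x i + \<kappa> ((transpose c d \<circ> p) i))))
      = (of_int (sign p) * (\<Prod>i<N. hsym (x i + \<kappa> ((transpose c d \<circ> p) i))) :: (nat, 'a) mps)" by simp
  qed (use * in \<open>auto simp: o_assoc transpose_comp_involutory\<close>)
  also have "\<dots> = - hdet N x \<kappa>" by (simp add: hdet_def sum_negf)
  finally show ?thesis .
qed

lemma hdet_equal_columns:
  assumes "c < N" "d < N" "c \<noteq> d" "\<kappa> c = \<kappa> d"
  shows "(hdet N x \<kappa> :: (nat, 'a :: field_char_0) mps) = 0"
proof -
  have "\<kappa> \<circ> transpose c d = \<kappa>" using assms(4) by (auto simp: fun_eq_iff transpose_def)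
  then have "(hdet N x \<kappa> :: (nat, 'a) mps) = - hdet N x \<kappa>" using hdet_swap_columns[OF assms(1-3), of x \<kappa>] by simp
  then show ?thesis by (rule mps_eq_uminus_self)
qed

lemma hdet_swap_rows:
  assumes "c < N" "d < N" "c \<noteq> d"
  shows "(hdet N (x \<circ> transpose c d) \<kappa> :: (nat, 'a :: field_char_0) mps) = - hdet N x \<kappa>"
proof -
  have tr: "transpose c d permutes {..<N}" using assms by (intro permutes_swap_id) auto
  have *: "p \<circ> transpose c d permutes {..<N}" if "p permutes {..<N}" for p
    using tr that by (rule permutes_compose)
  have "(hdet N (x \<circ> transpose c d) \<kappa> :: (nat, 'a) mps) = (\<Sum>p | p permutes {..<N}.
      of_int (sign p) * (\<Prod>i<N. hsym (x i + \<kappa> ((p \<circ> transpose c d) i))))"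
  proof (unfold hdet_def, intro sum.cong refl arg_cong2[where f = "(*)"])
    fix p
    show "(\<Prod>i<N. hsym ((x \<circ> transpose c d) i + \<kappa> (p i))) =
        (\<Prod>i<N. hsym (x i + \<kappa> ((p \<circ> transpose c d) i)) :: (nat, 'a) mps)"
      using prod.reindex_bij_betw[OF permutes_imp_bij[OF tr], of "\<lambda>i. hsym (x i + \<kappa> (p (transpose c d i)))"]
      by simp
  qed
  also have "\<dots> = (\<Sum>p | p permutes {..<N}. - (of_int (sign p) * (\<Prod>i<N. hsym (x i + \<kappa> (p i)))))"
  proof (rule sum.reindex_bij_witness[of _ "\<lambda>p. p \<circ> transpose c d" "\<lambda>p. p \<circ> transpose c d"])
    fix p assume "p \<in> {p. p permutes {..<N}}"
    then have p: "p permutes {..<N}" by simp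
    have "permutation p" using p by (meson finite_lessThan permutation_permutes)
    then have "sign (p \<circ> transpose c d) = - sign p"
      using assms by (simp add: sign_compose permutation_swap_id sign_swap_id)
    then show "- (of_int (sign (p \<circ> transpose c d)) * (\<Prod>i<N. hsym (x i + \<kappa> ((p \<circ> transpose c d) i))))
      = (of_int (sign p) * (\<Prod>i<N. hsym (x i + \<kappa> ((p \<circ> transpose c d) i))) :: (nat, 'a) mps)" by simp
  qed (use * in \<open>auto simp: o_assoc[symmetric] transpose_comp_involutory\<close>)
  also have "\<dots> = - hdet N x \<kappa>" by (simp add: hdet_def sum_negf)
  finally show ?thesis .
qed

lemma hdet_equal_rows:
  assumes "c < N" "d < N" "c \<noteq> d" "x c = x d"
  shows "(hdet N x \<kappa> :: (nat, 'a :: field_char_0) mps) = 0"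
proof -
  have "x \<circ> transpose c d = x" using assms(4) by (auto simp: fun_eq_iff transpose_def)
  then have "(hdet N x \<kappa> :: (nat, 'a) mps) = - hdet N x \<kappa>" using hdet_swap_rows[OF assms(1-3), of x \<kappa>] by simp
  then show ?thesis by (rule mps_eq_uminus_self)
qed

text \<open>Read as column shifts, a shift of a column \<open>c < N\<close> makes it equal to column
  \<open>c + 1\<close>, so only the last column remains. The last row stands for an empty row of the
  diagram: its entries are 0 up to the last one, which is \<open>h_0\<close> and becomes
  \<open>h_1 = p_1\<close>. The empty row is the place for a box that opens a new row.\<close>

lemma hdet_add_box:
  assumes "x N = - int N"
  shows "(\<Sum>i\<le>N. hdet (Suc N) (x(i := x i + 1)) int :: (nat, 'a :: field_char_0) mps) = mps_var 1 * hdet (Suc N) x int"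
proof -
  have h1: "hsym 1 = (mps_var 1 :: (nat, 'a) mps)"
    using schur_row_recursion[of 1 mps_var] by (simp add: schur_row_0)
  have "(\<Sum>i\<le>N. hdet (Suc N) (x(i := x i + 1)) int :: (nat, 'a) mps) = (\<Sum>c<Suc N. hdet (Suc N) x (int(c := int c + 1)))"
    using hdet_shift_rows_eq_columns[of "Suc N" x 1 int] by (simp only: lessThan_Suc_atMost)
  also have "\<dots> = (\<Sum>c\<in>{N}. hdet (Suc N) x (int(c := int c + 1)))"
  proof (rule sum.mono_neutral_right)
    show "\<forall>c\<in>{..<Suc N} - {N}. hdet (Suc N) x (int(c := int c + 1)) = (0 :: (nat, 'a) mps)"
    proof
      fix c assume "c \<in> {..<Suc N} - {N}"
      then show "hdet (Suc N) x (int(c := int c + 1)) = (0 :: (nat, 'a) mps)"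
        by (intro hdet_equal_columns[of c _ "Suc c"]) auto
    qed
  qed auto
  also have "\<dots> = hdet (Suc N) x (int(N := int N + 1))" by simp
  also have "\<dots> = mps_var 1 * hdet (Suc N) x int"
    unfolding hdet_def sum_distrib_left
  proof (rule sum.cong[OF refl])
    fix p assume "p \<in> {p. p permutes {..<Suc N}}"
    then have p: "p permutes {..<Suc N}" by simp
    show "of_int (sign p) * (\<Prod>i<Suc N. hsym (x i + (int(N := int N + 1)) (p i))) =
         (mps_var 1 * (of_int (sign p) * (\<Prod>i<Suc N. hsym (x i + int (p i)))) :: (nat, 'a) mps)"
    proof (cases "p N = N")
      case True
      have "p i \<noteq> N" if "i < N" for i using permutes_inj[OF p] True that by (metis inj_eq less_irrefl)
      then have "(\<Prod>i<N. hsym (x i + (int(N := int N + 1)) (p i))) = (\<Prod>i<N. hsym (x i + int (p i)) :: (nat, 'a) mps)"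
        by (intro prod.cong) auto
      then show ?thesis using True assms h1 by (simp add: schur_row_0 ac_simps)
    next
      case False
      moreover have "p N < Suc N" using permutes_in_image[OF p, of N] by simp
      ultimately have "p N < N" by simp
      then show ?thesis using assms by (simp add: schur_row_neg)
    qed
  qed
  finally show ?thesis .
qed

text \<open>The row consists of zeros and a final 1, so only permutations that fix \<open>N\<close>
  contribute. Empty rows can thus be appended to bring shapes with different numbers of rows to a
  common size.\<close>

lemma hdet_drop_zero_row:
  assumes "x N = - int N"
  shows "(hdet (Suc N) x int :: (nat, 'a :: field_char_0) mps) = hdet N x int"
proof -
  have "(hdet (Suc N) x int :: (nat, 'a) mps) = (\<Sum>p | p permutes {..<N}. of_int (sign p) * (\<Prod>i<Suc N. hsym (x i + int (p i))))"
    unfolding hdet_def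
  proof (rule sum.mono_neutral_right)
    show "finite {p. p permutes {..<Suc N}}" by (rule finite_permutations) simp
    show "{p. p permutes {..<N}} \<subseteq> {p. p permutes {..<Suc N}}" using permutes_subset by fastforce
    show "\<forall>p\<in>{p. p permutes {..<Suc N}} - {p. p permutes {..<N}}.
      of_int (sign p) * (\<Prod>i<Suc N. hsym (x i + int (p i))) = (0 :: (nat, 'a) mps)"
    proof
      fix p assume "p \<in> {p. p permutes {..<Suc N}} - {p. p permutes {..<N}}"
      then have p: "p permutes {..<Suc N}" and np: "\<not> p permutes {..<N}" by auto
      have "p N \<noteq> N"
      proof
        assume "p N = N"
        then have "p permutes {..<N}" using p by (intro permutes_superset[OF p]) (auto simp: less_Suc_eq)
        with np show False by simp
      qed
      moreover have "p N < Suc N" using permutes_in_image[OF p, of N] by simp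
      ultimately have "p N < N" by simp
      then show "of_int (sign p) * (\<Prod>i<Suc N. hsym (x i + int (p i))) = (0 :: (nat, 'a) mps)"
        using assms by (simp add: schur_row_neg)
    qed
  qed
  also have "\<dots> = hdet N x int"
    unfolding hdet_def
  proof (rule sum.cong[OF refl])
    fix p assume "p \<in> {p. p permutes {..<N}}"
    then have "p N = N" using permutes_not_in by fastforce
    then show "of_int (sign p) * (\<Prod>i<Suc N. hsym (x i + int (p i))) =
      (of_int (sign p) * (\<Prod>i<N. hsym (x i + int (p i))) :: (nat, 'a) mps)"
      using assms by (simp add: schur_row_0)
  qed
  finally show ?thesis .
qed

section \<open>The cut-and-join operator\<close>

text \<open>Twice the cut-and-join operator, truncated to the parameters up to \<open>B\<close>; on series of weight
  at most \<open>B\<close> the truncation has no effect.\<close>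

definition cut_join :: "nat \<Rightarrow> (nat, 'a :: field_char_0) mps \<Rightarrow> (nat, 'a) mps" where
  "cut_join B f = (\<Sum>i=1..B. \<Sum>j=1..B. mps_var i * mps_var j * mps_E (i + j) f
     + mps_var (i + j) * mps_E i (mps_E j f))"

text \<open>A truncated Witt operator. It collects the first-order part of the commutator of
  \<open>mps_E k\<close> with \<open>cut_join B\<close>.\<close>

definition mps_L :: "nat \<Rightarrow> nat \<Rightarrow> (nat, 'a :: field_char_0) mps \<Rightarrow> (nat, 'a) mps" where
  "mps_L B k f = (\<Sum>j=1..B. mps_var j * mps_E (k + j) f)"

lemma derivation_L: "derivation (mps_L B k)"
  unfolding mps_L_def by (intro derivation_sum_fun derivation_mult_left derivation_E)

lemma cut_join_add: "cut_join B (f + g) = cut_join B f + cut_join B g"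
  by (simp add: cut_join_def derivation_add[OF derivation_E] algebra_simps sum.distrib)

lemma cut_join_0: "cut_join B 0 = 0"
  by (simp add: cut_join_def derivation_0[OF derivation_E])

lemma cut_join_sum: "cut_join B (\<Sum>a\<in>A. f a) = (\<Sum>a\<in>A. cut_join B (f a))"
  by (induction A rule: infinite_finite_induct) (simp_all add: cut_join_add cut_join_0)

lemma cut_join_const_mult: "cut_join B (mps_const c * f) = mps_const c * cut_join B f"
  by (simp add: cut_join_def mps_E_const_mult sum_distrib_left distrib_left mult.assoc
      mult.left_commute[of _ "mps_const c"])

text \<open>The operators \<open>mps_E\<close> commute, so in the commutator \<open>mps_E k\<close>
  only hits the explicit variables: \<open>i = k\<close> and \<open>j = k\<close> give
  \<open>mps_L\<close> once each, and \<open>i + j = k\<close> gives the second-order sum. The bound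
  on \<open>k\<close> keeps these indices within the truncation.\<close>

lemma mps_E_cut_join:
  fixes f :: "(nat, 'a :: field_char_0) mps"
  assumes k: "1 \<le> k" "k \<le> B"
  shows "mps_E k (cut_join B f) = cut_join B (mps_E k f) + 2 * of_nat k * mps_L B k f
    + of_nat k * (\<Sum>i=1..<k. mps_E i (mps_E (k - i) f))"
proof -
  let ?E = "mps_E :: nat \<Rightarrow> (nat, 'a) mps \<Rightarrow> _" and ?p = "mps_var :: nat \<Rightarrow> (nat, 'a) mps"
  have tm: "?E k (?p i * ?p j * ?E (i + j) f + ?p (i + j) * ?E i (?E j f))
      = (?p i * ?p j * ?E (i + j) (?E k f) + ?p (i + j) * ?E i (?E j (?E k f)))
        + (if k = i then of_nat k * (?p j * ?E (k + j) f) else 0)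
        + (if k = j then of_nat k * (?p i * ?E (k + i) f) else 0)
        + (if k = i + j then of_nat k * ?E i (?E j f) else 0)" for i j
    by (simp add: derivation_add[OF derivation_E] derivation_mult[OF derivation_E] mps_E_var
        mps_E_commute[of k] algebra_simps)
  have S1: "(\<Sum>i=1..B. \<Sum>j=1..B. if k = i then of_nat k * (?p j * ?E (k + j) f) else 0) = of_nat k * mps_L B k f"
  proof -
    have "(\<Sum>i=1..B. \<Sum>j=1..B. if k = i then of_nat k * (?p j * ?E (k + j) f) else 0)
        = (\<Sum>i=1..B. if k = i then \<Sum>j=1..B. of_nat k * (?p j * ?E (k + j) f) else 0)"
      by (intro sum.cong refl) auto
    then show ?thesis using k by (simp add: mps_L_def sum_distrib_left)
  qed
  have S2: "(\<Sum>i=1..B. \<Sum>j=1..B. if k = j then of_nat k * (?p i * ?E (k + i) f) else 0) = of_nat k * mps_L B k f"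
    using k by (simp add: mps_L_def sum_distrib_left)
  have S3: "(\<Sum>i=1..B. \<Sum>j=1..B. if k = i + j then of_nat k * ?E i (?E j f) else 0)
      = of_nat k * (\<Sum>i=1..<k. ?E i (?E (k - i) f))"
  proof -
    have "(\<Sum>i=1..B. \<Sum>j=1..B. if k = i + j then of_nat k * ?E i (?E j f) else 0)
        = (\<Sum>i=1..B. if i < k then of_nat k * ?E i (?E (k - i) f) else 0)"
    proof (rule sum.cong[OF refl])
      fix i assume i: "i \<in> {1..B}"
      show "(\<Sum>j=1..B. if k = i + j then of_nat k * ?E i (?E j f) else 0)
          = (if i < k then of_nat k * ?E i (?E (k - i) f) else 0)"
      proof (cases "i < k")
        case True
        have "(\<Sum>j=1..B. if k = i + j then of_nat k * ?E i (?E j f) else 0)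
            = (\<Sum>j=1..B. if k - i = j then of_nat k * ?E i (?E j f) else 0)"
          using True by (intro sum.cong refl) auto
        also have "\<dots> = of_nat k * ?E i (?E (k - i) f)"
          using True k i by (subst sum.delta') auto
        finally show ?thesis using True by simp
      next
        case False
        then show ?thesis by (auto intro!: sum.neutral)
      qed
    qed
    also have "\<dots> = (\<Sum>i=1..<k. of_nat k * ?E i (?E (k - i) f))"
      by (subst sum.inter_filter[symmetric]) (use k in \<open>auto intro!: sum.cong\<close>)
    finally show ?thesis by (simp add: sum_distrib_left)
  qed
  have "?E k (cut_join B f) = (\<Sum>i=1..B. \<Sum>j=1..B. ?E k (?p i * ?p j * ?E (i + j) f + ?p (i + j) * ?E i (?E j f)))"
    by (simp only: cut_join_def derivation_sum[OF derivation_E])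
  also have "\<dots> = cut_join B (?E k f) + of_nat k * mps_L B k f + of_nat k * mps_L B k f
      + of_nat k * (\<Sum>i=1..<k. ?E i (?E (k - i) f))"
    unfolding tm sum.distrib S1 S2 S3 cut_join_def ..
  finally show ?thesis by (simp add: algebra_simps)
qed

text \<open>Each \<open>mps_E (k + j)\<close> lowers the index by \<open>k + j\<close>, and what
  remains is Newton's identity at \<open>a - k\<close>.\<close>

lemma mps_L_hsym:
  fixes B k :: nat
  assumes "a - int k \<le> int B"
  shows "mps_L B k (hsym a) = of_int (a - int k) * hsym (a - int k)"
proof -
  have "mps_L B k (hsym a) = (\<Sum>j=1..B. mps_var j * hsym (a - int k - int j))"
    unfolding mps_L_def by (intro sum.cong refl) (simp add: mps_E_schur_row algebra_simps)
  also have "\<dots> = of_int (a - int k) * hsym (a - int k)"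
    by (rule schur_row_recursion_int[OF assms])
  finally show ?thesis .
qed

text \<open>The operator lowers the index of the entry in row \<open>i\<close> and column
  \<open>c\<close> by \<open>k\<close> and multiplies it by \<open>x i + c - k\<close>. This factor
  splits into \<open>x i\<close>, which depends on the row only, and \<open>c - k\<close>, which
  depends on the column only, so the two weighted expansions apply.\<close>

lemma mps_L_hdet:
  fixes x :: "nat \<Rightarrow> int"
  assumes "\<And>i. i < N \<Longrightarrow> x i + int N \<le> int B"
  shows "(mps_L B k (hdet N x int) :: (nat, 'a :: field_char_0) mps)
    = (\<Sum>i<N. of_int (x i) * hdet N (x(i := x i - int k)) int)
    + (\<Sum>c<N. of_int (int c - int k) * hdet N x (int(c := int c - int k)))"
proof -
  have *: "(mps_L B k (hsym (x i + int (p i))) :: (nat, 'a) mps) = of_int (x i) * hsym (x i + int (p i) + (- int k))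
      + of_int (int (p i) - int k) * hsym (x i + int (p i) + (- int k))"
    if "p permutes {..<N}" "i < N" for p i
  proof -
    have "p i < N" using permutes_in_image[OF that(1), of i] that(2) by simp
    then have "x i + int (p i) - int k \<le> int B" using assms[OF that(2)] by simp
    then show ?thesis by (simp add: mps_L_hsym flip: distrib_right of_int_add) (simp add: algebra_simps)
  qed
  have "(mps_L B k (hdet N x int) :: (nat, 'a) mps) = (\<Sum>p | p permutes {..<N}. of_int (sign p) * (\<Sum>i<N.
      (of_int (x i) * hsym (x i + int (p i) + (- int k))
      + of_int (int (p i) - int k) * hsym (x i + int (p i) + (- int k))) * (\<Prod>j\<in>{..<N}-{i}. hsym (x j + int (p j)))))"
    unfolding derivation_hdet[OF derivation_L]
    by (intro sum.cong[OF refl] arg_cong2[where f = "(*)"] refl) (use * in auto)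
  also have "\<dots> = (\<Sum>p | p permutes {..<N}. of_int (sign p) * (\<Sum>i<N. of_int (x i) *
        (hsym (x i + int (p i) + (- int k)) * (\<Prod>j\<in>{..<N}-{i}. hsym (x j + int (p j))))))
      + (\<Sum>p | p permutes {..<N}. of_int (sign p) * (\<Sum>i<N. of_int (int (p i) - int k) *
        (hsym (x i + int (p i) + (- int k)) * (\<Prod>j\<in>{..<N}-{i}. hsym (x j + int (p j))))))"
    by (simp only: distrib_right distrib_left sum.distrib mult.assoc)
  also have "(\<Sum>p | p permutes {..<N}. of_int (sign p) * (\<Sum>i<N. of_int (x i) *
        (hsym (x i + int (p i) + (- int k)) * (\<Prod>j\<in>{..<N}-{i}. hsym (x j + int (p j)))))) =
      (\<Sum>i<N. of_int (x i) * hdet N (x(i := x i + (- int k))) int :: (nat, 'a) mps)"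
    by (rule hdet_weighted_rows)
  also have "(\<Sum>p | p permutes {..<N}. of_int (sign p) * (\<Sum>i<N. of_int (int (p i) - int k) *
        (hsym (x i + int (p i) + (- int k)) * (\<Prod>j\<in>{..<N}-{i}. hsym (x j + int (p j)))))) =
      (\<Sum>c<N. of_int (int c - int k) * hdet N x (int(c := int c + (- int k))) :: (nat, 'a) mps)"
    by (rule hdet_weighted_columns[where b = "\<lambda>c. int c - int k"])
  finally show ?thesis by (simp only: add_uminus_conv_diff)
qed

text \<open>A lowered column whose index is still non-negative coincides with an untouched column,
  and the determinant vanishes, unless this index is the place left by the other lowered column. In
  the exceptional case an exchange of the two columns leaves a single column lowered by
  \<open>k\<close>, with a minus sign. If both indices are negative, the terms cancel in
  pairs.\<close>

lemma hdet_two_columns_sum: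
  fixes x :: "nat \<Rightarrow> int"
  assumes c: "c < N" and d: "d < N" and cd: "c \<noteq> d" and k: "k > 0"
  shows "(\<Sum>i=1..<k. hdet N x (int(d := int d - int (k - i), c := int c - int i)))
    = - (if d < c \<and> c < k then hdet N x (int(c := int c - int k)) else 0)
      - (if c < d \<and> d < k then hdet N x (int(d := int d - int k)) else 0 :: (nat, 'a :: field_char_0) mps)"
proof -
  define g :: "nat \<Rightarrow> (nat, 'a) mps" where
    "g i = hdet N x (int(d := int d - int (k - i), c := int c - int i))" for i
  let ?D = "\<lambda>c. hdet N x (int(c := int c - int k)) :: (nat, 'a) mps"
  \<comment> \<open>Here both lowered columns have negative indices, so neither of them meets an
    untouched column.\<close>
  define I where "I = {i \<in> {1..<k}. c < i \<and> d < k - i}"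
  have swap: "hdet N x (int(d := f, c := e)) = - (hdet N x (int(d := e, c := f)) :: (nat, 'a) mps)" for e f
  proof -
    have "int(d := f, c := e) = int(d := e, c := f) \<circ> transpose c d"
      using cd by (auto simp: fun_eq_iff transpose_def)
    then show ?thesis by (simp only: hdet_swap_columns[OF c d cd])
  qed
  have g: "g i = (if i \<in> I then g i else 0) + (if i = c - d then if d < c \<and> c < k then - ?D c else 0 else 0)
      + (if i = c + k - d then if c < d \<and> d < k then - ?D d else 0 else 0)" if i: "i \<in> {1..<k}" for i
  proof -
    have dupc: "g i = 0" if "i \<le> c" "c - i \<noteq> d"
      unfolding g_def using that i c cd by (intro hdet_equal_columns[of c _ "c - i"]) auto
    have dupd: "g i = 0" if "k - i \<le> d" "d - (k - i) \<noteq> c"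
      unfolding g_def using that i d cd by (intro hdet_equal_columns[of d _ "d - (k - i)"]) auto
    have "i \<in> I \<or> (i \<le> c \<and> c - i \<noteq> d) \<or> (k - i \<le> d \<and> d - (k - i) \<noteq> c)
      \<or> (i \<le> c \<and> c - i = d \<and> d < k - i) \<or> (k - i \<le> d \<and> d - (k - i) = c \<and> c < i)"
    proof (cases "c < i")
      case True
      then show ?thesis using i by (cases "d < k - i") (auto simp: I_def not_less)
    next
      case ci: False
      show ?thesis
      proof (cases "c - i = d \<and> \<not> d < k - i")
        case True
        then have "d - (k - i) \<noteq> c" using i ci by auto
        then show ?thesis using True by auto
      qed (use ci in auto)
    qed
    then consider "i \<in> I" | "i \<le> c" "c - i \<noteq> d" | "k - i \<le> d" "d - (k - i) \<noteq> c"
      | "i \<le> c" "c - i = d" "d < k - i" | "k - i \<le> d" "d - (k - i) = c" "c < i"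
      by blast
    then show ?thesis
    proof cases
      case 1
      then show ?thesis using i by (auto simp: I_def)
    next
      case 2
      moreover have "i \<noteq> c - d \<or> \<not> d < c" using 2 by auto
      moreover have "i = c + k - d \<Longrightarrow> c < d \<Longrightarrow> d < k \<Longrightarrow> False" using 2 by auto
      ultimately show ?thesis using dupc by (auto simp: I_def)
    next
      case 3
      moreover have "i = c + k - d \<Longrightarrow> c < d \<Longrightarrow> d < k \<Longrightarrow> False" using 3 i by auto
      moreover have "i = c - d \<Longrightarrow> d < c \<Longrightarrow> c < k \<Longrightarrow> False" using 3 by auto
      ultimately show ?thesis using dupd by (auto simp: I_def)
    next
      case 4
      then have "int(d := int c - int i, c := int d - int (k - i)) = int(c := int c - int k)"
        using i by (auto simp: fun_eq_iff)
      then have "g i = - ?D c" unfolding g_def by (subst swap) simp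
      moreover have "i \<notin> I" "i = c - d" "d < c" "c < k" using 4 i by (auto simp: I_def)
      ultimately show ?thesis by simp
    next
      case 5
      then have "int(d := int c - int i, c := int d - int (k - i)) = int(d := int d - int k)"
        using i by (auto simp: fun_eq_iff)
      then have "g i = - ?D d" unfolding g_def by (subst swap) simp
      moreover have "i \<notin> I" "i = c + k - d" "c < d" "d < k" using 5 i by (auto simp: I_def)
      ultimately show ?thesis by simp
    qed
  qed
  \<comment> \<open>The reflection \<open>i \<mapsto> c + k - d - i\<close> interchanges the two
    column indices \<open>c - i\<close> and \<open>d - (k - i)\<close>, so each term is the negative
    of its mirror image.\<close>
  have "(\<Sum>i\<in>I. g i) = (\<Sum>i\<in>I. - g i)"
  proof (rule sum.reindex_bij_witness[of _ "\<lambda>i. c + k - d - i" "\<lambda>i. c + k - d - i"])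
    fix i assume i: "i \<in> I"
    show "c + k - d - i \<in> I" "c + k - d - (c + k - d - i) = i" using i by (auto simp: I_def)
    show "- g (c + k - d - i) = g i"
    proof -
      have eqs: "int d - int (k - (c + k - d - i)) = int c - int i" "int c - int (c + k - d - i) = int d - int (k - i)"
        using i by (auto simp: I_def of_nat_diff)
      show ?thesis unfolding g_def eqs by (subst swap) simp
    qed
  qed (auto simp: I_def)
  then have I0: "(\<Sum>i\<in>I. g i) = 0" by (intro mps_eq_uminus_self) (simp add: sum_negf)
  have "(\<Sum>i=1..<k. if i \<in> I then g i else 0) = (\<Sum>i\<in>I. g i)"
    by (rule sum.mono_neutral_cong_right) (auto simp: I_def)
  with I0 have I: "(\<Sum>i=1..<k. if i \<in> I then g i else 0) = 0" by simp
  have "(\<Sum>i=1..<k. g i) = (\<Sum>i=1..<k. (if i \<in> I then g i else 0) + (if i = c - d then if d < c \<and> c < k then - ?D c else 0 else 0)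
      + (if i = c + k - d then if c < d \<and> d < k then - ?D d else 0 else 0))"
    using g by (rule sum.cong[OF refl])
  also have "\<dots> = (\<Sum>i=1..<k. if i = c - d then if d < c \<and> c < k then - ?D c else 0 else 0)
      + (\<Sum>i=1..<k. if i = c + k - d then if c < d \<and> d < k then - ?D d else 0 else 0)"
    by (simp only: sum.distrib I add_0_left)
  also have "\<dots> = (if d < c \<and> c < k then - ?D c else 0) + (if c < d \<and> d < k then - ?D d else 0)"
    using k by (subst (1 2) sum.delta) auto
  finally show ?thesis by (simp add: g_def)
qed

text \<open>Both derivatives lower columns. If they lower the same column, each of the
  \<open>k - 1\<close> values of \<open>i\<close> gives \<open>D k c\<close>. Two different columns
  contribute \<open>- D k c\<close> for every \<open>d < c\<close>, and the order of the two
  derivatives doubles this.\<close>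

lemma mps_E_E_hdet:
  fixes x :: "nat \<Rightarrow> int" and N :: nat
  defines "D \<equiv> \<lambda>k c. hdet N x (int(c := int c - int k)) :: (nat, 'a :: field_char_0) mps"
  assumes k: "k > 0"
  shows "(\<Sum>i=1..<k. mps_E i (mps_E (k - i) (hdet N x int)))
    = of_nat (k - 1) * (\<Sum>c<N. D k c) - 2 * (\<Sum>c<N. of_nat c * D k c)"
proof -
  define G :: "nat \<Rightarrow> nat \<Rightarrow> nat \<Rightarrow> (nat, 'a) mps" where
    "G i d c = (let \<kappa> = int(d := int d - int (k - i)) in hdet N x (\<kappa>(c := \<kappa> c - int i)))" for i d c
  define F where "F c d = (\<Sum>i=1..<k. G i d c)" for c d
  have D0: "D k c = 0" if "c < N" "k \<le> c" for c
    unfolding D_def using that k by (intro hdet_equal_columns[of c _ "c - k"]) auto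
  have "(\<Sum>i=1..<k. mps_E i (mps_E (k - i) (hdet N x int))) = (\<Sum>i=1..<k. \<Sum>d<N. \<Sum>c<N. G i d c)"
  proof (rule sum.cong[OF refl])
    fix i assume "i \<in> {1..<k}"
    then have "i > 0" "k - i > 0" by auto
    then show "mps_E i (mps_E (k - i) (hdet N x int)) = (\<Sum>d<N. \<Sum>c<N. G i d c)"
      by (simp add: mps_E_hdet_columns derivation_sum[OF derivation_E] G_def Let_def)
  qed
  also have "\<dots> = (\<Sum>c<N. \<Sum>d<N. F c d)"
    unfolding F_def by (subst sum.swap, subst (2) sum.swap, subst sum.swap) rule
  also have "\<dots> = (\<Sum>c<N. \<Sum>d<N. (if c = d then of_nat (k - 1) * D k c else 0)
      - (if d < c then of_nat (if c < k then 1 else 0) * D k c else 0)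
      - (if c < d then of_nat (if d < k then 1 else 0) * D k d else 0))"
  proof (intro sum.cong refl)
    fix c d assume cd: "c \<in> {..<N}" "d \<in> {..<N}"
    show "F c d = (if c = d then of_nat (k - 1) * D k c else 0)
      - (if d < c then of_nat (if c < k then 1 else 0) * D k c else 0)
      - (if c < d then of_nat (if d < k then 1 else 0) * D k d else 0)"
    proof (cases "c = d")
      case True
      have "F c d = (\<Sum>i=1..<k. D k c)"
        unfolding F_def using True by (intro sum.cong refl) (auto simp: G_def D_def of_nat_diff)
      then show ?thesis using True by simp
    next
      case False
      have "F c d = (\<Sum>i=1..<k. hdet N x (int(d := int d - int (k - i), c := int c - int i)))"
        unfolding F_def using False by (intro sum.cong refl) (simp add: G_def)
      also have "\<dots> = - (if d < c \<and> c < k then D k c else 0) - (if c < d \<and> d < k then D k d else 0)"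
        unfolding D_def using cd False k by (intro hdet_two_columns_sum) auto
      finally show ?thesis using False by simp
    qed
  qed
  also have "\<dots> = (\<Sum>c<N. of_nat (k - 1) * D k c)
      - (\<Sum>c<N. \<Sum>d<N. if d < c then of_nat (if c < k then 1 else 0) * D k c else 0)
      - (\<Sum>c<N. \<Sum>d<N. if c < d then of_nat (if d < k then 1 else 0) * D k d else 0)"
    by (simp add: sum_subtractf)
  also have "(\<Sum>c<N. \<Sum>d<N. if c < d then of_nat (if d < k then 1 else 0) * D k d else 0)
      = (\<Sum>c<N. \<Sum>d<N. if d < c then of_nat (if c < k then 1 else 0) * D k c else 0)"
    by (rule sum.swap)
  also have "\<dots> = (\<Sum>c<N. of_nat c * D k c)"
  proof (rule sum.cong[OF refl])
    fix c assume c: "c \<in> {..<N}"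
    then have "(\<Sum>d<N. if d < c then of_nat (if c < k then 1 else 0) * D k c else 0)
        = (\<Sum>d<c. of_nat (if c < k then 1 else 0) * D k c)"
      by (intro sum.mono_neutral_cong_right) auto
    then show "(\<Sum>d<N. if d < c then of_nat (if c < k then 1 else 0) * D k c else 0) = of_nat c * D k c"
      using D0[of c] c by simp
  qed
  finally show ?thesis unfolding sum_distrib_left[symmetric] mult_2 by (simp only: diff_diff_eq)
qed

text \<open>Twice the sum of the contents if \<open>x i = l - i\<close> for a row \<open>i\<close>
  of length \<open>l\<close>, rows counted from 0: the contents of the row add up to
  \<open>l (l - 1 - 2 i) / 2\<close>, and
  \<open>l (l - 1 - 2 i) = x i (x i - 1) - i (i + 1)\<close>. The polynomial form makes sense for
  all integers. A new box in row \<open>i\<close> has content \<open>x i\<close> and raises the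
  value by \<open>2 * x i\<close>.\<close>

definition content_sum2 :: "nat \<Rightarrow> (nat \<Rightarrow> int) \<Rightarrow> int" where
  "content_sum2 N x = (\<Sum>i<N. x i * (x i - 1)) - (\<Sum>j<N. int j * (int j + 1))"

lemma content_sum2_shift:
  assumes "i < N"
  shows "content_sum2 N (x(i := x i + t)) = content_sum2 N x + t * (2 * x i + t - 1)"
proof -
  have "(\<Sum>j\<in>{..<N}-{i}. (x(i := x i + t)) j * ((x(i := x i + t)) j - 1))
      = (\<Sum>j\<in>{..<N}-{i}. x j * (x j - 1))"
    by (rule sum.cong) auto
  then have "(\<Sum>j<N. (x(i := x i + t)) j * ((x(i := x i + t)) j - 1))
      = (x i + t) * (x i + t - 1) + (\<Sum>j\<in>{..<N}-{i}. x j * (x j - 1))"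
    using sum.remove[of "{..<N}" i "\<lambda>j. (x(i := x i + t)) j * ((x(i := x i + t)) j - 1)"] assms by simp
  moreover have "(\<Sum>j<N. x j * (x j - 1)) = x i * (x i - 1) + (\<Sum>j\<in>{..<N}-{i}. x j * (x j - 1))"
    using sum.remove[of "{..<N}" i "\<lambda>j. x j * (x j - 1)"] assms by simp
  ultimately show ?thesis by (simp add: content_sum2_def algebra_simps)
qed

text \<open>The column sums with weights \<open>c\<close> from \<open>mps_L_hdet\<close> and
  \<open>mps_E_E_hdet\<close> cancel. What is left are row weights, and these are exactly the loss
  of \<open>content_sum2\<close> when the row index \<open>x i\<close> is lowered by
  \<open>k\<close>.\<close>

lemma mps_E_cut_join_hdet:
  fixes x :: "nat \<Rightarrow> int"
  assumes k: "1 \<le> k" "k \<le> B" and x: "\<And>i. i < N \<Longrightarrow> x i + int N \<le> int B"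
  shows "mps_E k (cut_join B (hdet N x int)) = (\<Sum>i<N. cut_join B (hdet N (x(i := x i - int k)) int)
    + of_int (int k * (2 * x i - int k - 1)) * hdet N (x(i := x i - int k)) int :: (nat, 'a :: field_char_0) mps)"
proof -
  define D where "D c = (hdet N x (int(c := int c - int k)) :: (nat, 'a) mps)" for c
  define R where "R i = (hdet N (x(i := x i - int k)) int :: (nat, 'a) mps)" for i
  have RD: "(\<Sum>i<N. R i) = (\<Sum>c<N. D c)"
    using hdet_shift_rows_eq_columns[of N x "- int k" int, where ?'a = 'a] by (simp add: R_def D_def)
  let ?K = "of_nat k :: (nat, 'a) mps"
  have k1: "of_nat (k - 1) = ?K - 1" using k by (simp add: of_nat_diff)
  have "mps_E k (cut_join B (hdet N x int)) = cut_join B (mps_E k (hdet N x int))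
      + 2 * ?K * mps_L B k (hdet N x int) + ?K * (\<Sum>i=1..<k. mps_E i (mps_E (k - i) (hdet N x int)))"
    by (rule mps_E_cut_join[OF k])
  also have "cut_join B (mps_E k (hdet N x int)) = (\<Sum>i<N. cut_join B (R i))"
    using k by (simp add: mps_E_hdet_rows cut_join_sum R_def)
  also have "mps_L B k (hdet N x int) = (\<Sum>i<N. of_int (x i) * R i) + (\<Sum>c<N. of_int (int c - int k) * D c)"
    unfolding R_def D_def by (rule mps_L_hdet[OF x])
  also have "(\<Sum>c<N. of_int (int c - int k) * D c) = (\<Sum>c<N. of_nat c * D c) - ?K * (\<Sum>i<N. R i)"
    unfolding RD by (simp add: left_diff_distrib sum_subtractf sum_distrib_left)
  also have "(\<Sum>i=1..<k. mps_E i (mps_E (k - i) (hdet N x int)))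
      = (?K - 1) * (\<Sum>i<N. R i) - 2 * (\<Sum>c<N. of_nat c * D c)"
    unfolding RD k1[symmetric] D_def using k by (intro mps_E_E_hdet) simp
  also have "(\<Sum>i<N. cut_join B (R i))
        + 2 * ?K * ((\<Sum>i<N. of_int (x i) * R i) + ((\<Sum>c<N. of_nat c * D c) - ?K * (\<Sum>i<N. R i)))
        + ?K * ((?K - 1) * (\<Sum>i<N. R i) - 2 * (\<Sum>c<N. of_nat c * D c))
      = (\<Sum>i<N. cut_join B (R i)) + (\<Sum>i<N. 2 * ?K * (of_int (x i) * R i))
        - (\<Sum>i<N. (?K * (?K + 1)) * R i)"
    unfolding sum_distrib_left[symmetric] by (simp add: algebra_simps)
  also have "\<dots> = (\<Sum>i<N. cut_join B (R i) + of_int (int k * (2 * x i - int k - 1)) * R i)"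
    by (simp add: sum.distrib[symmetric] sum_subtractf[symmetric] algebra_simps)
  finally show ?thesis by (simp only: R_def)
qed

lemma mps_coeff_empty_mult: "mps_coeff (f * g) {#} = mps_coeff f {#} * mps_coeff g {#}"
  by (simp add: mps_coeff_mult mset_splits_def)

lemma mps_coeff_empty_prod: "mps_coeff (\<Prod>a\<in>A. f a) {#} = (\<Prod>a\<in>A. mps_coeff (f a) {#})"
  by (induction A rule: infinite_finite_induct) (simp_all add: mps_coeff_one mps_coeff_empty_mult)

lemma mps_coeff_empty_cut_join: "mps_coeff (cut_join B f) {#} = 0"
  by (simp add: cut_join_def mps_coeff_empty_mult mps_coeff_var)

lemma mps_coeff_empty_hsym: "mps_coeff (hsym a) {#} = (if a = 0 then 1 else 0)"
proof (cases "a \<ge> 0")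
  case True
  then obtain n where n: "a = int n" by (metis nonneg_int_cases)
  show ?thesis
  proof (cases "n = 0")
    case False
    have "of_nat n * mps_coeff (hsym (int n)) {#} = mps_coeff (of_nat n * hsym (int n)) {#}" by simp
    also have "\<dots> = 0" unfolding schur_row_recursion by (simp add: mps_coeff_empty_mult mps_coeff_var)
    finally show ?thesis using n False by simp
  qed (simp add: n schur_row_0 mps_coeff_one)
next
  case False
  then show ?thesis by (simp add: schur_row_neg)
qed

text \<open>A determinant with a non-zero constant term has row indices \<open>0, -1, \<dots>, 1 - N\<close> in some order.\<close>

lemma content_sum2_constant_term:
  fixes x :: "nat \<Rightarrow> int"
  assumes "mps_coeff (hdet N x int :: (nat, 'a :: field_char_0) mps) {#} \<noteq> 0"
  shows "content_sum2 N x = 0"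
proof -
  have "(\<Sum>p | p permutes {..<N}. of_int (sign p) * (\<Prod>i<N. if x i + int (p i) = 0 then 1 else 0)) \<noteq> (0 :: 'a)"
    using assms by (simp add: hdet_def mps_coeff_empty_prod mps_coeff_empty_hsym)
  then obtain p where p: "p permutes {..<N}" "(\<Prod>i<N. if x i + int (p i) = 0 then 1 else (0 :: 'a)) \<noteq> 0"
    by (metis (no_types, lifting) mem_Collect_eq mult_zero_right sum.neutral)
  have "x i = - int (p i)" if "i < N" for i
  proof -
    have "\<forall>i\<in>{..<N}. (if x i + int (p i) = 0 then 1 else (0 :: 'a)) \<noteq> 0"
      using p(2) by (simp only: prod_zero_iff[OF finite_lessThan]) blast
    then have "x i + int (p i) = 0" using that by (auto split: if_splits)
    then show ?thesis by simp
  qed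
  then have "(\<Sum>i<N. x i * (x i - 1)) = (\<Sum>i<N. int (p i) * (int (p i) + 1))"
    by (intro sum.cong) (auto simp: algebra_simps)
  also have "\<dots> = (\<Sum>j<N. int j * (int j + 1))"
    by (rule sum.reindex_bij_betw[OF permutes_imp_bij[OF p(1)]])
  finally show ?thesis by (simp add: content_sum2_def)
qed

text \<open>Applying \<open>mps_E k\<close> removes one \<open>k\<close> from the monomial and
  replaces the determinant by those with one row index lowered by \<open>k\<close>. Few of them
  belong to partitions, so the induction runs over all integer \<open>x\<close>; it ends at the
  constant terms.\<close>

lemma mps_coeff_cut_join_hdet:
  assumes "\<And>i. i < N \<Longrightarrow> x i + int N \<le> int B" "set_mset M \<subseteq> {1..B}"
  shows "mps_coeff (cut_join B (hdet N x int)) M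
    = of_int (content_sum2 N x) * mps_coeff (hdet N x int :: (nat, 'a :: field_char_0) mps) M"
  using assms
proof (induction M arbitrary: x)
  case empty
  show ?case using content_sum2_constant_term[of N x, where ?'a = 'a]
    by (cases "mps_coeff (hdet N x int :: (nat, 'a) mps) {#} = 0") (auto simp: mps_coeff_empty_cut_join)
next
  case (add k M)
  have k: "1 \<le> k" "k \<le> B" using add.prems by auto
  let ?s = "hdet N x int :: (nat, 'a) mps"
  let ?R = "\<lambda>i. hdet N (x(i := x i - int k)) int :: (nat, 'a) mps"
  have shift: "content_sum2 N (x(i := x i - int k)) + int k * (2 * x i - int k - 1) = content_sum2 N x" if "i < N" for i
    using content_sum2_shift[OF that, of x "- int k"] by (simp add: algebra_simps)
  have IH: "mps_coeff (cut_join B (?R i)) M = of_int (content_sum2 N (x(i := x i - int k))) * mps_coeff (?R i) M"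
    if "i < N" for i
  proof (rule add.IH)
    show "(x(i := x i - int k)) j + int N \<le> int B" if "j < N" for j
      using add.prems(1)[OF that] by auto
  qed (use add.prems in auto)
  have "of_nat k * of_nat (count M k + 1) * mps_coeff (cut_join B ?s) (add_mset k M) = mps_coeff (mps_E k (cut_join B ?s)) M"
    by simp
  also have "\<dots> = (\<Sum>i<N. mps_coeff (cut_join B (?R i)) M + of_int (int k * (2 * x i - int k - 1)) * mps_coeff (?R i) M)"
    by (simp only: mps_E_cut_join_hdet[OF k add.prems(1), where ?'a = 'a] mps_coeff_sum mps_coeff_add mps_coeff_of_int_mult)
  also have "\<dots> = (\<Sum>i<N. of_int (content_sum2 N x) * mps_coeff (?R i) M)"
  proof (rule sum.cong[OF refl])
    fix i assume "i \<in> {..<N}"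
    then have i: "i < N" by simp
    show "mps_coeff (cut_join B (?R i)) M + of_int (int k * (2 * x i - int k - 1)) * mps_coeff (?R i) M
      = of_int (content_sum2 N x) * mps_coeff (?R i) M"
      unfolding IH[OF i] shift[OF i, symmetric] of_int_add by (simp only: distrib_right)
  qed
  also have "\<dots> = of_int (content_sum2 N x) * mps_coeff (mps_E k ?s) M"
    using k by (simp add: mps_E_hdet_rows sum_distrib_left del: mps_coeff_E)
  finally have eq: "(of_nat k * of_nat (count M k + 1)) * mps_coeff (cut_join B ?s) (add_mset k M)
      = (of_nat k * of_nat (count M k + 1)) * (of_int (content_sum2 N x) * mps_coeff ?s (add_mset k M))"
    by (simp add: ac_simps)
  have "of_nat k * of_nat (count M k + 1) \<noteq> (0 :: 'a)"
    using k by (simp del: of_nat_Suc of_nat_add)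
  then show ?case using eq by (rule mult_left_cancel[THEN iffD1])
qed

text \<open>The weight is an integer because the row indices of \<open>hdet\<close> may lead to a
  negative weight; a series of negative weight is zero. The variable of index 0 would not be seen by
  the weight and is excluded explicitly.\<close>

definition mps_hom :: "int \<Rightarrow> (nat, 'a :: comm_ring_1) mps \<Rightarrow> bool" where
  "mps_hom w f \<longleftrightarrow> (\<forall>M. mps_coeff f M \<noteq> 0 \<longrightarrow> int (sum_mset M) = w \<and> 0 \<notin># M)"

lemma mps_hom_0: "mps_hom w 0"
  by (simp add: mps_hom_def)

lemma mps_hom_1: "mps_hom 0 1"
  by (simp add: mps_hom_def mps_coeff_one)

lemma mps_hom_add: "mps_hom w f \<Longrightarrow> mps_hom w g \<Longrightarrow> mps_hom w (f + g)"
  unfolding mps_hom_def mps_coeff_add by (metis add_0)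

lemma mps_hom_sum: "(\<And>a. a \<in> A \<Longrightarrow> mps_hom w (f a)) \<Longrightarrow> mps_hom w (\<Sum>a\<in>A. f a)"
  by (induction A rule: infinite_finite_induct) (simp_all add: mps_hom_0 mps_hom_add)

lemma mps_hom_mult:
  assumes "mps_hom v f" "mps_hom w g" shows "mps_hom (v + w) (f * g)"
  unfolding mps_hom_def
proof (intro allI impI)
  fix M assume "mps_coeff (f * g) M \<noteq> 0"
  then obtain A B where AB: "A + B = M" "mps_coeff f A * mps_coeff g B \<noteq> 0"
    unfolding mps_coeff_mult mset_splits_def by (auto elim!: sum.not_neutral_contains_not_neutral)
  then have "mps_coeff f A \<noteq> 0" "mps_coeff g B \<noteq> 0" by auto
  then show "int (sum_mset M) = v + w \<and> 0 \<notin># M"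
    using assms AB(1) unfolding mps_hom_def by auto
qed

lemma mps_hom_const: "mps_hom 0 (mps_const c)"
  by (simp add: mps_hom_def mps_coeff_const)

lemma mps_hom_const_mult: "mps_hom w f \<Longrightarrow> mps_hom w (mps_const c * f)"
  using mps_hom_mult[OF mps_hom_const] by fastforce

lemma mps_hom_var: "i > 0 \<Longrightarrow> mps_hom (int i) (mps_var i)"
  by (simp add: mps_hom_def mps_coeff_var)

lemma mps_hom_prod:
  "(\<And>a. a \<in> A \<Longrightarrow> mps_hom (w a) (f a)) \<Longrightarrow> finite A \<Longrightarrow> mps_hom (\<Sum>a\<in>A. w a) (\<Prod>a\<in>A. f a)"
  by (induction A rule: infinite_finite_induct) (simp_all add: mps_hom_1 mps_hom_mult)

lemma mps_hom_E: "mps_hom w f \<Longrightarrow> mps_hom (w - int k) (mps_E k f)"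
  unfolding mps_hom_def
proof (intro allI impI)
  fix M assume f: "\<forall>M. mps_coeff f M \<noteq> 0 \<longrightarrow> int (sum_mset M) = w \<and> 0 \<notin># M" and "mps_coeff (mps_E k f) M \<noteq> 0"
  then have "mps_coeff f (add_mset k M) \<noteq> 0" by auto
  with f have "int (sum_mset (add_mset k M)) = w \<and> 0 \<notin># add_mset k M" by blast
  then show "int (sum_mset M) = w - int k \<and> 0 \<notin># M" by auto
qed

lemma mps_hom_cut_join:
  assumes "mps_hom w f" shows "mps_hom w (cut_join B f)"
  unfolding cut_join_def
proof (intro mps_hom_sum mps_hom_add)
  fix i j assume ij: "i \<in> {1..B}" "j \<in> {1..B}"
  have "mps_hom ((int i + int j) + (w - int (i + j))) (mps_var i * mps_var j * mps_E (i + j) f)"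
    using ij by (intro mps_hom_mult mps_hom_var mps_hom_E assms) auto
  then show "mps_hom w (mps_var i * mps_var j * mps_E (i + j) f)" by simp
  have "mps_hom (int (i + j) + (w - int j - int i)) (mps_var (i + j) * mps_E i (mps_E j f))"
    using ij by (intro mps_hom_mult mps_hom_var mps_hom_E assms) auto
  then show "mps_hom w (mps_var (i + j) * mps_E i (mps_E j f))" by simp
qed

lemma mps_hom_hsym: "mps_hom a (hsym a)"
proof (cases "a \<ge> 0")
  case True
  then obtain n where "a = int n" by (metis nonneg_int_cases)
  moreover have "mps_hom (int n) (hsym (int n) :: (nat, 'a) mps)"
  proof (induction n rule: less_induct)
    case (less n)
    show ?case
    proof (cases "n = 0")
      case False
      have "mps_hom (int n) (\<Sum>i=1..n. mps_var i * hsym (int n - int i) :: (nat, 'a) mps)"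
      proof (rule mps_hom_sum)
        fix i assume i: "i \<in> {1..n}"
        then have "mps_hom (int (n - i)) (hsym (int (n - i)) :: (nat, 'a) mps)" by (intro less.IH) auto
        then have "mps_hom (int i + int (n - i)) (mps_var i * hsym (int (n - i)) :: (nat, 'a) mps)"
          using i by (intro mps_hom_mult mps_hom_var) auto
        then show "mps_hom (int n) (mps_var i * hsym (int n - int i) :: (nat, 'a) mps)"
          using i by (simp add: of_nat_diff)
      qed
      then have "mps_hom (int n) (of_nat n * hsym (int n) :: (nat, 'a) mps)" by (simp only: schur_row_recursion)
      then show ?thesis using False by (simp add: mps_hom_def)
    qed (simp add: schur_row_0 mps_hom_1)
  qed
  ultimately show ?thesis by simp
next
  case False
  then show ?thesis by (simp add: schur_row_neg mps_hom_0)
qed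

lemma mps_hom_hdet: "mps_hom ((\<Sum>i<N. x i) + (\<Sum>i<N. int i)) (hdet N x int)"
  unfolding hdet_def of_int_mps
proof (intro mps_hom_sum mps_hom_const_mult)
  fix p assume "p \<in> {p. p permutes {..<N}}"
  then have p: "p permutes {..<N}" by simp
  have "mps_hom (\<Sum>i<N. x i + int (p i)) (\<Prod>i<N. hsym (x i + int (p i)))"
    by (intro mps_hom_prod mps_hom_hsym) simp
  also have "(\<Sum>i<N. x i + int (p i)) = (\<Sum>i<N. x i) + (\<Sum>i<N. int i)"
    using sum.reindex_bij_betw[OF permutes_imp_bij[OF p], of int] by (simp add: sum.distrib)
  finally show "mps_hom ((\<Sum>i<N. x i) + (\<Sum>i<N. int i)) (\<Prod>i<N. hsym (x i + int (p i)))" .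
qed

text \<open>The coefficientwise result covers the monomials in the variables 1 to \<open>B\<close>.
  Every other monomial contains the index 0 or has a weight above \<open>B\<close>, and by
  homogeneity it occurs on neither side.\<close>

theorem cut_join_hdet:
  assumes "\<And>i. i < N \<Longrightarrow> x i + int N \<le> int B" "(\<Sum>i<N. x i) + (\<Sum>i<N. int i) \<le> int B"
  shows "cut_join B (hdet N x int) = of_int (content_sum2 N x) * (hdet N x int :: (nat, 'a :: field_char_0) mps)"
proof (rule mps_eqI)
  fix M
  show "mps_coeff (cut_join B (hdet N x int)) M = mps_coeff (of_int (content_sum2 N x) * (hdet N x int :: (nat, 'a) mps)) M"
  proof (cases "set_mset M \<subseteq> {1..B}")
    case True
    then show ?thesis using mps_coeff_cut_join_hdet[OF assms(1) True] by simp
  next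
    case False
    have "\<not> (int (sum_mset M) = (\<Sum>i<N. x i) + (\<Sum>i<N. int i) \<and> 0 \<notin># M)"
    proof
      assume M: "int (sum_mset M) = (\<Sum>i<N. x i) + (\<Sum>i<N. int i) \<and> 0 \<notin># M"
      obtain k where k: "k \<in># M" "k \<notin> {1..B}" using False by blast
      then have "k \<le> sum_mset M" by (metis insert_DiffM le_add1 sum_mset.add_mset)
      moreover have "k \<noteq> 0" using k M by metis
      ultimately show False using k M assms(2) by auto
    qed
    then have *: "mps_coeff f M = 0" if "mps_hom ((\<Sum>i<N. x i) + (\<Sum>i<N. int i)) f" for f :: "(nat, 'a) mps"
      using that unfolding mps_hom_def by blast
    show ?thesis
      using *[OF mps_hom_hdet] *[OF mps_hom_cut_join[OF mps_hom_hdet]] by simp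
  qed
qed

section \<open>Cycles and transpositions\<close>

text \<open>The version of \<open>perm_cycles\<close> for an arbitrary set of points, since tuples
  of permutations are later restricted to their components.\<close>

definition cycles_on :: "'b set \<Rightarrow> ('b \<Rightarrow> 'b) \<Rightarrow> 'b set set" where
  "cycles_on A \<sigma> = orbit \<sigma> ` A"

lemma perm_cycles_eq: "perm_cycles n \<sigma> = cycles_on {1..n} \<sigma>"
  by (simp add: perm_cycles_def cycles_on_def)

lemma finite_cycles_on: "finite A \<Longrightarrow> finite (cycles_on A \<sigma>)"
  by (simp add: cycles_on_def)

lemma permutes_permutation: "\<sigma> permutes A \<Longrightarrow> finite A \<Longrightarrow> permutation \<sigma>"
  by (meson permutation_permutes)

lemma orbit_eqI_mem:
  assumes "permutation \<sigma>" "y \<in> orbit \<sigma> x" shows "orbit \<sigma> y = orbit \<sigma> x"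
  by (rule orbit_cyclic_eq3[OF cyclic_on_orbit'[OF assms(1)] assms(2)])

lemma mem_orbit_iff_eq: "permutation \<sigma> \<Longrightarrow> y \<in> orbit \<sigma> x \<longleftrightarrow> orbit \<sigma> y = orbit \<sigma> x"
  using orbit_eqI_mem permutation_self_in_orbit by metis

lemma orbit_eq_or_disjoint:
  "permutation \<sigma> \<Longrightarrow> orbit \<sigma> x = orbit \<sigma> y \<or> orbit \<sigma> x \<inter> orbit \<sigma> y = {}"
  by (metis disjoint_iff orbit_eqI_mem)

lemma orbit_cyclic_sequence:
  assumes "n > 0" "\<And>i. Suc i < n \<Longrightarrow> g (f i) = f (Suc i)" "g (f (n - 1)) = f 0"
  shows "orbit g (f 0) = f ` {..<n}"
proof
  have step: "g (f i) \<in> f ` {..<n}" if "i < n" for i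
  proof (cases "Suc i = n")
    case True
    then have "g (f i) = f 0" using assms(3) by auto
    then show ?thesis using assms(1) by auto
  next
    case False
    then show ?thesis using assms(2)[of i] that by auto
  qed
  show "orbit g (f 0) \<subseteq> f ` {..<n}"
  proof
    fix y assume "y \<in> orbit g (f 0)"
    then show "y \<in> f ` {..<n}" by induction (use step assms(1) in auto)
  qed
  have Suc: "f (Suc i) \<in> orbit g (f 0)" if "Suc i < n" for i
    using that
  proof (induction i)
    case 0
    then show ?case using assms(2)[of 0] by (metis orbit.base)
  next
    case (Suc i)
    then have "f (Suc i) \<in> orbit g (f 0)" by simp
    then have "g (f (Suc i)) \<in> orbit g (f 0)" by (rule orbit.step)
    then show ?case using assms(2)[OF Suc.prems] by simp
  qed
  have "f 0 \<in> orbit g (f 0)"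
  proof (cases "n = 1")
    case True
    then show ?thesis using assms(3) orbit.base[of g "f 0"] by simp
  next
    case False
    then have "f (n - 1) \<in> orbit g (f 0)" using Suc[of "n - 2"] assms(1)
      by (metis One_nat_def Suc_diff_Suc Suc_lessI diff_less numeral_2_eq_2 zero_less_Suc)
    then show ?thesis using orbit.step[of "f (n - 1)" g "f 0"] assms(3) by simp
  qed
  moreover have "f i \<in> orbit g (f 0)" if "i < n" "i \<noteq> 0" for i using Suc[of "i - 1"] that by simp
  ultimately show "f ` {..<n} \<subseteq> orbit g (f 0)" by force
qed

lemma orbit_enumeration:
  fixes a :: 'b
  assumes "permutation \<sigma>"
  defines "L \<equiv> card (orbit \<sigma> a)"
  shows "L > 0" "(\<sigma> ^^ L) a = a" "inj_on (\<lambda>i. (\<sigma> ^^ i) a) {..<L}"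
    "orbit \<sigma> a = (\<lambda>i. (\<sigma> ^^ i) a) ` {..<L}"
proof -
  have a: "a \<in> orbit \<sigma> a" using permutation_self_in_orbit[OF assms(1)] .
  let ?n = "funpow_dist1 \<sigma> a a"
  have orb: "orbit \<sigma> a = (\<lambda>i. (\<sigma> ^^ i) a) ` {..<?n}"
    using orbit_conv_funpow_dist1[OF a] by (simp only: atLeast0LessThan)
  have inj: "inj_on (\<lambda>i. (\<sigma> ^^ i) a) {..<?n}"
    using inj_on_funpow_dist1[OF a] by (simp only: atLeast0LessThan)
  have "L = ?n" unfolding L_def orb using card_image[OF inj] by simp
  then show "L > 0" "(\<sigma> ^^ L) a = a" "inj_on (\<lambda>i. (\<sigma> ^^ i) a) {..<L}"
    "orbit \<sigma> a = (\<lambda>i. (\<sigma> ^^ i) a) ` {..<L}"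
    using orb inj funpow_dist1_prop[OF a] by simp_all
qed

text \<open>Along the cycle \<open>a, \<sigma> a, ...\<close> the transposition redirects two
  arrows: the one into \<open>(\<sigma> ^^ d) a\<close> now leads to \<open>a\<close>, and the one
  into \<open>a\<close> leads to \<open>(\<sigma> ^^ d) a\<close>. So two arcs of lengths
  \<open>d\<close> and \<open>L - d\<close> close up.\<close>

lemma orbit_transpose_cut:
  assumes perm: "permutation \<sigma>" and d: "0 < d" "d < card (orbit \<sigma> a)"
  defines "L \<equiv> card (orbit \<sigma> a)" and "\<tau> \<equiv> transpose a ((\<sigma> ^^ d) a) \<circ> \<sigma>"
  shows "orbit \<tau> a = (\<lambda>i. (\<sigma> ^^ i) a) ` {..<d}"
    and "orbit \<tau> ((\<sigma> ^^ d) a) = (\<lambda>i. (\<sigma> ^^ i) a) ` {d..<L}"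
proof -
  note e = orbit_enumeration[OF perm, of a, folded L_def]
  define f where "f i = (\<sigma> ^^ i) a" for i
  have inj: "i < L \<Longrightarrow> j < L \<Longrightarrow> f i = f j \<longleftrightarrow> i = j" for i j
    using e(3) by (auto simp: inj_on_def f_def)
  have fS: "\<sigma> (f i) = f (Suc i)" for i by (simp add: f_def)
  have f0: "f 0 = a" and fL: "f L = a" using e(2) by (auto simp: f_def)
  have \<tau>: "\<tau> (f i) = transpose (f 0) (f d) (f (Suc i))" for i by (simp add: \<tau>_def fS f0 flip: f_def)
  have dL: "d < L" using d by (simp add: L_def)
  have \<tau>1: "\<tau> (f i) = f (Suc i)" if "Suc i < L" "Suc i \<noteq> d" for i
  proof -
    have "f (Suc i) \<noteq> f 0" "f (Suc i) \<noteq> f d" using inj that dL by auto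
    then show ?thesis unfolding \<tau> by (simp add: transpose_def)
  qed
  have "orbit \<tau> (f 0) = f ` {..<d}"
  proof (rule orbit_cyclic_sequence)
    show "\<tau> (f (d - 1)) = f 0" unfolding \<tau> using d by simp
  qed (use d dL \<tau>1 in auto)
  then show "orbit \<tau> a = (\<lambda>i. (\<sigma> ^^ i) a) ` {..<d}" by (simp add: f0 f_def)
  have "orbit \<tau> ((\<lambda>i. f (d + i)) 0) = (\<lambda>i. f (d + i)) ` {..<L - d}"
  proof (rule orbit_cyclic_sequence)
    have "Suc (d + (L - d - 1)) = L" using dL by simp
    then show "\<tau> (f (d + (L - d - 1))) = f (d + 0)" unfolding \<tau> using fL f0 by simp
  qed (use dL \<tau>1 in auto)
  also have "\<dots> = f ` {d..<L}"
  proof -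
    have "(\<lambda>i. d + i) ` {..<L - d} = {d..<L}" using dL image_add_atLeastLessThan[of d 0 "L - d"]
      by (simp add: atLeast0LessThan)
    then show ?thesis by (metis (no_types, lifting) image_cong image_image)
  qed
  finally show "orbit \<tau> ((\<sigma> ^^ d) a) = (\<lambda>i. (\<sigma> ^^ i) a) ` {d..<L}" by (simp add: f_def)
qed

lemma orbit_transpose_unaffected:
  assumes "permutation \<sigma>" "a \<notin> orbit \<sigma> x" "b \<notin> orbit \<sigma> x"
  shows "orbit (transpose a b \<circ> \<sigma>) x = orbit \<sigma> x"
proof (rule orbit_cong)
  show "x \<in> orbit \<sigma> x" using permutation_self_in_orbit[OF assms(1)] .
  fix s assume "s \<in> orbit \<sigma> x"
  then have "\<sigma> s \<in> orbit \<sigma> x" by (rule orbit.step)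
  then show "(transpose a b \<circ> \<sigma>) s = \<sigma> s" using assms by (auto simp: transpose_def)
qed

lemma cycles_on_cut:
  assumes perm: "\<sigma> permutes A" "finite A" and d: "0 < d" "d < card (orbit \<sigma> a)" and a: "a \<in> A"
  defines "\<tau> \<equiv> transpose a ((\<sigma> ^^ d) a) \<circ> \<sigma>" and "P \<equiv> orbit (transpose a ((\<sigma> ^^ d) a) \<circ> \<sigma>) a"
    and "Q \<equiv> orbit (transpose a ((\<sigma> ^^ d) a) \<circ> \<sigma>) ((\<sigma> ^^ d) a)"
  shows "cycles_on A \<tau> = cycles_on A \<sigma> - {orbit \<sigma> a} \<union> {P, Q}"
    and "P \<inter> Q = {}" and "P \<union> Q = orbit \<sigma> a"
    and "card P = d" and "card Q = card (orbit \<sigma> a) - d"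
    and "P \<notin> cycles_on A \<sigma> - {orbit \<sigma> a}" and "Q \<notin> cycles_on A \<sigma> - {orbit \<sigma> a}"
proof -
  have perm': "permutation \<sigma>" using permutes_permutation[OF perm] .
  let ?L = "card (orbit \<sigma> a)" and ?f = "\<lambda>i. (\<sigma> ^^ i) a" and ?b = "(\<sigma> ^^ d) a"
  note e = orbit_enumeration[OF perm', of a]
  have P: "P = ?f ` {..<d}" and Q: "Q = ?f ` {d..<?L}"
    using orbit_transpose_cut[OF perm' d] by (simp_all add: P_def Q_def)
  have lessL: "{..<?L} = {..<d} \<union> {d..<?L}" using d by auto
  show PQ: "P \<union> Q = orbit \<sigma> a"
    unfolding P Q image_Un[symmetric] lessL[symmetric] by (rule e(4)[symmetric])
  show PQ0: "P \<inter> Q = {}" unfolding P Q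
    by (subst inj_on_image_Int[OF e(3), symmetric]) (use d in auto)
  have "inj_on ?f {..<d}" "inj_on ?f {d..<?L}"
    by (rule inj_on_subset[OF e(3)], use d in auto)+
  then show "card P = d" "card Q = ?L - d" unfolding P Q by (simp_all add: card_image)
  have "?b \<in> ?f ` {..<?L}" using d by blast
  then have bO: "?b \<in> orbit \<sigma> a" by (rule e(4)[THEN equalityD2, THEN subsetD])
  have OA: "orbit \<sigma> a \<subseteq> A" using permutes_orbit_subset[OF perm(1) a] .
  then have bA: "?b \<in> A" using bO by blast
  have tr: "transpose a ?b permutes A" using a bA by (intro permutes_swap_id)
  have "\<tau> permutes A" unfolding \<tau>_def by (rule permutes_compose[OF perm(1) tr])
  then have perm\<tau>: "permutation \<tau>" using permutes_permutation perm(2) by blast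
  have off: "orbit \<tau> x = orbit \<sigma> x" if "x \<notin> orbit \<sigma> a" for x
    unfolding \<tau>_def
  proof (rule orbit_transpose_unaffected[OF perm'])
    show "a \<notin> orbit \<sigma> x" using that mem_orbit_iff_eq[OF perm'] by blast
    show "?b \<notin> orbit \<sigma> x" using that mem_orbit_iff_eq[OF perm'] bO by metis
  qed
  have on: "orbit \<tau> x \<in> {P, Q}" if "x \<in> orbit \<sigma> a" for x
  proof -
    have "x \<in> P \<or> x \<in> Q" using that PQ by blast
    then show ?thesis using orbit_eqI_mem[OF perm\<tau>] unfolding P_def Q_def \<tau>_def by blast
  qed
  have sub: "cycles_on A \<sigma> - {orbit \<sigma> a} = orbit \<sigma> ` (A - orbit \<sigma> a)"
    unfolding cycles_on_def using mem_orbit_iff_eq[OF perm'] by blast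
  have "orbit \<tau> ` (A - orbit \<sigma> a) = orbit \<sigma> ` (A - orbit \<sigma> a)" using off by (intro image_cong) auto
  moreover have "orbit \<tau> ` orbit \<sigma> a = {P, Q}"
  proof
    show "orbit \<tau> ` orbit \<sigma> a \<subseteq> {P, Q}" using on by blast
    show "{P, Q} \<subseteq> orbit \<tau> ` orbit \<sigma> a"
      using bO permutation_self_in_orbit[OF perm', of a] by (auto simp: P_def Q_def \<tau>_def)
  qed
  moreover have "cycles_on A \<tau> = orbit \<tau> ` (A - orbit \<sigma> a) \<union> orbit \<tau> ` orbit \<sigma> a"
    unfolding cycles_on_def using OA by (auto simp flip: image_Un)
  ultimately show "cycles_on A \<tau> = cycles_on A \<sigma> - {orbit \<sigma> a} \<union> {P, Q}" using sub by simp
  have *: "R \<notin> cycles_on A \<sigma> - {orbit \<sigma> a}" if R: "R \<subseteq> orbit \<sigma> a" "R \<noteq> {}" for R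
  proof
    assume "R \<in> cycles_on A \<sigma> - {orbit \<sigma> a}"
    then obtain x where "R = orbit \<sigma> x" "R \<noteq> orbit \<sigma> a" by (auto simp: cycles_on_def)
    then have "R \<inter> orbit \<sigma> a = {}" using orbit_eq_or_disjoint[OF perm'] by metis
    then show False using R by auto
  qed
  have "P \<noteq> {}" "Q \<noteq> {}" unfolding P_def Q_def by (rule orbit_nonempty)+
  then show "P \<notin> cycles_on A \<sigma> - {orbit \<sigma> a}" "Q \<notin> cycles_on A \<sigma> - {orbit \<sigma> a}"
    using PQ *[of P] *[of Q] by blast+
qed

lemma orbit_other_point:
  assumes "permutation \<sigma>" "b \<in> orbit \<sigma> a" "b \<noteq> a"
  obtains d where "0 < d" "d < card (orbit \<sigma> a)" "b = (\<sigma> ^^ d) a"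
proof -
  have "b \<in> (\<lambda>i. (\<sigma> ^^ i) a) ` {..<card (orbit \<sigma> a)}"
    using assms(2) by (rule orbit_enumeration(4)[OF assms(1), THEN equalityD1, THEN subsetD])
  then obtain d where "d < card (orbit \<sigma> a)" "b = (\<sigma> ^^ d) a" by auto
  moreover from this assms(3) have "d > 0" by (cases d) auto
  ultimately show ?thesis using that by blast
qed

text \<open>Starting at \<open>a\<close>, the new permutation follows the old cycle of
  \<open>a\<close> until it would return, and is sent to \<open>b\<close> instead.\<close>

lemma orbit_transpose_join:
  assumes perm: "permutation \<sigma>" and b: "b \<notin> orbit \<sigma> a"
  shows "b \<in> orbit (transpose a b \<circ> \<sigma>) a"
proof -
  let ?\<tau> = "transpose a b \<circ> \<sigma>"
  let ?L = "card (orbit \<sigma> a)"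
  note e = orbit_enumeration[OF perm, of a]
  have pow: "(?\<tau> ^^ i) a = (\<sigma> ^^ i) a" if "i < ?L" for i
    using that
  proof (induction i)
    case (Suc i)
    have "(\<sigma> ^^ Suc i) a \<noteq> (\<sigma> ^^ 0) a" using inj_onD[OF e(3), of "Suc i" 0] Suc.prems by auto
    moreover have "(\<sigma> ^^ Suc i) a \<in> orbit \<sigma> a" unfolding orbit_altdef by blast
    then have "(\<sigma> ^^ Suc i) a \<noteq> b" using b by blast
    ultimately show ?case using Suc by (simp add: transpose_def)
  qed auto
  obtain l where l: "?L = Suc l" using e(1) by (cases ?L) auto
  have "(?\<tau> ^^ ?L) a = ?\<tau> ((?\<tau> ^^ l) a)" by (simp add: l)
  also have "\<dots> = transpose a b (\<sigma> ((\<sigma> ^^ l) a))" using pow[of l] l by simp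
  also have "\<dots> = transpose a b ((\<sigma> ^^ ?L) a)" by (simp add: l)
  also have "\<dots> = b" using e(2) by simp
  finally have "(?\<tau> ^^ ?L) a = b" .
  moreover have "(?\<tau> ^^ n) a \<in> orbit ?\<tau> a" if "n > 0" for n
    using that unfolding orbit_altdef[of ?\<tau>] by blast
  ultimately show ?thesis using e(1) by metis
qed

lemma transpose_transpose_comp: "transpose a b \<circ> (transpose a b \<circ> \<sigma>) = \<sigma>"
  by (simp add: o_assoc)

text \<open>A second multiplication by the same transposition restores \<open>\<sigma>\<close>, so
  joining is cutting read backwards: \<open>cycles_on_cut\<close> is applied to the cycle of
  \<open>a\<close> under \<open>\<tau>\<close>, which contains \<open>b\<close>.\<close>

lemma cycles_on_join:
  assumes perm: "\<sigma> permutes A" "finite A" and ab: "a \<in> A" "b \<in> A" "b \<notin> orbit \<sigma> a"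
  defines "\<tau> \<equiv> transpose a b \<circ> \<sigma>"
  shows "cycles_on A \<tau> = insert (orbit \<sigma> a \<union> orbit \<sigma> b) (cycles_on A \<sigma> - {orbit \<sigma> a, orbit \<sigma> b})"
    and "orbit \<sigma> a \<union> orbit \<sigma> b \<notin> cycles_on A \<sigma> - {orbit \<sigma> a, orbit \<sigma> b}"
    and "orbit \<sigma> a \<inter> orbit \<sigma> b = {}"
proof -
  have perm': "permutation \<sigma>" using permutes_permutation[OF perm] .
  have tr: "transpose a b permutes A" using ab by (intro permutes_swap_id)
  have \<tau>A: "\<tau> permutes A" unfolding \<tau>_def by (rule permutes_compose[OF perm(1) tr])
  then have perm\<tau>: "permutation \<tau>" using permutes_permutation perm(2) by blast
  have b: "b \<in> orbit \<tau> a" unfolding \<tau>_def by (rule orbit_transpose_join[OF perm' ab(3)])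
  have "a \<in> orbit \<sigma> a" using permutation_self_in_orbit[OF perm'] .
  then have "b \<noteq> a" using ab by auto
  then obtain d where d: "0 < d" "d < card (orbit \<tau> a)" "b = (\<tau> ^^ d) a"
    using orbit_other_point[OF perm\<tau> b] by blast
  have \<sigma>: "transpose a ((\<tau> ^^ d) a) \<circ> \<tau> = \<sigma>" unfolding d(3)[symmetric] unfolding \<tau>_def
    by (rule transpose_transpose_comp)
  note cut = cycles_on_cut[OF \<tau>A perm(2) d(1,2) ab(1), unfolded \<sigma>, folded d(3)]
  show "orbit \<sigma> a \<inter> orbit \<sigma> b = {}" using cut(2) .
  have O: "orbit \<sigma> a \<union> orbit \<sigma> b = orbit \<tau> a" using cut(3) .
  have "orbit \<tau> a \<in> cycles_on A \<tau>" using ab by (simp add: cycles_on_def)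
  moreover have eq: "cycles_on A \<sigma> - {orbit \<sigma> a, orbit \<sigma> b} = cycles_on A \<tau> - {orbit \<tau> a}"
    using cut(1,6,7) by blast
  ultimately show "cycles_on A \<tau> = insert (orbit \<sigma> a \<union> orbit \<sigma> b) (cycles_on A \<sigma> - {orbit \<sigma> a, orbit \<sigma> b})"
    unfolding O eq by blast
  show "orbit \<sigma> a \<union> orbit \<sigma> b \<notin> cycles_on A \<sigma> - {orbit \<sigma> a, orbit \<sigma> b}"
    unfolding O eq by blast
qed

lemma card_cycles_on_cut:
  assumes perm: "\<sigma> permutes A" "finite A" and ab: "a \<in> A" "b \<in> orbit \<sigma> a" "b \<noteq> a"
  shows "card (cycles_on A (transpose a b \<circ> \<sigma>)) = Suc (card (cycles_on A \<sigma>))"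
proof -
  have perm': "permutation \<sigma>" using permutes_permutation[OF perm] .
  obtain d where d: "0 < d" "d < card (orbit \<sigma> a)" "b = (\<sigma> ^^ d) a"
    using orbit_other_point[OF perm' ab(2,3)] by blast
  note cut = cycles_on_cut[OF perm d(1,2) ab(1), folded d(3)]
  have ne: "orbit (transpose a b \<circ> \<sigma>) a \<noteq> orbit (transpose a b \<circ> \<sigma>) b"
    using cut(2) orbit_nonempty[of "transpose a b \<circ> \<sigma>" a] by auto
  have "orbit \<sigma> a \<in> cycles_on A \<sigma>" using ab by (simp add: cycles_on_def)
  then have "card (cycles_on A \<sigma>) = Suc (card (cycles_on A \<sigma> - {orbit \<sigma> a}))"
    by (rule card.remove[OF finite_cycles_on[OF perm(2)]])
  moreover have "cycles_on A (transpose a b \<circ> \<sigma>) = insert (orbit (transpose a b \<circ> \<sigma>) a)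
      (insert (orbit (transpose a b \<circ> \<sigma>) b) (cycles_on A \<sigma> - {orbit \<sigma> a}))"
    unfolding cut(1) by blast
  moreover have "card (insert (orbit (transpose a b \<circ> \<sigma>) a) (insert (orbit (transpose a b \<circ> \<sigma>) b)
      (cycles_on A \<sigma> - {orbit \<sigma> a}))) = Suc (Suc (card (cycles_on A \<sigma> - {orbit \<sigma> a})))"
    using cut(6,7) ne finite_cycles_on[OF perm(2), of \<sigma>] by simp
  ultimately show ?thesis by metis
qed

lemma card_cycles_on_join:
  assumes perm: "\<sigma> permutes A" "finite A" and ab: "a \<in> A" "b \<in> A" "b \<notin> orbit \<sigma> a"
  shows "card (cycles_on A \<sigma>) = Suc (card (cycles_on A (transpose a b \<circ> \<sigma>)))"
proof -
  have perm': "permutation \<sigma>" using permutes_permutation[OF perm] .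
  let ?\<tau> = "transpose a b \<circ> \<sigma>"
  have tr: "transpose a b permutes A" using ab by (intro permutes_swap_id)
  have \<tau>A: "?\<tau> permutes A" by (rule permutes_compose[OF perm(1) tr])
  have "b \<in> orbit ?\<tau> a" by (rule orbit_transpose_join[OF perm' ab(3)])
  moreover have "b \<noteq> a" using ab permutation_self_in_orbit[OF perm'] by auto
  ultimately have "card (cycles_on A (transpose a b \<circ> ?\<tau>)) = Suc (card (cycles_on A ?\<tau>))"
    by (intro card_cycles_on_cut[OF \<tau>A perm(2) ab(1)])
  then show ?thesis by (simp only: transpose_transpose_comp)
qed

section \<open>Factorization into transpositions\<close>

lemma orbit_id: "orbit id x = {x}"
  by (simp add: orbit_eq_singleton_iff)

lemma card_cycles_on_id: "card (cycles_on A id) = card A"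
proof -
  have "cycles_on A id = (\<lambda>x. {x}) ` A" by (simp add: cycles_on_def orbit_id)
  then show ?thesis by (simp add: card_image)
qed

lemma card_cycles_on_le: "finite A \<Longrightarrow> card (cycles_on A \<sigma>) \<le> card A"
  by (simp add: cycles_on_def card_image_le)

text \<open>The contribution of a branch point to the Riemann-Hurwitz formula. For finite
  \<open>A\<close> there are at most \<open>card A\<close> cycles, so the subtraction is
  exact.\<close>

definition perm_length :: "'b set \<Rightarrow> ('b \<Rightarrow> 'b) \<Rightarrow> nat" where
  "perm_length A \<sigma> = card A - card (cycles_on A \<sigma>)"

abbreviation transpositions_on :: "'b set \<Rightarrow> ('b \<times> 'b) list \<Rightarrow> bool" where
  "transpositions_on A ts \<equiv> \<forall>(a, b)\<in>set ts. a \<in> A \<and> b \<in> A \<and> a \<noteq> b"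

abbreviation transposition_product :: "('b \<times> 'b) list \<Rightarrow> 'b \<Rightarrow> 'b" where
  "transposition_product ts \<equiv> foldr (\<circ>) (map (\<lambda>(a, b). transpose a b) ts) id"

lemma permutes_transposition_product:
  "transpositions_on A ts \<Longrightarrow> transposition_product ts permutes A"
  by (induction ts) (auto simp: permutes_id intro!: permutes_compose permutes_swap_id)

text \<open>Multiplication by the transposition of a moved point \<open>a\<close> and
  \<open>\<sigma> a\<close> makes \<open>a\<close> a fixed point. This adds one cycle, so the length
  drops by one.\<close>

lemma exists_transpositions:
  assumes "\<sigma> permutes A" "finite A"
  shows "\<exists>ts. transpositions_on A ts \<and> length ts = perm_length A \<sigma> \<and> transposition_product ts = \<sigma>"
  using assms
proof (induction "perm_length A \<sigma>" arbitrary: \<sigma> rule: less_induct)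
  case less
  show ?case
  proof (cases "\<sigma> = id")
    case True
    then show ?thesis by (intro exI[of _ "[]"]) (simp add: perm_length_def card_cycles_on_id)
  next
    case False
    then obtain a where a: "\<sigma> a \<noteq> a" by (auto simp: fun_eq_iff)
    then have aA: "a \<in> A" using permutes_not_in[OF less.prems(1)] by blast
    then have bA: "\<sigma> a \<in> A" using permutes_in_image[OF less.prems(1)] by blast
    let ?\<tau> = "transpose a (\<sigma> a) \<circ> \<sigma>"
    have "card (cycles_on A ?\<tau>) = Suc (card (cycles_on A \<sigma>))"
      by (rule card_cycles_on_cut[OF less.prems aA orbit.base a])
    moreover have "card (cycles_on A ?\<tau>) \<le> card A" by (rule card_cycles_on_le[OF less.prems(2)])
    ultimately have len: "perm_length A \<sigma> = Suc (perm_length A ?\<tau>)" by (simp add: perm_length_def)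
    have "?\<tau> permutes A" using aA bA less.prems(1) by (intro permutes_compose permutes_swap_id)
    then obtain ts where ts: "transpositions_on A ts" "length ts = perm_length A ?\<tau>" "transposition_product ts = ?\<tau>"
      using less.hyps[of ?\<tau>] less.prems(2) len by auto
    have "transposition_product ((a, \<sigma> a) # ts) = \<sigma>"
      by (simp add: ts(3) transpose_transpose_comp)
    then show ?thesis using ts len aA bA a by (intro exI[of _ "(a, \<sigma> a) # ts"]) auto
  qed
qed

section \<open>The Riemann--Hurwitz inequality\<close>

lemma transpose_label: "c a = c b \<Longrightarrow> c (transpose a b y) = c y"
  by (cases "y = a"; cases "y = b") auto

lemma transposition_product_label:
  "\<forall>(a, b)\<in>set ts. c a = c b \<Longrightarrow> c (transposition_product ts x) = c x"
proof (induction ts)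
  case (Cons t ts)
  obtain a b where "t = (a, b)" by (cases t)
  with Cons show ?case by (simp add: transpose_label)
qed simp

text \<open>Every transposition that joins two connected components also joins two cycles. The labelling
  \<open>c\<close> of the points by components is constructed along the product.\<close>

lemma transposition_product_labelling:
  assumes "finite A" "transpositions_on A ts"
  shows "\<exists>c :: 'b \<Rightarrow> 'b. (\<forall>(a, b)\<in>set ts. c a = c b) \<and>
     int (length ts) \<ge> int (card A) - 2 * int (card (c ` A)) + int (card (cycles_on A (transposition_product ts))) \<and>
     even (length ts + card A + card (cycles_on A (transposition_product ts)))"
  using assms(2)
proof (induction ts)
  case Nil
  show ?case using card_cycles_on_id[of A] by (intro exI[of _ "\<lambda>x. x"]) (simp add: id_def)
next
  case (Cons t ts)
  obtain a b where t: "t = (a, b)" by (cases t)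
  have ab: "a \<in> A" "b \<in> A" "a \<noteq> b" and ts: "transpositions_on A ts" using Cons.prems t by auto
  let ?\<pi> = "transposition_product ts"
  obtain c :: "'b \<Rightarrow> 'b" where c: "\<forall>(a, b)\<in>set ts. c a = c b"
    "int (length ts) \<ge> int (card A) - 2 * int (card (c ` A)) + int (card (cycles_on A ?\<pi>))"
    "even (length ts + card A + card (cycles_on A ?\<pi>))"
    using Cons.IH[OF ts] by blast
  have perm: "?\<pi> permutes A" by (rule permutes_transposition_product[OF ts])
  have c\<pi>: "c (?\<pi> x) = c x" for x
    by (rule transposition_product_label[OF c(1)])
  have orb: "c y = c x" if "y \<in> orbit ?\<pi> x" for x y
    using that by induction (simp_all add: c\<pi>)
  define k where "k = card (cycles_on A ?\<pi>)"
  define l where "l = card (cycles_on A (transposition_product (t # ts)))"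
  have l: "l = card (cycles_on A (transpose a b \<circ> ?\<pi>))" by (simp add: t l_def)
  show ?case unfolding l_def[symmetric]
  proof (cases "c a = c b")
    case True
    have "l = Suc k \<or> k = Suc l"
    proof (cases "b \<in> orbit ?\<pi> a")
      case True
      then show ?thesis unfolding l k_def using card_cycles_on_cut[OF perm assms(1) ab(1) True] ab(3) by simp
    next
      case False
      then show ?thesis unfolding l k_def using card_cycles_on_join[OF perm assms(1) ab(1,2) False] by simp
    qed
    then show "\<exists>c :: 'b \<Rightarrow> 'b. (\<forall>(a, b)\<in>set (t # ts). c a = c b) \<and>
        int (length (t # ts)) \<ge> int (card A) - 2 * int (card (c ` A)) + int l \<and> even (length (t # ts) + card A + l)"
      using c[folded k_def] True t by (intro exI[of _ c]) auto
  next
    case False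
    \<comment> \<open>Labels are constant on the cycles of the product, so different labels put
      \<open>a\<close> and \<open>b\<close> into different cycles, and the transposition joins
      these.\<close>
    then have "b \<notin> orbit ?\<pi> a" using orb[of b a] by auto
    then have j: "k = Suc l" unfolding l k_def by (rule card_cycles_on_join[OF perm assms(1) ab(1,2)])
    \<comment> \<open>The class of \<open>b\<close> is merged into that of \<open>a\<close>. Losing
      a label raises the right-hand side by 2, losing a cycle lowers it by 1, and the length grows
      by 1.\<close>
    define c' where "c' x = (if c x = c b then c a else c x)" for x
    have "c' ` A = c ` A - {c b}" using ab False by (auto simp: c'_def image_iff)
    then have "card (c ` A) = Suc (card (c' ` A))"
      using assms(1) ab card.remove[of "c ` A" "c b"] by simp
    moreover have "\<forall>(a, b)\<in>set (t # ts). c' a = c' b" using c(1) t by (auto simp: c'_def)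
    ultimately show "\<exists>c :: 'b \<Rightarrow> 'b. (\<forall>(a, b)\<in>set (t # ts). c a = c b) \<and>
        int (length (t # ts)) \<ge> int (card A) - 2 * int (card (c ` A)) + int l \<and> even (length (t # ts) + card A + l)"
      using c(2,3)[folded k_def] j by (intro exI[of _ c']) auto
  qed
qed

lemma foldr_comp_append:
  "foldr (\<circ>) (fs @ gs) id = foldr (\<circ>) fs id \<circ> foldr (\<circ>) gs id"
  by (induction fs) (simp_all add: o_assoc)

text \<open>Factorizations of the single permutations are concatenated. The last clause carries a
  labelling from the transpositions back to the given permutations, because it is for these that
  connectedness is known.\<close>

lemma exists_transpositions_list:
  assumes "finite A" "\<forall>\<sigma>\<in>set \<sigma>s. \<sigma> permutes A"
  shows "\<exists>ts. transpositions_on A ts \<and> length ts = (\<Sum>\<sigma>\<leftarrow>\<sigma>s. perm_length A \<sigma>)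
    \<and> transposition_product ts = foldr (\<circ>) \<sigma>s id
    \<and> (\<forall>c :: 'b \<Rightarrow> 'b. (\<forall>(a, b)\<in>set ts. c a = c b) \<longrightarrow> (\<forall>\<sigma>\<in>set \<sigma>s. \<forall>x. c (\<sigma> x) = c x))"
  using assms(2)
proof (induction \<sigma>s)
  case Nil
  show ?case by (intro exI[of _ "[]"]) simp
next
  case (Cons \<sigma> \<sigma>s)
  have perms: "\<forall>\<sigma>\<in>set \<sigma>s. \<sigma> permutes A" using Cons.prems by simp
  obtain ts where ts: "transpositions_on A ts" "length ts = (\<Sum>\<sigma>\<leftarrow>\<sigma>s. perm_length A \<sigma>)"
    "transposition_product ts = foldr (\<circ>) \<sigma>s id"
    "\<forall>c :: 'b \<Rightarrow> 'b. (\<forall>(a, b)\<in>set ts. c a = c b) \<longrightarrow> (\<forall>\<sigma>\<in>set \<sigma>s. \<forall>x. c (\<sigma> x) = c x)"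
    using Cons.IH[OF perms] by blast
  obtain us where us: "transpositions_on A us" "length us = perm_length A \<sigma>" "transposition_product us = \<sigma>"
    using exists_transpositions[of \<sigma> A] Cons.prems assms(1) by auto
  have c: "c (\<sigma> x) = c x" if "\<forall>(a, b)\<in>set us. c a = c b" for c :: "'b \<Rightarrow> 'b" and x
    unfolding us(3)[symmetric] by (rule transposition_product_label[OF that])
  have "transposition_product (us @ ts) = foldr (\<circ>) (\<sigma> # \<sigma>s) id"
    by (simp only: map_append foldr_comp_append us(3) ts(3) foldr.simps o_apply)
  moreover have "transpositions_on A (us @ ts)" using ts(1) us(1) by auto
  moreover have "length (us @ ts) = (\<Sum>\<sigma>\<leftarrow>\<sigma> # \<sigma>s. perm_length A \<sigma>)" using ts(2) us(2) by simp
  moreover have "(\<forall>(a, b)\<in>set (us @ ts). c a = c b) \<longrightarrow> (\<forall>\<sigma>\<in>set (\<sigma> # \<sigma>s). \<forall>x. c (\<sigma> x) = c x)"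
    for c :: "'b \<Rightarrow> 'b"
  proof
    assume *: "\<forall>(a, b)\<in>set (us @ ts). c a = c b"
    then have "\<forall>(a, b)\<in>set us. c a = c b" "\<forall>(a, b)\<in>set ts. c a = c b" by auto
    then show "\<forall>\<sigma>\<in>set (\<sigma> # \<sigma>s). \<forall>x. c (\<sigma> x) = c x" using ts(4) c by simp
  qed
  ultimately show ?case by blast
qed

text \<open>Connectedness enters as the statement that a labelling invariant under all permutations
  takes at most one value on \<open>A\<close>. As the product is the identity, which has
  \<open>card A\<close> cycles, the bound of \<open>transposition_product_labelling\<close> for at
  most one label is the inequality, and the parity of the length comes from the same place.\<close>

theorem Riemann_Hurwitz_inequality:
  assumes "finite A" "\<forall>\<sigma>\<in>set \<sigma>s. \<sigma> permutes A" "foldr (\<circ>) \<sigma>s id = id"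
  shows "even (\<Sum>\<sigma>\<leftarrow>\<sigma>s. perm_length A \<sigma>)"
    and "(\<And>c :: 'b \<Rightarrow> 'b. (\<And>\<sigma> x. \<sigma> \<in> set \<sigma>s \<Longrightarrow> c (\<sigma> x) = c x) \<Longrightarrow> card (c ` A) \<le> 1) \<Longrightarrow>
      (\<Sum>\<sigma>\<leftarrow>\<sigma>s. perm_length A \<sigma>) + 2 \<ge> 2 * card A"
proof -
  obtain ts where ts: "transpositions_on A ts" "length ts = (\<Sum>\<sigma>\<leftarrow>\<sigma>s. perm_length A \<sigma>)"
    "transposition_product ts = foldr (\<circ>) \<sigma>s id"
    "\<forall>c :: 'b \<Rightarrow> 'b. (\<forall>(a, b)\<in>set ts. c a = c b) \<longrightarrow> (\<forall>\<sigma>\<in>set \<sigma>s. \<forall>x. c (\<sigma> x) = c x)"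
    using exists_transpositions_list[OF assms(1,2)] by blast
  obtain c :: "'b \<Rightarrow> 'b" where c: "\<forall>(a, b)\<in>set ts. c a = c b"
    "int (length ts) \<ge> int (card A) - 2 * int (card (c ` A)) + int (card A)"
    "even (length ts + card A + card A)"
    using transposition_product_labelling[OF assms(1) ts(1)] unfolding ts(3) assms(3) card_cycles_on_id by blast
  show "even (\<Sum>\<sigma>\<leftarrow>\<sigma>s. perm_length A \<sigma>)" using c(3) unfolding ts(2) by presburger
  assume "\<And>c :: 'b \<Rightarrow> 'b. (\<And>\<sigma> x. \<sigma> \<in> set \<sigma>s \<Longrightarrow> c (\<sigma> x) = c x) \<Longrightarrow> card (c ` A) \<le> 1"
  then have "card (c ` A) \<le> 1" using ts(4) c(1) by blast
  then show "(\<Sum>\<sigma>\<leftarrow>\<sigma>s. perm_length A \<sigma>) + 2 \<ge> 2 * card A" using c(2) ts(2) by linarith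
qed

section \<open>Multiplication by transpositions is the cut-and-join operator\<close>

lemma sum_pairs_with_sum:
  fixes g :: "nat \<Rightarrow> nat \<Rightarrow> 'c :: comm_monoid_add"
  assumes "L \<le> B"
  shows "(\<Sum>i=1..B. \<Sum>j=1..B. if i + j = L then g i j else 0) = (\<Sum>i=1..<L. g i (L - i))"
proof -
  have "(\<Sum>i=1..B. \<Sum>j=1..B. if i + j = L then g i j else 0) = (\<Sum>i=1..B. if i < L then g i (L - i) else 0)"
  proof (rule sum.cong[OF refl])
    fix i assume i: "i \<in> {1..B}"
    show "(\<Sum>j=1..B. if i + j = L then g i j else 0) = (if i < L then g i (L - i) else 0)"
    proof (cases "i < L")
      case True
      have "(\<Sum>j=1..B. if i + j = L then g i j else 0) = (\<Sum>j=1..B. if j = L - i then g i j else 0)"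
        using True by (intro sum.cong refl) auto
      also have "\<dots> = g i (L - i)" using True assms i by (subst sum.delta) auto
      finally show ?thesis using True by simp
    next
      case False
      then show ?thesis using i by (auto intro!: sum.neutral)
    qed
  qed
  also have "\<dots> = (\<Sum>i=1..<L. g i (L - i))"
    using assms by (intro sum.mono_neutral_cong_right) auto
  finally show ?thesis .
qed

lemma mps_E_monomial:
  assumes "finite S"
  shows "mps_E k (\<Prod>C\<in>S. mps_var (f C)) = (\<Sum>C\<in>S. if f C = k then of_nat k * (\<Prod>D\<in>S-{C}. mps_var (f D)) else 0)"
  unfolding derivation_prod[OF derivation_E assms] by (intro sum.cong) (auto simp: mps_E_var)

text \<open>Differentiation singles out one factor, or an ordered pair of factors, and brings down
  their weights. The factors are indexed by a set \<open>S\<close> so that equal variables, that is,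
  cycles of the same length, are kept apart.\<close>

lemma cut_join_monomial:
  fixes f :: "'i \<Rightarrow> nat"
  assumes S: "finite S" and f: "\<And>C. C \<in> S \<Longrightarrow> 1 \<le> f C \<and> f C \<le> B"
  shows "(cut_join B (\<Prod>C\<in>S. mps_var (f C)) :: (nat, 'a :: field_char_0) mps) =
    (\<Sum>C\<in>S. of_nat (f C) * (\<Sum>d=1..<f C. mps_var d * mps_var (f C - d)) * (\<Prod>D\<in>S-{C}. mps_var (f D)))
    + (\<Sum>C\<in>S. \<Sum>D\<in>S-{C}. of_nat (f C) * (of_nat (f D) * (mps_var (f C + f D) *
        (\<Prod>E\<in>S-{C,D}. mps_var (f E)))))"
    (is "_ = ?cut + ?join")
proof -
  let ?P = "\<lambda>S. \<Prod>C\<in>S. mps_var (f C) :: (nat, 'a) mps"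
  let ?p = "mps_var :: nat \<Rightarrow> (nat, 'a) mps"
  have "(\<Sum>i=1..B. \<Sum>j=1..B. ?p i * ?p j * mps_E (i + j) (?P S))
      = (\<Sum>i=1..B. \<Sum>j=1..B. \<Sum>C\<in>S. if i + j = f C then of_nat (f C) * (?p i * ?p j) * ?P (S - {C}) else 0)"
    unfolding mps_E_monomial[OF S] sum_distrib_left by (intro sum.cong refl) (simp add: ac_simps)
  also have "\<dots> = (\<Sum>C\<in>S. \<Sum>i=1..B. \<Sum>j=1..B. if i + j = f C then of_nat (f C) * (?p i * ?p j) * ?P (S - {C}) else 0)"
    by (subst (2) sum.swap, subst sum.swap) rule
  also have "\<dots> = (\<Sum>C\<in>S. \<Sum>d=1..<f C. of_nat (f C) * (?p d * ?p (f C - d)) * ?P (S - {C}))"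
    using f by (intro sum.cong refl sum_pairs_with_sum) auto
  also have "\<dots> = ?cut" by (simp add: sum_distrib_left sum_distrib_right)
  finally have cut: "(\<Sum>i=1..B. \<Sum>j=1..B. ?p i * ?p j * mps_E (i + j) (?P S)) = ?cut" .
  have EE: "mps_E i (mps_E j (?P S)) = (\<Sum>C\<in>S. \<Sum>D\<in>S-{C}. if f C = j then if f D = i then of_nat i * (of_nat j * ?P (S - {C,D})) else 0 else 0)" for i j
  proof -
    have "mps_E i (mps_E j (?P S)) = (\<Sum>C\<in>S. mps_E i (if f C = j then of_nat j * ?P (S - {C}) else 0))"
      unfolding mps_E_monomial[OF S] derivation_sum[OF derivation_E] ..
    also have "\<dots> = (\<Sum>C\<in>S. \<Sum>D\<in>S-{C}. if f C = j then if f D = i then of_nat i * (of_nat j * ?P (S - {C,D})) else 0 else 0)"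
    proof (rule sum.cong[OF refl])
      fix C assume "C \<in> S"
      have "mps_E i (of_nat j * ?P (S - {C})) = (\<Sum>D\<in>S-{C}. of_nat j * (if f D = i then of_nat i * ?P (S - {C} - {D}) else 0))"
        unfolding derivation_of_nat_mult[OF derivation_E] mps_E_monomial[OF finite_Diff[OF S]] sum_distrib_left ..
      also have "\<dots> = (\<Sum>D\<in>S-{C}. if f D = i then of_nat i * (of_nat j * ?P (S - {C,D})) else 0)"
        by (intro sum.cong refl) (simp add: Diff_insert2[symmetric] mult.left_commute)
      finally show "mps_E i (if f C = j then of_nat j * ?P (S - {C}) else 0)
        = (\<Sum>D\<in>S-{C}. if f C = j then if f D = i then of_nat i * (of_nat j * ?P (S - {C,D})) else 0 else 0)"
        by (simp add: derivation_0[OF derivation_E])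
    qed
    finally show ?thesis .
  qed
  have "(\<Sum>i=1..B. \<Sum>j=1..B. ?p (i + j) * mps_E i (mps_E j (?P S)))
      = (\<Sum>i=1..B. \<Sum>j=1..B. \<Sum>C\<in>S. \<Sum>D\<in>S-{C}. if f C = j then if f D = i then
          ?p (i + j) * (of_nat i * (of_nat j * ?P (S - {C,D}))) else 0 else 0)"
    unfolding EE sum_distrib_left by (intro sum.cong refl) auto
  also have "\<dots> = (\<Sum>C\<in>S. \<Sum>D\<in>S-{C}. \<Sum>i=1..B. \<Sum>j=1..B. if f C = j then if f D = i then
          ?p (i + j) * (of_nat i * (of_nat j * ?P (S - {C,D}))) else 0 else 0)"
    by (subst (2) sum.swap, subst sum.swap, subst (3) sum.swap, subst (2) sum.swap) rule
  also have "\<dots> = (\<Sum>C\<in>S. \<Sum>D\<in>S-{C}. ?p (f D + f C) * (of_nat (f D) * (of_nat (f C) * ?P (S - {C,D}))))"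
  proof (intro sum.cong refl)
    fix C D assume CD: "C \<in> S" "D \<in> S - {C}"
    have "(\<Sum>i=1..B. \<Sum>j=1..B. if f C = j then if f D = i then ?p (i + j) * (of_nat i * (of_nat j * ?P (S - {C,D}))) else 0 else 0)
       = (\<Sum>i=1..B. if f D = i then ?p (i + f C) * (of_nat i * (of_nat (f C) * ?P (S - {C,D}))) else 0)"
      using f[of C] CD by (intro sum.cong refl) (simp add: sum.delta')
    also have "\<dots> = ?p (f D + f C) * (of_nat (f D) * (of_nat (f C) * ?P (S - {C,D})))"
      using f[of D] CD by (subst sum.delta') auto
    finally show "(\<Sum>i=1..B. \<Sum>j=1..B. if f C = j then if f D = i then
          ?p (i + j) * (of_nat i * (of_nat j * ?P (S - {C,D}))) else 0 else 0)
        = ?p (f D + f C) * (of_nat (f D) * (of_nat (f C) * ?P (S - {C,D})))" .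
  qed
  also have "\<dots> = ?join" by (intro sum.cong refl) (simp add: ac_simps)
  finally have join: "(\<Sum>i=1..B. \<Sum>j=1..B. ?p (i + j) * mps_E i (mps_E j (?P S))) = ?join" .
  show ?thesis unfolding cut_join_def sum.distrib cut join ..
qed

definition cyc_monom :: "'b set \<Rightarrow> ('b \<Rightarrow> 'b) \<Rightarrow> (nat, 'a :: field_char_0) mps" where
  "cyc_monom A \<sigma> = (\<Prod>C\<in>cycles_on A \<sigma>. mps_var (card C))"

lemma cyc_monom_cut:
  assumes perm: "\<sigma> permutes A" "finite A" and d: "0 < d" "d < card (orbit \<sigma> a)" and a: "a \<in> A"
  shows "cyc_monom A (transpose a ((\<sigma> ^^ d) a) \<circ> \<sigma>) =
    mps_var d * mps_var (card (orbit \<sigma> a) - d) * (\<Prod>C\<in>cycles_on A \<sigma> - {orbit \<sigma> a}. mps_var (card C))"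
proof -
  let ?\<tau> = "transpose a ((\<sigma> ^^ d) a) \<circ> \<sigma>" and ?b = "(\<sigma> ^^ d) a"
  note cut = cycles_on_cut[OF perm d a]
  have ne: "orbit ?\<tau> a \<noteq> orbit ?\<tau> ?b" using cut(2) orbit_nonempty[of ?\<tau> a] by auto
  have "cycles_on A ?\<tau> = insert (orbit ?\<tau> a) (insert (orbit ?\<tau> ?b) (cycles_on A \<sigma> - {orbit \<sigma> a}))"
    unfolding cut(1) by blast
  then show ?thesis unfolding cyc_monom_def
    using ne cut(4-7) finite_cycles_on[OF perm(2), of \<sigma>] by (simp add: mult.assoc)
qed

lemma cyc_monom_join:
  assumes perm: "\<sigma> permutes A" "finite A" and ab: "a \<in> A" "b \<in> A" "b \<notin> orbit \<sigma> a"
  shows "cyc_monom A (transpose a b \<circ> \<sigma>) = mps_var (card (orbit \<sigma> a) + card (orbit \<sigma> b))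
    * (\<Prod>C\<in>cycles_on A \<sigma> - {orbit \<sigma> a, orbit \<sigma> b}. mps_var (card C))"
proof -
  note j = cycles_on_join[OF perm ab]
  have "finite (orbit \<sigma> a)" "finite (orbit \<sigma> b)"
    using permutes_orbit_subset[OF perm(1)] ab perm(2) finite_subset by metis+
  then have "card (orbit \<sigma> a \<union> orbit \<sigma> b) = card (orbit \<sigma> a) + card (orbit \<sigma> b)"
    using j(3) by (simp add: card_Un_disjoint)
  then show ?thesis unfolding cyc_monom_def j(1)
    using j(2) finite_cycles_on[OF perm(2), of \<sigma>] by simp
qed

lemma sum_over_cycles:
  fixes F :: "'b set \<Rightarrow> 'c :: comm_ring_1"
  assumes perm: "\<sigma> permutes A" "finite A"
  shows "(\<Sum>a\<in>A. F (orbit \<sigma> a)) = (\<Sum>C\<in>cycles_on A \<sigma>. of_nat (card C) * F C)"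
proof -
  have perm': "permutation \<sigma>" using permutes_permutation[OF perm] .
  have "(\<Sum>a\<in>A. F (orbit \<sigma> a)) = (\<Sum>C\<in>orbit \<sigma> ` A. \<Sum>a\<in>{a\<in>A. orbit \<sigma> a = C}. F (orbit \<sigma> a))"
    by (rule sum.image_gen[OF perm(2)])
  also have "\<dots> = (\<Sum>C\<in>orbit \<sigma> ` A. of_nat (card C) * F C)"
  proof (rule sum.cong[OF refl])
    fix C assume "C \<in> orbit \<sigma> ` A"
    then obtain x where x: "x \<in> A" "C = orbit \<sigma> x" by blast
    have "{a\<in>A. orbit \<sigma> a = C} = C"
      using permutes_orbit_subset[OF perm(1) x(1)] mem_orbit_iff_eq[OF perm'] unfolding x(2) by blast
    then show "(\<Sum>a\<in>{a\<in>A. orbit \<sigma> a = C}. F (orbit \<sigma> a)) = of_nat (card C) * F C"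
      by (metis (mono_tags, lifting) mem_Collect_eq sum.cong sum_constant)
  qed
  finally show ?thesis by (simp add: cycles_on_def)
qed

text \<open>For fixed \<open>a\<close>, a point \<open>(\<sigma> ^^ d) a\<close> of its cycle cuts
  the cycle into parts of sizes \<open>d\<close> and the rest; any point outside joins two cycles.
  Counting the points of each cycle gives the factors \<open>card C\<close> that differentiation
  produces in \<open>cut_join_monomial\<close>. Ordered pairs meet every transposition twice, which
  matches the doubled operator.\<close>

theorem sum_transpositions_cyc_monom:
  assumes perm: "\<sigma> permutes A" "finite A" and B: "card A \<le> B"
  shows "(\<Sum>a\<in>A. \<Sum>b\<in>A-{a}. cyc_monom A (transpose a b \<circ> \<sigma>))
    = cut_join B (cyc_monom A \<sigma> :: (nat, 'a :: field_char_0) mps)"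
proof -
  have perm': "permutation \<sigma>" using permutes_permutation[OF perm] .
  let ?cyc = "cycles_on A \<sigma>" and ?m = "\<lambda>\<tau>. cyc_monom A \<tau> :: (nat, 'a) mps"
  let ?P = "\<lambda>S. \<Prod>C\<in>S. mps_var (card C) :: (nat, 'a) mps"
  define F1 where "F1 C = (\<Sum>d=1..<card C. mps_var d * mps_var (card C - d)) * ?P (?cyc - {C})" for C
  \<comment> \<open>The value 0 on the diagonal allows the sum over the points outside the cycle of
    \<open>a\<close> to be extended to all of \<open>A\<close>.\<close>
  define F2 where "F2 C D = (if D = C then 0 else mps_var (card C + card D) * ?P (?cyc - {C, D}))" for C D
  have inner: "(\<Sum>b\<in>A-{a}. ?m (transpose a b \<circ> \<sigma>))
      = F1 (orbit \<sigma> a) + (\<Sum>D\<in>?cyc. of_nat (card D) * F2 (orbit \<sigma> a) D)" if a: "a \<in> A" for a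
  proof -
    let ?O = "orbit \<sigma> a"
    note e = orbit_enumeration[OF perm', of a]
    have OA: "?O \<subseteq> A" using permutes_orbit_subset[OF perm(1) a] .
    have aO: "a \<in> ?O" using permutation_self_in_orbit[OF perm'] .
    have "A - {a} = (?O - {a}) \<union> (A - ?O)" using OA aO by blast
    then have "(\<Sum>b\<in>A-{a}. ?m (transpose a b \<circ> \<sigma>)) = (\<Sum>b\<in>?O-{a}. ?m (transpose a b \<circ> \<sigma>))
        + (\<Sum>b\<in>A-?O. ?m (transpose a b \<circ> \<sigma>))"
      using perm(2) finite_subset[OF OA] by (simp only:) (rule sum.union_disjoint; auto)
    also have "(\<Sum>b\<in>?O-{a}. ?m (transpose a b \<circ> \<sigma>)) = (\<Sum>d\<in>{1..<card ?O}. ?m (transpose a ((\<sigma> ^^ d) a) \<circ> \<sigma>))"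
    proof (rule sum.reindex_bij_betw[symmetric])
      have "inj_on (\<lambda>d. (\<sigma> ^^ d) a) {1..<card ?O}" by (rule inj_on_subset[OF e(3)]) auto
      moreover have "(\<lambda>d. (\<sigma> ^^ d) a) ` {1..<card ?O} = ?O - {a}"
      proof
        show "(\<lambda>d. (\<sigma> ^^ d) a) ` {1..<card ?O} \<subseteq> ?O - {a}"
        proof clarify
          fix d assume d: "d \<in> {1..<card ?O}"
          have "(\<sigma> ^^ d) a \<in> (\<lambda>i. (\<sigma> ^^ i) a) ` {..<card ?O}" using d by auto
          then have "(\<sigma> ^^ d) a \<in> ?O" by (rule e(4)[THEN equalityD2, THEN subsetD])
          moreover have "(\<sigma> ^^ d) a \<noteq> (\<sigma> ^^ 0) a" using inj_onD[OF e(3), of d 0] d by auto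
          ultimately show "(\<sigma> ^^ d) a \<in> ?O - {a}" by simp
        qed
        show "?O - {a} \<subseteq> (\<lambda>d. (\<sigma> ^^ d) a) ` {1..<card ?O}"
        proof
          fix b assume "b \<in> ?O - {a}"
          then obtain d where "0 < d" "d < card ?O" "b = (\<sigma> ^^ d) a" using orbit_other_point[OF perm', of b a] by blast
          then show "b \<in> (\<lambda>d. (\<sigma> ^^ d) a) ` {1..<card ?O}" by auto
        qed
      qed
      ultimately show "bij_betw (\<lambda>d. (\<sigma> ^^ d) a) {1..<card ?O} (?O - {a})" by (rule bij_betw_imageI)
    qed
    also have "\<dots> = F1 ?O"
      unfolding F1_def sum_distrib_right by (rule sum.cong[OF refl], rule cyc_monom_cut[OF perm _ _ a]) auto
    also have "(\<Sum>b\<in>A-?O. ?m (transpose a b \<circ> \<sigma>)) = (\<Sum>b\<in>A. F2 ?O (orbit \<sigma> b))"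
    proof (rule sum.mono_neutral_cong_left)
      show "\<forall>b\<in>A - (A - ?O). F2 ?O (orbit \<sigma> b) = 0"
        using mem_orbit_iff_eq[OF perm'] by (auto simp: F2_def)
      fix b assume b: "b \<in> A - ?O"
      then have "orbit \<sigma> b \<noteq> ?O" using mem_orbit_iff_eq[OF perm'] by blast
      then show "?m (transpose a b \<circ> \<sigma>) = F2 ?O (orbit \<sigma> b)"
        using b a cyc_monom_join[OF perm, of a b] by (simp add: F2_def)
    qed (use perm in auto)
    also have "\<dots> = (\<Sum>D\<in>?cyc. of_nat (card D) * F2 ?O D)" by (rule sum_over_cycles[OF perm])
    finally show ?thesis .
  qed
  have "(\<Sum>a\<in>A. \<Sum>b\<in>A-{a}. ?m (transpose a b \<circ> \<sigma>))
      = (\<Sum>a\<in>A. F1 (orbit \<sigma> a) + (\<Sum>D\<in>?cyc. of_nat (card D) * F2 (orbit \<sigma> a) D))"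
    using inner by (rule sum.cong[OF refl])
  also have "\<dots> = (\<Sum>C\<in>?cyc. of_nat (card C) * (F1 C + (\<Sum>D\<in>?cyc. of_nat (card D) * F2 C D)))"
    by (rule sum_over_cycles[OF perm])
  also have "\<dots> = (\<Sum>C\<in>?cyc. of_nat (card C) * (\<Sum>d=1..<card C. mps_var d * mps_var (card C - d)) * ?P (?cyc - {C}))
     + (\<Sum>C\<in>?cyc. \<Sum>D\<in>?cyc. of_nat (card C) * (of_nat (card D) * F2 C D))"
    unfolding distrib_left sum.distrib
    by (rule arg_cong2[where f = "(+)"]) (simp add: F1_def mult.assoc, simp add: sum_distrib_left)
  also have "(\<Sum>C\<in>?cyc. \<Sum>D\<in>?cyc. of_nat (card C) * (of_nat (card D) * F2 C D))
      = (\<Sum>C\<in>?cyc. \<Sum>D\<in>?cyc-{C}. of_nat (card C) * (of_nat (card D) * (mps_var (card C + card D) * ?P (?cyc - {C, D}))))"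
  proof (rule sum.cong[OF refl])
    fix C assume "C \<in> ?cyc"
    show "(\<Sum>D\<in>?cyc. of_nat (card C) * (of_nat (card D) * F2 C D))
      = (\<Sum>D\<in>?cyc-{C}. of_nat (card C) * (of_nat (card D) * (mps_var (card C + card D) * ?P (?cyc - {C, D}))))"
      using finite_cycles_on[OF perm(2), of \<sigma>] by (intro sum.mono_neutral_cong_right) (auto simp: F2_def)
  qed
  also have "(\<Sum>C\<in>?cyc. of_nat (card C) * (\<Sum>d=1..<card C. mps_var d * mps_var (card C - d)) * ?P (?cyc - {C})) + \<dots>
      = cut_join B (?P ?cyc)"
  proof (rule cut_join_monomial[symmetric])
    show "finite ?cyc" using finite_cycles_on[OF perm(2)] .
    fix C assume "C \<in> ?cyc"
    then obtain x where x: "x \<in> A" "C = orbit \<sigma> x" by (auto simp: cycles_on_def)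
    have "C \<subseteq> A" unfolding x(2) by (rule permutes_orbit_subset[OF perm(1) x(1)])
    then have "card C \<le> card A" by (rule card_mono[OF perm(2)])
    moreover have "card C > 0" unfolding x(2) by (rule orbit_enumeration(1)[OF perm'])
    ultimately show "1 \<le> card C \<and> card C \<le> B" using B by simp
  qed
  finally show ?thesis unfolding cyc_monom_def .
qed

section \<open>Jucys--Murphy elements\<close>

text \<open>Elements of the group algebra of the symmetric group act on functions on permutations by
  left translation. Up to a factor of two, \<open>transp_sum n\<close> is the sum of all transpositions in
  \<open>S\<^sub>n\<close>, and \<open>jucys_murphy n\<close> is the Jucys--Murphy element of \<open>S\<^bsub>n+1\<^esub>\<close>.\<close>

definition transp_sum :: "nat \<Rightarrow> ((nat \<Rightarrow> nat) \<Rightarrow> 'c :: comm_ring_1) \<Rightarrow> (nat \<Rightarrow> nat) \<Rightarrow> 'c" where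
  "transp_sum n \<phi> \<tau> = (\<Sum>a\<in>{1..n}. \<Sum>b\<in>{1..n}-{a}. \<phi> (transpose a b \<circ> \<tau>))"

definition jucys_murphy :: "nat \<Rightarrow> ((nat \<Rightarrow> nat) \<Rightarrow> 'c :: comm_ring_1) \<Rightarrow> (nat \<Rightarrow> nat) \<Rightarrow> 'c" where
  "jucys_murphy n \<phi> \<tau> = (\<Sum>k\<in>{1..n}. \<phi> (transpose k (Suc n) \<circ> \<tau>))"

text \<open>The new transpositions are those that move \<open>Suc n\<close>, and each of them occurs
  as two ordered pairs.\<close>

lemma transp_sum_Suc:
  "transp_sum (Suc n) \<phi> \<tau> = transp_sum n \<phi> \<tau> + 2 * jucys_murphy n \<phi> \<tau>"
proof -
  let ?g = "\<lambda>a b. \<phi> (transpose a b \<circ> \<tau>)"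
  have S: "{1..Suc n} = insert (Suc n) {1..n}" by auto
  have "(\<Sum>b\<in>{1..Suc n}-{a}. ?g a b) = ?g a (Suc n) + (\<Sum>b\<in>{1..n}-{a}. ?g a b)" if "a \<in> {1..n}" for a
  proof -
    have "{1..Suc n} - {a} = insert (Suc n) ({1..n} - {a})" using that by auto
    then show ?thesis by simp
  qed
  moreover have "(\<Sum>b\<in>{1..Suc n}-{Suc n}. ?g (Suc n) b) = (\<Sum>b\<in>{1..n}. ?g b (Suc n))"
    by (rule sum.cong) (auto simp: transpose_commute)
  ultimately have "transp_sum (Suc n) \<phi> \<tau> = (\<Sum>b\<in>{1..n}. ?g b (Suc n))
      + (\<Sum>a\<in>{1..n}. ?g a (Suc n) + (\<Sum>b\<in>{1..n}-{a}. ?g a b))"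
    unfolding transp_sum_def by (subst S) (simp add: sum.insert)
  then show ?thesis by (simp add: transp_sum_def jucys_murphy_def sum.distrib)
qed

lemma permutes_comp_transpose:
  assumes "\<pi> permutes A" shows "\<pi> \<circ> transpose a b = transpose (\<pi> a) (\<pi> b) \<circ> \<pi>"
proof
  fix x
  show "(\<pi> \<circ> transpose a b) x = (transpose (\<pi> a) (\<pi> b) \<circ> \<pi>) x"
    by (simp add: transpose_def inj_eq[OF permutes_inj[OF assms]])
qed

text \<open>The transpositions form a conjugacy class, so their sum is central in the group
  algebra.\<close>

lemma transp_sum_translate:
  assumes "\<pi> permutes {1..n}"
  shows "transp_sum n (\<lambda>\<tau>. \<phi> (\<pi> \<circ> \<tau>)) \<tau> = transp_sum n \<phi> (\<pi> \<circ> \<tau>)"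
proof -
  let ?G = "\<lambda>a b. \<phi> (transpose a b \<circ> (\<pi> \<circ> \<tau>))"
  have "transp_sum n (\<lambda>\<tau>. \<phi> (\<pi> \<circ> \<tau>)) \<tau> = (\<Sum>a\<in>{1..n}. \<Sum>b\<in>{1..n}-{a}. ?G (\<pi> a) (\<pi> b))"
    unfolding transp_sum_def by (simp add: o_assoc permutes_comp_transpose[OF assms])
  also have "\<dots> = (\<Sum>a\<in>{1..n}. \<Sum>b\<in>{1..n}-{\<pi> a}. ?G (\<pi> a) b)"
  proof (rule sum.cong[OF refl])
    fix a assume "a \<in> {1..n}"
    have "bij_betw \<pi> ({1..n} - {a}) ({1..n} - {\<pi> a})"
      by (rule bij_betw_imageI)
         (simp_all add: permutes_inj_on[OF assms] image_set_diff[OF permutes_inj[OF assms]] permutes_image[OF assms] del: One_nat_def)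
    then show "(\<Sum>b\<in>{1..n}-{a}. ?G (\<pi> a) (\<pi> b)) = (\<Sum>b\<in>{1..n}-{\<pi> a}. ?G (\<pi> a) b)"
      by (rule sum.reindex_bij_betw)
  qed
  also have "\<dots> = (\<Sum>a\<in>{1..n}. \<Sum>b\<in>{1..n}-{a}. ?G a b)"
    by (rule sum.reindex_bij_betw[OF permutes_imp_bij[OF assms], of "\<lambda>a. \<Sum>b\<in>{1..n}-{a}. ?G a b"])
  finally show ?thesis by (simp add: transp_sum_def)
qed

text \<open>Conjugation by a permutation of \<open>{1..n}\<close> fixes \<open>Suc n\<close> and
  hence permutes the transpositions that make up the Jucys-Murphy element, which therefore commutes
  with \<open>S_n\<close>.\<close>

lemma jucys_murphy_translate:
  assumes "\<pi> permutes {1..n}"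
  shows "jucys_murphy n (\<lambda>\<tau>. \<phi> (\<pi> \<circ> \<tau>)) \<tau> = jucys_murphy n \<phi> (\<pi> \<circ> \<tau>)"
proof -
  have "\<pi> (Suc n) = Suc n" using permutes_not_in[OF assms] by simp
  then have "jucys_murphy n (\<lambda>\<tau>. \<phi> (\<pi> \<circ> \<tau>)) \<tau> = (\<Sum>k\<in>{1..n}. \<phi> (transpose (\<pi> k) (Suc n) \<circ> (\<pi> \<circ> \<tau>)))"
    unfolding jucys_murphy_def by (simp add: o_assoc permutes_comp_transpose[OF assms])
  also have "\<dots> = (\<Sum>k\<in>{1..n}. \<phi> (transpose k (Suc n) \<circ> (\<pi> \<circ> \<tau>)))"
    by (rule sum.reindex_bij_betw[OF permutes_imp_bij[OF assms], of "\<lambda>k. \<phi> (transpose k (Suc n) \<circ> (\<pi> \<circ> \<tau>))"])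
  finally show ?thesis by (simp add: jucys_murphy_def)
qed

definition perm_op :: "'a :: field_char_0 \<Rightarrow> nat \<Rightarrow> ((nat \<Rightarrow> nat) \<Rightarrow> (nat, 'a) mps) \<Rightarrow> (nat \<Rightarrow> nat) \<Rightarrow> (nat, 'a) mps" where
  "perm_op h n \<phi> \<tau> = (\<Sum>\<sigma> | \<sigma> permutes {1..n}. mps_const (h ^ perm_length {1..n} \<sigma>) * \<phi> (\<sigma> \<circ> \<tau>))"

definition jm_op :: "'a :: field_char_0 \<Rightarrow> nat \<Rightarrow> ((nat \<Rightarrow> nat) \<Rightarrow> (nat, 'a) mps) \<Rightarrow> (nat \<Rightarrow> nat) \<Rightarrow> (nat, 'a) mps" where
  "jm_op h n \<phi> \<tau> = \<phi> \<tau> + mps_const h * jucys_murphy n \<phi> \<tau>"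

lemma cycles_on_insert_fixed:
  assumes "\<sigma> permutes A" "x \<notin> A"
  shows "cycles_on (insert x A) \<sigma> = insert {x} (cycles_on A \<sigma>)" "{x} \<notin> cycles_on A \<sigma>"
proof -
  have "\<sigma> x = x" using permutes_not_in[OF assms] .
  then have "orbit \<sigma> x = {x}" by (simp add: orbit_eq_singleton_iff)
  then show "cycles_on (insert x A) \<sigma> = insert {x} (cycles_on A \<sigma>)" by (simp add: cycles_on_def)
  show "{x} \<notin> cycles_on A \<sigma>"
    using permutes_orbit_subset[OF assms(1)] assms(2) by (fastforce simp: cycles_on_def)
qed

lemma perm_length_insert_fixed:
  assumes "\<sigma> permutes A" "x \<notin> A" "finite A"
  shows "perm_length (insert x A) \<sigma> = perm_length A \<sigma>"
  using cycles_on_insert_fixed[OF assms(1,2)] assms finite_cycles_on[OF assms(3), of \<sigma>]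
  by (simp add: perm_length_def)

text \<open>The transposition joins the fixed point \<open>x\<close> to the cycle of
  \<open>k\<close>, so one cycle is lost.\<close>

lemma perm_length_insert_transpose:
  assumes "\<sigma> permutes A" "x \<notin> A" "finite A" "k \<in> A"
  shows "perm_length (insert x A) (transpose k x \<circ> \<sigma>) = Suc (perm_length A \<sigma>)"
proof -
  have perm: "\<sigma> permutes (insert x A)" using assms(1) by (rule permutes_subset) auto
  have "x \<notin> orbit \<sigma> k" using permutes_orbit_subset[OF assms(1,4)] assms(2) by blast
  then have "card (cycles_on (insert x A) \<sigma>) = Suc (card (cycles_on (insert x A) (transpose k x \<circ> \<sigma>)))"
    using assms by (intro card_cycles_on_join[OF perm]) auto
  moreover have "card (cycles_on (insert x A) \<sigma>) \<le> card (insert x A)"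
    by (rule card_cycles_on_le) (use assms in simp)
  ultimately have "perm_length (insert x A) (transpose k x \<circ> \<sigma>) = Suc (perm_length (insert x A) \<sigma>)"
    by (simp add: perm_length_def)
  then show ?thesis using perm_length_insert_fixed[OF assms(1-3)] by simp
qed

lemma sum_permutes_Suc:
  fixes F :: "(nat \<Rightarrow> nat) \<Rightarrow> 'c :: comm_ring_1"
  shows "(\<Sum>\<sigma> | \<sigma> permutes {1..Suc n}. F \<sigma>)
    = (\<Sum>\<sigma> | \<sigma> permutes {1..n}. F \<sigma> + (\<Sum>k\<in>{1..n}. F (transpose k (Suc n) \<circ> \<sigma>)))"
proof -
  have S: "{1..Suc n} = insert (Suc n) {1..n}" by auto
  have "(\<Sum>\<sigma> | \<sigma> permutes {1..Suc n}. F \<sigma>) = (\<Sum>k\<in>{1..Suc n}. \<Sum>\<sigma> | \<sigma> permutes {1..n}. F (transpose (Suc n) k \<circ> \<sigma>))"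
    unfolding S by (rule sum_over_permutations_insert) auto
  also have "\<dots> = (\<Sum>\<sigma> | \<sigma> permutes {1..n}. \<Sum>k\<in>{1..Suc n}. F (transpose (Suc n) k \<circ> \<sigma>))" by (rule sum.swap)
  also have "\<dots> = (\<Sum>\<sigma> | \<sigma> permutes {1..n}. F \<sigma> + (\<Sum>k\<in>{1..n}. F (transpose k (Suc n) \<circ> \<sigma>)))"
    by (rule sum.cong[OF refl], subst S) (simp add: transpose_commute)
  finally show ?thesis .
qed

text \<open>This is the factorization of \<open>\<Sum>\<^sub>\<sigma> h\<^bsup>n - \<ell>(\<sigma>)\<^esup> \<sigma>\<close> into the factors \<open>1 + h J\<^sub>k\<close>.\<close>

lemma perm_op_Suc: "perm_op h (Suc n) \<phi> = perm_op h n (jm_op h n \<phi>)"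
proof
  fix \<tau>
  have S: "{1..Suc n} = insert (Suc n) {1..n}" by auto
  have "perm_op h (Suc n) \<phi> \<tau> = (\<Sum>\<sigma> | \<sigma> permutes {1..n}. mps_const (h ^ perm_length {1..Suc n} \<sigma>) * \<phi> (\<sigma> \<circ> \<tau>)
    + (\<Sum>k\<in>{1..n}. mps_const (h ^ perm_length {1..Suc n} (transpose k (Suc n) \<circ> \<sigma>)) * \<phi> ((transpose k (Suc n) \<circ> \<sigma>) \<circ> \<tau>)))"
    unfolding perm_op_def by (rule sum_permutes_Suc)
  also have "\<dots> = (\<Sum>\<sigma> | \<sigma> permutes {1..n}. mps_const (h ^ perm_length {1..n} \<sigma>) * jm_op h n \<phi> (\<sigma> \<circ> \<tau>))"
  proof (rule sum.cong[OF refl])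
    fix \<sigma> assume "\<sigma> \<in> {\<sigma>. \<sigma> permutes {1..n}}"
    then have \<sigma>: "\<sigma> permutes {1..n}" by simp
    have "perm_length {1..Suc n} \<sigma> = perm_length {1..n} \<sigma>"
      unfolding S by (rule perm_length_insert_fixed[OF \<sigma>]) auto
    moreover have "perm_length {1..Suc n} (transpose k (Suc n) \<circ> \<sigma>) = Suc (perm_length {1..n} \<sigma>)" if "k \<in> {1..n}" for k
      unfolding S by (rule perm_length_insert_transpose[OF \<sigma> _ _ that]) auto
    ultimately show "mps_const (h ^ perm_length {1..Suc n} \<sigma>) * \<phi> (\<sigma> \<circ> \<tau>)
      + (\<Sum>k\<in>{1..n}. mps_const (h ^ perm_length {1..Suc n} (transpose k (Suc n) \<circ> \<sigma>)) * \<phi> ((transpose k (Suc n) \<circ> \<sigma>) \<circ> \<tau>))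
      = mps_const (h ^ perm_length {1..n} \<sigma>) * jm_op h n \<phi> (\<sigma> \<circ> \<tau>)"
      by (simp add: jm_op_def jucys_murphy_def distrib_left sum_distrib_left mps_const_mult o_assoc ac_simps)
  qed
  finally show "perm_op h (Suc n) \<phi> \<tau> = perm_op h n (jm_op h n \<phi>) \<tau>" by (simp add: perm_op_def)
qed

lemma jucys_murphy_sum:
  "jucys_murphy n (\<lambda>\<tau>. \<Sum>i\<in>I. f i \<tau>) \<tau> = (\<Sum>i\<in>I. jucys_murphy n (f i) \<tau>)"
  unfolding jucys_murphy_def by (rule sum.swap)

lemma jucys_murphy_mult: "jucys_murphy n (\<lambda>\<tau>. c * f \<tau>) \<tau> = c * jucys_murphy n f \<tau>"
  by (simp add: jucys_murphy_def sum_distrib_left)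

lemma perm_op_jm_op_commute: "perm_op h n (jm_op h n \<phi>) = jm_op h n (perm_op h n \<phi>)"
proof
  fix \<tau>
  have "jucys_murphy n (perm_op h n \<phi>) \<tau>
      = (\<Sum>\<sigma> | \<sigma> permutes {1..n}. mps_const (h ^ perm_length {1..n} \<sigma>) * jucys_murphy n \<phi> (\<sigma> \<circ> \<tau>))"
    unfolding perm_op_def jucys_murphy_sum jucys_murphy_mult
    by (intro sum.cong refl arg_cong2[where f = "(*)"] jucys_murphy_translate) simp
  then show "perm_op h n (jm_op h n \<phi>) \<tau> = jm_op h n (perm_op h n \<phi>) \<tau>"
    by (simp add: perm_op_def jm_op_def distrib_left sum.distrib sum_distrib_left mult.left_commute)
qed

text \<open>The factor that belongs to the point \<open>Suc n\<close> commutes with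
  \<open>perm_op h n\<close>. In the \<open>m\<close>-th power all these factors can be collected
  and applied to \<open>\<phi>\<close> first.\<close>

lemma perm_op_funpow_Suc:
  "(perm_op h (Suc n) ^^ m) \<phi> = (perm_op h n ^^ m) ((jm_op h n ^^ m) \<phi>)"
proof (induction m arbitrary: \<phi>)
  case (Suc m)
  have comm: "(perm_op h n ^^ m) (jm_op h n \<phi>) = jm_op h n ((perm_op h n ^^ m) \<phi>)" for \<phi>
    by (induction m) (simp_all add: perm_op_jm_op_commute)
  show ?case using Suc by (simp add: perm_op_Suc comm)
qed simp

text \<open>The effect of \<open>(1 + h J)^m\<close>, for the Jucys-Murphy element \<open>J\<close>
  of the new point, after this point has been adjoined as a fixed point, which multiplies by
  \<open>p_1\<close>. As \<open>2 J\<close> is the difference of the transposition sums for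
  \<open>n + 1\<close> and \<open>n\<close> points, which act as \<open>cut_join\<close> after and
  before the adjunction, each further factor adds \<open>h / 2\<close> times a commutator with
  \<open>cut_join\<close>.\<close>

fun add_box_op :: "'a :: field_char_0 \<Rightarrow> nat \<Rightarrow> nat \<Rightarrow> (nat, 'a) mps \<Rightarrow> (nat, 'a) mps" where
  "add_box_op h B 0 f = mps_var 1 * f"
| "add_box_op h B (Suc m) f = add_box_op h B m f
     + mps_const (h / 2) * (cut_join B (add_box_op h B m f) - add_box_op h B m (cut_join B f))"

lemma add_box_op_add: "add_box_op h B m (f + g) = add_box_op h B m f + add_box_op h B m g"
  by (induction m arbitrary: f g) (simp_all add: cut_join_add algebra_simps)

lemma add_box_op_0: "add_box_op h B m 0 = 0"
  using add_box_op_add[of h B m 0 0] by simp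

lemma add_box_op_sum: "add_box_op h B m (\<Sum>i\<in>I. f i) = (\<Sum>i\<in>I. add_box_op h B m (f i))"
  by (induction I rule: infinite_finite_induct) (simp_all add: add_box_op_add add_box_op_0)

lemma add_box_op_const_mult: "add_box_op h B m (mps_const c * f) = mps_const c * add_box_op h B m f"
  by (induction m arbitrary: f)
     (simp_all add: cut_join_const_mult right_diff_distrib distrib_left mult.left_commute[of _ "mps_const c"])

lemma permutes_transpose_comp:
  "\<tau> permutes A \<Longrightarrow> a \<in> A \<Longrightarrow> b \<in> A \<Longrightarrow> transpose a b \<circ> \<tau> permutes A"
  by (intro permutes_compose permutes_swap_id)

lemma transp_sum_linear:
  "transp_sum n (\<lambda>\<tau>. f \<tau> + c * g \<tau>) \<tau> = transp_sum n f \<tau> + c * transp_sum n g \<tau>"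
  by (simp add: transp_sum_def sum.distrib sum_distrib_left)

text \<open>On \<open>cyc_monom\<close> the transposition sum acts as \<open>cut_join\<close>. Being
  central, it commutes with the translations in \<open>jm_op\<close>, and \<open>cut_join\<close> is
  linear over constants, so the property survives every application of \<open>jm_op\<close>.\<close>

lemma transp_sum_jm_op_funpow:
  assumes "Suc n \<le> B" "\<tau> permutes {1..Suc n}"
  shows "transp_sum (Suc n) ((jm_op h n ^^ m) (cyc_monom {1..Suc n})) \<tau>
    = cut_join B ((jm_op h n ^^ m) (cyc_monom {1..Suc n}) \<tau>)"
  using assms(2)
proof (induction m arbitrary: \<tau>)
  case 0
  show ?case unfolding transp_sum_def funpow_0
    by (rule sum_transpositions_cyc_monom[OF 0]) (use assms(1) in auto)
next
  case (Suc m)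
  define \<psi> where "\<psi> = (jm_op h n ^^ m) (cyc_monom {1..Suc n})"
  have "transp_sum (Suc n) (jucys_murphy n \<psi>) \<tau> = (\<Sum>k\<in>{1..n}. transp_sum (Suc n) (\<lambda>\<tau>. \<psi> (transpose k (Suc n) \<circ> \<tau>)) \<tau>)"
    unfolding transp_sum_def jucys_murphy_def by (subst (2) sum.swap, subst sum.swap) rule
  also have "\<dots> = (\<Sum>k\<in>{1..n}. transp_sum (Suc n) \<psi> (transpose k (Suc n) \<circ> \<tau>))"
    by (intro sum.cong refl transp_sum_translate permutes_swap_id) auto
  also have "\<dots> = (\<Sum>k\<in>{1..n}. cut_join B (\<psi> (transpose k (Suc n) \<circ> \<tau>)))"
    unfolding \<psi>_def by (intro sum.cong refl Suc.IH permutes_transpose_comp Suc.prems) auto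
  also have "\<dots> = cut_join B (jucys_murphy n \<psi> \<tau>)" by (simp add: jucys_murphy_def cut_join_sum)
  finally have J: "transp_sum (Suc n) (jucys_murphy n \<psi>) \<tau> = cut_join B (jucys_murphy n \<psi> \<tau>)" .
  have "transp_sum (Suc n) (jm_op h n \<psi>) \<tau>
      = transp_sum (Suc n) \<psi> \<tau> + mps_const h * transp_sum (Suc n) (jucys_murphy n \<psi>) \<tau>"
    unfolding jm_op_def by (rule transp_sum_linear)
  also have "\<dots> = cut_join B (jm_op h n \<psi> \<tau>)"
    unfolding J Suc.IH[OF Suc.prems, folded \<psi>_def] by (simp add: jm_op_def[of h n \<psi>] cut_join_add cut_join_const_mult)
  finally show ?case by (simp add: \<psi>_def)
qed

text \<open>At a permutation that fixes \<open>Suc n\<close>, \<open>2 J\<close> is the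
  transposition sum for \<open>n + 1\<close> points, which acts as \<open>cut_join\<close> on the
  value, minus the sum for \<open>n\<close> points, which only involves values known by induction.
  This difference is the commutator in \<open>add_box_op\<close>.\<close>

lemma jm_op_funpow_restrict:
  assumes "Suc n \<le> B" "\<tau> permutes {1..n}"
  shows "(jm_op h n ^^ m) (cyc_monom {1..Suc n}) \<tau> = add_box_op h B m (cyc_monom {1..n} \<tau>)"
  using assms(2)
proof (induction m arbitrary: \<tau>)
  case 0
  have "{1..Suc n} = insert (Suc n) {1..n}" by auto
  then show ?case using cycles_on_insert_fixed[OF 0, of "Suc n"] finite_cycles_on[of "{1..n}" \<tau>]
    by (simp add: cyc_monom_def)
next
  case (Suc m)
  define \<psi> where "\<psi> = (jm_op h n ^^ m) (cyc_monom {1..Suc n})"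
  have IH: "\<psi> \<tau> = add_box_op h B m (cyc_monom {1..n} \<tau>)" if "\<tau> permutes {1..n}" for \<tau>
    using Suc.IH[OF that] by (simp add: \<psi>_def)
  have \<tau>: "\<tau> permutes {1..Suc n}" using Suc.prems by (rule permutes_subset) auto
  have "transp_sum n \<psi> \<tau> = (\<Sum>a\<in>{1..n}. \<Sum>b\<in>{1..n}-{a}. add_box_op h B m (cyc_monom {1..n} (transpose a b \<circ> \<tau>)))"
    unfolding transp_sum_def by (intro sum.cong refl IH permutes_transpose_comp Suc.prems) auto
  also have "\<dots> = add_box_op h B m (cut_join B (cyc_monom {1..n} \<tau>))"
  proof -
    have "(\<Sum>a\<in>{1..n}. \<Sum>b\<in>{1..n}-{a}. cyc_monom {1..n} (transpose a b \<circ> \<tau>)) = cut_join B (cyc_monom {1..n} \<tau> :: (nat, 'a) mps)"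
      by (rule sum_transpositions_cyc_monom[OF Suc.prems]) (use assms(1) in auto)
    then show ?thesis by (simp only: add_box_op_sum[symmetric])
  qed
  finally have n: "transp_sum n \<psi> \<tau> = add_box_op h B m (cut_join B (cyc_monom {1..n} \<tau>))" .
  have "2 * jucys_murphy n \<psi> \<tau> = transp_sum (Suc n) \<psi> \<tau> - transp_sum n \<psi> \<tau>"
    by (simp add: transp_sum_Suc)
  also have "\<dots> = cut_join B (add_box_op h B m (cyc_monom {1..n} \<tau>)) - add_box_op h B m (cut_join B (cyc_monom {1..n} \<tau>))"
    unfolding n transp_sum_jm_op_funpow[OF assms(1) \<tau>, where h = h and m = m, folded \<psi>_def] IH[OF Suc.prems] ..
  finally have J: "2 * jucys_murphy n \<psi> \<tau> = cut_join B (add_box_op h B m (cyc_monom {1..n} \<tau>))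
      - add_box_op h B m (cut_join B (cyc_monom {1..n} \<tau>))" .
  have two: "(2 :: (nat, 'a) mps) = mps_const 2" using of_nat_mps[of 2] by simp
  have "mps_const h = mps_const (h / 2) * (2 :: (nat, 'a) mps)"
    unfolding two mps_const_mult[symmetric] by simp
  then have "mps_const h * jucys_murphy n \<psi> \<tau> = mps_const (h / 2) * (2 * jucys_murphy n \<psi> \<tau>)"
    by (simp add: mult.assoc)
  then have "jm_op h n \<psi> \<tau> = add_box_op h B (Suc m) (cyc_monom {1..n} \<tau>)"
    unfolding jm_op_def J IH[OF Suc.prems] by simp
  then show ?case by (simp only: \<psi>_def funpow.simps o_apply)
qed

lemma perm_op_cong:
  assumes "\<And>\<tau>. \<tau> permutes {1..n} \<Longrightarrow> \<phi> \<tau> = \<psi> \<tau>" "\<tau> permutes {1..n}"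
  shows "perm_op h n \<phi> \<tau> = perm_op h n \<psi> \<tau>"
  unfolding perm_op_def
  by (intro sum.cong refl arg_cong2[where f = "(*)"] assms(1) permutes_compose[OF assms(2)]) simp

lemma perm_op_funpow_cong:
  assumes "\<And>\<tau>. \<tau> permutes {1..n} \<Longrightarrow> \<phi> \<tau> = \<psi> \<tau>" "\<tau> permutes {1..n}"
  shows "(perm_op h n ^^ m) \<phi> \<tau> = (perm_op h n ^^ m) \<psi> \<tau>"
  using assms(2)
proof (induction m arbitrary: \<tau>)
  case (Suc m)
  show ?case unfolding funpow.simps o_apply by (rule perm_op_cong[OF Suc.IH Suc.prems])
qed (use assms in auto)

lemma perm_op_add_box_op:
  "(perm_op h n ^^ m) (\<lambda>\<tau>. add_box_op h B k (\<phi> \<tau>)) = (\<lambda>\<tau>. add_box_op h B k ((perm_op h n ^^ m) \<phi> \<tau>))"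
proof (induction m)
  case (Suc m)
  have "perm_op h n (\<lambda>\<tau>. add_box_op h B k (\<psi> \<tau>)) = (\<lambda>\<tau>. add_box_op h B k (perm_op h n \<psi> \<tau>))" for \<psi>
    by (simp add: fun_eq_iff perm_op_def add_box_op_sum add_box_op_const_mult)
  then show ?case by (simp add: Suc)
qed simp

text \<open>The sum over all \<open>m\<close>-tuples of permutations of the weighted cycle monomial
  of their product. The remaining permutation of a factorization is the inverse of this product; its
  own weight is still missing here and is supplied by \<open>mps_scale\<close>.\<close>

definition factorization_sum :: "'a :: field_char_0 \<Rightarrow> nat \<Rightarrow> nat \<Rightarrow> (nat, 'a) mps" where
  "factorization_sum h m n = (perm_op h n ^^ m) (cyc_monom {1..n}) id"

lemma factorization_sum_0: "factorization_sum h m 0 = 1"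
proof -
  have *: "perm_op h 0 \<phi> \<tau> = \<phi> \<tau>" for \<phi> :: "_ \<Rightarrow> (nat, 'a) mps" and \<tau>
    by (simp add: perm_op_def perm_length_def cycles_on_def)
  then have "perm_op h 0 = id" by (auto simp: fun_eq_iff)
  then show ?thesis by (simp add: factorization_sum_def cyc_monom_def cycles_on_def)
qed

theorem factorization_sum_Suc:
  assumes "Suc n \<le> B"
  shows "factorization_sum h m (Suc n) = add_box_op h B m (factorization_sum h m n)"
proof -
  have "factorization_sum h m (Suc n) = (perm_op h n ^^ m) ((jm_op h n ^^ m) (cyc_monom {1..Suc n})) id"
    by (simp add: factorization_sum_def perm_op_funpow_Suc)
  also have "\<dots> = (perm_op h n ^^ m) (\<lambda>\<tau>. add_box_op h B m (cyc_monom {1..n} \<tau>)) id"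
    by (rule perm_op_funpow_cong[OF jm_op_funpow_restrict[OF assms] permutes_id])
  finally show ?thesis by (simp add: perm_op_add_box_op factorization_sum_def)
qed

section \<open>Expansion over lattice words\<close>

text \<open>A lattice word records the rows of the boxes in the order in which a Young diagram is built up,
  so it encodes a standard tableau.\<close>

primrec lattice_words :: "nat \<Rightarrow> nat list set" where
  "lattice_words 0 = {[]}"
| "lattice_words (Suc n) = {w @ [i] |w i. w \<in> lattice_words n \<and> (i = 0 \<or> count_list w i < count_list w (i - 1))}"

lemma lattice_words_length: "w \<in> lattice_words n \<Longrightarrow> length w = n"
  by (induction n arbitrary: w) auto

lemma lattice_words_letter: "w \<in> lattice_words n \<Longrightarrow> i \<in> set w \<Longrightarrow> i < n"
proof (induction n arbitrary: w i)
  case (Suc n)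
  then obtain v j where v: "w = v @ [j]" "v \<in> lattice_words n" "j = 0 \<or> count_list v j < count_list v (j - 1)"
    by auto
  show ?case
  proof (cases "i \<in> set v")
    case True
    then show ?thesis using Suc.IH[OF v(2)] by (simp add: less_SucI)
  next
    case False
    then have "i = j" using Suc.prems v by simp
    moreover have "j = 0 \<or> j - 1 < n" using v(3) Suc.IH[OF v(2), of "j - 1"] by (metis count_list_0_iff not_less_zero)
    ultimately show ?thesis by linarith
  qed
qed simp

lemma lattice_words_count_antimono: "w \<in> lattice_words n \<Longrightarrow> count_list w (Suc r) \<le> count_list w r"
proof (induction n arbitrary: w)
  case (Suc n)
  then obtain v j where v: "w = v @ [j]" "v \<in> lattice_words n" "j = 0 \<or> count_list v j < count_list v (j - 1)"
    by auto
  then show ?case using Suc.IH[OF v(2)] by (auto simp: le_Suc_eq)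
qed simp

lemma finite_lattice_words: "finite (lattice_words n)"
proof (rule finite_subset)
  show "lattice_words n \<subseteq> {w. set w \<subseteq> {..<n} \<and> length w = n}"
    using lattice_words_letter lattice_words_length by blast
qed (rule finite_lists_length_eq, simp)

text \<open>The row index of the Jacobi-Trudi determinant, which is at the same time the content of
  the next box in row \<open>i\<close>.\<close>

definition word_index :: "nat list \<Rightarrow> nat \<Rightarrow> int" where
  "word_index w i = int (count_list w i) - int i"

definition word_cells :: "nat list \<Rightarrow> (nat \<times> nat) set" where
  "word_cells w = {(r, j). j < count_list w r}"

lemma word_index_append: "word_index (w @ [i]) = (word_index w)(i := word_index w i + 1)"
  by (auto simp: word_index_def fun_eq_iff)

lemma word_cells_append: "word_cells (w @ [i]) = insert (i, count_list w i) (word_cells w)"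
  by (auto simp: word_cells_def less_Suc_eq count_list.simps split: if_splits)

lemma word_cells_append_new: "(i, count_list w i) \<notin> word_cells w"
  by (simp add: word_cells_def)

lemma finite_word_cells: "finite (word_cells w)"
proof (induction w rule: rev_induct)
  case Nil
  then show ?case by (simp add: word_cells_def)
next
  case (snoc i w)
  then show ?case by (simp only: word_cells_append finite_insert)
qed

lemma sum_count_list_le:
  fixes w :: "nat list"
  shows "(\<Sum>i<N. count_list w i) \<le> length w"
proof (induction w)
  case (Cons a w)
  have "(\<Sum>i<N. count_list (a # w) i) = (\<Sum>i<N. count_list w i + (if a = i then 1 else 0))"
    by (intro sum.cong) auto
  also have "\<dots> = (\<Sum>i<N. count_list w i) + (\<Sum>i<N. if a = i then 1 else 0)" by (rule sum.distrib)
  also have "(\<Sum>i<N. if a = i then 1 else 0) = (if a \<in> {..<N} then 1 else 0 :: nat)" by (rule sum.delta') simp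
  also have "(\<Sum>i<N. count_list w i) + \<dots> \<le> (\<Sum>i<N. count_list w i) + 1" by simp
  finally show ?case using Cons by simp
qed simp

text \<open>The commutator with \<open>cut_join\<close> multiplies each summand by a difference of
  eigenvalues, \<open>2 * x i\<close>; with the factor \<open>h / 2\<close> this yields one more
  factor \<open>1 + x i h\<close>. The bounds by \<open>B\<close> keep the truncated operator exact
  before and after the box is added.\<close>

lemma add_box_op_hdet:
  fixes x :: "nat \<Rightarrow> int" and h :: "'a :: field_char_0"
  assumes x: "x M = - int M" "\<And>i. i < Suc M \<Longrightarrow> x i + 1 + int (Suc M) \<le> int B"
    "(\<Sum>i<Suc M. x i) + (\<Sum>i<Suc M. int i) + 1 \<le> int B"
  shows "add_box_op h B m (hdet (Suc M) x int) =
    (\<Sum>i\<le>M. mps_const ((1 + of_int (x i) * h) ^ m) * hdet (Suc M) (x(i := x i + 1)) int)"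
proof (induction m)
  case 0
  show ?case by (simp only: add_box_op.simps hdet_add_box[of x M, OF x(1)] power_0 mps_const_1 mult_1)
next
  case (Suc m)
  let ?s = "hdet (Suc M) x int :: (nat, 'a) mps"
  let ?t = "\<lambda>i. hdet (Suc M) (x(i := x i + 1)) int :: (nat, 'a) mps"
  let ?c = "content_sum2 (Suc M) x"
  have K: "cut_join B ?s = of_int ?c * ?s"
    by (rule cut_join_hdet) (use x(2,3) in force)+
  have Kt: "cut_join B (?t i) = of_int (?c + 2 * x i) * ?t i" if "i \<le> M" for i
  proof -
    have sum: "(\<Sum>j<Suc M. (x(i := x i + 1)) j) = (\<Sum>j<Suc M. x j) + 1"
    proof -
      have "(\<Sum>j<Suc M. (x(i := x i + 1)) j) = (\<Sum>j<Suc M. x j + (if j = i then 1 else 0))"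
        by (intro sum.cong) auto
      also have "\<dots> = (\<Sum>j<Suc M. x j) + (\<Sum>j<Suc M. if j = i then 1 else 0)" by (rule sum.distrib)
      also have "(\<Sum>j<Suc M. if j = i then 1 else 0) = (1 :: int)" using that by (subst sum.delta) auto
      finally show ?thesis .
    qed
    have "cut_join B (?t i) = of_int (content_sum2 (Suc M) (x(i := x i + 1))) * ?t i"
    proof (rule cut_join_hdet)
      show "(\<Sum>j<Suc M. (x(i := x i + 1)) j) + (\<Sum>j<Suc M. int j) \<le> int B" unfolding sum using x(3) by linarith
      show "(x(i := x i + 1)) j + int (Suc M) \<le> int B" if "j < Suc M" for j
        using x(2)[OF that] by (cases "j = i") auto
    qed
    moreover have "content_sum2 (Suc M) (x(i := x i + 1)) = ?c + 2 * x i"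
      using content_sum2_shift[of i "Suc M" x 1] that by simp
    ultimately show ?thesis by simp
  qed
  have k1: "cut_join B (add_box_op h B m ?s) = (\<Sum>i\<le>M. mps_const ((1 + of_int (x i) * h) ^ m) * (of_int (?c + 2 * x i) * ?t i))"
    unfolding Suc.IH cut_join_sum cut_join_const_mult by (intro sum.cong refl arg_cong2[where f = "(*)"] Kt) simp
  have k2: "add_box_op h B m (cut_join B ?s) = (\<Sum>i\<le>M. mps_const ((1 + of_int (x i) * h) ^ m) * (of_int ?c * ?t i))"
    unfolding K of_int_mps add_box_op_const_mult Suc.IH sum_distrib_left by (simp add: mult.left_commute)
  have diff: "cut_join B (add_box_op h B m ?s) - add_box_op h B m (cut_join B ?s)
      = (\<Sum>i\<le>M. mps_const ((1 + of_int (x i) * h) ^ m) * (of_int (2 * x i) * ?t i))"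
    unfolding k1 k2 sum_subtractf[symmetric] by (rule sum.cong[OF refl]) (simp add: algebra_simps)
  have "add_box_op h B (Suc m) ?s = add_box_op h B m ?s
      + mps_const (h / 2) * (\<Sum>i\<le>M. mps_const ((1 + of_int (x i) * h) ^ m) * (of_int (2 * x i) * ?t i))"
    by (simp only: add_box_op.simps diff)
  also have "\<dots> = (\<Sum>i\<le>M. mps_const ((1 + of_int (x i) * h) ^ m) * ?t i
      + mps_const (h / 2) * (mps_const ((1 + of_int (x i) * h) ^ m) * (of_int (2 * x i) * ?t i)))"
    unfolding Suc.IH sum_distrib_left sum.distrib ..
  also have "\<dots> = (\<Sum>i\<le>M. mps_const ((1 + of_int (x i) * h) ^ Suc m) * ?t i)"
  proof (rule sum.cong[OF refl])
    fix i
    have "mps_const ((1 + of_int (x i) * h) ^ m) * ?t i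
        + mps_const (h / 2) * (mps_const ((1 + of_int (x i) * h) ^ m) * (of_int (2 * x i) * ?t i))
      = mps_const ((1 + of_int (x i) * h) ^ m + (h / 2) * ((1 + of_int (x i) * h) ^ m * of_int (2 * x i))) * ?t i"
      by (simp only: of_int_mps mps_const_add mps_const_mult distrib_right mult.assoc)
    also have "(1 + of_int (x i) * h) ^ m + (h / 2) * ((1 + of_int (x i) * h) ^ m * of_int (2 * x i))
        = (1 + of_int (x i) * h) ^ Suc m"
      by (simp add: algebra_simps)
    finally show "mps_const ((1 + of_int (x i) * h) ^ m) * ?t i
        + mps_const (h / 2) * (mps_const ((1 + of_int (x i) * h) ^ m) * (of_int (2 * x i) * ?t i))
      = mps_const ((1 + of_int (x i) * h) ^ Suc m) * ?t i" .
  qed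
  finally show ?case .
qed

text \<open>Each letter is one box. A box that would make row \<open>i\<close> longer than row
  \<open>i - 1\<close> produces two equal row indices, so its determinant vanishes and only lattice
  words survive. Since \<open>n \<le> M\<close>, row \<open>M\<close> is still empty whenever a box
  is added.\<close>

theorem factorization_sum_lattice_words:
  fixes h :: "'a :: field_char_0"
  assumes "n \<le> M"
  shows "factorization_sum h m n = (\<Sum>w\<in>lattice_words n.
    mps_const (\<Prod>k\<in>word_cells w. (1 + of_int (cell_content k) * h) ^ m) * hdet (Suc M) (word_index w) int)"
  using assms
proof (induction n)
  case 0
  have "hdet (Suc M) (word_index []) int = (1 :: (nat, 'a) mps)"
  proof -
    have x: "word_index [] = (\<lambda>i. - int i)" by (simp add: word_index_def fun_eq_iff)
    have "hdet k (\<lambda>i. - int i) int = (1 :: (nat, 'a) mps)" for k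
      by (induction k) (simp add: hdet_def, simp add: hdet_drop_zero_row)
    then show ?thesis unfolding x .
  qed
  then show ?case by (simp add: factorization_sum_0 word_cells_def)
next
  case (Suc n)
  \<comment> \<open>Large enough for all indices and weights that occur with at most
    \<open>n + 1\<close> boxes in \<open>Suc M\<close> rows.\<close>
  define B where "B = 2 * Suc M + n + 2"
  let ?W = "\<lambda>w. \<Prod>k\<in>word_cells w. (1 + of_int (cell_content k) * h) ^ m"
  let ?s = "\<lambda>x. hdet (Suc M) x int :: (nat, 'a) mps"
  have step: "add_box_op h B m (?s (word_index w))
      = (\<Sum>i | i = 0 \<or> count_list w i < count_list w (i - 1).
          mps_const ((1 + of_int (word_index w i) * h) ^ m) * ?s (word_index (w @ [i])))"
    and fin: "finite {i. i = 0 \<or> count_list w i < count_list w (i - 1)}"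
    if w: "w \<in> lattice_words n" for w
  proof -
    have len: "length w = n" using lattice_words_length[OF w] .
    have cnt: "count_list w i \<le> n" for i using count_le_length[of w i] len by simp
    have "M \<notin> set w" using lattice_words_letter[OF w, of M] Suc.prems by auto
    then have M: "word_index w M = - int M" by (simp add: word_index_def count_list_0_iff)
    have "(\<Sum>i<Suc M. word_index w i) + (\<Sum>i<Suc M. int i) = (\<Sum>i<Suc M. int (count_list w i))"
      by (simp add: word_index_def sum_subtractf)
    also have "\<dots> \<le> int n" using sum_count_list_le[of w "Suc M"] len by (simp only: of_nat_sum[symmetric] of_nat_le_iff)
    finally have sum: "(\<Sum>i<Suc M. word_index w i) + (\<Sum>i<Suc M. int i) + 1 \<le> int B" by (simp add: B_def)
    have bound: "word_index w i + 1 + int (Suc M) \<le> int B" for i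
      using cnt[of i] by (simp add: word_index_def B_def)
    have sub: "{i. i = 0 \<or> count_list w i < count_list w (i - 1)} \<subseteq> {..M}"
    proof
      fix i assume "i \<in> {i. i = 0 \<or> count_list w i < count_list w (i - 1)}"
      then have "i = 0 \<or> count_list w i < count_list w (i - 1)" by simp
      then have "i = 0 \<or> i - 1 \<in> set w" by (metis count_list_0_iff not_less_zero)
      then show "i \<in> {..M}" using lattice_words_letter[OF w, of "i - 1"] Suc.prems by auto
    qed
    then show "finite {i. i = 0 \<or> count_list w i < count_list w (i - 1)}" by (rule finite_subset) simp
    have "add_box_op h B m (?s (word_index w))
      = (\<Sum>i\<le>M. mps_const ((1 + of_int (word_index w i) * h) ^ m) * ?s (word_index (w @ [i])))"
      unfolding word_index_append by (rule add_box_op_hdet[OF M bound sum])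
    also have "\<dots> = (\<Sum>i | i = 0 \<or> count_list w i < count_list w (i - 1).
          mps_const ((1 + of_int (word_index w i) * h) ^ m) * ?s (word_index (w @ [i])))"
    proof (rule sum.mono_neutral_right[OF _ sub])
      show "\<forall>i\<in>{..M} - {i. i = 0 \<or> count_list w i < count_list w (i - 1)}.
        mps_const ((1 + of_int (word_index w i) * h) ^ m) * ?s (word_index (w @ [i])) = 0"
      proof
        fix i assume i: "i \<in> {..M} - {i. i = 0 \<or> count_list w i < count_list w (i - 1)}"
        then have "i > 0" "count_list w i = count_list w (i - 1)"
          using lattice_words_count_antimono[OF w, of "i - 1"] by auto
        then have "word_index (w @ [i]) (i - 1) = word_index (w @ [i]) i"
          by (simp add: word_index_def)
        then have "?s (word_index (w @ [i])) = 0" using i \<open>i > 0\<close> by (intro hdet_equal_rows[of "i - 1" _ i]) auto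
        then show "mps_const ((1 + of_int (word_index w i) * h) ^ m) * ?s (word_index (w @ [i])) = 0" by simp
      qed
    qed simp
    finally show "add_box_op h B m (?s (word_index w))
      = (\<Sum>i | i = 0 \<or> count_list w i < count_list w (i - 1).
          mps_const ((1 + of_int (word_index w i) * h) ^ m) * ?s (word_index (w @ [i])))" .
  qed
  have "factorization_sum h m (Suc n) = add_box_op h B m (factorization_sum h m n)"
    by (rule factorization_sum_Suc) (use Suc.prems in \<open>simp add: B_def\<close>)
  also have "\<dots> = (\<Sum>w\<in>lattice_words n. mps_const (?W w) * add_box_op h B m (?s (word_index w)))"
    using Suc by (simp add: add_box_op_sum add_box_op_const_mult)
  also have "\<dots> = (\<Sum>w\<in>lattice_words n. \<Sum>i | i = 0 \<or> count_list w i < count_list w (i - 1).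
      mps_const (?W (w @ [i])) * ?s (word_index (w @ [i])))"
  proof (rule sum.cong[OF refl])
    fix w assume w: "w \<in> lattice_words n"
    have "?W (w @ [i]) = ?W w * (1 + of_int (word_index w i) * h) ^ m" for i
      using finite_word_cells[of w] word_cells_append_new[of i w]
      by (simp add: word_cells_append cell_content_def word_index_def)
    then show "mps_const (?W w) * add_box_op h B m (?s (word_index w)) =
      (\<Sum>i | i = 0 \<or> count_list w i < count_list w (i - 1). mps_const (?W (w @ [i])) * ?s (word_index (w @ [i])))"
      unfolding step[OF w] sum_distrib_left by (simp add: mps_const_mult mult.assoc)
  qed
  also have "\<dots> = (\<Sum>(w, i)\<in>(SIGMA w:lattice_words n. {i. i = 0 \<or> count_list w i < count_list w (i - 1)}).
      mps_const (?W (w @ [i])) * ?s (word_index (w @ [i])))"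
    using fin by (intro sum.Sigma finite_lattice_words) auto
  also have "\<dots> = (\<Sum>w\<in>lattice_words (Suc n). mps_const (?W w) * ?s (word_index w))"
    by (rule sum.reindex_bij_witness[of _ "\<lambda>w. (butlast w, last w)" "\<lambda>(w, i). w @ [i]"]) auto
  finally show ?case .
qed

section \<open>Grouping lattice words by shape\<close>

definition word_tabloid :: "nat list \<Rightarrow> nat \<Rightarrow> nat set" where
  "word_tabloid w r = {e \<in> {1..length w}. w ! (e - 1) = r}"

text \<open>Prefixes of a lattice word are built by the same recursion, so the condition on the last
  letter amounts to a ballot condition on all prefixes. In this form it matches
  \<open>lattice_tabloids\<close>, where \<open>{..k}\<close> plays the role of the prefix.\<close>

lemma lattice_words_iff:
  "w \<in> lattice_words n \<longleftrightarrow>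
    length w = n \<and> (\<forall>k r. count_list (take k w) (Suc r) \<le> count_list (take k w) r)"
proof (induction n arbitrary: w)
  case (Suc n)
  show ?case
  proof (cases w rule: rev_cases)
    case (snoc v i)
    have "w \<in> lattice_words (Suc n) \<longleftrightarrow> v \<in> lattice_words n \<and> (i = 0 \<or> count_list v i < count_list v (i - 1))"
      by (auto simp: snoc)
    also have "\<dots> \<longleftrightarrow> length w = Suc n \<and> (\<forall>k r. count_list (take k w) (Suc r) \<le> count_list (take k w) r)"
    proof
      assume *: "v \<in> lattice_words n \<and> (i = 0 \<or> count_list v i < count_list v (i - 1))"
      then have v: "length v = n" "\<And>k r. count_list (take k v) (Suc r) \<le> count_list (take k v) r" using Suc by auto
      have "count_list (take k w) (Suc r) \<le> count_list (take k w) r" for k r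
      proof (cases "k \<le> n")
        case True
        then show ?thesis using v by (simp add: snoc)
      next
        case False
        then have "take k w = w" using v by (simp add: snoc)
        then show ?thesis using v(2)[of n r] v(1) * by (cases "i = Suc r") (auto simp: snoc)
      qed
      then show "length w = Suc n \<and> (\<forall>k r. count_list (take k w) (Suc r) \<le> count_list (take k w) r)"
        using v by (simp add: snoc)
    next
      assume *: "length w = Suc n \<and> (\<forall>k r. count_list (take k w) (Suc r) \<le> count_list (take k w) r)"
      then have n: "length v = n" by (simp add: snoc)
      have "count_list (take k v) (Suc r) \<le> count_list (take k v) r" for k r
      proof (cases "k \<le> n")
        case True
        then have "take k v = take k w" using n by (simp add: snoc)
        then show ?thesis using * by simp
      next
        case False
        then have "take k v = take n w" using n by (simp add: snoc)
        then show ?thesis using * by simp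
      qed
      then have "v \<in> lattice_words n" using Suc n by blast
      moreover have "i = 0 \<or> count_list v i < count_list v (i - 1)"
      proof (cases i)
        case (Suc j)
        have "count_list w (Suc j) \<le> count_list w j" using * by (metis order_refl take_all)
        then show ?thesis by (simp add: snoc Suc)
      qed simp
      ultimately show "v \<in> lattice_words n \<and> (i = 0 \<or> count_list v i < count_list v (i - 1))" by blast
    qed
    finally show ?thesis .
  qed auto
qed auto

lemma card_word_tabloid: "card (word_tabloid w r \<inter> {..k}) = count_list (take k w) r"
proof -
  have "count_list (take k w) r = length (filter (\<lambda>y. r = y) (take k w))" by (simp add: count_list_eq_length_filter)
  also have "\<dots> = card {i. i < length (take k w) \<and> r = take k w ! i}" by (rule length_filter_conv_card)
  also have "{i. i < length (take k w) \<and> r = take k w ! i} = {i. i < k \<and> i < length w \<and> w ! i = r}" by auto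
  also have "card \<dots> = card (Suc ` {i. i < k \<and> i < length w \<and> w ! i = r})" by (simp add: card_image)
  also have "Suc ` {i. i < k \<and> i < length w \<and> w ! i = r} = word_tabloid w r \<inter> {..k}"
  proof
    show "word_tabloid w r \<inter> {..k} \<subseteq> Suc ` {i. i < k \<and> i < length w \<and> w ! i = r}"
    proof
      fix e assume "e \<in> word_tabloid w r \<inter> {..k}"
      then show "e \<in> Suc ` {i. i < k \<and> i < length w \<and> w ! i = r}"
        by (intro image_eqI[of _ _ "e - 1"]) (auto simp: word_tabloid_def)
    qed
  qed (auto simp: word_tabloid_def)
  finally show ?thesis by simp
qed

lemma card_word_tabloid_row: "card (word_tabloid w r) = count_list w r"
proof -
  have "word_tabloid w r \<inter> {..length w} = word_tabloid w r" by (auto simp: word_tabloid_def)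
  then show ?thesis using card_word_tabloid[of w r "length w"] by simp
qed

text \<open>Listing the rows of the entries \<open>1, ..., n\<close> turns a tabloid into a word,
  and the entries up to \<open>k\<close> of a row become the occurrences of a letter in the prefix
  of length \<open>k\<close>. So the two ballot conditions agree.\<close>

lemma card_lattice_words_shape:
  assumes \<nu>: "sum_list \<nu> = n"
  shows "card {w \<in> lattice_words n. row_len \<nu> = count_list w} = card (lattice_tabloids \<nu>)"
proof (rule bij_betw_same_card[of word_tabloid], rule bij_betw_imageI)
  let ?L = "{w \<in> lattice_words n. row_len \<nu> = count_list w}"
  show "inj_on word_tabloid ?L"
  proof (rule inj_onI)
    fix v w assume vw: "v \<in> ?L" "w \<in> ?L" "word_tabloid v = word_tabloid w"
    then have len: "length v = n" "length w = n" by (auto simp: lattice_words_length)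
    have "v ! i = w ! i" if "i < n" for i
    proof -
      have "Suc i \<in> word_tabloid v (v ! i)" using that len by (simp add: word_tabloid_def)
      then have "Suc i \<in> word_tabloid w (v ! i)" by (simp add: vw(3))
      then show ?thesis by (simp add: word_tabloid_def)
    qed
    then show "v = w" using len by (intro nth_equalityI) auto
  qed
  show "word_tabloid ` ?L = lattice_tabloids \<nu>"
  proof
    show "word_tabloid ` ?L \<subseteq> lattice_tabloids \<nu>"
    proof clarify
      fix w assume w: "w \<in> lattice_words n" "row_len \<nu> = count_list w"
      have len: "length w = n" using lattice_words_length[OF w(1)] .
      have "word_tabloid w \<in> tabloids \<nu>"
      proof (rule tabloidsI)
        show "card (word_tabloid w r) = row_len \<nu> r" for r by (simp add: card_word_tabloid_row w(2))
      qed (auto simp: word_tabloid_def len \<nu>)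
      then show "word_tabloid w \<in> lattice_tabloids \<nu>"
        using w(1) by (simp add: lattice_tabloids_def card_word_tabloid lattice_words_iff)
    qed
    show "lattice_tabloids \<nu> \<subseteq> word_tabloid ` ?L"
    proof
      fix x assume x: "x \<in> lattice_tabloids \<nu>"
      then have xt: "x \<in> tabloids \<nu>" by (simp add: lattice_tabloids_def)
      define f where "f i = (SOME r. Suc i \<in> x r)" for i
      have f: "Suc i \<in> x (f i)" if "i < n" for i
      proof -
        have "\<exists>r. Suc i \<in> x r" using tabloid_cover[OF xt, of "Suc i"] that \<nu> by auto
        then show ?thesis unfolding f_def by (rule someI_ex)
      qed
      define w where "w = map f [0..<n]"
      have len: "length w = n" by (simp add: w_def)
      have "word_tabloid w r = x r" for r
      proof (rule Set.set_eqI)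
        fix e
        show "e \<in> word_tabloid w r \<longleftrightarrow> e \<in> x r"
        proof (cases "e \<in> {1..n}")
          case True
          then have "e \<in> x (f (e - 1))" "w ! (e - 1) = f (e - 1)" using f[of "e - 1"] by (auto simp: w_def)
          then show ?thesis using True tabloid_disjoint[OF xt, of e r "f (e - 1)"] by (auto simp: word_tabloid_def len)
        next
          case False
          then show ?thesis using tabloid_subset[OF xt, of r] \<nu> by (auto simp: word_tabloid_def len)
        qed
      qed
      then have wx: "word_tabloid w = x" ..
      have "w \<in> lattice_words n"
        using x len unfolding lattice_words_iff card_word_tabloid[symmetric] wx by (simp add: lattice_tabloids_def)
      moreover have "row_len \<nu> = count_list w"
        using card_tabloid_row[OF xt] by (auto simp: fun_eq_iff card_word_tabloid_row[symmetric] wx)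
      ultimately show "x \<in> word_tabloid ` ?L" using wx by blast
    qed
  qed
qed

lemma row_len_eq_0_iff:
  assumes "0 \<notin> set \<nu>" shows "row_len \<nu> r = 0 \<longleftrightarrow> length \<nu> \<le> r"
proof (cases "r < length \<nu>")
  case True
  then have "\<nu> ! r \<in> set \<nu>" by (rule nth_mem)
  with assms have "\<nu> ! r \<noteq> 0" by metis
  then show ?thesis using True by (simp add: row_len_def)
qed (simp add: row_len_def)

lemma row_len_inject:
  assumes "0 \<notin> set \<nu>" "0 \<notin> set \<mu>" "row_len \<nu> = row_len \<mu>"
  shows "\<nu> = \<mu>"
proof (rule nth_equalityI)
  have "length \<nu> \<le> r \<longleftrightarrow> length \<mu> \<le> r" for r
    using row_len_eq_0_iff[OF assms(1)] row_len_eq_0_iff[OF assms(2)] assms(3) by simp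
  then show len: "length \<nu> = length \<mu>" by (metis order_antisym order_refl)
  fix i assume "i < length \<nu>"
  then show "\<nu> ! i = \<mu> ! i" using fun_cong[OF assms(3), of i] len by (simp add: row_len_def)
qed

lemma exists_partition_of_word:
  assumes w: "w \<in> lattice_words n"
  shows "\<exists>\<nu>\<in>partitions n. row_len \<nu> = count_list w"
proof -
  let ?c = "count_list w"
  \<comment> \<open>The first empty row; the later rows are empty as well because the counts
    decrease weakly.\<close>
  define t where "t = (LEAST r. ?c r = 0)"
  have "n \<notin> set w" using lattice_words_letter[OF w, of n] by auto
  then have "?c n = 0" by (simp add: count_list_0_iff)
  then have t: "?c t = 0" unfolding t_def by (rule LeastI)
  have below: "?c r \<noteq> 0" if "r < t" for r using not_less_Least[of r "\<lambda>r. ?c r = 0"] that by (simp add: t_def)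
  have anti: "?c s \<le> ?c r" if "r \<le> s" for r s
    using lift_Suc_antimono_le[of ?c] lattice_words_count_antimono[OF w] that by blast
  have above: "?c r = 0" if "t \<le> r" for r using anti[OF that] t by simp
  define \<nu> where "\<nu> = map ?c [0..<t]"
  have row: "row_len \<nu> = ?c" using above by (auto simp: row_len_def \<nu>_def fun_eq_iff)
  have "set w \<subseteq> {..<t}" using above by (metis count_list_0_iff lessThan_iff not_less subsetI)
  then have "sum_list \<nu> = length w"
    using sum_count_set[of w "{..<t}"] by (simp add: \<nu>_def interv_sum_list_conv_sum_set_nat atLeast0LessThan)
  moreover have "sorted_wrt (\<ge>) \<nu>" using anti by (auto simp: \<nu>_def sorted_wrt_iff_nth_less)
  moreover have "0 \<notin> set \<nu>"
  proof
    assume "0 \<in> set \<nu>"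
    then obtain r where "r < t" "?c r = 0" by (auto simp: \<nu>_def)
    then show False using below[of r] by simp
  qed
  ultimately show ?thesis using row lattice_words_length[OF w] by (auto simp: partitions_def)
qed

lemma finite_partitions: "finite (partitions n)"
proof (rule finite_subset)
  have "length \<nu> \<le> sum_list \<nu>" if "0 \<notin> set \<nu>" for \<nu> :: "nat list"
    using that by (induction \<nu>) auto
  then show "partitions n \<subseteq> {\<nu>. set \<nu> \<subseteq> {..n} \<and> length \<nu> \<le> n}"
    using member_le_sum_list by (fastforce simp: partitions_def)
qed (rule finite_lists_length_le, simp)

lemma word_cells_shape: "row_len \<nu> = count_list w \<Longrightarrow> word_cells w = diagram \<nu>"
  by (auto simp: word_cells_def mem_diagram_iff)

section \<open>Schur functions as determinants of a common size\<close>

lemma schur_Leibniz: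
  "schur q \<nu> = (\<Sum>p | p permutes {..<length \<nu>}.
    of_int (sign p) * (\<Prod>i<length \<nu>. schur_row q (int (\<nu> ! i) - int i + int (p i))))"
proof -
  let ?M = "mat (length \<nu>) (length \<nu>) (\<lambda>(i, j). schur_row q (int (\<nu> ! i) - int i + int j))"
  have "schur q \<nu> = (\<Sum>p | p permutes {..<length \<nu>}. of_int (sign p) * (\<Prod>i<length \<nu>. ?M $$ (i, p i)))"
    by (simp add: schur_def det_def atLeast0LessThan)
  also have "\<dots> = (\<Sum>p | p permutes {..<length \<nu>}.
    of_int (sign p) * (\<Prod>i<length \<nu>. schur_row q (int (\<nu> ! i) - int i + int (p i))))"
  proof (intro sum.cong refl arg_cong2[where f = "(*)"] prod.cong)
    fix p i assume p: "p \<in> {p. p permutes {..<length \<nu>}}" and i: "i \<in> {..<length \<nu>}"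
    then have "p i < length \<nu>" using permutes_in_image[of p "{..<length \<nu>}" i] by auto
    then show "?M $$ (i, p i) = schur_row q (int (\<nu> ! i) - int i + int (p i))" using i by simp
  qed
  finally show ?thesis .
qed

text \<open>The determinant is enlarged by empty rows, since the sum over lattice words uses one
  size for all shapes.\<close>

lemma schur_eq_hdet:
  assumes "length \<nu> \<le> N"
  shows "schur mps_var \<nu> = hdet N (\<lambda>i. int (row_len \<nu> i) - int i) int"
  using assms
proof (induction N rule: dec_induct)
  case base
  show ?case
    unfolding hdet_def schur_Leibniz by (intro sum.cong refl arg_cong2[where f = "(*)"] prod.cong) (auto simp: row_len_def)
next
  case (step N)
  have "row_len \<nu> N = 0" using step by (simp add: row_len_def)
  then have x: "int (row_len \<nu> N) - int N = - int N" by simp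
  show ?case unfolding hdet_drop_zero_row[of "\<lambda>i. int (row_len \<nu> i) - int i" N, OF x] by (rule step.IH)
qed

theorem factorization_sum_schur:
  fixes h :: "'a :: field_char_0"
  shows "factorization_sum h m n = (\<Sum>\<nu>\<in>partitions n.
    mps_const ((\<Prod>k\<in>diagram \<nu>. (1 + of_int (cell_content k) * h) ^ m) * of_nat (irrep_dim \<nu>)) * schur mps_var \<nu>)"
proof -
  define G :: "nat list \<Rightarrow> (nat, 'a) mps" where
    "G w = mps_const (\<Prod>k\<in>word_cells w. (1 + of_int (cell_content k) * h) ^ m) * hdet (Suc n) (word_index w) int" for w
  define F :: "nat list \<Rightarrow> (nat, 'a) mps" where
    "F \<nu> = mps_const (\<Prod>k\<in>diagram \<nu>. (1 + of_int (cell_content k) * h) ^ m) * schur mps_var \<nu>" for \<nu>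
  define shape where "shape w = (SOME \<nu>. \<nu> \<in> partitions n \<and> row_len \<nu> = count_list w)" for w
  have shape: "shape w \<in> partitions n" "row_len (shape w) = count_list w" if "w \<in> lattice_words n" for w
  proof -
    have "\<exists>\<nu>. \<nu> \<in> partitions n \<and> row_len \<nu> = count_list w" using exists_partition_of_word[OF that] by blast
    then show "shape w \<in> partitions n" "row_len (shape w) = count_list w"
      unfolding shape_def by (rule someI2_ex; blast)+
  qed
  have fibre: "{w \<in> lattice_words n. shape w = \<nu>} = {w \<in> lattice_words n. row_len \<nu> = count_list w}" if \<nu>: "\<nu> \<in> partitions n" for \<nu>
  proof -
    have "shape w = \<nu>" if "w \<in> lattice_words n" "row_len \<nu> = count_list w" for w
      using row_len_inject[of "shape w" \<nu>] shape[OF that(1)] that(2) \<nu> by (simp add: partitions_def)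
    then show ?thesis using shape(2) by blast
  qed
  have GF: "G w = F \<nu>" if "\<nu> \<in> partitions n" "row_len \<nu> = count_list w" for w \<nu>
  proof -
    have "length \<nu> \<le> sum_list \<nu>" if "0 \<notin> set \<nu>" using that by (induction \<nu>) auto
    then have "length \<nu> \<le> Suc n" using that(1) by (simp add: partitions_def)
    moreover have "word_index w = (\<lambda>i. int (row_len \<nu> i) - int i)" by (simp add: word_index_def that(2) fun_eq_iff)
    ultimately show ?thesis using schur_eq_hdet[of \<nu> "Suc n", where ?'a = 'a] by (simp add: G_def F_def word_cells_shape[OF that(2)])
  qed
  have "factorization_sum h m n = (\<Sum>w\<in>lattice_words n. G w)"
    unfolding G_def by (rule factorization_sum_lattice_words) simp
  also have "\<dots> = (\<Sum>\<nu>\<in>partitions n. \<Sum>w | w \<in> lattice_words n \<and> shape w = \<nu>. G w)"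
    using shape by (intro sum.group[symmetric] finite_lattice_words finite_partitions) auto
  also have "\<dots> = (\<Sum>\<nu>\<in>partitions n. of_nat (irrep_dim \<nu>) * F \<nu>)"
  proof (rule sum.cong[OF refl])
    fix \<nu> assume \<nu>: "\<nu> \<in> partitions n"
    have "(\<Sum>w | w \<in> lattice_words n \<and> shape w = \<nu>. G w) = (\<Sum>w | w \<in> lattice_words n \<and> shape w = \<nu>. F \<nu>)"
      using GF[OF \<nu>] unfolding fibre[OF \<nu>] by (intro sum.cong) auto
    also have "\<dots> = of_nat (card {w \<in> lattice_words n. shape w = \<nu>}) * F \<nu>" by simp
    also have "card {w \<in> lattice_words n. shape w = \<nu>} = irrep_dim \<nu>"
      unfolding fibre[OF \<nu>] using \<nu> card_lattice_words_shape[of \<nu> n] irrep_dim_eq_card_lattice_tabloids[of \<nu>]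
      by (simp add: partitions_def)
    finally show "(\<Sum>w | w \<in> lattice_words n \<and> shape w = \<nu>. G w) = of_nat (irrep_dim \<nu>) * F \<nu>" .
  qed
  also have "\<dots> = (\<Sum>\<nu>\<in>partitions n.
    mps_const ((\<Prod>k\<in>diagram \<nu>. (1 + of_int (cell_content k) * h) ^ m) * of_nat (irrep_dim \<nu>)) * schur mps_var \<nu>)"
    by (intro sum.cong refl) (simp add: F_def of_nat_mps mps_const_mult ac_simps)
  finally show ?thesis .
qed

section \<open>Rescaling the power-sum variables\<close>

text \<open>The substitution \<open>p_i \<mapsto> u_i p_i\<close>, which is a ring endomorphism. The
  coefficientwise form avoids a general notion of substitution.\<close>

definition mps_scale :: "(nat \<Rightarrow> 'a) \<Rightarrow> (nat, 'a :: field_char_0) mps \<Rightarrow> (nat, 'a) mps" where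
  "mps_scale u f = Abs_mps (\<lambda>M. (\<Prod>i\<in>#M. u i) * mps_coeff f M)"

lemma mps_coeff_scale [simp]: "mps_coeff (mps_scale u f) M = (\<Prod>i\<in>#M. u i) * mps_coeff f M"
  by (simp add: mps_scale_def)

lemma mps_scale_add: "mps_scale u (f + g) = mps_scale u f + mps_scale u g"
  by (rule mps_eqI) (simp add: algebra_simps)

lemma mps_scale_0: "mps_scale u 0 = 0"
  by (rule mps_eqI) simp

lemma mps_scale_sum: "mps_scale u (\<Sum>a\<in>A. f a) = (\<Sum>a\<in>A. mps_scale u (f a))"
  by (induction A rule: infinite_finite_induct) (simp_all add: mps_scale_0 mps_scale_add)

lemma mps_scale_mult: "mps_scale u (f * g) = mps_scale u f * mps_scale u g"
proof (rule mps_eqI)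
  fix M
  have "(\<Prod>i\<in>#M. u i) * mps_coeff (f * g) M
      = (\<Sum>(A, B)\<in>mset_splits M. (\<Prod>i\<in>#M. u i) * (mps_coeff f A * mps_coeff g B))"
    by (simp add: mps_coeff_mult sum_distrib_left split_def)
  also have "\<dots> = (\<Sum>(A, B)\<in>mset_splits M. ((\<Prod>i\<in>#A. u i) * mps_coeff f A) * ((\<Prod>i\<in>#B. u i) * mps_coeff g B))"
    by (intro sum.cong refl) (auto simp: mset_splits_def)
  finally show "mps_coeff (mps_scale u (f * g)) M = mps_coeff (mps_scale u f * mps_scale u g) M"
    by (simp add: mps_coeff_mult)
qed

lemma mps_scale_const: "mps_scale u (mps_const c) = mps_const c"
  by (rule mps_eqI) (simp add: mps_coeff_const)

lemma mps_scale_of_int: "mps_scale u (of_int n) = of_int n"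
  by (simp add: of_int_mps mps_scale_const)

lemma mps_scale_1: "mps_scale u 1 = 1"
  using mps_scale_const[of u 1] by simp

lemma mps_scale_prod: "mps_scale u (\<Prod>a\<in>A. f a) = (\<Prod>a\<in>A. mps_scale u (f a))"
  by (induction A rule: infinite_finite_induct) (simp_all add: mps_scale_1 mps_scale_mult)

lemma mps_scale_var: "mps_scale u (mps_var i) = mps_var i * mps_const (u i)"
  by (rule mps_eqI) (simp add: mult.commute[of _ "mps_const _"] mps_coeff_var)

text \<open>Both sides satisfy Newton's identity for the variables \<open>u_i p_i\<close> and start
  with 1, so they agree by induction. The composition of power series in the definition does not
  have to be opened.\<close>

lemma mps_scale_schur_row:
  "mps_scale u (schur_row mps_var a) = schur_row (\<lambda>i. mps_var i * mps_const (u i)) a"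
proof (cases "a \<ge> 0")
  case True
  then obtain n where "a = int n" by (metis nonneg_int_cases)
  moreover have "mps_scale u (schur_row mps_var (int n)) = schur_row (\<lambda>i. mps_var i * mps_const (u i)) (int n)"
  proof (induction n rule: less_induct)
    case (less n)
    show ?case
    proof (cases "n = 0")
      case False
      have "of_nat n * mps_scale u (schur_row mps_var (int n)) = mps_scale u (of_nat n * schur_row mps_var (int n))"
        by (simp add: of_nat_mps mps_scale_mult mps_scale_const)
      also have "\<dots> = (\<Sum>i=1..n. mps_var i * mps_const (u i) * mps_scale u (schur_row mps_var (int n - int i)))"
        by (simp only: schur_row_recursion mps_scale_sum mps_scale_mult mps_scale_var)
      also have "\<dots> = (\<Sum>i=1..n. mps_var i * mps_const (u i) * schur_row (\<lambda>i. mps_var i * mps_const (u i)) (int n - int i))"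
      proof (rule sum.cong[OF refl])
        fix i assume i: "i \<in> {1..n}"
        then have eq: "int n - int i = int (n - i)" and "n - i < n" by auto
        show "mps_var i * mps_const (u i) * mps_scale u (schur_row mps_var (int n - int i))
          = mps_var i * mps_const (u i) * schur_row (\<lambda>i. mps_var i * mps_const (u i)) (int n - int i)"
          unfolding eq less.IH[OF \<open>n - i < n\<close>] ..
      qed
      also have "\<dots> = of_nat n * schur_row (\<lambda>i. mps_var i * mps_const (u i)) (int n)"
        by (simp only: schur_row_recursion)
      finally have "of_nat n * mps_scale u (schur_row mps_var (int n))
        = of_nat n * schur_row (\<lambda>i. mps_var i * mps_const (u i)) (int n)" .
      then show ?thesis by (rule mps_of_nat_cancel) (use False in simp)
    qed (simp add: schur_row_0 mps_scale_1)
  qed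
  ultimately show ?thesis by simp
next
  case False
  then show ?thesis by (simp add: schur_row_neg mps_scale_0)
qed

lemma mps_scale_schur: "mps_scale u (schur mps_var \<nu>) = schur (\<lambda>i. mps_var i * mps_const (u i)) \<nu>"
  by (simp only: schur_Leibniz mps_scale_sum mps_scale_mult mps_scale_prod mps_scale_of_int mps_scale_schur_row)

section \<open>The logarithm\<close>

definition mset_weight :: "nat multiset \<Rightarrow> nat" where
  "mset_weight M = (\<Sum>i\<in>#M. max 1 i)"

lemma mset_weight_add: "mset_weight (A + B) = mset_weight A + mset_weight B"
  by (simp add: mset_weight_def)

lemma mset_weight_eq_0_iff: "mset_weight M = 0 \<longleftrightarrow> M = {#}"
  by (cases M) (auto simp: mset_weight_def)

lemma mset_weight_eq_sum: "0 \<notin># M \<Longrightarrow> mset_weight M = sum_mset M"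
  by (induction M) (auto simp: mset_weight_def)

text \<open>The Euler derivation. The index \<open>0\<close>, which does not occur in the series considered here, is
  given weight \<open>1\<close>, so that a series with zero derivative is constant.\<close>

definition mps_D :: "(nat, 'a :: field_char_0) mps \<Rightarrow> (nat, 'a) mps" where
  "mps_D f = Abs_mps (\<lambda>M. of_nat (mset_weight M) * mps_coeff f M)"

lemma mps_coeff_D [simp]: "mps_coeff (mps_D f) M = of_nat (mset_weight M) * mps_coeff f M"
  by (simp add: mps_D_def)

lemma derivation_D: "derivation (mps_D :: (nat, 'a :: field_char_0) mps \<Rightarrow> _)"
  unfolding derivation_def
proof (intro conjI allI)
  fix f g :: "(nat, 'a) mps"
  show "mps_D (f + g) = mps_D f + mps_D g"
    by (rule mps_eqI) (simp add: algebra_simps)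
  show "mps_D (f * g) = mps_D f * g + f * mps_D g"
  proof (rule mps_eqI)
    fix M
    have "mps_coeff (mps_D (f * g)) M = (\<Sum>(A, B)\<in>mset_splits M. of_nat (mset_weight M) * (mps_coeff f A * mps_coeff g B))"
      by (simp add: mps_coeff_mult sum_distrib_left split_def)
    also have "\<dots> = (\<Sum>(A, B)\<in>mset_splits M. of_nat (mset_weight A) * mps_coeff f A * mps_coeff g B
        + mps_coeff f A * (of_nat (mset_weight B) * mps_coeff g B))"
      by (intro sum.cong refl) (auto simp: mset_splits_def mset_weight_add algebra_simps)
    finally show "mps_coeff (mps_D (f * g)) M = mps_coeff (mps_D f * g + f * mps_D g) M"
      by (simp add: mps_coeff_mult split_def sum.distrib)
  qed
qed

lemma mps_D_const_mult: "mps_D (mps_const c * f) = mps_const c * mps_D f"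
  by (rule mps_eqI) simp

lemma mps_D_power: "mps_D (X ^ Suc k) = of_nat (Suc k) * (X ^ k * mps_D X)"
proof (induction k)
  case (Suc k)
  have "mps_D (X ^ Suc (Suc k)) = mps_D X * X ^ Suc k + X * mps_D (X ^ Suc k)"
    using derivation_mult[OF derivation_D, of X "X ^ Suc k"] by simp
  also have "\<dots> = of_nat (Suc (Suc k)) * (X ^ Suc k * mps_D X)"
    unfolding Suc by (simp add: algebra_simps)
  finally show ?case .
qed simp

text \<open>Without a constant term each factor \<open>X\<close> uses up at least one variable, so
  all monomials of \<open>X ^ k\<close> have size at least \<open>k\<close>.\<close>

lemma mps_coeff_power_mult_small:
  assumes "mps_coeff X {#} = 0" "size M < k"
  shows "mps_coeff (X ^ k * f) M = 0"
  using assms(2)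
proof (induction k arbitrary: M)
  case (Suc k)
  have "mps_coeff (X ^ Suc k * f) M = (\<Sum>(A, B)\<in>mset_splits M. mps_coeff X A * mps_coeff (X ^ k * f) B)"
    by (simp add: mult.assoc mps_coeff_mult)
  also have "\<dots> = 0"
  proof (rule sum.neutral, clarify)
    fix A B assume "(A, B) \<in> mset_splits M"
    then have AB: "A + B = M" by (simp add: mset_splits_def)
    show "mps_coeff X A * mps_coeff (X ^ k * f) B = 0"
    proof (cases "A = {#}")
      case False
      then have "size A > 0" by (simp add: nonempty_has_size)
      moreover have "size A + size B = size M" using AB by (metis size_union)
      ultimately have "size B < k" using Suc.prems by linarith
      then show ?thesis using Suc.IH[of B] by simp
    qed (simp add: assms(1))
  qed
  finally show ?case .
qed simp

lemma mps_coeff_mult_cong: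
  assumes "\<And>B. size B \<le> size M \<Longrightarrow> mps_coeff g B = mps_coeff h B"
  shows "mps_coeff (f * g) M = mps_coeff (f * h) M"
  unfolding mps_coeff_mult
proof (intro sum.cong refl, clarify)
  fix A B assume "(A, B) \<in> mset_splits M"
  then have "A + B = M" by (simp add: mset_splits_def)
  then have "size B \<le> size M" by (metis le_add2 size_union)
  then show "mps_coeff f A * mps_coeff g B = mps_coeff f A * mps_coeff h B" using assms by simp
qed

lemma mps_const_minus_1_power: "mps_const ((-1) ^ k) = ((-1) ^ k :: ('v, 'a :: field_char_0) mps)"
proof -
  have "mps_const (-1 :: 'a) = (-1 :: ('v, 'a) mps)"
    by (rule mps_eqI) (simp add: mps_coeff_const mps_coeff_one mps_coeff_uminus)
  then show ?thesis by (simp only: mps_const_power)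
qed

text \<open>For \<open>F = 1 + X\<close> the derivative of the logarithm series is
  \<open>mps_D X\<close> times the geometric series in \<open>- X\<close>, which multiplication by
  \<open>F\<close> telescopes to \<open>1 - (- X) ^ K\<close>. The last power does not reach the
  monomial \<open>M\<close>, as \<open>K\<close> exceeds its size.\<close>

lemma mps_D_log:
  fixes F :: "(nat, 'a :: field_char_0) mps"
  assumes "mps_coeff F {#} = 1"
  shows "F * mps_D (mps_log F) = mps_D F"
proof (rule mps_eqI)
  fix M :: "nat multiset"
  define X where "X = F - 1"
  have X0: "mps_coeff X {#} = 0" using assms by (simp add: X_def mps_coeff_one)
  define K where "K = Suc (size M)"
  define P where "P = (\<Sum>k<K. mps_const ((-1) ^ k / of_nat (Suc k)) * X ^ Suc k)"
  have log: "mps_coeff (mps_log F) B = mps_coeff P B" if "size B \<le> size M" for B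
  proof -
    have "mps_coeff (mps_log F) B = (\<Sum>k\<in>Suc ` {..<size B}. (-1) ^ (k + 1) / of_nat k * mps_coeff (X ^ k) B)"
      by (simp add: mps_log_def X_def image_Suc_lessThan)
    also have "\<dots> = (\<Sum>k<size B. (-1) ^ k / of_nat (Suc k) * mps_coeff (X ^ Suc k) B)"
      by (subst sum.reindex) simp_all
    also have "\<dots> = (\<Sum>k<K. (-1) ^ k / of_nat (Suc k) * mps_coeff (X ^ Suc k) B)"
    proof (rule sum.mono_neutral_left)
      show "\<forall>k\<in>{..<K} - {..<size B}. (-1) ^ k / of_nat (Suc k) * mps_coeff (X ^ Suc k) B = 0"
      proof
        fix k assume "k \<in> {..<K} - {..<size B}"
        then have "mps_coeff (X ^ Suc k * 1) B = 0" by (intro mps_coeff_power_mult_small[OF X0]) auto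
        then show "(-1) ^ k / of_nat (Suc k) * mps_coeff (X ^ Suc k) B = 0" by (simp only: mult_1_right mult_zero_right)
      qed
    qed (use that in \<open>auto simp: K_def\<close>)
    finally show ?thesis by (simp add: P_def del: power_Suc of_nat_Suc)
  qed
  have "mps_D P = (\<Sum>k<K. (- X) ^ k * mps_D X)"
    unfolding P_def derivation_sum[OF derivation_D]
  proof (rule sum.cong[OF refl])
    fix k
    have "mps_D (mps_const ((-1) ^ k / of_nat (Suc k)) * X ^ Suc k)
        = mps_const ((-1) ^ k / of_nat (Suc k)) * (of_nat (Suc k) * (X ^ k * mps_D X))"
      by (simp only: mps_D_const_mult mps_D_power)
    also have "\<dots> = mps_const ((-1) ^ k / of_nat (Suc k) * of_nat (Suc k)) * (X ^ k * mps_D X)"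
      by (simp only: of_nat_mps mps_const_mult mult.assoc)
    also have "(-1) ^ k / of_nat (Suc k) * of_nat (Suc k) = ((-1) ^ k :: 'a)" by (simp del: of_nat_Suc)
    also have "mps_const ((-1) ^ k :: 'a) = (-1) ^ k"
      by (rule mps_const_minus_1_power)
    finally show "mps_D (mps_const ((-1) ^ k / of_nat (Suc k)) * X ^ Suc k) = (- X) ^ k * mps_D X"
      by (simp add: power_minus[of X] mult.assoc)
  qed
  then have "F * mps_D P = (F * (\<Sum>k<K. (- X) ^ k)) * mps_D X" by (simp add: sum_distrib_right mult.assoc)
  also have "F * (\<Sum>k<K. (- X) ^ k) = 1 - (- X) ^ K"
    using one_diff_power_eq[of "- X" K] by (simp add: X_def)
  finally have FP: "F * mps_D P = mps_D X - (- X) ^ K * mps_D X" by (simp add: algebra_simps)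
  have "mps_coeff (F * mps_D (mps_log F)) M = mps_coeff (F * mps_D P) M"
    by (rule mps_coeff_mult_cong) (simp add: log)
  also have "\<dots> = mps_coeff (mps_D X) M"
    unfolding FP using mps_coeff_power_mult_small[of "- X" M K "mps_D X"] X0 by (simp add: K_def)
  also have "mps_D X = mps_D F" by (simp add: X_def derivation_diff[OF derivation_D] derivation_1[OF derivation_D])
  finally show "mps_coeff (F * mps_D (mps_log F)) M = mps_coeff (mps_D F) M" .
qed

text \<open>Because of the constant term 1, the coefficient of \<open>F * V\<close> at
  \<open>M\<close> is that of \<open>V\<close> plus contributions of \<open>V\<close> at smaller
  monomials, which vanish by induction.\<close>

lemma mps_mult_eq_0:
  fixes F V :: "('v, 'a :: field_char_0) mps"
  assumes "mps_coeff F {#} = 1" "F * V = 0"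
  shows "V = 0"
proof (rule mps_eqI)
  fix M show "mps_coeff V M = mps_coeff 0 M"
  proof (induction "size M" arbitrary: M rule: less_induct)
    case less
    have "0 = mps_coeff (F * V) M" by (simp add: assms(2))
    also have "\<dots> = (\<Sum>(A, B)\<in>{({#} :: 'v multiset, M)}. mps_coeff F A * mps_coeff V B)"
      unfolding mps_coeff_mult
    proof (rule sum.mono_neutral_right)
      show "\<forall>i\<in>mset_splits M - {({#}, M)}. (case i of (A, B) \<Rightarrow> mps_coeff F A * mps_coeff V B) = 0"
      proof
        fix i assume i: "i \<in> mset_splits M - {({#}, M)}"
        obtain A B where iAB: "i = (A, B)" by (cases i)
        then have AB: "A + B = M" using i by (simp add: mset_splits_def)
        then have "A \<noteq> {#}" using i iAB by auto
        then have "size A > 0" by (simp add: nonempty_has_size)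
        moreover have "size A + size B = size M" using AB by (metis size_union)
        ultimately have "size B < size M" by linarith
        then show "(case i of (A, B) \<Rightarrow> mps_coeff F A * mps_coeff V B) = 0" using less[of B] by (simp add: iAB)
      qed
    qed (simp, simp add: mset_splits_def)
    finally show ?case using assms(1) by simp
  qed
qed

text \<open>The logarithm solves the same differential equation, and \<open>F\<close> can be
  cancelled, so both series have the same Euler derivative. This leaves only the constant term
  undetermined, which is 0 in both cases.\<close>

lemma mps_log_eqI:
  fixes F :: "(nat, 'a :: field_char_0) mps"
  assumes "mps_coeff F {#} = 1" "mps_coeff C {#} = 0" "F * mps_D C = mps_D F"
  shows "mps_log F = C"
proof -
  have "F * (mps_D (mps_log F) - mps_D C) = 0"
    using mps_D_log[OF assms(1)] assms(3) by (simp add: right_diff_distrib)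
  then have eq: "mps_D (mps_log F) = mps_D C" by (rule mps_mult_eq_0[OF assms(1), THEN eq_iff_diff_eq_0[THEN iffD2]])
  show ?thesis
  proof (rule mps_eqI)
    fix M show "mps_coeff (mps_log F) M = mps_coeff C M"
    proof (cases "M = {#}")
      case True
      then show ?thesis using assms(2) by (simp add: mps_log_def)
    next
      case False
      then have "mset_weight M \<noteq> 0" by (simp add: mset_weight_eq_0_iff)
      then show ?thesis using arg_cong[OF eq, of "\<lambda>f. mps_coeff f M"] by simp
    qed
  qed
qed

section \<open>The logarithm of a sum of homogeneous series\<close>

lemma mps_hom_zero:
  assumes "mps_hom (int n) f" "0 \<in># M \<or> n \<noteq> sum_mset M" shows "mps_coeff f M = 0"
  using assms unfolding mps_hom_def of_nat_eq_iff by blast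

text \<open>By homogeneity only the summand whose index is the weight of \<open>M\<close>
  contributes, so the family is locally finite.\<close>

lemma mps_coeff_mps_sum:
  assumes "\<And>n. mps_hom (int n) (f n)"
  shows "mps_coeff (mps_sum f) M = mps_coeff (f (sum_mset M)) M"
proof -
  have "{n. mps_coeff (f n) M \<noteq> 0} \<subseteq> {sum_mset M}" using mps_hom_zero[OF assms] by blast
  then have "Sum_any (\<lambda>n. mps_coeff (f n) M) = (\<Sum>n\<in>{sum_mset M}. mps_coeff (f n) M)"
    by (intro Sum_any.expand_superset) auto
  then show ?thesis by (simp add: mps_sum_def)
qed

text \<open>The Euler derivation multiplies the part of weight \<open>k\<close> by \<open>k\<close>.
  Hence the recursion is the weight-\<open>n\<close> part of \<open>F * mps_D C = mps_D F\<close>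
  for the sums \<open>F\<close> of \<open>g\<close> and \<open>C\<close> of \<open>c\<close>, and
  this equation characterizes the logarithm.\<close>

theorem mps_log_mps_sum:
  fixes g c :: "nat \<Rightarrow> (nat, 'a :: field_char_0) mps"
  assumes g: "\<And>n. mps_hom (int n) (g n)" and c: "\<And>n. mps_hom (int n) (c n)" and "g 0 = 1" "c 0 = 0"
    and rec: "\<And>n. n > 0 \<Longrightarrow> of_nat n * g n = (\<Sum>k=1..n. of_nat k * (c k * g (n - k)))"
  shows "mps_log (mps_sum g) = mps_sum c"
proof (rule mps_log_eqI)
  show "mps_coeff (mps_sum g) {#} = 1" "mps_coeff (mps_sum c) {#} = 0"
    by (simp_all add: mps_coeff_mps_sum[OF g] mps_coeff_mps_sum[OF c] assms(3,4) mps_coeff_one)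
  show "mps_sum g * mps_D (mps_sum c) = mps_D (mps_sum g)"
  proof (rule mps_eqI)
    fix M
    define s :: "nat multiset \<Rightarrow> nat" where "s = sum_mset"
    have s_add: "s (A + B) = s A + s B" for A B by (simp add: s_def)
    have zero: "mps_coeff (f n) A = 0" if "\<And>n. mps_hom (int n) (f n)" "0 \<in># A \<or> n \<noteq> s A"
      for f :: "nat \<Rightarrow> (nat, 'a) mps" and n A
      using mps_hom_zero[OF that(1)] that(2) unfolding s_def by blast
    have sum_g: "mps_coeff (mps_sum g) A = mps_coeff (g (s A)) A" for A
      unfolding s_def by (rule mps_coeff_mps_sum[OF g])
    have sum_c: "mps_coeff (mps_sum c) A = mps_coeff (c (s A)) A" for A
      unfolding s_def by (rule mps_coeff_mps_sum[OF c])
    have weight: "mset_weight A = s A" if "0 \<notin># A" for A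
      unfolding s_def by (rule mset_weight_eq_sum[OF that])
    have L: "mps_coeff (mps_sum g * mps_D (mps_sum c)) M = (\<Sum>(A, B)\<in>mset_splits M.
        mps_coeff (g (s A)) A * (of_nat (mset_weight B) * mps_coeff (c (s B)) B))"
      by (simp add: mps_coeff_mult sum_g sum_c)
    show "mps_coeff (mps_sum g * mps_D (mps_sum c)) M = mps_coeff (mps_D (mps_sum g)) M"
    \<comment> \<open>With the index 0 present the Euler weight differs from the sum of the indices,
      and at weight 0 there is no recursion. In both situations the two sides are zero.\<close>
    proof (cases "0 \<in># M \<or> s M = 0")
      case True
      have "(\<Sum>(A, B)\<in>mset_splits M. mps_coeff (g (s A)) A * (of_nat (mset_weight B) * mps_coeff (c (s B)) B)) = 0"
      proof (rule sum.neutral, clarify)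
        fix A B assume "(A, B) \<in> mset_splits M"
        then have AB: "A + B = M" by (simp add: mset_splits_def)
        show "mps_coeff (g (s A)) A * (of_nat (mset_weight B) * mps_coeff (c (s B)) B) = 0"
        proof (cases "0 \<in># M")
          case True
          then have "0 \<in># A \<or> 0 \<in># B" using AB by auto
          then show ?thesis using zero[OF g] zero[OF c] by auto
        next
          case False
          with \<open>0 \<in># M \<or> s M = 0\<close> have "s B = 0" using s_add[of A B] AB by simp
          then show ?thesis by (simp add: assms(4))
        qed
      qed
      moreover have "of_nat (mset_weight M) * mps_coeff (g (s M)) M = 0"
        using True zero[OF g, of M] weight[of M] by (cases "0 \<in># M") auto
      ultimately show ?thesis unfolding L by (simp add: sum_g)
    next
      case False
      then have M0: "0 \<notin># M" and n: "s M > 0" by auto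
      have "of_nat (s M) * mps_coeff (g (s M)) M = mps_coeff (\<Sum>k=1..s M. of_nat k * (c k * g (s M - k))) M"
        unfolding rec[OF n, symmetric] by simp
      also have "\<dots> = (\<Sum>k=1..s M. of_nat k * (\<Sum>(B, A)\<in>mset_splits M. mps_coeff (c k) B * mps_coeff (g (s M - k)) A))"
        unfolding mps_coeff_sum mps_coeff_of_nat_mult by (simp only: mps_coeff_mult)
      also have "\<dots> = (\<Sum>k=1..s M. \<Sum>(A, B)\<in>mset_splits M. of_nat k * (mps_coeff (c k) B * mps_coeff (g (s M - k)) A))"
        by (subst mset_splits_swap) (simp add: sum_distrib_left split_def)
      also have "\<dots> = (\<Sum>(A, B)\<in>mset_splits M. \<Sum>k=1..s M. of_nat k * (mps_coeff (c k) B * mps_coeff (g (s M - k)) A))"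
        by (subst sum.swap) (simp add: split_def)
      also have "\<dots> = (\<Sum>(A, B)\<in>mset_splits M. mps_coeff (g (s A)) A * (of_nat (mset_weight B) * mps_coeff (c (s B)) B))"
      proof (intro sum.cong refl, clarify)
        fix A B assume "(A, B) \<in> mset_splits M"
        then have AB: "A + B = M" by (simp add: mset_splits_def)
        then have sumAB: "s A + s B = s M" by (simp add: s_add[symmetric])
        have wB: "mset_weight B = s B" using M0 AB by (intro weight) auto
        have "(\<Sum>k=1..s M. of_nat k * (mps_coeff (c k) B * mps_coeff (g (s M - k)) A))
            = (\<Sum>k=1..s M. if k = s B then of_nat (s B) * (mps_coeff (c (s B)) B * mps_coeff (g (s A)) A) else 0)"
        proof (rule sum.cong[OF refl])
          fix k
          have "s M - s B = s A" using sumAB by simp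
          then show "of_nat k * (mps_coeff (c k) B * mps_coeff (g (s M - k)) A)
            = (if k = s B then of_nat (s B) * (mps_coeff (c (s B)) B * mps_coeff (g (s A)) A) else 0)"
            using zero[OF c, of B k] by (cases "k = s B") auto
        qed
        also have "\<dots> = (if s B \<in> {1..s M} then of_nat (s B) * (mps_coeff (c (s B)) B * mps_coeff (g (s A)) A) else 0)"
          by (rule sum.delta) simp
        also have "\<dots> = of_nat (s B) * (mps_coeff (c (s B)) B * mps_coeff (g (s A)) A)"
          using sumAB by (cases "s B = 0") auto
        finally show "(\<Sum>k=1..s M. of_nat k * (mps_coeff (c k) B * mps_coeff (g (s M - k)) A))
          = mps_coeff (g (s A)) A * (of_nat (mset_weight B) * mps_coeff (c (s B)) B)"
          unfolding wB by (simp only: ac_simps)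
      qed
      finally show ?thesis unfolding L using weight[OF M0] by (simp add: sum_g)
    qed
  qed
qed

section \<open>Connected and arbitrary factorizations of the identity\<close>

definition id_tuples :: "nat \<Rightarrow> 'b set \<Rightarrow> ('b \<Rightarrow> 'b) list set" where
  "id_tuples m A = {\<sigma>s. length \<sigma>s = Suc m \<and> (\<forall>\<sigma>\<in>set \<sigma>s. \<sigma> permutes A) \<and> foldr (\<circ>) \<sigma>s id = id}"

definition invariant_set :: "('b \<Rightarrow> 'b) list \<Rightarrow> 'b set \<Rightarrow> bool" where
  "invariant_set \<sigma>s S \<longleftrightarrow> (\<forall>\<sigma>\<in>set \<sigma>s. \<sigma> ` S \<subseteq> S)"

text \<open>Transitivity, phrased as the absence of proper invariant subsets. For
  \<open>A = {}\<close> the condition holds vacuously, which is why the term for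
  \<open>n = 0\<close> is set to 0 separately in the connected series.\<close>

definition connected_tuples :: "nat \<Rightarrow> 'b set \<Rightarrow> ('b \<Rightarrow> 'b) list set" where
  "connected_tuples m A = {\<sigma>s \<in> id_tuples m A. \<forall>S\<subseteq>A. S \<noteq> {} \<longrightarrow> invariant_set \<sigma>s S \<longrightarrow> S = A}"

definition tuple_weight :: "'a :: field_char_0 \<Rightarrow> 'b set \<Rightarrow> ('b \<Rightarrow> 'b) list \<Rightarrow> (nat, 'a) mps" where
  "tuple_weight h A \<sigma>s = mps_const (h ^ (\<Sum>\<sigma>\<leftarrow>\<sigma>s. perm_length A \<sigma>)) * cyc_monom A (hd \<sigma>s)"

lemma finite_id_tuples:
  assumes "finite A" shows "finite (id_tuples m A)"
proof (rule finite_subset)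
  show "id_tuples m A \<subseteq> {\<sigma>s. set \<sigma>s \<subseteq> {\<sigma>. \<sigma> permutes A} \<and> length \<sigma>s = Suc m}"
    by (auto simp: id_tuples_def)
  show "finite {\<sigma>s. set \<sigma>s \<subseteq> {\<sigma>. \<sigma> permutes A} \<and> length \<sigma>s = Suc m}"
    by (rule finite_lists_length_eq[OF finite_permutations[OF assms]])
qed

lemma id_tuplesD:
  assumes "\<sigma>s \<in> id_tuples m A"
  shows "length \<sigma>s = Suc m" "\<And>\<sigma>. \<sigma> \<in> set \<sigma>s \<Longrightarrow> \<sigma> permutes A" "foldr (\<circ>) \<sigma>s id = id"
  using assms by (auto simp: id_tuples_def)

lemma connected_tuplesD:
  "\<sigma>s \<in> connected_tuples m A \<Longrightarrow> S \<subseteq> A \<Longrightarrow> S \<noteq> {} \<Longrightarrow> invariant_set \<sigma>s S \<Longrightarrow> S = A"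
  by (simp add: connected_tuples_def)

lemma invariant_setD: "invariant_set \<sigma>s S \<Longrightarrow> \<sigma> \<in> set \<sigma>s \<Longrightarrow> x \<in> S \<Longrightarrow> \<sigma> x \<in> S"
  by (auto simp: invariant_set_def)

lemma id_tuples_invariant_set: "\<sigma>s \<in> id_tuples m A \<Longrightarrow> invariant_set \<sigma>s A"
  by (auto simp: invariant_set_def id_tuples_def permutes_image)

lemma permutes_image_invariant:
  assumes "\<sigma> permutes A" "finite S" "\<sigma> ` S \<subseteq> S" shows "\<sigma> ` S = S"
  by (rule endo_inj_surj[OF assms(2,3) inj_on_subset[OF permutes_inj[OF assms(1)] subset_UNIV]])

text \<open>A permutation maps a finite invariant set onto itself, so no point outside can be mapped
  into it.\<close>

lemma invariant_set_diff:
  assumes "\<And>\<sigma>. \<sigma> \<in> set \<sigma>s \<Longrightarrow> \<sigma> permutes A" "finite S" "invariant_set \<sigma>s S" "invariant_set \<sigma>s T"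
  shows "invariant_set \<sigma>s (T - S)"
  unfolding invariant_set_def
proof (intro ballI subsetI)
  fix \<sigma> y assume \<sigma>: "\<sigma> \<in> set \<sigma>s" and "y \<in> \<sigma> ` (T - S)"
  then obtain z where z: "y = \<sigma> z" "z \<in> T" "z \<notin> S" by blast
  have "\<sigma> ` S \<subseteq> S" using assms(3) \<sigma> by (simp add: invariant_set_def)
  then have im: "\<sigma> ` S = S" by (rule permutes_image_invariant[OF assms(1)[OF \<sigma>] assms(2)])
  have "\<sigma> z \<notin> S"
  proof
    assume "\<sigma> z \<in> S"
    then obtain w where "w \<in> S" "\<sigma> z = \<sigma> w" using im by (metis imageE)
    then show False using z(3) injD[OF permutes_inj[OF assms(1)[OF \<sigma>]]] by metis
  qed
  then show "y \<in> T - S" using z invariant_setD[OF assms(4) \<sigma>] by simp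
qed

lemma perm_restrict_permutes:
  assumes "\<sigma> permutes A" "finite S" "\<sigma> ` S \<subseteq> S"
  shows "perm_restrict \<sigma> S permutes S"
proof (rule bij_imp_permutes)
  have "bij_betw \<sigma> S S"
    using permutes_image_invariant[OF assms] inj_on_subset[OF permutes_inj[OF assms(1)] subset_UNIV]
    by (simp add: bij_betw_def)
  then show "bij_betw (perm_restrict \<sigma> S) S S"
    by (rule bij_betw_cong[THEN iffD1, rotated]) (simp add: perm_restrict_def)
qed (simp add: perm_restrict_def)

lemma foldr_perm_restrict:
  assumes "invariant_set \<sigma>s S"
  shows "foldr (\<circ>) (map (\<lambda>\<sigma>. perm_restrict \<sigma> S) \<sigma>s) id = perm_restrict (foldr (\<circ>) \<sigma>s id) S"
proof -
  have "foldr (\<circ>) (map (\<lambda>\<sigma>. perm_restrict \<sigma> S) \<sigma>s) id = perm_restrict (foldr (\<circ>) \<sigma>s id) S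
    \<and> (\<forall>x\<in>S. foldr (\<circ>) \<sigma>s id x \<in> S)"
    using assms by (induction \<sigma>s) (auto simp: invariant_set_def perm_restrict_def fun_eq_iff)
  then show ?thesis ..
qed

lemma perm_restrict_id_tuple:
  assumes "\<sigma>s \<in> id_tuples m A" "finite S" "invariant_set \<sigma>s S"
  shows "map (\<lambda>\<sigma>. perm_restrict \<sigma> S) \<sigma>s \<in> id_tuples m S"
proof -
  have "perm_restrict id S = id" by (auto simp: perm_restrict_def)
  moreover have "perm_restrict \<sigma> S permutes S" if "\<sigma> \<in> set \<sigma>s" for \<sigma>
    using that assms(3) by (intro perm_restrict_permutes[OF id_tuplesD(2)[OF assms(1) that] assms(2)])
      (simp add: invariant_set_def)
  ultimately show ?thesis
    using id_tuplesD(1,3)[OF assms(1)] foldr_perm_restrict[OF assms(3)] by (auto simp: id_tuples_def)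
qed

section \<open>Gluing tuples with disjoint supports\<close>

lemma permutes_disjoint_commute:
  assumes "\<alpha> permutes K" "\<beta> permutes L" "K \<inter> L = {}"
  shows "\<alpha> \<circ> \<beta> = \<beta> \<circ> \<alpha>"
proof
  fix x
  consider "x \<in> K" | "x \<in> L" "x \<notin> K" | "x \<notin> K" "x \<notin> L" by blast
  then show "(\<alpha> \<circ> \<beta>) x = (\<beta> \<circ> \<alpha>) x"
  proof cases
    case 1
    then have "\<alpha> x \<in> K" using permutes_in_image[OF assms(1)] by simp
    then have "x \<notin> L" "\<alpha> x \<notin> L" using 1 assms(3) by auto
    then show ?thesis by (simp add: permutes_not_in[OF assms(2)])
  next
    case 2
    then have "\<beta> x \<in> L" using permutes_in_image[OF assms(2)] by simp
    then have "\<beta> x \<notin> K" using assms(3) by auto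
    then show ?thesis using 2 by (simp add: permutes_not_in[OF assms(1)])
  next
    case 3
    then show ?thesis by (simp add: permutes_not_in[OF assms(1)] permutes_not_in[OF assms(2)])
  qed
qed

lemma foldr_comp_Cons: "foldr (\<circ>) (\<sigma> # \<sigma>s) id = \<sigma> \<circ> foldr (\<circ>) \<sigma>s id"
  by simp

lemma foldr_comp_permutes:
  "(\<And>\<sigma>. \<sigma> \<in> set \<sigma>s \<Longrightarrow> \<sigma> permutes A) \<Longrightarrow> foldr (\<circ>) \<sigma>s id permutes A"
proof (induction \<sigma>s)
  case (Cons \<sigma> \<sigma>s)
  have "foldr (\<circ>) \<sigma>s id permutes A" by (rule Cons.IH) (rule Cons.prems, simp)
  then have "\<sigma> \<circ> foldr (\<circ>) \<sigma>s id permutes A" by (rule permutes_compose) (rule Cons.prems, simp)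
  then show ?case by (simp only: foldr_comp_Cons)
qed (simp add: permutes_id)

text \<open>Each \<open>\<beta>\<close> can be moved past the product of the remaining
  \<open>\<alpha>s\<close> because their supports are disjoint.\<close>

lemma foldr_map2_comp:
  assumes "length \<alpha>s = length \<beta>s" "\<forall>\<alpha>\<in>set \<alpha>s. \<alpha> permutes K" "\<forall>\<beta>\<in>set \<beta>s. \<beta> permutes L" "K \<inter> L = {}"
  shows "foldr (\<circ>) (map2 (\<circ>) \<alpha>s \<beta>s) id = foldr (\<circ>) \<alpha>s id \<circ> foldr (\<circ>) \<beta>s id"
  using assms(1-3)
proof (induction \<alpha>s \<beta>s rule: list_induct2)
  case (Cons \<alpha> \<alpha>s \<beta> \<beta>s)
  define F G where "F = foldr (\<circ>) \<alpha>s id" and "G = foldr (\<circ>) \<beta>s id"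
  have "F permutes K" unfolding F_def using Cons.prems(1) by (intro foldr_comp_permutes) simp
  then have comm: "\<beta> \<circ> F = F \<circ> \<beta>"
    using Cons.prems(2) assms(4) by (intro permutes_disjoint_commute[symmetric]) auto
  have IH: "foldr (\<circ>) (map2 (\<circ>) \<alpha>s \<beta>s) id = F \<circ> G"
    unfolding F_def G_def using Cons.prems by (intro Cons.IH) auto
  have "foldr (\<circ>) (map2 (\<circ>) (\<alpha> # \<alpha>s) (\<beta> # \<beta>s)) id = (\<alpha> \<circ> \<beta>) \<circ> foldr (\<circ>) (map2 (\<circ>) \<alpha>s \<beta>s) id"
    by (simp only: zip_Cons_Cons list.map prod.case foldr_comp_Cons)
  also have "\<dots> = (\<alpha> \<circ> \<beta>) \<circ> (F \<circ> G)" by (simp only: IH)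
  also have "\<dots> = \<alpha> \<circ> (\<beta> \<circ> F) \<circ> G" by (simp only: o_assoc)
  also have "\<dots> = (\<alpha> \<circ> F) \<circ> (\<beta> \<circ> G)" by (simp only: comm o_assoc)
  also have "\<dots> = foldr (\<circ>) (\<alpha> # \<alpha>s) id \<circ> foldr (\<circ>) (\<beta> # \<beta>s) id"
    unfolding F_def G_def by (simp only: foldr_comp_Cons)
  finally show ?case .
qed simp

lemma id_tuples_map2:
  assumes "\<alpha>s \<in> id_tuples m K" "\<beta>s \<in> id_tuples m L" "K \<inter> L = {}"
  shows "map2 (\<circ>) \<alpha>s \<beta>s \<in> id_tuples m (K \<union> L)"
proof -
  note \<alpha> = id_tuplesD[OF assms(1)] and \<beta> = id_tuplesD[OF assms(2)]
  have "foldr (\<circ>) (map2 (\<circ>) \<alpha>s \<beta>s) id = id"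
    using foldr_map2_comp[of \<alpha>s \<beta>s K L] \<alpha> \<beta> assms(3) by simp
  moreover have "\<sigma> permutes (K \<union> L)" if \<sigma>: "\<sigma> \<in> set (map2 (\<circ>) \<alpha>s \<beta>s)" for \<sigma>
  proof -
    obtain a b where ab: "(a, b) \<in> set (zip \<alpha>s \<beta>s)" "\<sigma> = a \<circ> b" using \<sigma> by auto
    have "a permutes K" by (rule \<alpha>(2)[OF set_zip_leftD[OF ab(1)]])
    moreover have "b permutes L" by (rule \<beta>(2)[OF set_zip_rightD[OF ab(1)]])
    ultimately have "a permutes (K \<union> L)" "b permutes (K \<union> L)" by (auto elim: permutes_subset)
    then show ?thesis unfolding ab(2) by (intro permutes_compose)
  qed
  ultimately show ?thesis using \<alpha>(1) \<beta>(1) by (simp add: id_tuples_def)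
qed

lemma perm_restrict_comp_disjoint:
  assumes "\<alpha> permutes K" "\<beta> permutes L" "K \<inter> L = {}"
  shows "perm_restrict (\<alpha> \<circ> \<beta>) K = \<alpha>" "perm_restrict (\<alpha> \<circ> \<beta>) L = \<beta>"
proof -
  have K: "\<beta> x = x" if "x \<in> K" for x using that assms(3) by (intro permutes_not_in[OF assms(2)]) auto
  have L: "\<alpha> x = x" if "x \<in> L" for x using that assms(3) by (intro permutes_not_in[OF assms(1)]) auto
  have L': "\<beta> x \<in> L" if "x \<in> L" for x using that permutes_in_image[OF assms(2)] by simp
  show "perm_restrict (\<alpha> \<circ> \<beta>) K = \<alpha>"
    using permutes_not_in[OF assms(1)] K by (auto simp: perm_restrict_def fun_eq_iff)
  show "perm_restrict (\<alpha> \<circ> \<beta>) L = \<beta>"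
    using permutes_not_in[OF assms(2)] L L' by (auto simp: perm_restrict_def fun_eq_iff)
qed

lemma perm_restrict_partition:
  assumes "\<sigma> permutes A" "K \<subseteq> A" "\<sigma> ` (A - K) \<subseteq> A - K"
  shows "perm_restrict \<sigma> K \<circ> perm_restrict \<sigma> (A - K) = \<sigma>"
proof
  fix x show "(perm_restrict \<sigma> K \<circ> perm_restrict \<sigma> (A - K)) x = \<sigma> x"
    using assms permutes_not_in[OF assms(1), of x] by (auto simp: perm_restrict_def)
qed

lemma cycles_on_comp_disjoint:
  assumes "finite K" "finite L" "\<alpha> permutes K" "\<beta> permutes L" "K \<inter> L = {}"
  shows "cycles_on (K \<union> L) (\<alpha> \<circ> \<beta>) = cycles_on K \<alpha> \<union> cycles_on L \<beta>"
    and "cycles_on K \<alpha> \<inter> cycles_on L \<beta> = {}"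
proof -
  have p: "permutation \<alpha>" "permutation \<beta>" using permutes_permutation assms(1-4) by metis+
  have sub: "orbit \<alpha> x \<subseteq> K" if "x \<in> K" for x using permutes_orbit_subset[OF assms(3) that] .
  have sub': "orbit \<beta> x \<subseteq> L" if "x \<in> L" for x using permutes_orbit_subset[OF assms(4) that] .
  have "orbit (\<alpha> \<circ> \<beta>) x = orbit \<alpha> x" if "x \<in> K" for x
  proof (rule orbit_cong)
    show "x \<in> orbit \<alpha> x" by (rule permutation_self_in_orbit[OF p(1)])
    fix s assume "s \<in> orbit \<alpha> x"
    then have "s \<notin> L" using sub[OF that] assms(5) by blast
    then show "(\<alpha> \<circ> \<beta>) s = \<alpha> s" using permutes_not_in[OF assms(4)] by simp
  qed
  moreover have "orbit (\<alpha> \<circ> \<beta>) x = orbit \<beta> x" if "x \<in> L" for x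
  proof (rule orbit_cong)
    show "x \<in> orbit \<beta> x" by (rule permutation_self_in_orbit[OF p(2)])
    fix s assume "s \<in> orbit \<beta> x"
    then have "\<beta> s \<in> L" using sub'[OF that] permutes_in_image[OF assms(4)] by blast
    then have "\<beta> s \<notin> K" using assms(5) by blast
    then show "(\<alpha> \<circ> \<beta>) s = \<beta> s" using permutes_not_in[OF assms(3)] by simp
  qed
  ultimately show "cycles_on (K \<union> L) (\<alpha> \<circ> \<beta>) = cycles_on K \<alpha> \<union> cycles_on L \<beta>"
    by (simp add: cycles_on_def image_Un)
  show "cycles_on K \<alpha> \<inter> cycles_on L \<beta> = {}"
  proof (rule equals0I)
    fix C assume "C \<in> cycles_on K \<alpha> \<inter> cycles_on L \<beta>"
    then obtain x y where xy: "x \<in> K" "y \<in> L" "C = orbit \<alpha> x" "C = orbit \<beta> y"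
      unfolding cycles_on_def by blast
    then have "x \<in> C" using permutation_self_in_orbit[OF p(1)] by simp
    then have "x \<in> L" using sub'[OF xy(2)] xy(4) by blast
    then show False using xy(1) assms(5) by blast
  qed
qed

lemma perm_length_comp_disjoint:
  assumes "finite K" "finite L" "\<alpha> permutes K" "\<beta> permutes L" "K \<inter> L = {}"
  shows "perm_length (K \<union> L) (\<alpha> \<circ> \<beta>) = perm_length K \<alpha> + perm_length L \<beta>"
  using cycles_on_comp_disjoint[OF assms] card_cycles_on_le[OF assms(1), of \<alpha>]
    card_cycles_on_le[OF assms(2), of \<beta>] finite_cycles_on[OF assms(1)] finite_cycles_on[OF assms(2)] assms(1,2,5)
  by (simp add: perm_length_def card_Un_disjoint)

lemma cyc_monom_comp_disjoint:
  assumes "finite K" "finite L" "\<alpha> permutes K" "\<beta> permutes L" "K \<inter> L = {}"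
  shows "cyc_monom (K \<union> L) (\<alpha> \<circ> \<beta>) = cyc_monom K \<alpha> * cyc_monom L \<beta>"
  using cycles_on_comp_disjoint[OF assms] finite_cycles_on[OF assms(1)] finite_cycles_on[OF assms(2)]
  by (simp add: cyc_monom_def prod.union_disjoint)

lemma tuple_weight_map2:
  fixes h :: "'a :: field_char_0"
  assumes "\<alpha>s \<in> id_tuples m K" "\<beta>s \<in> id_tuples m L" "K \<inter> L = {}" "finite K" "finite L"
  shows "tuple_weight h (K \<union> L) (map2 (\<circ>) \<alpha>s \<beta>s) = tuple_weight h K \<alpha>s * tuple_weight h L \<beta>s"
proof -
  note \<alpha> = id_tuplesD[OF assms(1)] and \<beta> = id_tuplesD[OF assms(2)]
  have len: "length \<alpha>s = length \<beta>s" using \<alpha>(1) \<beta>(1) by simp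
  have "\<forall>\<alpha>\<in>set \<alpha>s. \<alpha> permutes K" "\<forall>\<beta>\<in>set \<beta>s. \<beta> permutes L" using \<alpha>(2) \<beta>(2) by auto
  with len have "(\<Sum>\<sigma>\<leftarrow>map2 (\<circ>) \<alpha>s \<beta>s. perm_length (K \<union> L) \<sigma>)
      = (\<Sum>\<sigma>\<leftarrow>\<alpha>s. perm_length K \<sigma>) + (\<Sum>\<sigma>\<leftarrow>\<beta>s. perm_length L \<sigma>)"
    by (induction \<alpha>s \<beta>s rule: list_induct2) (simp_all add: perm_length_comp_disjoint assms)
  moreover obtain a \<alpha>' b \<beta>' where ab: "\<alpha>s = a # \<alpha>'" "\<beta>s = b # \<beta>'"
    using \<alpha>(1) \<beta>(1) by (metis length_Suc_conv)
  moreover have "a permutes K" "b permutes L" using \<alpha>(2) \<beta>(2) ab by auto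
  ultimately show ?thesis
    unfolding tuple_weight_def by (simp add: cyc_monom_comp_disjoint assms power_add mps_const_mult)
qed

text \<open>The orbit of \<open>x\<close> under the generated group, obtained from closure under
  forward images alone; for permutations of a finite set the inverses then preserve it as
  well.\<close>

definition component :: "('b \<Rightarrow> 'b) list \<Rightarrow> 'b \<Rightarrow> 'b set" where
  "component \<sigma>s x = \<Inter>{S. x \<in> S \<and> invariant_set \<sigma>s S}"

lemma component_self: "x \<in> component \<sigma>s x"
  by (simp add: component_def)

lemma component_invariant: "invariant_set \<sigma>s (component \<sigma>s x)"
  unfolding invariant_set_def
proof (intro ballI image_subsetI)
  fix \<sigma> y assume \<sigma>: "\<sigma> \<in> set \<sigma>s" and y: "y \<in> component \<sigma>s x"
  have "\<sigma> y \<in> S" if "x \<in> S" "invariant_set \<sigma>s S" for S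
    using y that by (intro invariant_setD[OF that(2) \<sigma>]) (simp add: component_def)
  then show "\<sigma> y \<in> component \<sigma>s x" by (simp add: component_def)
qed

lemma component_least: "x \<in> S \<Longrightarrow> invariant_set \<sigma>s S \<Longrightarrow> component \<sigma>s x \<subseteq> S"
  by (auto simp: component_def)

lemma map_perm_restrict_map2:
  assumes "\<alpha>s \<in> id_tuples m K" "\<beta>s \<in> id_tuples m L" "K \<inter> L = {}"
  shows "map (\<lambda>\<sigma>. perm_restrict \<sigma> K) (map2 (\<circ>) \<alpha>s \<beta>s) = \<alpha>s" (is ?A)
    and "map (\<lambda>\<sigma>. perm_restrict \<sigma> L) (map2 (\<circ>) \<alpha>s \<beta>s) = \<beta>s" (is ?B)
proof -
  note \<alpha> = id_tuplesD[OF assms(1)] and \<beta> = id_tuplesD[OF assms(2)]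
  have len: "length \<alpha>s = length \<beta>s" using \<alpha>(1) \<beta>(1) by simp
  have "\<forall>\<alpha>\<in>set \<alpha>s. \<alpha> permutes K" "\<forall>\<beta>\<in>set \<beta>s. \<beta> permutes L" using \<alpha>(2) \<beta>(2) by auto
  with len have "?A \<and> ?B"
    by (induction \<alpha>s \<beta>s rule: list_induct2) (simp_all add: perm_restrict_comp_disjoint[OF _ _ assms(3)])
  then show ?A ?B by auto
qed

lemma invariant_set_perm_restrict:
  assumes "S \<subseteq> K"
  shows "invariant_set (map (\<lambda>\<sigma>. perm_restrict \<sigma> K) \<sigma>s) S \<longleftrightarrow> invariant_set \<sigma>s S"
  using assms by (auto simp: invariant_set_def perm_restrict_def subset_iff)

text \<open>If a nonempty invariant subset of the component missed \<open>x\<close>, its complement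
  in the component would be a smaller invariant set around \<open>x\<close>. If it contains
  \<open>x\<close>, minimality applies directly.\<close>

lemma connected_component:
  assumes \<sigma>s: "\<sigma>s \<in> id_tuples m A" and A: "finite A" and x: "x \<in> A"
  defines "K \<equiv> component \<sigma>s x"
  shows "map (\<lambda>\<sigma>. perm_restrict \<sigma> K) \<sigma>s \<in> connected_tuples m K" "K \<subseteq> A" "invariant_set \<sigma>s (A - K)"
proof -
  show KA: "K \<subseteq> A" unfolding K_def by (rule component_least[OF x id_tuples_invariant_set[OF \<sigma>s]])
  have fin: "finite K" using KA A finite_subset by blast
  have inv: "invariant_set \<sigma>s K" unfolding K_def by (rule component_invariant)
  note perm = id_tuplesD(2)[OF \<sigma>s]
  show "invariant_set \<sigma>s (A - K)"
    by (rule invariant_set_diff[OF perm fin inv id_tuples_invariant_set[OF \<sigma>s]])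
  have "S = K" if S: "S \<subseteq> K" "S \<noteq> {}" "invariant_set \<sigma>s S" for S
  proof (cases "x \<in> S")
    case True
    then have "K \<subseteq> S" unfolding K_def by (rule component_least[OF _ S(3)])
    then show ?thesis using S(1) by blast
  next
    case False
    have "finite S" using S(1) fin finite_subset by blast
    have "invariant_set \<sigma>s (K - S)" by (rule invariant_set_diff[OF perm \<open>finite S\<close> S(3) inv])
    moreover have "x \<in> K - S" using False component_self[of x \<sigma>s] unfolding K_def by simp
    ultimately have "K \<subseteq> K - S" using component_least[of x "K - S" \<sigma>s] unfolding K_def by simp
    then show ?thesis using S(1,2) by blast
  qed
  then show "map (\<lambda>\<sigma>. perm_restrict \<sigma> K) \<sigma>s \<in> connected_tuples m K"
    unfolding connected_tuples_def
    by (intro CollectI conjI allI impI)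
      (rule perm_restrict_id_tuple[OF \<sigma>s fin inv], simp add: invariant_set_perm_restrict)
qed

text \<open>The component lies in the invariant set \<open>K\<close>. There only
  \<open>\<alpha>s\<close> acts, and its connectedness makes every nonempty invariant subset equal
  to \<open>K\<close>.\<close>

lemma component_map2:
  assumes \<alpha>s: "\<alpha>s \<in> connected_tuples m K" and \<beta>s: "\<beta>s \<in> id_tuples m L" and "K \<inter> L = {}" "x \<in> K"
  shows "component (map2 (\<circ>) \<alpha>s \<beta>s) x = K"
proof -
  have \<alpha>: "\<alpha>s \<in> id_tuples m K" using \<alpha>s by (simp add: connected_tuples_def)
  let ?\<sigma>s = "map2 (\<circ>) \<alpha>s \<beta>s"
  have eq: "invariant_set ?\<sigma>s S \<longleftrightarrow> invariant_set \<alpha>s S" if "S \<subseteq> K" for S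
    using invariant_set_perm_restrict[OF that, of ?\<sigma>s] map_perm_restrict_map2(1)[OF \<alpha> \<beta>s assms(3)] by simp
  have K: "invariant_set ?\<sigma>s K" using eq[of K] id_tuples_invariant_set[OF \<alpha>] by simp
  have sub: "component ?\<sigma>s x \<subseteq> K" by (rule component_least[OF assms(4) K])
  have ne: "component ?\<sigma>s x \<noteq> {}" by (rule ex_in_conv[THEN iffD1, OF exI, OF component_self])
  have inv: "invariant_set \<alpha>s (component ?\<sigma>s x)" by (rule eq[OF sub, THEN iffD1, OF component_invariant])
  show ?thesis by (rule connected_tuplesD[OF \<alpha>s sub ne inv])
qed

definition tuple_sum :: "'a :: field_char_0 \<Rightarrow> nat \<Rightarrow> 'b set \<Rightarrow> (nat, 'a) mps" where
  "tuple_sum h m A = (\<Sum>\<sigma>s\<in>id_tuples m A. tuple_weight h A \<sigma>s)"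

definition connected_sum :: "'a :: field_char_0 \<Rightarrow> nat \<Rightarrow> 'b set \<Rightarrow> (nat, 'a) mps" where
  "connected_sum h m A = (\<Sum>\<sigma>s\<in>connected_tuples m A. tuple_weight h A \<sigma>s)"

text \<open>Restriction to \<open>K\<close> and to \<open>A - K\<close> and entrywise composition
  are inverse to each other, and the weights are multiplicative. The part on \<open>K\<close> is
  connected, while the part on \<open>A - K\<close> is arbitrary.\<close>

lemma tuple_sum_component:
  fixes h :: "'a :: field_char_0"
  assumes A: "finite A" and K: "K \<subseteq> A" "x \<in> K"
  shows "(\<Sum>\<sigma>s | \<sigma>s \<in> id_tuples m A \<and> component \<sigma>s x = K. tuple_weight h A \<sigma>s)
    = connected_sum h m K * tuple_sum h m (A - K)"
proof -
  have fin: "finite K" "finite (A - K)" using A K finite_subset by auto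
  have AK: "K \<union> (A - K) = A" "K \<inter> (A - K) = {}" using K by auto
  have xA: "x \<in> A" using K by blast
  have "(\<Sum>\<sigma>s | \<sigma>s \<in> id_tuples m A \<and> component \<sigma>s x = K. tuple_weight h A \<sigma>s)
    = (\<Sum>(\<alpha>s, \<beta>s)\<in>connected_tuples m K \<times> id_tuples m (A - K). tuple_weight h K \<alpha>s * tuple_weight h (A - K) \<beta>s)"
  proof (rule sum.reindex_bij_witness[of _ "\<lambda>(\<alpha>s, \<beta>s). map2 (\<circ>) \<alpha>s \<beta>s"
        "\<lambda>\<sigma>s. (map (\<lambda>\<sigma>. perm_restrict \<sigma> K) \<sigma>s, map (\<lambda>\<sigma>. perm_restrict \<sigma> (A - K)) \<sigma>s)"])
    fix \<sigma>s assume "\<sigma>s \<in> {\<sigma>s. \<sigma>s \<in> id_tuples m A \<and> component \<sigma>s x = K}"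
    then have \<sigma>s: "\<sigma>s \<in> id_tuples m A" and comp: "component \<sigma>s x = K" by auto
    let ?\<alpha>s = "map (\<lambda>\<sigma>. perm_restrict \<sigma> K) \<sigma>s" and ?\<beta>s = "map (\<lambda>\<sigma>. perm_restrict \<sigma> (A - K)) \<sigma>s"
    note c = connected_component[OF \<sigma>s A xA, unfolded comp]
    have "map2 (\<circ>) ?\<alpha>s ?\<beta>s = map (\<lambda>\<sigma>. perm_restrict \<sigma> K \<circ> perm_restrict \<sigma> (A - K)) \<sigma>s"
      by (simp add: zip_map_map zip_same_conv_map)
    also have "\<dots> = map (\<lambda>\<sigma>. \<sigma>) \<sigma>s"
    proof (rule map_cong[OF refl])
      fix \<sigma> assume \<sigma>: "\<sigma> \<in> set \<sigma>s"
      then show "perm_restrict \<sigma> K \<circ> perm_restrict \<sigma> (A - K) = \<sigma>"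
        using c(3) by (intro perm_restrict_partition[OF id_tuplesD(2)[OF \<sigma>s \<sigma>] K(1)]) (simp add: invariant_set_def)
    qed
    finally have m2: "map2 (\<circ>) ?\<alpha>s ?\<beta>s = \<sigma>s" by simp
    then show "(case (?\<alpha>s, ?\<beta>s) of (\<alpha>s, \<beta>s) \<Rightarrow> map2 (\<circ>) \<alpha>s \<beta>s) = \<sigma>s" by (simp only: prod.case)
    have b: "?\<beta>s \<in> id_tuples m (A - K)" by (rule perm_restrict_id_tuple[OF \<sigma>s fin(2) c(3)])
    then show "(?\<alpha>s, ?\<beta>s) \<in> connected_tuples m K \<times> id_tuples m (A - K)" using c(1) by simp
    have a: "?\<alpha>s \<in> id_tuples m K" using c(1) by (simp add: connected_tuples_def)
    show "(case (?\<alpha>s, ?\<beta>s) of (\<alpha>s, \<beta>s) \<Rightarrow> tuple_weight h K \<alpha>s * tuple_weight h (A - K) \<beta>s) = tuple_weight h A \<sigma>s"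
      using tuple_weight_map2[OF a b AK(2) fin, of h] unfolding m2 AK(1) by simp
  next
    fix p assume "p \<in> connected_tuples m K \<times> id_tuples m (A - K)"
    then obtain \<alpha>s \<beta>s where p: "p = (\<alpha>s, \<beta>s)" and \<alpha>s: "\<alpha>s \<in> connected_tuples m K"
      and \<beta>s: "\<beta>s \<in> id_tuples m (A - K)" by blast
    have a: "\<alpha>s \<in> id_tuples m K" using \<alpha>s by (simp add: connected_tuples_def)
    show "(map (\<lambda>\<sigma>. perm_restrict \<sigma> K) (case p of (\<alpha>s, \<beta>s) \<Rightarrow> map2 (\<circ>) \<alpha>s \<beta>s),
        map (\<lambda>\<sigma>. perm_restrict \<sigma> (A - K)) (case p of (\<alpha>s, \<beta>s) \<Rightarrow> map2 (\<circ>) \<alpha>s \<beta>s)) = p"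
      unfolding p prod.case map_perm_restrict_map2[OF a \<beta>s AK(2)] ..
    have "map2 (\<circ>) \<alpha>s \<beta>s \<in> id_tuples m A" using id_tuples_map2[OF a \<beta>s AK(2)] unfolding AK(1) .
    then show "(case p of (\<alpha>s, \<beta>s) \<Rightarrow> map2 (\<circ>) \<alpha>s \<beta>s) \<in> {\<sigma>s. \<sigma>s \<in> id_tuples m A \<and> component \<sigma>s x = K}"
      using component_map2[OF \<alpha>s \<beta>s AK(2) K(2)] by (simp add: p)
  qed
  also have "\<dots> = connected_sum h m K * tuple_sum h m (A - K)"
    unfolding connected_sum_def tuple_sum_def by (simp add: sum_product sum.cartesian_product)
  finally show ?thesis .
qed

lemma tuple_sum_recursion:
  fixes h :: "'a :: field_char_0"
  assumes A: "finite A" and x: "x \<in> A"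
  shows "tuple_sum h m A = (\<Sum>K | K \<subseteq> A \<and> x \<in> K. connected_sum h m K * tuple_sum h m (A - K))"
proof -
  have "component \<sigma>s x \<in> {K. K \<subseteq> A \<and> x \<in> K}" if "\<sigma>s \<in> id_tuples m A" for \<sigma>s
    using connected_component(2)[OF that A x] component_self[of x \<sigma>s] by simp
  then have "tuple_sum h m A = (\<Sum>K | K \<subseteq> A \<and> x \<in> K.
      \<Sum>\<sigma>s | \<sigma>s \<in> id_tuples m A \<and> component \<sigma>s x = K. tuple_weight h A \<sigma>s)"
    unfolding tuple_sum_def using A
    by (intro sum.group[symmetric] finite_id_tuples) auto
  also have "\<dots> = (\<Sum>K | K \<subseteq> A \<and> x \<in> K. connected_sum h m K * tuple_sum h m (A - K))"
    by (rule sum.cong[OF refl]) (simp add: tuple_sum_component[OF A])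
  finally show ?thesis .
qed

section \<open>Relabelling the points\<close>

definition conj_by :: "('b \<Rightarrow> 'b) \<Rightarrow> ('b \<Rightarrow> 'b) \<Rightarrow> 'b \<Rightarrow> 'b" where
  "conj_by \<pi> \<sigma> = \<pi> \<circ> \<sigma> \<circ> inv' \<pi>"

lemma conj_by_apply: "bij \<pi> \<Longrightarrow> conj_by \<pi> \<sigma> (\<pi> x) = \<pi> (\<sigma> x)"
  by (simp add: conj_by_def bij_is_inj)

lemma conj_by_inv: "bij \<pi> \<Longrightarrow> conj_by (inv' \<pi>) (conj_by \<pi> \<sigma>) = \<sigma>"
  by (simp add: conj_by_def fun_eq_iff inv_inv_eq bij_is_inj)

lemma conj_by_permutes:
  assumes "bij \<pi>" "\<sigma> permutes A" shows "conj_by \<pi> \<sigma> permutes \<pi> ` A"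
proof -
  have "bij (conj_by \<pi> \<sigma>)"
    unfolding conj_by_def by (intro bij_comp bij_imp_bij_inv assms(1) permutes_bij[OF assms(2)])
  moreover have "conj_by \<pi> \<sigma> y = y" if "y \<notin> \<pi> ` A" for y
  proof -
    obtain x where y: "y = \<pi> x" using assms(1) by (metis bij_is_surj surjD)
    then have "x \<notin> A" using that by blast
    then show ?thesis by (simp add: y conj_by_apply[OF assms(1)] permutes_not_in[OF assms(2)])
  qed
  ultimately show ?thesis by (simp add: permutes_def bij_iff)
qed

lemma foldr_conj_by:
  assumes "bij \<pi>" shows "foldr (\<circ>) (map (conj_by \<pi>) \<sigma>s) id = conj_by \<pi> (foldr (\<circ>) \<sigma>s id)"
proof -
  have "foldr (\<circ>) (map (conj_by \<pi>) \<sigma>s) id (\<pi> x) = conj_by \<pi> (foldr (\<circ>) \<sigma>s id) (\<pi> x)" for x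
    by (induction \<sigma>s) (simp_all add: conj_by_apply[OF assms])
  moreover have "\<exists>x. y = \<pi> x" for y using assms by (metis bij_is_surj surjD)
  ultimately show ?thesis by (metis ext)
qed

lemma id_tuples_conj_by:
  assumes "bij \<pi>" "\<sigma>s \<in> id_tuples m A" shows "map (conj_by \<pi>) \<sigma>s \<in> id_tuples m (\<pi> ` A)"
proof -
  have "conj_by \<pi> id = id" using assms(1) by (simp add: conj_by_def bij_is_surj surj_iff[symmetric])
  then show ?thesis
    using id_tuplesD[OF assms(2)] conj_by_permutes[OF assms(1)] foldr_conj_by[OF assms(1), of \<sigma>s]
    by (auto simp: id_tuples_def)
qed

lemma invariant_set_conj_by:
  assumes "bij \<pi>" shows "invariant_set (map (conj_by \<pi>) \<sigma>s) (\<pi> ` S) \<longleftrightarrow> invariant_set \<sigma>s S"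
  by (auto simp: invariant_set_def image_subset_iff conj_by_apply[OF assms] inj_image_mem_iff[OF bij_is_inj[OF assms]])

lemma connected_tuples_conj_by:
  assumes "bij \<pi>" "\<sigma>s \<in> connected_tuples m A" shows "map (conj_by \<pi>) \<sigma>s \<in> connected_tuples m (\<pi> ` A)"
proof -
  have \<sigma>s: "\<sigma>s \<in> id_tuples m A" and conn: "\<And>S. S \<subseteq> A \<Longrightarrow> S \<noteq> {} \<Longrightarrow> invariant_set \<sigma>s S \<Longrightarrow> S = A"
    using assms(2) by (auto simp: connected_tuples_def)
  have "T = \<pi> ` A" if T: "T \<subseteq> \<pi> ` A" "T \<noteq> {}" "invariant_set (map (conj_by \<pi>) \<sigma>s) T" for T
  proof -
    obtain S where S: "S \<subseteq> A" "T = \<pi> ` S" using T(1) by (auto simp: subset_image_iff)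
    then have "S = A" using T(2,3) by (intro conn) (auto simp: invariant_set_conj_by[OF assms(1)])
    then show ?thesis using S by simp
  qed
  then show ?thesis using id_tuples_conj_by[OF assms(1) \<sigma>s] by (simp add: connected_tuples_def)
qed

lemma cycles_on_conj_by:
  assumes "bij \<pi>" "\<sigma> permutes A" "finite A"
  shows "cycles_on (\<pi> ` A) (conj_by \<pi> \<sigma>) = image \<pi> ` cycles_on A \<sigma>"
proof -
  have "orbit (conj_by \<pi> \<sigma>) (\<pi> x) = \<pi> ` orbit \<sigma> x" for x
    by (rule orbit_inverse[symmetric])
      (simp_all add: conj_by_apply[OF assms(1)] permutation_self_in_orbit[OF permutes_permutation[OF assms(2,3)]])
  then show ?thesis by (simp add: cycles_on_def image_image)
qed

lemma inj_image_set: "bij \<pi> \<Longrightarrow> inj_on (image \<pi>) X"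
  by (rule inj_onI) (simp add: inj_image_eq_iff[OF bij_is_inj])

lemma card_image_bij: "bij \<pi> \<Longrightarrow> card (\<pi> ` A) = card A"
  by (intro card_image inj_on_subset[OF bij_is_inj]) auto

lemma perm_length_conj_by:
  assumes "bij \<pi>" "\<sigma> permutes A" "finite A"
  shows "perm_length (\<pi> ` A) (conj_by \<pi> \<sigma>) = perm_length A \<sigma>"
  unfolding perm_length_def cycles_on_conj_by[OF assms]
  by (simp add: card_image_bij[OF assms(1)] card_image[OF inj_image_set[OF assms(1)]])

lemma cyc_monom_conj_by:
  assumes "bij \<pi>" "\<sigma> permutes A" "finite A"
  shows "cyc_monom (\<pi> ` A) (conj_by \<pi> \<sigma>) = cyc_monom A \<sigma>"
  unfolding cyc_monom_def cycles_on_conj_by[OF assms] prod.reindex[OF inj_image_set[OF assms(1)]]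
  by (simp add: card_image_bij[OF assms(1)])

lemma tuple_weight_conj_by:
  fixes h :: "'a :: field_char_0"
  assumes "bij \<pi>" "\<sigma>s \<in> id_tuples m A" "finite A"
  shows "tuple_weight h (\<pi> ` A) (map (conj_by \<pi>) \<sigma>s) = tuple_weight h A \<sigma>s"
proof -
  note d = id_tuplesD[OF assms(2)]
  have "map (perm_length (\<pi> ` A)) (map (conj_by \<pi>) \<sigma>s) = map (perm_length A) \<sigma>s"
    unfolding map_map comp_def by (rule map_cong[OF refl]) (rule perm_length_conj_by[OF assms(1) d(2) assms(3)])
  moreover have ne: "\<sigma>s \<noteq> []" using d(1) by auto
  moreover have "cyc_monom (\<pi> ` A) (conj_by \<pi> (hd \<sigma>s)) = (cyc_monom A (hd \<sigma>s) :: (nat, 'a) mps)"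
    by (rule cyc_monom_conj_by[OF assms(1) d(2)[OF hd_in_set[OF ne]] assms(3)])
  ultimately show ?thesis
    unfolding tuple_weight_def by (simp only: hd_map[OF ne])
qed

text \<open>The bijection is wanted on the whole type, because permutations are total functions and
  are conjugated by it. Points are added one at a time: a transposition moves the image of the new
  point \<open>a\<close> to \<open>b\<close> and preserves \<open>B'\<close>, which contains neither
  of the two.\<close>

lemma exists_bij_image:
  fixes A B :: "'b set"
  assumes "finite A" "card A = card B" "finite B"
  shows "\<exists>\<pi>. bij \<pi> \<and> \<pi> ` A = B"
  using assms
proof (induction A arbitrary: B rule: finite_induct)
  case empty
  then show ?case using bij_id by auto
next
  case (insert a A)
  then obtain b B' where b: "B = insert b B'" "b \<notin> B'" "card A = card B'" "finite B'"
    by (metis card_Suc_eq card_insert_disjoint finite_insert)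
  then obtain \<pi> where \<pi>: "bij \<pi>" "\<pi> ` A = B'" using insert.IH[of B'] by blast
  have a: "\<pi> a \<notin> B'" using insert(2) \<pi> inj_image_mem_iff[OF bij_is_inj[OF \<pi>(1)]] by blast
  have "(transpose (\<pi> a) b \<circ> \<pi>) ` insert a A = insert b (transpose (\<pi> a) b ` B')"
    unfolding \<pi>(2)[symmetric] by (simp add: image_image)
  also have "transpose (\<pi> a) b ` B' = B'" using a b(2) by simp
  finally have "(transpose (\<pi> a) b \<circ> \<pi>) ` insert a A = B" by (simp add: b(1))
  moreover have "bij (transpose (\<pi> a) b \<circ> \<pi>)" by (intro bij_comp \<pi>(1)) simp
  ultimately show ?case by blast
qed

lemma
  fixes h :: "'a :: field_char_0" and A B :: "'b set"
  assumes fin: "finite A" "finite B" and "card A = card B"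
  shows tuple_sum_cong_card: "tuple_sum h m A = tuple_sum h m B"
    and connected_sum_cong_card: "connected_sum h m A = connected_sum h m B"
proof -
  obtain \<pi> :: "'b \<Rightarrow> 'b" where \<pi>: "bij \<pi>" "\<pi> ` A = B" using exists_bij_image[OF fin(1) assms(3) fin(2)] by blast
  have \<pi>': "bij (inv' \<pi>)" "inv' \<pi> ` B = A"
    using \<pi> bij_imp_bij_inv by (auto simp: image_inv_f_f bij_is_inj)
  have i1: "map (conj_by (inv' \<pi>)) (map (conj_by \<pi>) \<sigma>s) = \<sigma>s" for \<sigma>s
    by (simp add: conj_by_inv[OF \<pi>(1)] comp_def)
  have i2: "map (conj_by \<pi>) (map (conj_by (inv' \<pi>)) \<sigma>s) = \<sigma>s" for \<sigma>s
    using conj_by_inv[OF \<pi>'(1)] by (simp add: inv_inv_eq[OF \<pi>(1)] comp_def)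
  have w: "tuple_weight h B (map (conj_by \<pi>) \<sigma>s) = tuple_weight h A \<sigma>s" if "\<sigma>s \<in> id_tuples m A" for \<sigma>s
    using tuple_weight_conj_by[OF \<pi>(1) that fin(1)] by (simp add: \<pi>(2))
  show "tuple_sum h m A = tuple_sum h m B"
    unfolding tuple_sum_def
    by (rule sum.reindex_bij_witness[of _ "map (conj_by (inv' \<pi>))" "map (conj_by \<pi>)"])
      (use id_tuples_conj_by[OF \<pi>(1)] id_tuples_conj_by[OF \<pi>'(1)] \<pi>(2) \<pi>'(2) i1 i2 w in \<open>metis\<close>)+
  have sub: "\<sigma>s \<in> id_tuples m A" if "\<sigma>s \<in> connected_tuples m A" for \<sigma>s
    using that by (simp add: connected_tuples_def)
  show "connected_sum h m A = connected_sum h m B"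
    unfolding connected_sum_def
    by (rule sum.reindex_bij_witness[of _ "map (conj_by (inv' \<pi>))" "map (conj_by \<pi>)"])
      (use connected_tuples_conj_by[OF \<pi>(1)] connected_tuples_conj_by[OF \<pi>'(1)] \<pi>(2) \<pi>'(2) i1 i2 w sub in \<open>metis\<close>)+
qed

text \<open>The component of the point \<open>Suc n\<close> consists of it and of \<open>k\<close>
  points chosen among \<open>{1..n}\<close>, and both sums depend only on the sizes of the
  sets.\<close>

lemma tuple_sum_nat_recursion:
  fixes h :: "'a :: field_char_0"
  shows "tuple_sum h m {1..Suc n} = (\<Sum>k\<le>n. of_nat (n choose k) *
    (connected_sum h m {1..Suc k} * tuple_sum h m {1..n - k}))"
proof -
  let ?A = "{1..Suc n}" and ?x = "Suc n"
  let ?F = "\<lambda>K. connected_sum h m K * tuple_sum h m (?A - K)"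
  let ?G = "\<lambda>k. connected_sum h m {1..Suc k} * tuple_sum h m {1..n - k}"
  have A: "?A = insert ?x {1..n}" by auto
  have K: "{K. K \<subseteq> ?A \<and> ?x \<in> K} = insert ?x ` Pow {1..n}"
  proof (rule Set.set_eqI)
    fix K
    have "K = insert ?x (K - {?x}) \<and> K - {?x} \<in> Pow {1..n}" if "K \<subseteq> ?A" "?x \<in> K"
      using that unfolding A by auto
    then show "K \<in> {K. K \<subseteq> ?A \<and> ?x \<in> K} \<longleftrightarrow> K \<in> insert ?x ` Pow {1..n}"
      unfolding A by blast
  qed
  have inj: "inj_on (insert ?x) (Pow {1..n})"
  proof (rule inj_onI)
    fix B B' assume "B \<in> Pow {1..n}" "B' \<in> Pow {1..n}" and eq: "insert ?x B = insert ?x B'"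
    then have "?x \<notin> B" "?x \<notin> B'" by auto
    then show "B = B'" using eq by (metis Diff_insert_absorb)
  qed
  have FG: "?F (insert ?x B) = ?G (card B)" if B: "B \<subseteq> {1..n}" for B
  proof -
    have fB: "finite B" using B finite_subset by blast
    have nB: "?x \<notin> B" using B by auto
    have "card (?A - insert ?x B) = card ({1..n} - B)" using nB by (intro arg_cong[of _ _ card]) auto
    also have "\<dots> = n - card B" using B fB by (simp add: card_Diff_subset)
    finally have "tuple_sum h m (?A - insert ?x B) = tuple_sum h m {1..n - card B}"
      by (intro tuple_sum_cong_card) auto
    moreover have "connected_sum h m (insert ?x B) = connected_sum h m {1..Suc (card B)}"
      using fB nB by (intro connected_sum_cong_card) auto
    ultimately show ?thesis by simp
  qed
  have "tuple_sum h m ?A = (\<Sum>K\<in>insert ?x ` Pow {1..n}. ?F K)"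
    unfolding K[symmetric] by (rule tuple_sum_recursion) auto
  also have "\<dots> = (\<Sum>B\<in>Pow {1..n}. ?F (insert ?x B))" by (rule sum.reindex_cong[OF inj refl refl])
  also have "\<dots> = (\<Sum>B\<in>Pow {1..n}. ?G (card B))" using FG by (intro sum.cong) auto
  also have "\<dots> = (\<Sum>k\<le>n. \<Sum>B | B \<in> Pow {1..n} \<and> card B = k. ?G (card B))"
  proof (rule sum.group[symmetric])
    show "card ` Pow {1..n} \<subseteq> {..n}" using card_mono[of "{1..n}"] by fastforce
  qed auto
  also have "\<dots> = (\<Sum>k\<le>n. of_nat (n choose k) * ?G k)"
  proof (rule sum.cong[OF refl])
    fix k
    have "card {B. B \<in> Pow {1..n} \<and> card B = k} = n choose k"
      using n_subsets[of "{1..n}" k] by simp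
    then show "(\<Sum>B | B \<in> Pow {1..n} \<and> card B = k. ?G (card B)) = of_nat (n choose k) * ?G k"
      by simp
  qed
  finally show ?thesis .
qed

lemma tuple_sum_empty:
  fixes h :: "'a :: field_char_0"
  shows "tuple_sum h m ({} :: 'b set) = 1"
proof -
  have "foldr (\<circ>) (replicate k id) id = id" for k by (induction k) simp_all
  then have "id_tuples m ({} :: 'b set) = {replicate (Suc m) id}"
    by (auto simp: id_tuples_def permutes_empty replicate_eqI simp del: replicate_Suc)
  moreover have "perm_length ({} :: 'b set) id = 0" "cyc_monom ({} :: 'b set) id = (1 :: (nat, 'a) mps)"
    by (simp_all add: perm_length_def cycles_on_def cyc_monom_def)
  ultimately show ?thesis by (simp add: tuple_sum_def tuple_weight_def map_replicate_const sum_list_replicate)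
qed

section \<open>Homogeneity and the exponential formula\<close>

lemma card_cycle_pos:
  assumes "\<sigma> permutes A" "finite A" "C \<in> cycles_on A \<sigma>" shows "card C > 0"
proof -
  obtain x where "C = orbit \<sigma> x" using assms(3) by (auto simp: cycles_on_def)
  then show ?thesis using orbit_enumeration(1)[OF permutes_permutation[OF assms(1,2)], of x] by simp
qed

lemma sum_card_cycles:
  assumes "\<sigma> permutes A" "finite A" shows "(\<Sum>C\<in>cycles_on A \<sigma>. card C) = card A"
proof -
  have "int (\<Sum>C\<in>cycles_on A \<sigma>. card C) = int (card A)"
    using sum_over_cycles[OF assms, of "\<lambda>_. 1 :: int"] by simp
  then show ?thesis by (simp only: of_nat_eq_iff)
qed

lemma mps_hom_cyc_monom:
  assumes "\<sigma> permutes A" "finite A" shows "mps_hom (int (card A)) (cyc_monom A \<sigma>)"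
proof -
  have "int (card A) = (\<Sum>C\<in>cycles_on A \<sigma>. int (card C))"
    by (simp flip: sum_card_cycles[OF assms])
  then show ?thesis
    unfolding cyc_monom_def
    by (simp add: mps_hom_prod mps_hom_var card_cycle_pos[OF assms] finite_cycles_on[OF assms(2)])
qed

lemma mps_hom_tuple_weight:
  assumes "\<sigma>s \<in> id_tuples m A" "finite A" shows "mps_hom (int (card A)) (tuple_weight h A \<sigma>s)"
proof -
  have "hd \<sigma>s \<in> set \<sigma>s" using id_tuplesD(1)[OF assms(1)] by (intro hd_in_set) auto
  then have "hd \<sigma>s permutes A" by (rule id_tuplesD(2)[OF assms(1)])
  then show ?thesis unfolding tuple_weight_def by (intro mps_hom_const_mult mps_hom_cyc_monom assms(2))
qed

text \<open>The binomial coefficient cancels against the factorials, which makes the right-hand side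
  of \<open>tuple_sum_nat_recursion\<close> a product of exponential generating functions; the
  factor \<open>Suc k\<close> comes from differentiating the connected one.\<close>

lemma exponential_coefficients:
  fixes t :: "'a :: field_char_0"
  assumes "k \<le> n"
  shows "of_nat (Suc n) * (t ^ Suc n / fact (Suc n)) * of_nat (n choose k)
    = of_nat (Suc k) * ((t ^ Suc k / fact (Suc k)) * (t ^ (n - k) / fact (n - k)))"
proof -
  have "of_nat (Suc j) * (c / fact (Suc j)) = c / fact j" for c :: 'a and j
    by (simp add: fact_Suc del: of_nat_Suc)
  note f = this
  have "Suc n = Suc k + (n - k)" using assms by simp
  then have t: "t ^ Suc n = t ^ Suc k * t ^ (n - k)" by (metis power_add)
  have "of_nat (Suc n) * (t ^ Suc n / fact (Suc n)) * of_nat (n choose k)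
    = t ^ Suc n / fact n * (fact n / (fact k * fact (n - k)))"
    unfolding f binomial_fact[OF assms] ..
  also have "\<dots> = t ^ Suc k / fact k * (t ^ (n - k) / fact (n - k))" unfolding t by simp
  also have "\<dots> = of_nat (Suc k) * ((t ^ Suc k / fact (Suc k)) * (t ^ (n - k) / fact (n - k)))"
    unfolding f[of k, symmetric] by (simp only: mult.assoc)
  finally show ?thesis .
qed

text \<open>The recursion by the component of the last point is that of an exponential. Every
  component of \<open>k\<close> points takes its own share \<open>t ^ k\<close> of the power of
  \<open>t\<close>, so the scalar is arbitrary here; later it is
  \<open>inverse (hbar ^ 2)\<close>.\<close>

theorem mps_log_tuple_sum:
  fixes h t :: "'a :: field_char_0"
  shows "mps_log (mps_sum (\<lambda>n. mps_const (t ^ n / fact n) * tuple_sum h m {1..n}))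
    = mps_sum (\<lambda>n. if n = 0 then 0 else mps_const (t ^ n / fact n) * connected_sum h m {1..n})"
proof (rule mps_log_mps_sum)
  define Z where "Z n = tuple_sum h m {1..n}" for n :: nat
  define C where "C n = connected_sum h m {1..n}" for n :: nat
  show "mps_hom (int n) (mps_const (t ^ n / fact n) * tuple_sum h m {1..n})" for n
    unfolding tuple_sum_def using mps_hom_tuple_weight[where A = "{1..n}"]
    by (intro mps_hom_const_mult mps_hom_sum) simp
  show "mps_hom (int n) (if n = 0 then 0 else mps_const (t ^ n / fact n) * connected_sum h m {1..n})" for n
    unfolding connected_sum_def connected_tuples_def using mps_hom_tuple_weight[where A = "{1..n}"]
    by (auto intro!: mps_hom_const_mult mps_hom_sum mps_hom_0)
  show "mps_const (t ^ 0 / fact 0) * tuple_sum h m {1..0 :: nat} = 1"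
    by (simp add: tuple_sum_empty)
  fix N :: nat assume "N > 0"
  then obtain n where n: "N = Suc n" by (cases N) auto
  have "of_nat N * (mps_const (t ^ N / fact N) * tuple_sum h m {1..N})
    = (\<Sum>k\<le>n. mps_const (of_nat (Suc n) * (t ^ Suc n / fact (Suc n)) * of_nat (n choose k)) * (C (Suc k) * Z (n - k)))"
    unfolding n tuple_sum_nat_recursion sum_distrib_left of_nat_mps C_def Z_def
    by (simp only: mps_const_mult ac_simps)
  also have "\<dots> = (\<Sum>k\<le>n. of_nat (Suc k) * (mps_const (t ^ Suc k / fact (Suc k)) * C (Suc k) *
      (mps_const (t ^ (n - k) / fact (n - k)) * Z (n - k))))"
  proof (rule sum.cong[OF refl])
    fix k assume "k \<in> {..n}"
    then have "k \<le> n" by simp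
    show "mps_const (of_nat (Suc n) * (t ^ Suc n / fact (Suc n)) * of_nat (n choose k)) * (C (Suc k) * Z (n - k))
      = of_nat (Suc k) * (mps_const (t ^ Suc k / fact (Suc k)) * C (Suc k) *
      (mps_const (t ^ (n - k) / fact (n - k)) * Z (n - k)))"
      unfolding exponential_coefficients[OF \<open>k \<le> n\<close>] of_nat_mps mps_const_mult by (simp only: ac_simps)
  qed
  also have "\<dots> = (\<Sum>k=1..N. of_nat k * ((if k = 0 then 0 else mps_const (t ^ k / fact k) * C k) *
      (mps_const (t ^ (N - k) / fact (N - k)) * Z (N - k))))"
  proof (rule sum.reindex_bij_witness[of _ "\<lambda>k. k - 1" Suc])
  qed (auto simp: n)
  finally show "of_nat N * (mps_const (t ^ N / fact N) * tuple_sum h m {1..N}) = (\<Sum>k=1..N. of_nat k *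
     ((if k = 0 then 0 else mps_const (t ^ k / fact k) * connected_sum h m {1..k}) *
      (mps_const (t ^ (N - k) / fact (N - k)) * tuple_sum h m {1..N - k})))"
    unfolding C_def Z_def .
qed simp

section \<open>Restoring the first permutation of a factorization\<close>

definition perm_tuples :: "nat \<Rightarrow> 'b set \<Rightarrow> ('b \<Rightarrow> 'b) list set" where
  "perm_tuples m A = {\<sigma>s. length \<sigma>s = m \<and> (\<forall>\<sigma>\<in>set \<sigma>s. \<sigma> permutes A)}"

lemma perm_op_funpow:
  "(perm_op h n ^^ m) \<phi> \<tau> = (\<Sum>\<sigma>s\<in>perm_tuples m {1..n}.
    mps_const (h ^ (\<Sum>\<sigma>\<leftarrow>\<sigma>s. perm_length {1..n} \<sigma>)) * \<phi> (foldr (\<circ>) \<sigma>s id \<circ> \<tau>))"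
proof (induction m arbitrary: \<phi>)
  case 0
  have "perm_tuples 0 {1..n} = {[]}" by (auto simp: perm_tuples_def)
  then show ?case by (simp add: comp_def)
next
  case (Suc m)
  let ?P = "{\<sigma>. \<sigma> permutes {1..n}}" and ?l = "perm_length {1..n}"
  let ?T = "\<lambda>\<sigma>s. mps_const (h ^ (\<Sum>\<sigma>\<leftarrow>\<sigma>s. ?l \<sigma>)) * \<phi> (foldr (\<circ>) \<sigma>s id \<circ> \<tau>)"
  have "(perm_op h n ^^ Suc m) \<phi> \<tau> = (perm_op h n ^^ m) (perm_op h n \<phi>) \<tau>"
    by (simp only: funpow_Suc_right o_apply)
  also have "\<dots> = (\<Sum>\<sigma>s\<in>perm_tuples m {1..n}. \<Sum>\<sigma>\<in>?P. ?T (\<sigma> # \<sigma>s))"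
    unfolding Suc perm_op_def sum_distrib_left
    by (simp add: power_add mps_const_mult mult.assoc mult.left_commute o_assoc)
  also have "\<dots> = (\<Sum>(\<sigma>s, \<sigma>)\<in>perm_tuples m {1..n} \<times> ?P. ?T (\<sigma> # \<sigma>s))"
    by (rule sum.cartesian_product)
  also have "\<dots> = (\<Sum>\<sigma>s\<in>perm_tuples (Suc m) {1..n}. ?T \<sigma>s)"
    by (rule sum.reindex_bij_witness[of _ "\<lambda>\<sigma>s. (tl \<sigma>s, hd \<sigma>s)" "\<lambda>(\<sigma>s, \<sigma>). \<sigma> # \<sigma>s"])
      (auto simp: perm_tuples_def length_Suc_conv)
  finally show ?case .
qed

lemma cycles_on_inv:
  assumes "\<sigma> permutes A" "finite A" shows "cycles_on A (inv' \<sigma>) = cycles_on A \<sigma>"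
  using orbit_inv_eq[OF permutes_permutation[OF assms]] by (simp add: cycles_on_def)

lemma perm_length_eq_sum:
  assumes "\<sigma> permutes A" "finite A"
  shows "perm_length A \<sigma> = (\<Sum>C\<in>cycles_on A \<sigma>. card C - 1)"
proof -
  have "card A = (\<Sum>C\<in>cycles_on A \<sigma>. (card C - 1) + 1)"
    unfolding sum_card_cycles[OF assms, symmetric]
    by (rule sum.cong[OF refl]) (use card_cycle_pos[OF assms] in fastforce)
  then have "card A = (\<Sum>C\<in>cycles_on A \<sigma>. card C - 1) + card (cycles_on A \<sigma>)"
    by (simp only: sum.distrib card_eq_sum)
  then show ?thesis unfolding perm_length_def by linarith
qed

text \<open>A cycle of length \<open>i\<close> contributes \<open>i - 1\<close> to
  \<open>perm_length\<close>; this is the origin of the exponents in the scaled Schur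
  function.\<close>

lemma mps_scale_cyc_monom:
  fixes A :: "'b set" and h :: "'a :: field_char_0"
  assumes "\<sigma> permutes A" "finite A"
  shows "mps_scale (\<lambda>i. h ^ (i - 1)) (cyc_monom A \<sigma>) = mps_const (h ^ perm_length A \<sigma>) * cyc_monom A \<sigma>"
proof -
  have const: "(\<Prod>C\<in>S. mps_const (h ^ f C)) = (mps_const (h ^ (\<Sum>C\<in>S. f C)) :: (nat, 'a) mps)" if "finite S" for S :: "'b set set" and f
    using that by (induction S rule: finite_induct) (simp_all add: mps_const_mult power_add)
  have "mps_scale (\<lambda>i. h ^ (i - 1)) (cyc_monom A \<sigma>)
      = cyc_monom A \<sigma> * (\<Prod>C\<in>cycles_on A \<sigma>. mps_const (h ^ (card C - 1)))"
    by (simp add: cyc_monom_def mps_scale_prod mps_scale_var prod.distrib)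
  then show ?thesis
    unfolding const[OF finite_cycles_on[OF assms(2)]] perm_length_eq_sum[OF assms] by (simp only: mult.commute)
qed

text \<open>In a factorization of the identity the first permutation is the inverse of the product
  of the others and has the same cycles as this product. Its weight is supplied by the rescaling of
  the cycle monomial.\<close>

theorem mps_scale_factorization_sum:
  fixes h :: "'a :: field_char_0"
  shows "mps_scale (\<lambda>i. h ^ (i - 1)) (factorization_sum h m n) = tuple_sum h m {1..n}"
proof -
  let ?A = "{1..n}"
  let ?F = "\<lambda>\<sigma>s :: (nat \<Rightarrow> nat) list. foldr (\<circ>) \<sigma>s id"
  have perm: "?F \<sigma>s permutes ?A" if "\<sigma>s \<in> perm_tuples m ?A" for \<sigma>s
    using that by (intro foldr_comp_permutes) (simp add: perm_tuples_def)
  have "mps_scale (\<lambda>i. h ^ (i - 1)) (factorization_sum h m n) = (\<Sum>\<sigma>s\<in>perm_tuples m ?A.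
      mps_const (h ^ (\<Sum>\<sigma>\<leftarrow>\<sigma>s. perm_length ?A \<sigma>)) * mps_scale (\<lambda>i. h ^ (i - 1)) (cyc_monom ?A (?F \<sigma>s)))"
    unfolding factorization_sum_def perm_op_funpow mps_scale_sum mps_scale_mult mps_scale_const by simp
  also have "\<dots> = (\<Sum>\<sigma>s\<in>perm_tuples m ?A. tuple_weight h ?A (inv' (?F \<sigma>s) # \<sigma>s))"
  proof (rule sum.cong[OF refl])
    fix \<sigma>s assume \<sigma>s: "\<sigma>s \<in> perm_tuples m ?A"
    define \<tau> where "\<tau> = ?F \<sigma>s"
    have \<tau>: "\<tau> permutes ?A" unfolding \<tau>_def by (rule perm[OF \<sigma>s])
    have "perm_length ?A (inv' \<tau>) = perm_length ?A \<tau>" "cyc_monom ?A (inv' \<tau>) = (cyc_monom ?A \<tau> :: (nat, 'a) mps)"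
      using cycles_on_inv[OF \<tau>] by (simp_all add: perm_length_def cyc_monom_def)
    then show "mps_const (h ^ (\<Sum>\<sigma>\<leftarrow>\<sigma>s. perm_length ?A \<sigma>)) * mps_scale (\<lambda>i. h ^ (i - 1)) (cyc_monom ?A (?F \<sigma>s))
      = tuple_weight h ?A (inv' (?F \<sigma>s) # \<sigma>s)"
      unfolding \<tau>_def[symmetric] tuple_weight_def mps_scale_cyc_monom[OF \<tau> finite_atLeastAtMost]
      by (simp only: list.map sum_list.Cons list.sel(1) power_add mps_const_mult ac_simps)
  qed
  also have "\<dots> = tuple_sum h m ?A"
    unfolding tuple_sum_def
  proof (rule sum.reindex_bij_witness[of _ tl "\<lambda>\<sigma>s. inv' (?F \<sigma>s) # \<sigma>s"])
    fix \<sigma>s assume \<sigma>s: "\<sigma>s \<in> perm_tuples m ?A"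
    have "foldr (\<circ>) (inv' (?F \<sigma>s) # \<sigma>s) id = id"
      unfolding foldr_comp_Cons by (rule permutes_inv_o(2)[OF perm[OF \<sigma>s]])
    then show "inv' (?F \<sigma>s) # \<sigma>s \<in> id_tuples m ?A"
      unfolding id_tuples_def using \<sigma>s permutes_inv[OF perm[OF \<sigma>s]] by (auto simp: perm_tuples_def)
  next
    fix \<sigma>s assume \<sigma>s: "\<sigma>s \<in> id_tuples m ?A"
    note d = id_tuplesD[OF \<sigma>s]
    obtain \<sigma> \<tau>s where \<sigma>s_eq: "\<sigma>s = \<sigma> # \<tau>s" using d(1) by (metis length_Suc_conv)
    then show t: "tl \<sigma>s \<in> perm_tuples m ?A" using d(1,2) by (simp add: perm_tuples_def)
    have "\<sigma> \<circ> ?F \<tau>s = id" using d(3) unfolding \<sigma>s_eq foldr_comp_Cons .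
    moreover have "?F \<tau>s permutes ?A" using perm[OF t] by (simp add: \<sigma>s_eq)
    ultimately have "inv' (?F \<tau>s) = \<sigma>" by (metis inv_unique_comp permutes_inv_o(1) comp_assoc comp_id id_comp)
    then show "inv' (?F (tl \<sigma>s)) # tl \<sigma>s = \<sigma>s" by (simp add: \<sigma>s_eq)
  qed simp_all
  finally show ?thesis .
qed

section \<open>Comparison with the numbers of factorizations\<close>

text \<open>A nonempty level set of an invariant labelling is an invariant set, hence it is all of
  \<open>A\<close>.\<close>

lemma connected_tuples_card_image:
  assumes \<sigma>s: "\<sigma>s \<in> connected_tuples m A" and c: "\<And>\<sigma> x. \<sigma> \<in> set \<sigma>s \<Longrightarrow> c (\<sigma> x) = c x"
  shows "card (c ` A) \<le> 1"
proof (cases "A = {}")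
  case False
  then obtain a where a: "a \<in> A" by blast
  let ?S = "{x \<in> A. c x = c a}"
  have id: "\<sigma>s \<in> id_tuples m A" using \<sigma>s by (simp add: connected_tuples_def)
  have "invariant_set \<sigma>s ?S"
    unfolding invariant_set_def
    using c permutes_in_image[OF id_tuplesD(2)[OF id]] by auto
  then have "?S = A" using a by (intro connected_tuplesD[OF \<sigma>s]) auto
  then have "c ` A \<subseteq> {c a}" by blast
  then show ?thesis using card_mono[of "{c a}" "c ` A"] by simp
qed simp

text \<open>On connected tuples the truncated subtraction and the division are exact by
  \<open>Riemann_Hurwitz_formula\<close>.\<close>

definition tuple_genus :: "nat \<Rightarrow> (nat \<Rightarrow> nat) list \<Rightarrow> nat" where
  "tuple_genus n \<sigma>s = ((\<Sum>\<sigma>\<leftarrow>\<sigma>s. perm_length {1..n} \<sigma>) + 2 - 2 * n) div 2"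

lemma Riemann_Hurwitz_formula:
  assumes "\<sigma>s \<in> connected_tuples m {1..n}"
  shows "(\<Sum>\<sigma>\<leftarrow>\<sigma>s. perm_length {1..n} \<sigma>) + 2 = 2 * n + 2 * tuple_genus n \<sigma>s"
proof -
  let ?L = "\<Sum>\<sigma>\<leftarrow>\<sigma>s. perm_length {1..n} \<sigma>"
  have id: "\<sigma>s \<in> id_tuples m {1..n}" using assms by (simp add: connected_tuples_def)
  have perm: "\<forall>\<sigma>\<in>set \<sigma>s. \<sigma> permutes {1..n}" using id_tuplesD(2)[OF id] by blast
  note RH = Riemann_Hurwitz_inequality[OF finite_atLeastAtMost perm id_tuplesD(3)[OF id]]
  have "?L + 2 \<ge> 2 * card {1..n}"
    by (rule RH(2)) (rule connected_tuples_card_image[OF assms])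
  moreover have "even ?L" by (rule RH(1))
  moreover have "L + 2 = 2 * n + 2 * ((L + 2 - 2 * n) div 2)" if "L + 2 \<ge> 2 * n" "even L" for L :: nat
    using that by presburger
  ultimately show ?thesis unfolding tuple_genus_def by simp
qed

section \<open>Cycle types as partitions\<close>

definition partition_of :: "nat multiset \<Rightarrow> nat list" where
  "partition_of M = rev (sorted_list_of_multiset M)"

lemma partition_of_eq_iff:
  assumes "\<nu> \<in> partitions n" shows "partition_of M = \<nu> \<longleftrightarrow> M = mset \<nu>"
proof
  assume "M = mset \<nu>"
  moreover have "sorted (rev \<nu>)" using assms by (simp add: partitions_def sorted_wrt_rev)
  then have "sort \<nu> = rev \<nu>" by (intro properties_for_sort) simp_all
  ultimately show "partition_of M = \<nu>" by (simp add: partition_of_def)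
next
  assume "partition_of M = \<nu>"
  then have "mset \<nu> = mset (rev (sorted_list_of_multiset M))" by (simp add: partition_of_def)
  then show "M = mset \<nu>" by simp
qed

lemma partition_of_cycle_type:
  assumes "\<sigma> permutes {1..n}" shows "partition_of (cycle_type n \<sigma>) \<in> partitions n"
proof -
  let ?M = "cycle_type n \<sigma>" and ?l = "sorted_list_of_multiset (cycle_type n \<sigma>)"
  have M: "?M = image_mset card (mset_set (cycles_on {1..n} \<sigma>))"
    by (simp add: cycle_type_def perm_cycles_eq)
  have fin: "finite (cycles_on {1..n} \<sigma>)" by (rule finite_cycles_on) simp
  have "sorted_wrt (\<ge>) (rev ?l)" by (simp add: sorted_wrt_rev sorted_sorted_list_of_multiset)
  moreover have "0 \<notin># ?M"
  proof
    assume "0 \<in># ?M"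
    then obtain C where "C \<in> cycles_on {1..n} \<sigma>" "card C = 0" using fin by (auto simp: M)
    then show False using card_cycle_pos[OF assms, of C] by simp
  qed
  moreover have "sum_list ?l = n"
  proof -
    have "sum_list ?l = sum_mset (mset ?l)" by (rule sum_mset_sum_list[symmetric])
    also have "mset ?l = ?M" by simp
    also have "sum_mset ?M = (\<Sum>C\<in>cycles_on {1..n} \<sigma>. card C)" by (simp add: M sum_unfold_sum_mset)
    also have "\<dots> = n" using sum_card_cycles[OF assms] by simp
    finally show ?thesis .
  qed
  ultimately show ?thesis by (simp add: partitions_def partition_of_def)
qed

lemma cyc_monom_eq_p_monom:
  assumes "cycle_type n \<sigma> = mset \<nu>" shows "cyc_monom {1..n} \<sigma> = p_monom \<nu>"
proof -
  have "cyc_monom {1..n} \<sigma> = prod_mset (image_mset mps_var (cycle_type n \<sigma>))"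
    by (simp add: cyc_monom_def cycle_type_def perm_cycles_eq prod_unfold_prod_mset image_mset.compositionality comp_def)
  then show ?thesis by (simp add: assms p_monom_def prod_mset_prod_list flip: mset_map)
qed

section \<open>Transitivity of the generated group and the genus\<close>

lemma generate_invariant:
  assumes "\<forall>\<sigma>\<in>set \<sigma>s. \<sigma> permutes {1..n}" "finite S" "invariant_set \<sigma>s S" "\<tau> \<in> generate (sym_group n) (set \<sigma>s)"
  shows "\<tau> ` S \<subseteq> S"
  using assms(4)
proof (induction rule: generate.induct)
  case (inv \<sigma>)
  then have \<sigma>: "\<sigma> permutes {1..n}" "\<sigma> ` S \<subseteq> S" using assms(1,3) by (auto simp: invariant_set_def)
  have "inv\<^bsub>sym_group n\<^esub> \<sigma> = inv' \<sigma>" by (rule sym_group_inv_equality) (simp only: sym_group_carrier \<sigma>(1))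
  moreover have "inv' \<sigma> ` S = S"
    using permutes_image_invariant[OF \<sigma>(1) assms(2) \<sigma>(2)] image_inv_f_f[OF permutes_inj[OF \<sigma>(1)], of S] by simp
  ultimately show ?case by simp
next
  case (eng \<tau> \<rho>)
  then show ?case by (simp add: sym_group_mult image_subset_iff)
qed (use assms(3) in \<open>auto simp: sym_group_one invariant_set_def\<close>)

text \<open>An invariant subset is preserved by the whole generated group, inverses included since
  it is finite, so it contains the orbits of its points. Conversely, such an orbit is itself a
  nonempty invariant set.\<close>

lemma transitive_iff_connected:
  assumes "\<sigma>s \<in> id_tuples m {1..n}"
  shows "(\<forall>x\<in>{1..n}. \<forall>y\<in>{1..n}. \<exists>\<tau>\<in>generate (sym_group n) (set \<sigma>s). \<tau> x = y) \<longleftrightarrow> \<sigma>s \<in> connected_tuples m {1..n}"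
    (is "?L \<longleftrightarrow> ?R")
proof
  have perm: "\<forall>\<sigma>\<in>set \<sigma>s. \<sigma> permutes {1..n}" using id_tuplesD(2)[OF assms] by blast
  {
    assume trans: ?L
    have "S = {1..n}" if S: "S \<subseteq> {1..n}" "S \<noteq> {}" "invariant_set \<sigma>s S" for S
    proof
      show "{1..n} \<subseteq> S"
      proof
        fix y assume y: "y \<in> {1..n}"
        obtain x where x: "x \<in> S" using S(2) by blast
        then have "x \<in> {1..n}" using S(1) by blast
        then obtain \<tau> where \<tau>: "\<tau> \<in> generate (sym_group n) (set \<sigma>s)" "\<tau> x = y" using trans y by meson
        have "finite S" using S(1) by (rule finite_subset) simp
        then have "\<tau> ` S \<subseteq> S" by (rule generate_invariant[OF perm _ S(3) \<tau>(1)])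
        then show "y \<in> S" using x \<tau>(2) by blast
      qed
    qed (rule S(1))
    then show ?R using assms by (simp add: connected_tuples_def)
  }
  assume conn: ?R
  show ?L
  proof (intro ballI)
    fix x y assume x: "x \<in> {1..n}" and y: "y \<in> {1..n}"
    let ?S = "(\<lambda>\<tau>. \<tau> x) ` generate (sym_group n) (set \<sigma>s)"
    have sub: "set \<sigma>s \<subseteq> carrier (sym_group n)" using perm by (simp add: sym_group_carrier subset_iff)
    have "?S \<subseteq> {1..n}"
    proof (rule image_subsetI)
      fix \<tau> assume "\<tau> \<in> generate (sym_group n) (set \<sigma>s)"
      then have "\<tau> \<in> carrier (sym_group n)" by (rule group.generate_in_carrier[OF sym_group_is_group sub])
      then have "\<tau> permutes {1..n}" by (simp only: sym_group_carrier)
      then show "\<tau> x \<in> {1..n}" using x by (simp only: permutes_in_image)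
    qed
    moreover have "?S \<noteq> {}" using generate.one[of "sym_group n" "set \<sigma>s"] by blast
    moreover have "invariant_set \<sigma>s ?S"
      unfolding invariant_set_def
    proof (intro ballI image_subsetI)
      fix \<sigma> z assume \<sigma>: "\<sigma> \<in> set \<sigma>s" and "z \<in> ?S"
      then obtain \<tau> where \<tau>: "\<tau> \<in> generate (sym_group n) (set \<sigma>s)" "z = \<tau> x" by blast
      have "\<sigma> \<circ> \<tau> \<in> generate (sym_group n) (set \<sigma>s)"
        using generate.eng[OF generate.incl[OF \<sigma>] \<tau>(1)] by (simp only: sym_group_mult)
      moreover have "\<sigma> z = (\<sigma> \<circ> \<tau>) x" by (simp add: \<tau>(2))
      ultimately show "\<sigma> z \<in> ?S" by blast
    qed
    ultimately have "?S = {1..n}" by (rule connected_tuplesD[OF conn])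
    then have "y \<in> ?S" using y by (simp only:)
    then show "\<exists>\<tau>\<in>generate (sym_group n) (set \<sigma>s). \<tau> x = y" by blast
  qed
qed

text \<open>The defining equation for \<open>g\<close> lives in the integers. On connected tuples
  the Riemann-Hurwitz formula turns it into an equation of natural numbers whose only solution is
  \<open>tuple_genus\<close>, so every connected tuple is counted for exactly one genus.\<close>

lemma factorizations_eq:
  assumes \<nu>: "\<nu> \<in> partitions n"
  shows "factorizations g \<nu> m =
    {\<sigma>s \<in> connected_tuples m {1..n}. partition_of (cycle_type n (hd \<sigma>s)) = \<nu> \<and> tuple_genus n \<sigma>s = g}"
proof (rule Set.set_eqI)
  fix \<sigma>s
  have n: "sum_list \<nu> = n" using \<nu> by (simp add: partitions_def)
  define trans where "trans \<longleftrightarrow> (\<forall>x\<in>{1..n}. \<forall>y\<in>{1..n}. \<exists>\<tau>\<in>generate (sym_group n) (set \<sigma>s). \<tau> x = y)"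
  have trans: "trans \<longleftrightarrow> \<sigma>s \<in> connected_tuples m {1..n}" if "\<sigma>s \<in> id_tuples m {1..n}"
    unfolding trans_def by (rule transitive_iff_connected[OF that])
  let ?sum = "\<Sum>i = 0..m. int n - int (card (perm_cycles n (\<sigma>s ! i)))"
  have "\<sigma>s \<in> factorizations g \<nu> m \<longleftrightarrow> \<sigma>s \<in> id_tuples m {1..n} \<and> cycle_type n (\<sigma>s ! 0) = mset \<nu> \<and> trans
      \<and> 2 - 2 * int g = 2 * int n - ?sum"
    unfolding trans_def factorizations_def n Let_def id_tuples_def mem_Collect_eq
    by (auto simp: sym_group_carrier subset_iff simp del: One_nat_def)
  also have "\<dots> \<longleftrightarrow> \<sigma>s \<in> connected_tuples m {1..n} \<and> partition_of (cycle_type n (hd \<sigma>s)) = \<nu> \<and> tuple_genus n \<sigma>s = g"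
  proof (cases "\<sigma>s \<in> connected_tuples m {1..n}")
    case True
    then have id: "\<sigma>s \<in> id_tuples m {1..n}" by (simp add: connected_tuples_def)
    have len: "length \<sigma>s = Suc m" by (rule id_tuplesD(1)[OF id])
    have "?sum = (\<Sum>i = 0..m. int (perm_length {1..n} (\<sigma>s ! i)))"
    proof (rule sum.cong[OF refl])
      fix i
      have "card (perm_cycles n (\<sigma>s ! i)) \<le> n"
        using card_cycles_on_le[of "{1..n}" "\<sigma>s ! i"] by (simp add: perm_cycles_eq)
      then show "int n - int (card (perm_cycles n (\<sigma>s ! i))) = int (perm_length {1..n} (\<sigma>s ! i))"
        by (simp add: perm_length_def perm_cycles_eq of_nat_diff)
    qed
    also have "\<dots> = int (\<Sum>i = 0..m. perm_length {1..n} (\<sigma>s ! i))" by (rule of_nat_sum[symmetric])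
    also have "(\<Sum>i = 0..m. perm_length {1..n} (\<sigma>s ! i)) = (\<Sum>\<sigma>\<leftarrow>\<sigma>s. perm_length {1..n} \<sigma>)"
      by (simp add: sum_list_sum_nth len atLeastLessThanSuc_atLeastAtMost del: One_nat_def)
    finally have sum: "?sum = int (\<Sum>\<sigma>\<leftarrow>\<sigma>s. perm_length {1..n} \<sigma>)" .
    have "int (\<Sum>\<sigma>\<leftarrow>\<sigma>s. perm_length {1..n} \<sigma>) + 2 = 2 * int n + 2 * int (tuple_genus n \<sigma>s)"
      using arg_cong[OF Riemann_Hurwitz_formula[OF True], of int] by simp
    then have "2 - 2 * int g = 2 * int n - ?sum \<longleftrightarrow> tuple_genus n \<sigma>s = g"
      unfolding sum by linarith
    moreover have "hd \<sigma>s = \<sigma>s ! 0" using len by (intro hd_conv_nth) auto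
    ultimately show ?thesis using trans[OF id] id True partition_of_eq_iff[OF \<nu>] by (simp only: simp_thms)
  next
    case False
    then show ?thesis using trans by (cases "\<sigma>s \<in> id_tuples m {1..n}") (simp_all only: simp_thms)
  qed
  finally show "\<sigma>s \<in> factorizations g \<nu> m \<longleftrightarrow>
      \<sigma>s \<in> {\<sigma>s \<in> connected_tuples m {1..n}. partition_of (cycle_type n (hd \<sigma>s)) = \<nu> \<and> tuple_genus n \<sigma>s = g}"
    by (simp only: mem_Collect_eq)
qed

lemma sum_hbar_power:
  fixes G :: "'b \<Rightarrow> nat"
  assumes "finite T"
  shows "(\<Sum>a\<in>T. hbar ^ (2 * G a)) / fact n
    = fps_to_fls (Abs_fps (\<lambda>d. if even d then of_nat (card {a \<in> T. G a = d div 2}) / fact n else 0))"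
proof -
  have sum: "fps_to_fls (\<Sum>a\<in>S. F a) = (\<Sum>a\<in>S. fps_to_fls (F a))" if "finite S" for F :: "'b \<Rightarrow> rat fps" and S
    using that by (induction S rule: finite_induct) simp_all
  have "(\<Sum>a\<in>T. hbar ^ (2 * G a)) / fact n = fls_const (1 / fact n) * (\<Sum>a\<in>T. hbar ^ (2 * G a))"
  proof -
    have "(fact n :: rat fls) = fls_const (fact n)" by (metis fls_of_nat of_nat_fact)
    then show ?thesis by (simp add: divide_inverse fls_inverse_const)
  qed
  also have "\<dots> = fps_to_fls (fps_const (1 / fact n) * (\<Sum>a\<in>T. fps_X ^ (2 * G a)))"
    by (simp add: fls_times_fps_to_fls sum[OF assms] fps_to_fls_power)
  also have "fps_const (1 / fact n :: rat) * (\<Sum>a\<in>T. fps_X ^ (2 * G a))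
      = Abs_fps (\<lambda>d. if even d then of_nat (card {a \<in> T. G a = d div 2}) / fact n else 0)"
  proof (rule fps_ext)
    fix d
    have "{a \<in> T. d = 2 * G a} = (if even d then {a \<in> T. G a = d div 2} else {})" by auto
    then have "(\<Sum>a\<in>T. if d = 2 * G a then 1 else (0 :: rat))
        = of_nat (card (if even d then {a \<in> T. G a = d div 2} else {}))"
      using assms by (simp add: sum.If_cases Int_def)
    then show "(fps_const (1 / fact n :: rat) * (\<Sum>a\<in>T. fps_X ^ (2 * G a))) $ d
      = Abs_fps (\<lambda>d. if even d then of_nat (card {a \<in> T. G a = d div 2}) / fact n else 0) $ d"
      by (simp add: fps_sum_nth fps_X_power_nth)
  qed
  finally show ?thesis .
qed

text \<open>With \<open>L\<close> the sum of the lengths, the powers of \<open>hbar\<close> have the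
  exponents 2, \<open>- 2 n\<close> and \<open>L\<close>, which add up to \<open>2 g\<close> by the
  Riemann-Hurwitz formula \<open>L + 2 = 2 n + 2 g\<close>. Sorting the tuples by cycle type and
  genus then gives the numbers of factorizations divided by \<open>n!\<close>.\<close>

lemma S_series_term:
  assumes "n > 0"
  shows "(\<Sum>\<nu>\<in>partitions n.
        mps_const (fps_to_fls (Abs_fps (\<lambda>d. if even d then b_number (d div 2) \<nu> m else 0))) * p_monom \<nu>)
    = mps_const (hbar ^ 2) * (mps_const (inverse (hbar ^ 2) ^ n / fact n) * connected_sum hbar m {1..n})"
proof -
  let ?C = "connected_tuples m {1..n}"
  let ?type = "\<lambda>\<sigma>s. partition_of (cycle_type n (hd \<sigma>s))"
  let ?w = "\<lambda>\<sigma>s. mps_const (hbar ^ (2 * tuple_genus n \<sigma>s) / fact n) * cyc_monom {1..n} (hd \<sigma>s)"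
  have finC: "finite ?C" unfolding connected_tuples_def using finite_id_tuples[of "{1..n}" m] by simp
  have id: "\<sigma>s \<in> id_tuples m {1..n}" if "\<sigma>s \<in> ?C" for \<sigma>s using that by (simp add: connected_tuples_def)
  have type: "?type \<sigma>s \<in> partitions n" if "\<sigma>s \<in> ?C" for \<sigma>s
  proof (rule partition_of_cycle_type)
    have "hd \<sigma>s \<in> set \<sigma>s" using id_tuplesD(1)[OF id[OF that]] by (intro hd_in_set) auto
    then show "hd \<sigma>s permutes {1..n}" by (rule id_tuplesD(2)[OF id[OF that]])
  qed
  have "mps_const (hbar ^ 2) * (mps_const (inverse (hbar ^ 2) ^ n / fact n) * connected_sum hbar m {1..n})
    = (\<Sum>\<sigma>s\<in>?C. ?w \<sigma>s)"
    unfolding connected_sum_def sum_distrib_left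
  proof (rule sum.cong[OF refl])
    fix \<sigma>s assume \<sigma>s: "\<sigma>s \<in> ?C"
    define L where "L = (\<Sum>\<sigma>\<leftarrow>\<sigma>s. perm_length {1..n} \<sigma>)"
    have "hbar ^ 2 * hbar ^ L = hbar ^ (2 * n + 2 * tuple_genus n \<sigma>s)"
      using Riemann_Hurwitz_formula[OF \<sigma>s] by (metis L_def add.commute power_add)
    then have "hbar ^ 2 * hbar ^ L = (hbar ^ 2) ^ n * hbar ^ (2 * tuple_genus n \<sigma>s)"
      by (simp add: power_add power_mult)
    then have "hbar ^ 2 * hbar ^ L * inverse (hbar ^ 2) ^ n
        = (hbar ^ 2) ^ n * inverse (hbar ^ 2) ^ n * hbar ^ (2 * tuple_genus n \<sigma>s)"
      by (simp only: ac_simps)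
    moreover have inv: "c ^ n * inverse c ^ n = 1" if "c \<noteq> 0" for c :: "rat fls"
      using that by (simp add: power_mult_distrib[symmetric])
    have "(hbar ^ 2) ^ n * inverse (hbar ^ 2) ^ n = 1" by (rule inv) simp
    ultimately have "hbar ^ 2 * hbar ^ L * inverse (hbar ^ 2) ^ n = hbar ^ (2 * tuple_genus n \<sigma>s)"
      by (simp only: mult_1_left)
    then have "hbar ^ 2 * (inverse (hbar ^ 2) ^ n / fact n * hbar ^ L) = hbar ^ (2 * tuple_genus n \<sigma>s) / fact n"
      by (simp only: divide_inverse mult.assoc mult.commute mult.left_commute)
    then show "mps_const (hbar ^ 2) * (mps_const (inverse (hbar ^ 2) ^ n / fact n) * tuple_weight hbar {1..n} \<sigma>s) = ?w \<sigma>s"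
      unfolding tuple_weight_def L_def[symmetric] by (simp only: mult.assoc[symmetric] mps_const_mult[symmetric])
  qed
  also have "\<dots> = (\<Sum>\<nu>\<in>partitions n. \<Sum>\<sigma>s | \<sigma>s \<in> ?C \<and> ?type \<sigma>s = \<nu>. ?w \<sigma>s)"
    using type by (intro sum.group[symmetric] finC finite_partitions) auto
  also have "\<dots> = (\<Sum>\<nu>\<in>partitions n.
        mps_const (fps_to_fls (Abs_fps (\<lambda>d. if even d then b_number (d div 2) \<nu> m else 0))) * p_monom \<nu>)"
  proof (rule sum.cong[OF refl])
    fix \<nu> assume \<nu>: "\<nu> \<in> partitions n"
    let ?T = "{\<sigma>s. \<sigma>s \<in> ?C \<and> ?type \<sigma>s = \<nu>}"
    have "(\<Sum>\<sigma>s\<in>?T. ?w \<sigma>s) = (\<Sum>\<sigma>s\<in>?T. mps_const (hbar ^ (2 * tuple_genus n \<sigma>s) / fact n) * p_monom \<nu>)"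
    proof (rule sum.cong[OF refl])
      fix \<sigma>s assume "\<sigma>s \<in> ?T"
      then have "cycle_type n (hd \<sigma>s) = mset \<nu>" using partition_of_eq_iff[OF \<nu>] by blast
      then show "?w \<sigma>s = mps_const (hbar ^ (2 * tuple_genus n \<sigma>s) / fact n) * p_monom \<nu>"
        by (simp only: cyc_monom_eq_p_monom)
    qed
    also have "\<dots> = mps_const ((\<Sum>\<sigma>s\<in>?T. hbar ^ (2 * tuple_genus n \<sigma>s)) / fact n) * p_monom \<nu>"
      by (simp only: sum_distrib_right[symmetric] mps_const_sum[symmetric] sum_divide_distrib[symmetric])
    also have "(\<Sum>\<sigma>s\<in>?T. hbar ^ (2 * tuple_genus n \<sigma>s)) / fact n
      = fps_to_fls (Abs_fps (\<lambda>d. if even d then of_nat (card {\<sigma>s \<in> ?T. tuple_genus n \<sigma>s = d div 2}) / fact n else 0))"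
      by (rule sum_hbar_power) (use finC in simp)
    also have "(\<lambda>d. if even d then of_nat (card {\<sigma>s \<in> ?T. tuple_genus n \<sigma>s = d div 2}) / fact n else 0)
      = (\<lambda>d. if even d then b_number (d div 2) \<nu> m else 0)"
    proof
      fix d
      have "sum_list \<nu> = n" using \<nu> by (simp add: partitions_def)
      moreover have "{\<sigma>s \<in> ?T. tuple_genus n \<sigma>s = d div 2} = factorizations (d div 2) \<nu> m"
        unfolding factorizations_eq[OF \<nu>] by blast
      ultimately show "(if even d then of_nat (card {\<sigma>s \<in> ?T. tuple_genus n \<sigma>s = d div 2}) / fact n else 0)
        = (if even d then b_number (d div 2) \<nu> m else 0)"
        by (simp only: b_number_def)
    qed
    finally show "(\<Sum>\<sigma>s\<in>?T. ?w \<sigma>s) = mps_const (fps_to_fls (Abs_fps (\<lambda>d. if even d then b_number (d div 2) \<nu> m else 0))) * p_monom \<nu>" .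
  qed
  finally show ?thesis by (rule sym)
qed

lemma schur_sum_term:
  "(\<Sum>\<nu>\<in>partitions n. mps_const ((\<Prod>k\<in>diagram \<nu>. (1 + of_int (cell_content k) * hbar) ^ m)
      * (of_nat (irrep_dim \<nu>) / fact n) * hbar powi (- 2 * int n)) * schur_scaled \<nu>)
    = mps_const (inverse (hbar ^ 2) ^ n / fact n) * tuple_sum hbar m {1..n}"
proof -
  have "hbar powi (- 2 * int n) = inverse (hbar powi int (2 * n))"
    by (simp add: power_int_minus)
  also have "\<dots> = inverse (hbar ^ 2) ^ n" by (simp only: power_int_of_nat power_mult power_inverse)
  finally have powi: "hbar powi (- 2 * int n) = inverse (hbar ^ 2) ^ n" .
  show ?thesis
    unfolding mps_scale_factorization_sum[symmetric] factorization_sum_schur mps_scale_sum mps_scale_mult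
      mps_scale_const mps_scale_schur sum_distrib_left schur_scaled_def powi
    by (rule sum.cong[OF refl]) (simp only: mult.assoc[symmetric] mps_const_mult[symmetric], simp add: mult_ac)
qed

lemma mps_const_mult_mps_sum:
  fixes c :: "'a :: field_char_0"
  shows "mps_const c * mps_sum f = mps_sum (\<lambda>i. mps_const c * f i)"
proof (rule mps_eqI)
  fix M
  have "{i. mps_coeff (mps_const c * f i) M \<noteq> 0} = (if c = 0 then {} else {i. mps_coeff (f i) M \<noteq> 0})" by auto
  then show "mps_coeff (mps_const c * mps_sum f) M = mps_coeff (mps_sum (\<lambda>i. mps_const c * f i)) M"
    by (simp add: mps_sum_def Sum_any.expand_set sum_distrib_left)
qed

theorem theorem2:
  fixes m :: nat
  assumes "m \<ge> 1"
  shows "S_series m =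
    mps_const (hbar ^ 2) * mps_log (mps_sum (\<lambda>n. \<Sum>\<nu>\<in>partitions n.
      mps_const ((\<Prod>k\<in>diagram \<nu>. (1 + of_int (cell_content k) * hbar) ^ m)
                 * (of_nat (irrep_dim \<nu>) / fact n)
                 * hbar powi (- 2 * int n))
      * schur_scaled \<nu>))"
proof -
  have "S_series m = mps_sum (\<lambda>n. mps_const (hbar ^ 2) *
      (if n = 0 then 0 else mps_const (inverse (hbar ^ 2) ^ n / fact n) * connected_sum hbar m {1..n}))"
    unfolding S_series_def by (rule arg_cong[of _ _ mps_sum], rule ext) (simp add: S_series_term del: One_nat_def)
  then show ?thesis
    unfolding schur_sum_term mps_log_tuple_sum mps_const_mult_mps_sum .
qed

end
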